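(* Let $0\le c<2$ and let $\bar u_c:(-\infty,0]\to[0,1)$ be the asymptotic spreading profile of speed $c$. Then $\bar u_c$ is nonlinearly stable as a stationary solution of $$U_\tau=U_{zz}+c\,U_z+U(1-U),\quad \tau>0,\ -\infty<z<0,\qquad U_z(\tau,-\infty)=0,\quad U(\tau,0)=0,$$ with respect to perturbations in $H^1_0((-\infty,0))$, in the following sense: there exist constants $\beta>0$, $\nu>0$ and $M\ge 1$ such that, whenever $V_0-\bar u_c\in H^1_0((-\infty,0))$ and $\|V_0-\bar u_c\|_{H^1_0((-\infty,0))}\le \nu/(2M)$, there exists a unique solution $V(\cdot,\tau)$ of the problem $V_\tau=V_{zz}+c\,V_z+V(1-V)$ for $\tau>0$, $-\infty<z<0$, with boundary conditions $V_z(-\infty,\tau)=0$ and $V(0,\tau)=0$, existing for all $\tau>0$, with $V(\cdot,0)=V_0$, and it satisfies for all $\tau>0$ $$\|V(\cdot,\tau)-\bar u_c\|_{H^1_0((-\infty,0))}\le 2M e^{-\beta \tau}\,\|V_0-\bar u_c\|_{H^1_0((-\infty,0))}.$$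
   Context: For $0\le c<2$, $\bar u_c$ denotes the unique solution on $(-\infty,0]$ of $u_{zz}+c\,u_z+u(1-u)=0$, $u_z(-\infty)=0$, $u(0)=0$, that is positive on $(-\infty,0)$, decreasing in $z$, and tends to $1$ as $z\to-\infty$; equivalently, $(\bar u_c,\bar u_c')$ is the part in the fourth quadrant ($u\ge0$, $v\le0$) of the unstable manifold of the saddle $(1,0)$ of the system $u_z=v$, $v_z=-cv-u(1-u)$, parametrized so that $u=0$ at $z=0$. The existence and uniqueness of $\bar u_c$ is a known fact. $H^1_0((-\infty,0))=\{\phi\in H^1((-\infty,0)):\phi(0)=0\}$, equipped with the $H^1$ norm; functions are real-valued. Solutions are understood in the usual semigroup sense: $w=V-\bar u_c$ is a continuous function of $\tau\in[0,\infty)$ with values in $H^1_0((-\infty,0))$ solving the semilinear evolution equation $w_\tau=\mathcal{L}w-w^2$ in $L^2((-\infty,0))$ for $\tau>0$, where $\mathcal{L}w=w_{zz}+c\,w_z+(1-2\bar u_c)w$ with domain $\{w\in H^2((-\infty,0)):w(0)=0\}$. *)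

theory Defs
  imports "HOL-Analysis.Analysis"
begin

section \<open>Lebesgue and Sobolev spaces on the half-line\<close>

text \<open>Only the values of a function on the half-line matter, although its type is
  \<^typ>\<open>real \<Rightarrow> real\<close>; the values at positive arguments are never used.\<close>

abbreviation half_line :: "real measure" where
  "half_line \<equiv> lebesgue_on {..<0}"

definition L2 :: "(real \<Rightarrow> real) set" where
  "L2 = {f. f \<in> borel_measurable half_line \<and> integrable half_line (\<lambda>z. (f z)\<^sup>2)}"

definition L2_norm :: "(real \<Rightarrow> real) \<Rightarrow> real" where
  "L2_norm f = sqrt (integral\<^sup>L half_line (\<lambda>z. (f z)\<^sup>2))"

text \<open>Test functions on the open half-line are continuously differentiable with compact support,
  as is usual for Sobolev spaces on intervals.\<close>

definition test_functions :: "(real \<Rightarrow> real) set" where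
  "test_functions =
     {\<psi>. \<psi> C1_differentiable_on UNIV \<and> (\<exists>a b. b < 0 \<and> (\<forall>z. z \<notin> {a..b} \<longrightarrow> \<psi> z = 0))}"

definition has_weak_deriv :: "(real \<Rightarrow> real) \<Rightarrow> (real \<Rightarrow> real) \<Rightarrow> bool" where
  "has_weak_deriv f g \<longleftrightarrow>
     (\<forall>\<psi>\<in>test_functions.
        integral\<^sup>L half_line (\<lambda>z. f z * deriv \<psi> z) = - integral\<^sup>L half_line (\<lambda>z. g z * \<psi> z))"

text \<open>The weak derivative is unique up to a null set, so the choice below is immaterial
  in norms and in equations that hold in L2.\<close>

definition weak_deriv :: "(real \<Rightarrow> real) \<Rightarrow> real \<Rightarrow> real" where
  "weak_deriv f = (SOME g. g \<in> L2 \<and> has_weak_deriv f g)"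

text \<open>An element of H1 is represented by its unique representative that is continuous up to the
  boundary point 0; thus \<^term>\<open>f 0\<close> is the boundary trace, and two elements are the same iff
  they agree on \<^term>\<open>{..0::real}\<close>.\<close>

definition H1 :: "(real \<Rightarrow> real) set" where
  "H1 = {f. continuous_on {..0} f \<and> f \<in> L2 \<and> (\<exists>g\<in>L2. has_weak_deriv f g)}"

definition H1_norm :: "(real \<Rightarrow> real) \<Rightarrow> real" where
  "H1_norm f = sqrt ((L2_norm f)\<^sup>2 + (L2_norm (weak_deriv f))\<^sup>2)"

definition H1_0 :: "(real \<Rightarrow> real) set" where
  "H1_0 = {f \<in> H1. f 0 = 0}"

definition H2 :: "(real \<Rightarrow> real) set" where
  "H2 = {f \<in> H1. \<exists>g\<in>L2. has_weak_deriv f g \<and> (\<exists>h\<in>L2. has_weak_deriv g h)}"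


section \<open>The spreading profile and the evolution equation\<close>

definition spreading_profile :: "real \<Rightarrow> (real \<Rightarrow> real) \<Rightarrow> bool" where
  "spreading_profile c u \<longleftrightarrow>
     (\<exists>v. (\<forall>z\<le>0. (u has_real_derivative v z) (at z within {..0})) \<and>
          (\<forall>z\<le>0. (v has_real_derivative (- c * v z - u z * (1 - u z))) (at z within {..0})) \<and>
          (v \<longlongrightarrow> 0) at_bot) \<and>
     u 0 = 0 \<and>
     u \<in> {..0} \<rightarrow> {0..<1} \<and>
     (\<forall>z<0. u z > 0) \<and>
     strict_antimono_on {..0} u \<and>
     (u \<longlongrightarrow> 1) at_bot"

definition linop_domain :: "(real \<Rightarrow> real) set" where
  "linop_domain = {w \<in> H2. w 0 = 0}"

definition linop :: "real \<Rightarrow> (real \<Rightarrow> real) \<Rightarrow> (real \<Rightarrow> real) \<Rightarrow> real \<Rightarrow> real" where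
  "linop c u w = (\<lambda>z. weak_deriv (weak_deriv w) z + c * weak_deriv w z + (1 - 2 * u z) * w z)"

definition evolution_solution :: "real \<Rightarrow> (real \<Rightarrow> real) \<Rightarrow> (real \<Rightarrow> real \<Rightarrow> real) \<Rightarrow> bool" where
  "evolution_solution c u w \<longleftrightarrow>
     (\<forall>\<tau>\<ge>0. w \<tau> \<in> H1_0) \<and>
     (\<forall>\<tau>\<ge>0. ((\<lambda>s. H1_norm (\<lambda>z. w s z - w \<tau> z)) \<longlongrightarrow> 0) (at \<tau> within {0..})) \<and>
     (\<forall>\<tau>>0. w \<tau> \<in> linop_domain \<and>
        ((\<lambda>h. L2_norm (\<lambda>z. (w (\<tau> + h) z - w \<tau> z) / h - (linop c u (w \<tau>) z - (w \<tau> z)\<^sup>2)))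
           \<longlongrightarrow> 0) (at 0))"

text \<open>\<open>V \<tau> z\<close> solves the problem for \<open>V\<close> with initial value \<open>V0\<close>: the equation is the one for
  the perturbation \<open>V \<tau> - u\<close>, to which it is equivalent because \<open>u\<close> is stationary.
  The two boundary conditions are also implied by the domain of the linear operator.\<close>

definition fkpp_solution ::
  "real \<Rightarrow> (real \<Rightarrow> real) \<Rightarrow> (real \<Rightarrow> real) \<Rightarrow> (real \<Rightarrow> real \<Rightarrow> real) \<Rightarrow> bool" where
  "fkpp_solution c u V0 V \<longleftrightarrow>
     evolution_solution c u (\<lambda>\<tau> z. V \<tau> z - u z) \<and>
     (\<forall>\<tau>>0. ((\<lambda>z. deriv (V \<tau>) z) \<longlongrightarrow> 0) at_bot \<and> V \<tau> 0 = 0) \<and>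
     (\<forall>z\<le>0. V 0 z = V0 z)"

end

theory Submission
  imports Defs
begin

text \<open>
  The perturbation \<open>w = V - u\<close> solves \<open>w' = L w - w\<^sup>2\<close> with \<open>L w = w_zz + c w_z + (1 - 2 u) w\<close>.
  The theorem combines a coercivity estimate for \<open>- L\<close> in a weighted norm, a Lyapunov functional
  built from it, and enough regularity of solutions to differentiate that functional in time.

  \<^bold>\<open>Linear decay.\<close> The derivative \<open>v\<close> of the profile satisfies \<open>L v = 0\<close> and is negative
  up to and including the boundary point \<open>0\<close>, where perturbations vanish. In Riccati form this gives
  strict positivity: with \<open>\<rho> z = exp (c z)\<close>, the square \<open>\<rho> (w_z - r w)\<^sup>2\<close> with
  \<open>r = v_z / v\<close> integrates to the quadratic form of \<open>- \<rho> L\<close>, and since \<open>v\<close> does not vanish on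
  \<open>{..0}\<close> there is room to lower \<open>r\<close> on a compact set and gain a positive zero-order term there. Near
  \<open>-\<infinity>\<close> the potential \<open>1 - 2 u\<close> is at most \<open>- 1/2\<close>, but the weight \<open>\<rho>\<close> decays if \<open>c > 0\<close>. Adding a large
  multiple of the first estimate to the unweighted one covers both regions
  (\<open>weighted_coercivity\<close>): for \<open>m = K \<rho> + 1\<close> the pairing of \<open>m w\<close> with \<open>L w\<close> is at most
  \<open>- (\<parallel>w\<parallel>\<^sup>2 / 2 + \<parallel>w_z\<parallel>\<^sup>2)\<close>.

  \<^bold>\<open>Nonlinear decay.\<close> The pairing of \<open>m w\<close> with \<open>w\<close> therefore decreases at a rate controlled by the
  full \<open>H1\<close> norm as long as \<open>\<bar>w\<bar>\<close> is small. Adding the energy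
  \<open>\<parallel>w_z\<parallel>\<^sup>2 + \<langle>(1 + 2 u) w, w\<rangle>\<close>, whose growth is at most a multiple of the squared \<open>H1\<close> norm, to a
  large multiple of that pairing gives a functional that is equivalent to the squared \<open>H1\<close> norm and
  decays exponentially (\<open>energy_derivative\<close>, \<open>nonlinear_stability\<close>). No continuation argument is
  made: \<open>w\<^sup>2\<close> is first replaced by \<open>w clip w\<close>, which is globally Lipschitz on \<open>L2\<close>, so that the
  solution is global. The decay of its \<open>H1\<close> norm, which bounds the supremum in one dimension, then
  keeps \<open>\<bar>w\<bar>\<close> below the clipping threshold for all time.

  \<^bold>\<open>Solutions.\<close> The operator \<open>A = 2 - L\<close> comes from the form
  \<open>\<langle>x', p'\<rangle> - c \<langle>x', p\<rangle> + \<langle>(1 + 2 u) x, p\<rangle>\<close> on \<open>H1_0\<close> and is m-accretive in \<open>L2\<close>. Its contraction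
  semigroup \<open>S\<close> is the limit of the flows of the Yosida approximations (\<open>S_deriv_dA\<close>). A Lyapunov
  function along orbits gives \<open>\<parallel>A (S t x)\<parallel> \<le> C \<parallel>x\<parallel> / t\<close> (\<open>norm_A_S\<close>). Mild solutions starting in
  \<open>H1_0\<close> are Hoelder continuous in time with exponent \<open>1/2\<close>, and this compensates the singularity
  \<open>1/t\<close> in Duhamel's formula, so that they are strong solutions, continuous with values in \<open>H1_0\<close>
  (\<open>strong_solution_exists\<close>). Uniqueness is Gronwall's inequality for the \<open>L2\<close> norm of a
  difference of two solutions (\<open>evolution_solution_unique\<close>).
\<close>


section \<open>Preliminaries\<close>

lemma gronwall_derivative:
  fixes f :: "real \<Rightarrow> real"
  assumes cont: "continuous_on {0..t} f"
    and der: "\<And>s. 0 < s \<Longrightarrow> s < t \<Longrightarrow> \<exists>y. (f has_real_derivative y) (at s) \<and> y \<le> k * f s"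
    and t: "t \<ge> 0"
  shows "f t \<le> exp (k * t) * f 0"
proof -
  define g where "g s = exp (- k * s) * f s" for s
  have "g t \<le> g 0"
  proof (rule DERIV_nonpos_imp_decreasing_open[OF t])
    fix s :: real assume s: "0 < s" "s < t"
    obtain y where y: "(f has_real_derivative y) (at s)" "y \<le> k * f s" using der s by blast
    have "(g has_real_derivative exp (- k * s) * y + (- k * exp (- k * s)) * f s) (at s)"
      unfolding g_def by (auto intro!: derivative_eq_intros y)
    moreover have "exp (- k * s) * y + (- k * exp (- k * s)) * f s = exp (- k * s) * (y - k * f s)"
      by (simp add: algebra_simps)
    moreover have "\<dots> \<le> 0" using y by (simp add: mult_le_0_iff)
    ultimately show "\<exists>y. (g has_real_derivative y) (at s) \<and> y \<le> 0" by metis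
  next
    show "continuous_on {0..t} g" unfolding g_def by (intro continuous_intros cont)
  qed
  then have "exp (k * t) * (exp (- k * t) * f t) \<le> exp (k * t) * f 0"
    unfolding g_def by (intro mult_left_mono) auto
  then show ?thesis by (simp add: mult.assoc[symmetric] exp_add[symmetric])
qed

lemma gronwall_integral:
  fixes f :: "real \<Rightarrow> real"
  assumes cont: "continuous_on {0..} f" and L: "L \<ge> 0"
    and le: "\<And>t. 0 \<le> t \<Longrightarrow> f t \<le> a + L * integral {0..t} f"
    and t: "t \<ge> 0"
  shows "f t \<le> a * exp (L * t)"
proof -
  define g where "g s = a + L * integral {0..s} f" for s
  have der: "(g has_real_derivative L * f s) (at s within {0..T})" if "0 \<le> s" "s \<le> T" for s T
  proof -
    have "((\<lambda>u. integral {0..u} f) has_real_derivative f s) (at s within {0..T})"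
      using that by (intro integral_has_real_derivative continuous_on_subset[OF cont]) auto
    then show ?thesis unfolding g_def by (auto intro!: derivative_eq_intros)
  qed
  have contg: "continuous_on {0..} g"
  proof (rule continuous_on_eq_continuous_within[THEN iffD2], rule ballI)
    fix s :: real assume "s \<in> {0..}"
    then have "continuous (at s within {0..s+1}) g"
      using der[of s "s+1"] DERIV_continuous by force
    moreover have "at s within {0..s+1} = at s within {0..}"
      using \<open>s \<in> {0..}\<close> by (intro at_within_nhd[of s "{..<s+1}"]) auto
    ultimately show "continuous (at s within {0..}) g" by simp
  qed
  have "g t \<le> exp (L * t) * g 0"
  proof (rule gronwall_derivative[OF _ _ t])
    show "continuous_on {0..t} g" by (rule continuous_on_subset[OF contg]) auto
    fix s :: real assume s: "0 < s"
    have "(g has_real_derivative L * f s) (at s)"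
      using der[of s "s+1"] s at_within_Icc_at[of 0 s "s+1"] by simp
    moreover have "L * f s \<le> L * g s" using le[of s] s L unfolding g_def by (intro mult_left_mono) auto
    ultimately show "\<exists>y. (g has_real_derivative y) (at s) \<and> y \<le> L * g s" by blast
  qed
  then show ?thesis using le[OF t] by (simp add: g_def mult.commute)
qed

text \<open>The norm is not differentiable at zeros of \<open>y\<close>; the proof differentiates
  \<open>sqrt (\<parallel>y\<parallel>\<^sup>2 + e\<^sup>2)\<close> instead and lets \<open>e\<close> tend to \<open>0\<close>.\<close>

lemma dissipative_growth:
  fixes y :: "real \<Rightarrow> 'a::real_inner"
  assumes der: "\<And>t. t \<ge> 0 \<Longrightarrow> (y has_vector_derivative y' t) (at t within {0..})"
    and K: "K \<ge> 0"
    and diss: "\<And>t. t > 0 \<Longrightarrow> t < T \<Longrightarrow> inner (y' t) (y t) \<le> K * norm (y t)"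
    and T: "T \<ge> 0"
  shows "norm (y T) \<le> norm (y 0) + K * T"
proof (rule field_le_epsilon)
  fix e :: real assume e: "e > 0"
  define g where "g t = sqrt (inner (y t) (y t) + e\<^sup>2) - K * t" for t
  have conty: "continuous_on {0..} y"
    using der by (auto simp: continuous_on_eq_continuous_within intro: has_vector_derivative_continuous)
  have "g T \<le> g 0"
  proof (rule DERIV_nonpos_imp_decreasing_open[OF T])
    fix t :: real assume t: "0 < t" "t < T"
    have d: "(y has_vector_derivative y' t) (at t)"
      using der[of t] t at_within_interior[of t "{0..}"] by (simp add: interior_Ici[where b="-1"])
    have pos: "inner (y t) (y t) + e\<^sup>2 > 0" using e
      by (simp add: add_nonneg_pos)
    have "((\<lambda>t. inner (y t) (y t)) has_real_derivative 2 * inner (y' t) (y t)) (at t)"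
      using has_derivative_inner[OF d[unfolded has_vector_derivative_def] d[unfolded has_vector_derivative_def]]
      unfolding has_field_derivative_def
      by (rule has_derivative_eq_rhs) (auto simp: inner_commute algebra_simps)
    then have "(g has_real_derivative (inner (y' t) (y t)) / sqrt (inner (y t) (y t) + e\<^sup>2) - K) (at t)"
      unfolding g_def using pos by (auto intro!: derivative_eq_intros simp: field_simps)
    moreover have "inner (y' t) (y t) \<le> K * sqrt (inner (y t) (y t) + e\<^sup>2)"
    proof -
      have "norm (y t) \<le> sqrt (inner (y t) (y t) + e\<^sup>2)"
        unfolding norm_eq_sqrt_inner by (intro real_sqrt_le_mono) auto
      then show ?thesis using diss[OF t] K by (meson mult_left_mono order_trans)
    qed
    ultimately show "\<exists>z. (g has_real_derivative z) (at t) \<and> z \<le> 0"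
      using pos by (intro exI conjI) (assumption, simp add: field_simps)
  next
    show "continuous_on {0..T} g" unfolding g_def
      by (intro continuous_intros continuous_on_subset[OF conty]) auto
  qed
  moreover have "sqrt (inner (y 0) (y 0) + e\<^sup>2) \<le> norm (y 0) + e"
    using e by (intro real_le_lsqrt) (auto simp: power2_sum dot_square_norm)
  moreover have "norm (y T) \<le> sqrt (inner (y T) (y T) + e\<^sup>2)"
    unfolding norm_eq_sqrt_inner by (intro real_sqrt_le_mono) auto
  ultimately show "norm (y T) \<le> norm (y 0) + K * T + e" unfolding g_def by simp
qed

text \<open>By the parallelogram law a minimizing sequence for the distance to \<open>S\<close> is Cauchy. The lemma
  is applied below to graphs of unbounded operators in a product space.\<close>

lemma orthogonal_projection_exists:
  fixes S :: "'a::{real_inner,banach} set"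
  assumes sub: "subspace S" and cl: "closed S"
  shows "\<exists>y\<in>S. \<forall>s\<in>S. inner (x - y) s = 0"
proof -
  define d where "d = infdist x S"
  have ne: "S \<noteq> {}" using subspace_0[OF sub] by auto
  have dle: "d \<le> norm (x - s)" if "s \<in> S" for s
    using infdist_le[OF that, of x] by (simp add: d_def dist_norm)
  have d0: "d \<ge> 0" by (simp add: d_def infdist_nonneg)
  have "\<exists>s\<in>S. norm (x - s) < d + 1 / Suc n" for n :: nat
  proof (rule ccontr)
    assume "\<not> ?thesis"
    then have "d + 1 / Suc n \<le> infdist x S"
      unfolding infdist_def using ne by (auto intro!: cINF_greatest simp: dist_norm)
    then show False by (simp add: d_def)
  qed
  then obtain s where s: "\<And>n. s n \<in> S" and sd: "\<And>n. norm (x - s n) < d + 1 / Suc n" by metis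
  have par: "(norm (s n - s m))\<^sup>2 \<le> 2 * (norm (x - s n))\<^sup>2 + 2 * (norm (x - s m))\<^sup>2 - 4 * d\<^sup>2" for n m
  proof -
    have mid: "(1/2) *\<^sub>R (s n + s m) \<in> S" using s sub by (simp add: subspace_add subspace_scale)
    have "d\<^sup>2 \<le> (norm (x - (1/2) *\<^sub>R (s n + s m)))\<^sup>2" using dle[OF mid] d0 by (intro power_mono) auto
    moreover have "(norm (s n - s m))\<^sup>2 = 2 * (norm (x - s n))\<^sup>2 + 2 * (norm (x - s m))\<^sup>2
        - 4 * (norm (x - (1/2) *\<^sub>R (s n + s m)))\<^sup>2"
      by (simp add: power2_norm_eq_inner algebra_simps inner_commute)
    ultimately show ?thesis by linarith
  qed
  have lim: "(\<lambda>n. norm (x - s n)) \<longlonglongrightarrow> d"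
  proof (rule tendsto_sandwich[of "\<lambda>_. d" _ _ "\<lambda>n. d + 1 / Suc n"])
    show "(\<lambda>n. d + 1 / real (Suc n)) \<longlonglongrightarrow> d"
      using LIMSEQ_inverse_real_of_nat_add[of d] by (simp add: inverse_eq_divide)
  qed (use dle s sd less_imp_le in \<open>blast intro!: eventuallyI\<close>)+
  have "Cauchy s"
  proof (rule metric_CauchyI)
    fix e :: real assume e: "e > 0"
    have "(\<lambda>n. (norm (x - s n))\<^sup>2) \<longlonglongrightarrow> d\<^sup>2" using lim by (intro tendsto_intros)
    then obtain M where M: "\<And>n. n \<ge> M \<Longrightarrow> (norm (x - s n))\<^sup>2 < d\<^sup>2 + e\<^sup>2 / 4"
      using order_tendstoD(2)[of _ "d\<^sup>2" sequentially "d\<^sup>2 + e\<^sup>2/4"] e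
      by (force simp: eventually_sequentially)
    have "(norm (s m - s n))\<^sup>2 < e\<^sup>2" if "m \<ge> M" "n \<ge> M" for m n
      using par[of m n] M[OF that(1)] M[OF that(2)] by argo
    then show "\<exists>M. \<forall>m\<ge>M. \<forall>n\<ge>M. dist (s m) (s n) < e"
      using e by (metis dist_norm less_imp_le power_less_imp_less_base)
  qed
  then obtain y where y: "s \<longlonglongrightarrow> y" using Cauchy_convergent convergent_def by blast
  have yS: "y \<in> S" using closed_sequentially[OF cl] s y by blast
  have nd: "norm (x - y) = d"
    by (rule LIMSEQ_unique[OF tendsto_norm[OF tendsto_diff[OF tendsto_const y]] lim])
  have "inner (x - y) z = 0" if z: "z \<in> S" for z
  proof (cases "z = 0")
    case False
    define t where "t = inner (x - y) z / (norm z)\<^sup>2"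
    have zz: "(norm z)\<^sup>2 > 0" using False by simp
    have "y + t *\<^sub>R z \<in> S" using yS z sub by (simp add: subspace_add subspace_scale)
    then have "d\<^sup>2 \<le> (norm (x - (y + t *\<^sub>R z)))\<^sup>2" using dle d0 by (intro power_mono) auto
    also have "\<dots> = d\<^sup>2 - 2 * t * inner (x - y) z + t\<^sup>2 * (norm z)\<^sup>2"
      unfolding nd[symmetric] diff_diff_eq[symmetric] power2_norm_eq_inner
      by (simp add: inner_diff_left inner_diff_right algebra_simps inner_commute power2_eq_square)
    also have "\<dots> = d\<^sup>2 - (inner (x - y) z)\<^sup>2 / (norm z)\<^sup>2"
      using zz False by (simp add: t_def field_simps power2_eq_square)
    finally have "(inner (x - y) z)\<^sup>2 / (norm z)\<^sup>2 \<le> 0" by simp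
    then show ?thesis using zz False by (simp add: divide_le_0_iff)
  qed simp
  then show ?thesis using yS by blast
qed

lemma subspace_closure:
  fixes S :: "'a::real_normed_vector set"
  assumes "subspace S"
  shows "subspace (closure S)"
proof (rule subspaceI)
  show "0 \<in> closure S" using subspace_0[OF assms] closure_subset by blast
next
  fix x y assume "x \<in> closure S" "y \<in> closure S"
  then obtain f g where "\<And>n. f n \<in> S" "f \<longlonglongrightarrow> x" "\<And>n. g n \<in> S" "g \<longlonglongrightarrow> y"
    unfolding closure_sequential by blast
  then have "(\<lambda>n. f n + g n) \<longlonglongrightarrow> x + y" "\<forall>n. f n + g n \<in> S"
    by (auto intro: tendsto_add subspace_add[OF assms])
  then show "x + y \<in> closure S" unfolding closure_sequential by (intro exI[of _ "\<lambda>n. f n + g n"]) auto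
next
  fix x and c :: real assume "x \<in> closure S"
  then obtain f where "\<And>n. f n \<in> S" "f \<longlonglongrightarrow> x" unfolding closure_sequential by blast
  then have "(\<lambda>n. c *\<^sub>R f n) \<longlonglongrightarrow> c *\<^sub>R x" "\<forall>n. c *\<^sub>R f n \<in> S"
    by (auto intro: tendsto_intros subspace_scale[OF assms])
  then show "c *\<^sub>R x \<in> closure S" unfolding closure_sequential by (intro exI[of _ "\<lambda>n. c *\<^sub>R f n"]) auto
qed

lemma subspace_dense_if_no_orthogonal:
  fixes S :: "'a::{real_inner,banach} set"
  assumes sub: "subspace S" and z: "\<And>z. (\<And>s. s \<in> S \<Longrightarrow> inner z s = 0) \<Longrightarrow> z = 0"
  shows "closure S = UNIV"
proof -
  have "x \<in> closure S" for x
  proof -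
    obtain y where y: "y \<in> closure S" "\<And>s. s \<in> closure S \<Longrightarrow> inner (x - y) s = 0"
      using orthogonal_projection_exists[OF subspace_closure[OF sub] closed_closure, of x] by blast
    have "x - y = 0" by (rule z) (use y(2) closure_subset in blast)
    then show ?thesis using y by simp
  qed
  then show ?thesis by auto
qed


section \<open>Contraction families and Duhamel's formula\<close>

text \<open>What Duhamel's integral needs of a semigroup. The constant family \<open>S t = id\<close> is an instance as
  well, so that one fixed point argument produces both the solutions of the evolution equation and
  the solutions of the Lipschitz ordinary differential equations in the Yosida approximation.\<close>

locale contraction_family =
  fixes S :: "real \<Rightarrow> 'a::banach \<Rightarrow> 'a"
  assumes lin: "t \<ge> 0 \<Longrightarrow> linear (S t)"
    and contr: "t \<ge> 0 \<Longrightarrow> norm (S t x) \<le> norm x"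
    and cont: "continuous_on {0..} (\<lambda>t. S t x)"
    and S0: "S 0 x = x"
begin

lemma S_diff: "t \<ge> 0 \<Longrightarrow> S t x - S t y = S t (x - y)"
  using lin by (simp add: linear_diff)

lemma bounded_linear_S: "t \<ge> 0 \<Longrightarrow> bounded_linear (S t)"
  using contr[of t] by (intro bounded_linear_intro[of _ 1]) (auto simp: linear_add[OF lin] linear_scale[OF lin])

lemma S_tendsto:
  assumes g: "(g \<longlongrightarrow> t) F" and f: "(f \<longlongrightarrow> x) F" and ge: "eventually (\<lambda>s. g s \<ge> 0) F" and t: "t \<ge> 0"
  shows "((\<lambda>s. S (g s) (f s)) \<longlongrightarrow> S t x) F"
proof -
  have "((\<lambda>s. S (g s) x) \<longlongrightarrow> S t x) F"
    by (rule continuous_on_tendsto_compose[OF cont g]) (use t ge in auto)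
  moreover have "((\<lambda>s. S (g s) (f s) - S (g s) x) \<longlongrightarrow> 0) F"
  proof (rule Lim_null_comparison)
    show "\<forall>\<^sub>F s in F. norm (S (g s) (f s) - S (g s) x) \<le> norm (f s - x)"
      using ge by eventually_elim (simp add: S_diff contr)
    show "((\<lambda>s. norm (f s - x)) \<longlongrightarrow> 0) F" using f by (simp add: LIM_zero tendsto_norm_zero)
  qed
  ultimately show ?thesis using tendsto_add by fastforce
qed

lemma continuous_on_S:
  assumes "continuous_on I g" "continuous_on I f" "\<And>s. s \<in> I \<Longrightarrow> g s \<ge> 0"
  shows "continuous_on I (\<lambda>s. S (g s) (f s))"
  unfolding continuous_on_def
proof
  fix s assume s: "s \<in> I"
  show "((\<lambda>s. S (g s) (f s)) \<longlongrightarrow> S (g s) (f s)) (at s within I)"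
    using assms s by (intro S_tendsto) (auto simp: continuous_on_def eventually_at_filter)
qed

definition duhamel :: "(real \<Rightarrow> 'a) \<Rightarrow> real \<Rightarrow> 'a" where
  "duhamel f t = integral {0..t} (\<lambda>s. S (t - s) (f s))"

lemma duhamel_integrable:
  assumes "continuous_on {0..t} f" "a \<ge> 0" "b \<le> t"
  shows "(\<lambda>s. S (t - s) (f s)) integrable_on {a..b}"
  by (intro integrable_continuous_real continuous_on_S continuous_intros
        continuous_on_subset[OF assms(1)]) (use assms in auto)

text \<open>On a fixed interval the time \<open>t\<close> becomes a parameter of the integrand, which gives continuity
  in \<open>t\<close>.\<close>

lemma duhamel_rescale:
  assumes "continuous_on {0..} f" "t \<ge> 0"
  shows "duhamel f t = t *\<^sub>R integral {0..1} (\<lambda>r. S (t - t * r) (f (t * r)))"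
proof (cases "t = 0")
  case False
  then have t: "t > 0" using assms by simp
  have "((\<lambda>s. S (t - s) (f s)) has_integral duhamel f t) {0..t}"
    unfolding duhamel_def using duhamel_integrable[of t f 0 t] assms continuous_on_subset
    by (metis Icc_subset_Ici_iff has_integral_iff order_refl)
  from has_integral_stretch_real[OF this, of t] t
  have "((\<lambda>r. S (t - t * r) (f (t * r))) has_integral (1/t) *\<^sub>R duhamel f t) {0..1}"
    by (simp add: image_divide_atLeastAtMost)
  then show ?thesis using t by (simp add: integral_unique)
qed (simp add: duhamel_def)

lemma duhamel_continuous:
  assumes f: "continuous_on {0..} f"
  shows "continuous_on {0..} (duhamel f)"
proof -
  have *: "continuous_on ({0..} \<times> cbox 0 1) (\<lambda>(t, r). S (t - t * r) (f (t * r)))"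
    unfolding case_prod_beta
    by (intro continuous_on_S continuous_intros continuous_on_compose2[OF f])
       (auto simp: mult_left_le)
  have "continuous_on {0..} (\<lambda>t. integral (cbox 0 1) (\<lambda>r. S (t - t * r) (f (t * r))))"
    by (rule integral_continuous_on_param[OF *])
  then have "continuous_on {0..} (\<lambda>t. t *\<^sub>R integral {0..1} (\<lambda>r. S (t - t * r) (f (t * r))))"
    by (intro continuous_intros) auto
  then show ?thesis by (rule continuous_on_eq) (simp add: duhamel_rescale[OF f])
qed

lemma duhamel_norm_le:
  assumes f: "continuous_on {0..} f" and t: "t \<ge> 0" and h: "continuous_on {0..t} h"
    and le: "\<And>s. 0 \<le> s \<Longrightarrow> s \<le> t \<Longrightarrow> norm (f s) \<le> h s"
  shows "norm (duhamel f t) \<le> integral {0..t} h"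
  unfolding duhamel_def
proof (rule integral_norm_bound_integral)
  show "(\<lambda>s. S (t - s) (f s)) integrable_on {0..t}"
    using duhamel_integrable[of t f 0 t] continuous_on_subset[OF f] by auto
  show "h integrable_on {0..t}" using h integrable_continuous_real by blast
  show "norm (S (t - s) (f s)) \<le> h s" if "s \<in> {0..t}" for s
    using that contr[of "t - s" "f s"] le[of s] by auto
qed

lemma duhamel_diff:
  assumes "continuous_on {0..} f" "continuous_on {0..} g" "t \<ge> 0"
  shows "duhamel f t - duhamel g t = duhamel (\<lambda>s. f s - g s) t"
proof -
  have "integral {0..t} (\<lambda>s. S (t - s) (f s)) - integral {0..t} (\<lambda>s. S (t - s) (g s))
     = integral {0..t} (\<lambda>s. S (t - s) (f s) - S (t - s) (g s))"
    using duhamel_integrable[of t f 0 t] duhamel_integrable[of t g 0 t]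
      continuous_on_subset[OF assms(1), of "{0..t}"] continuous_on_subset[OF assms(2), of "{0..t}"]
    by (intro Henstock_Kurzweil_Integration.integral_diff[symmetric]) auto
  also have "\<dots> = duhamel (\<lambda>s. f s - g s) t"
    unfolding duhamel_def by (rule Henstock_Kurzweil_Integration.integral_cong) (simp add: S_diff)
  finally show ?thesis by (simp add: duhamel_def)
qed

text \<open>The ansatz \<open>y t = exp (2 L t) g t\<close> with \<open>g\<close> bounded turns the Duhamel map into a contraction
  with factor \<open>1/2\<close> on the whole half-line at once, so that no local solutions have to be
  continued. Functions \<open>g\<close> are defined on all of \<open>\<real>\<close>, hence the clamping \<open>max 0 t\<close>.\<close>

lemma mild_solution_exists:
  assumes N0: "N 0 = 0" and L: "L > 0"
    and Lip: "\<And>x y. norm (N x - N y) \<le> L * norm (x - y :: 'a)"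
  shows "\<exists>y. continuous_on {0..} y \<and> (\<forall>t\<ge>0. y t = S t x + duhamel (\<lambda>s. N (y s)) t)"
proof -
  define k where "k = 2 * L"
  have k: "k > 0" using L by (simp add: k_def)
  have contN: "continuous_on I N" for I
    using Lip by (intro lipschitz_on_continuous_on[of L]) (auto simp: lipschitz_on_def dist_norm L[THEN less_imp_le])
  define u where "u g = (\<lambda>s. N (exp (k * s) *\<^sub>R apply_bcontfun g s))" for g :: "(real, 'a) bcontfun"
  have contu: "continuous_on I (u g)" for g I
    unfolding u_def by (intro continuous_on_compose2[OF contN] continuous_intros) auto
  define T where "T g t = exp (- k * max 0 t) *\<^sub>R (S (max 0 t) x + duhamel (u g) (max 0 t))" for g t
  have expint: "integral {0..t} (\<lambda>s. L * exp (k * s) * C) \<le> exp (k*t) * (C / 2)" if "t \<ge> 0" "C \<ge> 0" for t C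
  proof -
    have "((\<lambda>s. L * exp (k * s) * C) has_integral (exp (k*t) * (C/2) - exp (k*0) * (C/2))) {0..t}"
      using that k
      by (intro fundamental_theorem_of_calculus)
         (auto intro!: derivative_eq_intros simp: k_def has_real_derivative_iff_has_vector_derivative[symmetric])
    then have "integral {0..t} (\<lambda>s. L * exp (k * s) * C) = exp (k * t) * (C/2) - exp (k * 0) * (C/2)"
      by (rule integral_unique)
    moreover have "exp (k * 0) * (C/2) \<ge> 0" using that by simp
    ultimately show ?thesis by linarith
  qed
  have inner_bound: "norm (exp (- k * t) *\<^sub>R duhamel f t) \<le> C / 2"
    if f: "continuous_on {0..} f" and t: "t \<ge> 0" and C: "C \<ge> 0"
      and le: "\<And>s. s \<ge> 0 \<Longrightarrow> norm (f s) \<le> L * exp (k * s) * C" for f t C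
  proof -
    have "norm (duhamel f t) \<le> integral {0..t} (\<lambda>s. L * exp (k * s) * C)"
      using f t le by (intro duhamel_norm_le continuous_intros) auto
    also have "\<dots> \<le> exp (k*t) * (C / 2)" using expint t C by simp
    finally have "exp (-k*t) * norm (duhamel f t) \<le> exp (-k*t) * (exp (k*t) * (C / 2))"
      by (intro mult_left_mono) auto
    then show ?thesis by (simp add: mult.assoc[symmetric] exp_add[symmetric])
  qed
  have norm_le: "norm (apply_bcontfun g s) \<le> norm g" for g :: "(real, 'a) bcontfun" and s
    by (rule norm_bounded)
  have Tb: "T g \<in> bcontfun" for g
  proof -
    have "norm (T g t) \<le> norm x + norm g / 2" for t
    proof -
      have "norm (exp (- k * max 0 t) *\<^sub>R S (max 0 t) x) \<le> 1 * norm x"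
        unfolding norm_scaleR using k contr[of "max 0 t" x] by (intro mult_mono) auto
      moreover have "norm (exp (- k * max 0 t) *\<^sub>R duhamel (u g) (max 0 t)) \<le> norm g / 2"
      proof (rule inner_bound[OF contu])
        show "norm (u g s) \<le> L * exp (k * s) * norm g" for s
          using Lip[of "exp (k * s) *\<^sub>R g s" 0] norm_le[of g s] L
          unfolding u_def N0 by (simp add: mult.assoc) (meson exp_ge_zero order.strict_implies_order mult_left_mono order_trans)
      qed auto
      ultimately show ?thesis unfolding T_def scaleR_add_right
        by (intro order_trans[OF norm_triangle_ineq] add_mono) auto
    qed
    moreover have "continuous_on UNIV (T g)"
      unfolding T_def
      by (intro continuous_intros continuous_on_S continuous_on_compose2[OF duhamel_continuous[OF contu]]) auto
    ultimately show ?thesis unfolding bcontfun_def bounded_iff by auto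
  qed
  define F where "F g = Bcontfun (T g)" for g
  have F: "apply_bcontfun (F g) = T g" for g unfolding F_def using Tb by (simp add: Bcontfun_inverse)
  have "dist (F g) (F h) \<le> (1/2) * dist g h" for g h
  proof (rule dist_bound)
    fix t
    have "dist (F g t) (F h t) = norm (exp (- k * max 0 t) *\<^sub>R (duhamel (u g) (max 0 t) - duhamel (u h) (max 0 t)))"
      unfolding F T_def dist_norm by (simp add: scaleR_diff_right scaleR_add_right)
    also have "\<dots> = norm (exp (- k * max 0 t) *\<^sub>R (duhamel (\<lambda>s. u g s - u h s) (max 0 t)))"
      by (simp add: duhamel_diff contu)
    also have "\<dots> \<le> dist g h / 2"
    proof (rule inner_bound)
      show "norm (u g s - u h s) \<le> L * exp (k * s) * dist g h" for s
      proof -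
        have "norm (u g s - u h s) \<le> L * (exp (k * s) * dist (g s) (h s))"
          using Lip[of "exp (k * s) *\<^sub>R g s" "exp (k * s) *\<^sub>R h s"]
          by (simp add: u_def scaleR_diff_right[symmetric] dist_norm)
        also have "\<dots> \<le> L * (exp (k * s) * dist g h)" using L dist_bounded[of g s h]
          by (intro mult_left_mono) auto
        finally show ?thesis by simp
      qed
    qed (auto intro!: continuous_intros contu)
    finally show "dist (F g t) (F h t) \<le> (1/2) * dist g h" by simp
  qed
  then obtain g where g: "F g = g" using banach_fix_type[of "1/2" F] by auto
  define y where "y t = exp (k * t) *\<^sub>R apply_bcontfun g t" for t
  have "y t = S t x + duhamel (\<lambda>s. N (y s)) t" if "t \<ge> 0" for t
  proof -
    have "y t = exp (k * t) *\<^sub>R T g t" unfolding y_def by (metis F g)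
    also have "\<dots> = S t x + duhamel (u g) t"
      using that by (simp add: T_def exp_add[symmetric])
    finally show ?thesis by (simp add: u_def y_def)
  qed
  moreover have "continuous_on {0..} y" unfolding y_def by (intro continuous_intros) auto
  ultimately show ?thesis by blast
qed

end

lemma lipschitz_ode_exists:
  fixes N :: "'a::banach \<Rightarrow> 'a"
  assumes N0: "N 0 = 0" and L: "L > 0"
    and Lip: "\<And>x y. norm (N x - N y) \<le> L * norm (x - y)"
  shows "\<exists>y. y 0 = x \<and> (\<forall>t\<ge>0. (y has_vector_derivative N (y t)) (at t within {0..}))"
proof -
  interpret contraction_family "\<lambda>_ x. x" by unfold_locales (auto intro: linear_ident)
  from mild_solution_exists[OF N0 L Lip, of x] obtain y where y1: "continuous_on {0..} y"
    and y2: "\<forall>t\<ge>0. y t = x + duhamel (\<lambda>s. N (y s)) t" by (elim exE conjE)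
  note y = y1 y2[rule_format, unfolded duhamel_def]
  have y0: "y 0 = x" by (subst y(2)) auto
  have contN: "continuous_on UNIV N"
    using Lip by (intro lipschitz_on_continuous_on[of L]) (auto simp: lipschitz_on_def dist_norm L[THEN less_imp_le])
  have "(y has_vector_derivative N (y t)) (at t within {0..})" if t: "t \<ge> 0" for t
  proof -
    have "((\<lambda>u. integral {0..u} (\<lambda>s. N (y s))) has_vector_derivative N (y t)) (at t within {0..t+1})"
      using t by (intro integral_has_vector_derivative continuous_on_compose2[OF contN]
         continuous_on_subset[OF y(1)]) auto
    then have "((\<lambda>u. x + integral {0..u} (\<lambda>s. N (y s))) has_vector_derivative N (y t)) (at t within {0..t+1})"
      by (auto intro!: derivative_eq_intros)
    then have "(y has_vector_derivative N (y t)) (at t within {0..t+1})"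
      by (rule has_vector_derivative_transform[rotated 2]) (use t in \<open>auto simp: y(2)[symmetric]\<close>)
    moreover have "at t within {0..t+1} = at t within {0..}"
      using t by (intro at_within_nhd[of t "{..<t+1}"]) auto
    ultimately show ?thesis by simp
  qed
  then show ?thesis using y0 by blast
qed


section \<open>The semigroup of an m-accretive operator\<close>

text \<open>The Hille-Yosida setting. The range condition is stated for large \<open>l\<close> because the operator
  constructed later is inverted by a perturbation argument, which works for large \<open>l\<close>.\<close>

locale m_accretive =
  fixes dA :: "'a::{real_inner,banach} set" and A :: "'a \<Rightarrow> 'a" and l0 :: real
  assumes dA_subspace: "subspace dA"
    and A_add: "x \<in> dA \<Longrightarrow> y \<in> dA \<Longrightarrow> A (x + y) = A x + A y"
    and A_scale: "x \<in> dA \<Longrightarrow> A (r *\<^sub>R x) = r *\<^sub>R A x"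
    and accretive: "x \<in> dA \<Longrightarrow> inner (A x) x \<ge> 0"
    and dense: "closure dA = UNIV"
    and range: "l \<ge> l0 \<Longrightarrow> \<exists>x\<in>dA. l *\<^sub>R x + A x = f"
    and l0: "l0 > 0"
begin

lemma A_diff: "x \<in> dA \<Longrightarrow> y \<in> dA \<Longrightarrow> A (x - y) = A x - A y"
  using A_add[of x "(-1) *\<^sub>R y"] A_scale[of y "-1"] subspace_scale[OF dA_subspace, of y "-1"] by simp

definition res :: "real \<Rightarrow> 'a \<Rightarrow> 'a" where
  "res l f = (SOME x. x \<in> dA \<and> l *\<^sub>R x + A x = f)"

lemma res:
  assumes "l \<ge> l0"
  shows res_in: "res l f \<in> dA" and res_eq: "l *\<^sub>R res l f + A (res l f) = f"
proof -
  have "\<exists>x. x \<in> dA \<and> l *\<^sub>R x + A x = f" using range[OF assms] by blast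
  from someI_ex[OF this] show "res l f \<in> dA" "l *\<^sub>R res l f + A (res l f) = f"
    unfolding res_def by auto
qed

lemma res_bound_aux:
  assumes l: "l > 0" and x: "x \<in> dA"
  shows "l * norm x \<le> norm (l *\<^sub>R x + A x)"
proof (cases "x = 0")
  case False
  have "l * (norm x * norm x) \<le> inner (l *\<^sub>R x + A x) x"
    using accretive[OF x] by (simp add: inner_add_left norm_eq_sqrt_inner)
  also have "\<dots> \<le> norm (l *\<^sub>R x + A x) * norm x" by (rule norm_cauchy_schwarz)
  finally show ?thesis using False by (simp add: mult.assoc[symmetric])
qed simp

lemma res_unique:
  assumes l: "l \<ge> l0" and x: "x \<in> dA" and eq: "l *\<^sub>R x + A x = f"
  shows "res l f = x"
proof -
  have "l * norm (res l f - x) \<le> norm (l *\<^sub>R (res l f - x) + A (res l f - x))"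
    using l l0 by (intro res_bound_aux subspace_diff[OF dA_subspace] res_in x) auto
  also have "l *\<^sub>R (res l f - x) + A (res l f - x) = (l *\<^sub>R res l f + A (res l f)) - (l *\<^sub>R x + A x)"
    by (simp add: A_diff res_in l x algebra_simps)
  also have "\<dots> = 0" using res_eq[OF l] eq by simp
  finally have "norm (res l f - x) \<le> 0" using l l0 by (simp add: mult_le_0_iff)
  then show ?thesis by simp
qed

lemma norm_res: "l \<ge> l0 \<Longrightarrow> l * norm (res l f) \<le> norm f"
  using res_bound_aux[of l "res l f"] res_in[of l f] res_eq[of l f] l0 by simp

lemma linear_res: assumes l: "l \<ge> l0" shows "linear (res l)"
proof (rule linearI)
  fix x y
  have "l *\<^sub>R (res l x + res l y) + A (res l x + res l y)
      = (l *\<^sub>R res l x + A (res l x)) + (l *\<^sub>R res l y + A (res l y))"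
    using l by (simp add: A_add res_in algebra_simps)
  then show "res l (x + y) = res l x + res l y"
    using l by (intro res_unique subspace_add[OF dA_subspace] res_in) (auto simp: res_eq)
next
  fix r :: real and x
  have "l *\<^sub>R (r *\<^sub>R res l x) + A (r *\<^sub>R res l x) = r *\<^sub>R (l *\<^sub>R res l x + A (res l x))"
    using l by (simp add: A_scale res_in algebra_simps)
  then show "res l (r *\<^sub>R x) = r *\<^sub>R res l x"
    using l by (intro res_unique subspace_scale[OF dA_subspace] res_in) (auto simp: res_eq)
qed

lemma bounded_linear_res: assumes l: "l \<ge> l0" shows "bounded_linear (res l)"
proof (rule bounded_linear_intro)
  show "norm (res l x) \<le> norm x * (1/l)" for x
    using norm_res[OF l, of x] l l0 by (simp add: field_simps)
qed (auto simp: linear_add[OF linear_res[OF l]] linear_scale[OF linear_res[OF l]])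

lemma A_res: "l \<ge> l0 \<Longrightarrow> A (res l x) = x - l *\<^sub>R res l x"
  using res_eq[of l x] by (simp add: algebra_simps)

lemma res_A:
  assumes l: "l \<ge> l0" and x: "x \<in> dA"
  shows "res l (A x) = x - l *\<^sub>R res l x"
proof -
  have "res l (l *\<^sub>R x + A x) = x" by (rule res_unique[OF l x refl])
  then show ?thesis by (simp add: linear_add[OF linear_res[OF l]] linear_scale[OF linear_res[OF l]] algebra_simps)
qed

lemma res_commute:
  assumes l: "l \<ge> l0" and m: "m \<ge> l0"
  shows "res l (res m f) = res m (res l f)"
proof -
  have "A (res l (res m f)) = res l (A (res m f))"
    by (simp only: A_res[OF l] res_A[OF l res_in[OF m]])
  then have "m *\<^sub>R res l (res m f) + A (res l (res m f)) = m *\<^sub>R res l (res m f) + res l (A (res m f))"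
    by simp
  also have "\<dots> = res l (m *\<^sub>R res m f + A (res m f))"
    using l by (simp add: linear_add[OF linear_res[OF l]] linear_scale[OF linear_res[OF l]])
  also have "\<dots> = res l f" using m by (simp add: res_eq)
  finally have "res m (res l f) = res l (res m f)"
    using l m by (intro res_unique) (auto simp: res_in)
  then show ?thesis by simp
qed

text \<open>\<open>res l0\<close> is bounded and inverts \<open>l0 + A\<close>, and the inverse of a bounded operator is closed.\<close>

lemma closed_graph:
  assumes x: "\<And>n. x n \<in> dA" "x \<longlonglongrightarrow> y" "(\<lambda>n. A (x n)) \<longlonglongrightarrow> z"
  shows "y \<in> dA" "A y = z"
proof -
  have "(\<lambda>n. res l0 (l0 *\<^sub>R x n + A (x n))) \<longlonglongrightarrow> res l0 (l0 *\<^sub>R y + z)"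
    by (intro bounded_linear.tendsto[OF bounded_linear_res] tendsto_intros x) auto
  moreover have "res l0 (l0 *\<^sub>R x n + A (x n)) = x n" for n by (intro res_unique x) auto
  ultimately have y: "y = res l0 (l0 *\<^sub>R y + z)" using x(2) LIMSEQ_unique by auto
  show "y \<in> dA" by (subst y, rule res_in) simp
  have "A y = l0 *\<^sub>R y + z - l0 *\<^sub>R y" using A_res[of l0 "l0 *\<^sub>R y + z"] y by simp
  then show "A y = z" by simp
qed

definition lam :: "nat \<Rightarrow> real" where "lam n = l0 + real n"

lemma lam: "lam n \<ge> l0" "lam n > 0"
  using l0 by (auto simp: lam_def)

lemma lam_inf: "filterlim lam at_top sequentially"
  unfolding lam_def by (intro filterlim_tendsto_add_at_top[OF tendsto_const] filterlim_real_sequentially)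

text \<open>The operators \<open>J n\<close> are contractions into the domain that tend to the identity; \<open>Y n = A J n\<close>
  is the Yosida approximation, bounded and still accretive.\<close>

definition J :: "nat \<Rightarrow> 'a \<Rightarrow> 'a" where "J n x = lam n *\<^sub>R res (lam n) x"

lemma J_in: "J n x \<in> dA"
  unfolding J_def by (intro subspace_scale[OF dA_subspace] res_in lam)

lemma linear_J: "linear (J n)"
  unfolding J_def by (intro linear_compose_scale_right linear_res lam)

lemma norm_J: "norm (J n x) \<le> norm x"
  using norm_res[of "lam n" x] lam[of n] by (simp add: J_def)

lemma J_tendsto: "(\<lambda>n. J n x) \<longlonglongrightarrow> x"
proof (rule LIMSEQ_I)
  fix e :: real assume e: "e > 0"
  have "x \<in> closure dA" using dense by simp
  then obtain z where z: "z \<in> dA" "norm (x - z) < e / 4"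
    unfolding closure_approachable using e by (metis dist_norm norm_minus_commute zero_less_divide_iff zero_less_numeral)
  have "(\<lambda>n. norm (A z) / lam n) \<longlonglongrightarrow> 0"
    by (intro real_tendsto_divide_at_top[OF tendsto_const] lam_inf)
  then obtain K where K: "\<And>n. n \<ge> K \<Longrightarrow> norm (A z) / lam n < e / 4"
    using order_tendstoD(2)[of _ 0 sequentially "e/4"] e by (force simp: eventually_sequentially)
  have "norm (J n x - x) < e" if "n \<ge> K" for n
  proof -
    have "J n x - x = J n (x - z) + (J n z - z) + (z - x)"
      by (simp add: linear_diff[OF linear_J])
    then have "norm (J n x - x) \<le> norm (J n (x - z)) + norm (J n z - z) + norm (z - x)"
      by (metis norm_triangle_le norm_triangle_mono order_refl)
    moreover have "norm (J n (x - z)) < e/4" using norm_J z(2) by (meson le_less_trans)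
    moreover have "norm (z - x) < e/4" using z(2) by (simp add: norm_minus_commute)
    moreover have "norm (J n z - z) \<le> norm (A z) / lam n"
    proof -
      have "J n z - z = - res (lam n) (A z)" by (simp add: J_def res_A[OF lam(1) z(1)])
      then show ?thesis using norm_res[OF lam(1), of n "A z"] lam(2)[of n]
        by (simp add: pos_le_divide_eq mult.commute)
    qed
    ultimately show ?thesis using K[OF that] e by linarith
  qed
  then show "\<exists>K. \<forall>n\<ge>K. norm (J n x - x) < e" by blast
qed

definition Y :: "nat \<Rightarrow> 'a \<Rightarrow> 'a" where "Y n x = lam n *\<^sub>R (x - J n x)"

lemma linear_Y: "linear (Y n)"
  unfolding Y_def by (intro linear_compose_scale_right linear_compose_sub linear_ident linear_J)

lemma Y_eq: "Y n x = A (J n x)"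
  unfolding Y_def J_def by (simp add: A_scale res_in lam A_res)

lemma Y_domain: assumes "x \<in> dA" shows "Y n x = J n (A x)"
  unfolding Y_def J_def using res_A[OF lam(1) assms] by simp

lemma Y_accretive: "inner (Y n x) x \<ge> 0"
proof -
  have "x = J n x + (1 / lam n) *\<^sub>R Y n x" using lam(2)[of n] by (simp add: Y_def)
  then have "inner (Y n x) x = inner (A (J n x)) (J n x) + (1 / lam n) * inner (Y n x) (Y n x)"
    by (metis Y_eq inner_add_right inner_scaleR_right)
  then show ?thesis using accretive[OF J_in] lam(2)[of n] by simp
qed

lemma norm_Y: "norm (Y n x) \<le> 2 * lam n * norm x"
proof -
  have "norm (x - J n x) \<le> norm x + norm x" using norm_triangle_ineq4[of x "J n x"] norm_J[of n x] by linarith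
  then show ?thesis using lam(2)[of n] by (simp add: Y_def mult_left_mono)
qed

lemma Y_commute: "Y n (Y m x) = Y m (Y n x)"
  unfolding Y_def J_def
  using res_commute[OF lam(1)[of n] lam(1)[of m]]
  by (simp add: linear_diff[OF linear_res] linear_scale[OF linear_res] lam algebra_simps)

lemma res_Y: assumes "l \<ge> l0" shows "res l (Y n x) = Y n (res l x)"
  unfolding Y_def J_def using res_commute[OF assms lam(1)]
  by (simp add: linear_diff[OF linear_res] linear_scale[OF linear_res] assms)

text \<open>The flow \<open>exp (- t Y n)\<close>, obtained as the solution of a Lipschitz differential equation.\<close>

definition E :: "nat \<Rightarrow> 'a \<Rightarrow> real \<Rightarrow> 'a" where
  "E n x = (SOME y. y 0 = x \<and> (\<forall>t\<ge>0. (y has_vector_derivative - Y n (y t)) (at t within {0..})))"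

lemma E: shows E_0: "E n x 0 = x"
  and E_deriv: "t \<ge> 0 \<Longrightarrow> (E n x has_vector_derivative - Y n (E n x t)) (at t within {0..})"
proof -
  have "\<exists>y. y 0 = x \<and> (\<forall>t\<ge>0. (y has_vector_derivative - Y n (y t)) (at t within {0..}))"
  proof (rule lipschitz_ode_exists)
    show "norm (- Y n a - - Y n b) \<le> (2 * lam n) * norm (a - b)" for a b
      using norm_Y[of n "b - a"] by (simp add: linear_diff[OF linear_Y] norm_minus_commute)
  qed (use lam in \<open>auto simp: linear_0[OF linear_Y]\<close>)
  from someI_ex[OF this] show "E n x 0 = x"
    "t \<ge> 0 \<Longrightarrow> (E n x has_vector_derivative - Y n (E n x t)) (at t within {0..})"
    unfolding E_def by auto
qed

lemma E_stability:
  assumes der: "\<And>t. t \<ge> 0 \<Longrightarrow> (y has_vector_derivative - Y n (y t) + f t) (at t within {0..})"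
    and K: "\<And>t. t > 0 \<Longrightarrow> t < T \<Longrightarrow> norm (f t) \<le> K" "K \<ge> 0" and T: "T \<ge> 0"
  shows "norm (y T) \<le> norm (y 0) + K * T"
proof (rule dissipative_growth[OF der K(2) _ T])
  fix t assume t: "0 < t" "t < T"
  have "inner (f t) (y t) \<le> K * norm (y t)"
    using norm_cauchy_schwarz[of "f t" "y t"] K(1)[OF t] by (meson mult_right_mono norm_ge_zero order_trans)
  then show "inner (- Y n (y t) + f t) (y t) \<le> K * norm (y t)"
    using Y_accretive[of n "y t"] by (simp add: inner_diff_left)
qed

lemma E_unique:
  assumes der: "\<And>t. t \<ge> 0 \<Longrightarrow> (y has_vector_derivative - Y n (y t)) (at t within {0..})"
    and T: "T \<ge> 0"
  shows "y T = E n (y 0) T"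
proof -
  have "norm (y T - E n (y 0) T) \<le> norm (y 0 - E n (y 0) 0) + 0 * T"
  proof (rule E_stability[where f = "\<lambda>_. 0" and y = "\<lambda>t. y t - E n (y 0) t" and n = n])
    fix t :: real assume t: "t \<ge> 0"
    show "((\<lambda>t. y t - E n (y 0) t) has_vector_derivative - Y n (y t - E n (y 0) t) + 0) (at t within {0..})"
      by (rule has_vector_derivative_eq_rhs, rule has_vector_derivative_diff[OF der[OF t] E_deriv[OF t]])
         (simp add: linear_diff[OF linear_Y])
  qed (use T in auto)
  then show ?thesis by (simp add: E_0)
qed

lemma norm_E: "t \<ge> 0 \<Longrightarrow> norm (E n x t) \<le> norm x"
  using E_stability[of "E n x" n "\<lambda>_. 0" t 0] E_deriv by (simp add: E_0)

lemma E_commute: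
  assumes B: "bounded_linear B" and c: "\<And>x. B (Y n x) = Y n (B x)" and t: "t \<ge> 0"
  shows "B (E n x t) = E n (B x) t"
proof -
  have "((\<lambda>t. B (E n x t)) has_vector_derivative - Y n (B (E n x s))) (at s within {0..})" if "s \<ge> 0" for s
    using bounded_linear.has_vector_derivative[OF B E_deriv[OF that, of n x]]
    by (simp add: c linear_neg[OF bounded_linear.linear[OF B]])
  from E_unique[OF this t] show ?thesis by (simp add: E_0)
qed

lemma linear_E: assumes t: "t \<ge> 0" shows "linear (\<lambda>x. E n x t)"
proof (rule linearI)
  fix x y
  have "((\<lambda>t. E n x t + E n y t) has_vector_derivative - Y n (E n x s + E n y s)) (at s within {0..})" if "s \<ge> 0" for s
    by (rule has_vector_derivative_eq_rhs, rule has_vector_derivative_add[OF E_deriv[OF that] E_deriv[OF that]])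
       (simp add: linear_add[OF linear_Y])
  from E_unique[OF this t] show "E n (x + y) t = E n x t + E n y t" by (simp add: E_0)
next
  fix r :: real and x
  have "bounded_linear (\<lambda>x. r *\<^sub>R x)" by (rule bounded_linear_scaleR_right)
  from E_commute[OF this _ t, of n x] show "E n (r *\<^sub>R x) t = r *\<^sub>R E n x t"
    by (simp add: linear_scale[OF linear_Y])
qed

lemma bounded_linear_Y: "bounded_linear (Y n)"
proof (rule bounded_linear_intro)
  show "norm (Y n x) \<le> norm x * (2 * lam n)" for x using norm_Y[of n x] by (simp add: mult.commute)
qed (auto simp: linear_add[OF linear_Y] linear_scale[OF linear_Y])

lemma E_semigroup:
  assumes t: "t \<ge> 0" and s: "s \<ge> 0"
  shows "E n x (t + s) = E n (E n x s) t"
proof -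
  have "((\<lambda>t. E n x (t + s)) has_vector_derivative - Y n (E n x (r + s))) (at r within {0..})" if r: "r \<ge> 0" for r
  proof -
    have "((E n x \<circ> (\<lambda>t. t + s)) has_vector_derivative (1 *\<^sub>R (- Y n (E n x (r + s))))) (at r within {0..})"
    proof (rule vector_diff_chain_within)
      show "(E n x has_vector_derivative - Y n (E n x (r + s))) (at (r + s) within (\<lambda>t. t + s) ` {0..})"
        by (rule has_vector_derivative_within_subset[OF E_deriv]) (use r s in auto)
    qed (auto intro!: derivative_eq_intros)
    then show ?thesis by (simp add: o_def)
  qed
  from E_unique[OF this t] show ?thesis by simp
qed

text \<open>The difference of the two flows solves the equation of \<open>Y n\<close> with the forcing
  \<open>E m (Y m x - Y n x)\<close>, because all these operators commute; accretivity excludes exponential growth in the estimate.\<close>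

lemma E_diff_le:
  assumes t: "t \<ge> 0"
  shows "norm (E n x t - E m x t) \<le> norm (Y n x - Y m x) * t"
proof -
  have "norm (E n x t - E m x t) \<le> norm (E n x 0 - E m x 0) + norm (Y n x - Y m x) * t"
  proof (rule E_stability[where f = "\<lambda>t. Y m (E m x t) - Y n (E m x t)" and y = "\<lambda>t. E n x t - E m x t" and n = n])
    fix s :: real assume s: "s \<ge> 0"
    show "((\<lambda>t. E n x t - E m x t) has_vector_derivative - Y n (E n x s - E m x s)
        + (Y m (E m x s) - Y n (E m x s))) (at s within {0..})"
      by (rule has_vector_derivative_eq_rhs, rule has_vector_derivative_diff[OF E_deriv[OF s] E_deriv[OF s]])
         (simp add: linear_diff[OF linear_Y])
  next
    fix s :: real assume "0 < s"
    have "Y m (E m x s) - Y n (E m x s) = E m (Y m x - Y n x) s"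
      using E_commute[OF bounded_linear_sub[OF bounded_linear_Y[of m] bounded_linear_Y[of n]], of m s x] \<open>0 < s\<close>
      by (simp add: linear_diff[OF linear_Y] Y_commute)
    then show "norm (Y m (E m x s) - Y n (E m x s)) \<le> norm (Y n x - Y m x)"
      using norm_E[of s m "Y m x - Y n x"] \<open>0 < s\<close> by (simp add: norm_minus_commute)
  qed (use t in auto)
  then show ?thesis by (simp add: E_0)
qed

text \<open>The flows converge on the domain, where \<open>Y n x = J n (A x)\<close> tends to \<open>A x\<close>, and by density
  everywhere (\<open>E_tendsto\<close>).\<close>

definition S :: "real \<Rightarrow> 'a \<Rightarrow> 'a" where "S t x = lim (\<lambda>n. E n x t)"

lemma approx_dA: assumes "e > 0" obtains z where "z \<in> dA" "norm (x - z) < e"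
proof -
  have "x \<in> closure dA" using dense by simp
  then show ?thesis using assms that unfolding closure_approachable by (metis dist_norm norm_minus_commute)
qed

lemma E_tendsto: assumes t: "t \<ge> 0" shows "(\<lambda>n. E n x t) \<longlonglongrightarrow> S t x"
proof -
  have "Cauchy (\<lambda>n. E n x t)"
  proof (rule CauchyI)
    fix e :: real assume e: "e > 0"
    then obtain z where z: "z \<in> dA" "norm (x - z) < e / 4" using approx_dA[of "e/4" x] by auto
    have "Cauchy (\<lambda>n. Y n z)"
      unfolding Y_domain[OF z(1)] using J_tendsto LIMSEQ_imp_Cauchy by blast
    then obtain K where K: "\<And>m n. m \<ge> K \<Longrightarrow> n \<ge> K \<Longrightarrow> norm (Y m z - Y n z) < e / (4 * (t + 1))"
      using CauchyD[of _ "e / (4 * (t + 1))"] e t by (metis add_nonneg_pos divide_pos_pos mult_pos_pos zero_less_numeral zero_less_one)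
    have "norm (E m x t - E n x t) < e" if "m \<ge> K" "n \<ge> K" for m n
    proof -
      have "E m x t - E n x t = E m (x - z) t + (E m z t - E n z t) - E n (x - z) t"
        by (simp add: linear_diff[OF linear_E[OF t]])
      then have "norm (E m x t - E n x t) \<le> norm (E m (x - z) t) + norm (E m z t - E n z t) + norm (E n (x - z) t)"
        by (metis norm_triangle_ineq norm_triangle_le_diff add_right_mono)
      moreover have "norm (E m (x - z) t) < e / 4" "norm (E n (x - z) t) < e / 4"
        using norm_E[OF t] z(2) by (meson le_less_trans)+
      moreover have "norm (E m z t - E n z t) \<le> e / 4"
      proof -
        have "norm (E m z t - E n z t) \<le> e / (4 * (t + 1)) * t"
          using E_diff_le[OF t, of m z n] K[OF that] t
          by (meson less_imp_le mult_right_mono order_trans)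
        also have "\<dots> \<le> e / 4" using e t by (simp add: field_simps)
        finally show ?thesis .
      qed
      ultimately show ?thesis using e by linarith
    qed
    then show "\<exists>M. \<forall>m\<ge>M. \<forall>n\<ge>M. norm (E m x t - E n x t) < e" by blast
  qed
  then show ?thesis unfolding S_def using Cauchy_convergent convergent_LIMSEQ_iff by blast
qed

lemma E_tendsto_compose:
  assumes t: "t \<ge> 0" and z: "z \<longlonglongrightarrow> x"
  shows "(\<lambda>n. E n (z n) t) \<longlonglongrightarrow> S t x"
proof -
  have "(\<lambda>n. E n (z n - x) t) \<longlonglongrightarrow> 0"
  proof (rule Lim_null_comparison[of _ "\<lambda>n. norm (z n - x)"])
    show "(\<lambda>n. norm (z n - x)) \<longlonglongrightarrow> 0" using z by (simp add: LIM_zero tendsto_norm_zero)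
  qed (simp add: norm_E t)
  from tendsto_add[OF this E_tendsto[OF t, of x]] show ?thesis by (simp add: linear_diff[OF linear_E[OF t]])
qed

lemma E_lipschitz:
  assumes x: "x \<in> dA" and ts: "t \<ge> 0" "s \<ge> 0"
  shows "norm (E n x t - E n x s) \<le> norm (A x) * \<bar>t - s\<bar>"
proof -
  have "norm (E n x t - E n x s) \<le> norm (A x) * norm (t - s)"
  proof (rule differentiable_bound[of "{0..}"])
    fix r :: real assume r: "r \<in> {0..}"
    show "(E n x has_derivative (\<lambda>h. h *\<^sub>R (- Y n (E n x r)))) (at r within {0..})"
      using E_deriv[of r n x] r by (simp add: has_vector_derivative_def)
    have "norm (Y n (E n x r)) \<le> norm (A x)"
      using E_commute[OF bounded_linear_Y[of n] refl, of r x] norm_E[of r n "Y n x"] r norm_J[of n "A x"]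
      by (simp add: Y_domain[OF x])
    then show "onorm (\<lambda>h. h *\<^sub>R (- Y n (E n x r))) \<le> norm (A x)"
      by (intro onorm_le) (auto simp: mult.commute intro!: mult_left_mono)
  qed (use ts in auto)
  then show ?thesis by simp
qed

lemma S_lipschitz:
  assumes x: "x \<in> dA" and ts: "t \<ge> 0" "s \<ge> 0"
  shows "norm (S t x - S s x) \<le> norm (A x) * \<bar>t - s\<bar>"
  by (rule LIMSEQ_le_const2[OF tendsto_norm[OF tendsto_diff[OF E_tendsto[OF ts(1)] E_tendsto[OF ts(2)]]]])
     (use E_lipschitz[OF assms] in auto)

lemma norm_S: "t \<ge> 0 \<Longrightarrow> norm (S t x) \<le> norm x"
  by (rule LIMSEQ_le_const2[OF tendsto_norm[OF E_tendsto]]) (use norm_E in auto)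

lemma linear_S: assumes t: "t \<ge> 0" shows "linear (S t)"
proof (rule linearI)
  show "S t (x + y) = S t x + S t y" for x y
    using LIMSEQ_unique[OF E_tendsto[OF t, of "x + y"]]
      tendsto_add[OF E_tendsto[OF t, of x] E_tendsto[OF t, of y]]
    by (simp add: linear_add[OF linear_E[OF t]])
  show "S t (r *\<^sub>R x) = r *\<^sub>R S t x" for r x
    using LIMSEQ_unique[OF E_tendsto[OF t, of "r *\<^sub>R x"]]
      tendsto_scaleR[OF tendsto_const E_tendsto[OF t, of x], of r]
    by (simp add: linear_scale[OF linear_E[OF t]])
qed

text \<open>The modulus of continuity does not depend on the times: approximate \<open>x\<close> by a point of the
  domain, whose orbit is globally Lipschitz.\<close>

lemma S_uniform:
  assumes e: "e > 0"
  obtains d where "d > 0" "\<And>t s. t \<ge> 0 \<Longrightarrow> s \<ge> 0 \<Longrightarrow> \<bar>t - s\<bar> < d \<Longrightarrow> norm (S t x - S s x) < e"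
proof -
  obtain z where z: "z \<in> dA" "norm (x - z) < e / 3" using approx_dA[of "e/3" x] e by auto
  have "norm (S t x - S s x) < e" if ts: "t \<ge> 0" "s \<ge> 0" and d: "\<bar>t - s\<bar> < e / (3 * (norm (A z) + 1))" for t s
  proof -
    have "S t x - S s x = S t (x - z) + (S t z - S s z) - S s (x - z)"
      using ts by (simp add: linear_diff[OF linear_S])
    then have "norm (S t x - S s x) \<le> norm (S t (x - z)) + norm (S t z - S s z) + norm (S s (x - z))"
      by (metis norm_triangle_ineq norm_triangle_le_diff add_right_mono)
    moreover have "norm (S t (x - z)) < e / 3" "norm (S s (x - z)) < e / 3"
      using norm_S ts z(2) by (meson le_less_trans)+
    moreover have "norm (S t z - S s z) \<le> e / 3"
    proof -
      have "norm (S t z - S s z) \<le> norm (A z) * (e / (3 * (norm (A z) + 1)))"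
        using S_lipschitz[OF z(1) ts] d by (meson less_imp_le mult_left_mono norm_ge_zero order_trans)
      also have "\<dots> \<le> e / 3" using e by (simp add: field_simps add_pos_nonneg)
      finally show ?thesis .
    qed
    ultimately show ?thesis by linarith
  qed
  moreover have "e / (3 * (norm (A z) + 1)) > 0" using e by (simp add: add_nonneg_pos)
  ultimately show ?thesis using that by blast
qed

lemma S_0: "S 0 x = x"
  using E_tendsto[of 0 x] by (simp add: E_0 LIMSEQ_const_iff)

sublocale contraction_family S
proof
  fix x
  show "continuous_on {0..} (\<lambda>t. S t x)"
    unfolding continuous_on_iff dist_norm
  proof (intro ballI allI impI)
    fix t e :: real assume t: "t \<in> {0..}" and e: "0 < e"
    obtain d where "d > 0" "\<And>t s. t \<ge> 0 \<Longrightarrow> s \<ge> 0 \<Longrightarrow> \<bar>t - s\<bar> < d \<Longrightarrow> norm (S t x - S s x) < e"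
      using S_uniform[OF e] by blast
    then show "\<exists>d>0. \<forall>x'\<in>{0..}. norm (x' - t) < d \<longrightarrow> norm (S x' x - S t x) < e"
      using t by (intro exI[of _ d]) auto
  qed
qed (auto simp: norm_S S_0 linear_add[OF linear_S] linear_scale[OF linear_S])

lemma S_semigroup:
  assumes t: "t \<ge> 0" and s: "s \<ge> 0"
  shows "S (t + s) x = S t (S s x)"
proof (rule LIMSEQ_unique)
  show "(\<lambda>n. E n x (t + s)) \<longlonglongrightarrow> S (t + s) x" using t s by (intro E_tendsto) simp
  show "(\<lambda>n. E n x (t + s)) \<longlonglongrightarrow> S t (S s x)"
    unfolding E_semigroup[OF t s] by (rule E_tendsto_compose[OF t E_tendsto[OF s]])
qed

lemma res_S:
  assumes l: "l \<ge> l0" and t: "t \<ge> 0"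
  shows "res l (S t x) = S t (res l x)"
proof (rule LIMSEQ_unique)
  show "(\<lambda>n. res l (E n x t)) \<longlonglongrightarrow> res l (S t x)"
    by (rule bounded_linear.tendsto[OF bounded_linear_res[OF l] E_tendsto[OF t]])
  show "(\<lambda>n. res l (E n x t)) \<longlonglongrightarrow> S t (res l x)"
    using E_tendsto[OF t, of "res l x"] E_commute[OF bounded_linear_res[OF l] res_Y[OF l] t] by simp
qed

text \<open>The domain is the range of the resolvent, which commutes with the semigroup.\<close>

lemma
  assumes x: "x \<in> dA" and t: "t \<ge> 0"
  shows S_in: "S t x \<in> dA" and A_S: "A (S t x) = S t (A x)"
proof -
  have eq: "S t x = res l0 (S t (l0 *\<^sub>R x + A x))"
    using res_S[OF order_refl t, of "l0 *\<^sub>R x + A x"] res_unique[OF order_refl x refl] by simp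
  show "S t x \<in> dA" by (subst eq) (rule res_in, simp)
  have "A (S t x) = S t (l0 *\<^sub>R x + A x) - l0 *\<^sub>R S t x"
    using A_res[OF order_refl, of "S t (l0 *\<^sub>R x + A x)"] eq by simp
  then show "A (S t x) = S t (A x)"
    by (simp add: linear_add[OF linear_S[OF t]] linear_scale[OF linear_S[OF t]])
qed

text \<open>A first-order expansion of the approximating flows whose remainder is independent of \<open>n\<close>.
  The derivative \<open>E n (Y n x)\<close> is Lipschitz in time, uniformly in \<open>n\<close>, only for \<open>A x\<close> in the domain; the auxiliary
  point \<open>z\<close> of the domain replaces \<open>A x\<close> at the cost of the term \<open>norm (A x - z)\<close>.\<close>

lemma E_taylor:
  assumes x: "x \<in> dA" and z: "z \<in> dA" and ts: "t \<ge> 0" "s \<ge> 0"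
  shows "norm (E n x s - E n x t + (s - t) *\<^sub>R E n (Y n x) t)
     \<le> (2 * norm (A x - z) + norm (A z) * \<bar>s - t\<bar>) * \<bar>s - t\<bar>"
proof -
  define I where "I = closed_segment t s"
  have I: "r \<in> I \<Longrightarrow> r \<ge> 0 \<and> \<bar>r - t\<bar> \<le> \<bar>s - t\<bar>" for r
    using ts unfolding I_def closed_segment_eq_real_ivl by (auto split: if_splits)
  have Y: "Y n (E n x r) = E n (Y n x) r" if "r \<ge> 0" for r
    using E_commute[OF bounded_linear_Y[of n] refl that] .
  have lin: "r \<ge> 0 \<Longrightarrow> linear (\<lambda>x. E n x r)" for r by (rule linear_E)
  have "norm (E n x s - E n x t - (s - t) *\<^sub>R (- E n (Y n x) t)) \<le> norm (s - t) * (2 * norm (A x - z) + norm (A z) * \<bar>s - t\<bar>)"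
  proof (rule vector_differentiable_bound_linearization[where S = I and f' = "\<lambda>r. - E n (Y n x) r"])
    fix r assume r: "r \<in> I"
    show "(E n x has_vector_derivative - E n (Y n x) r) (at r within I)"
      using has_vector_derivative_within_subset[OF E_deriv[of r n x], of I] I r Y by auto
    have "E n (Y n x) r - E n (Y n x) t = E n (J n (A x - z)) r - E n (J n (A x - z)) t + (E n (J n z) r - E n (J n z) t)"
      using I[OF r] ts by (simp add: Y_domain[OF x] linear_diff[OF linear_J] linear_diff[OF lin])
    then have "norm (E n (Y n x) r - E n (Y n x) t) \<le> norm (E n (J n (A x - z)) r) + norm (E n (J n (A x - z)) t) + norm (E n (J n z) r - E n (J n z) t)"
      by (metis norm_triangle_ineq4 norm_triangle_le add_right_mono)
    also have "\<dots> \<le> norm (A x - z) + norm (A x - z) + norm (A z) * \<bar>s - t\<bar>"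
    proof (intro add_mono)
      show "norm (E n (J n (A x - z)) r) \<le> norm (A x - z)" "norm (E n (J n (A x - z)) t) \<le> norm (A x - z)"
        using norm_E[of _ n "J n (A x - z)"] norm_J[of n "A x - z"] I[OF r] ts by (meson order_trans)+
      have "norm (E n (J n z) r - E n (J n z) t) \<le> norm (A (J n z)) * \<bar>r - t\<bar>"
        using I[OF r] ts by (intro E_lipschitz J_in) auto
      also have "\<dots> \<le> norm (A z) * \<bar>s - t\<bar>"
        using norm_J[of n "A z"] I[OF r] by (intro mult_mono) (auto simp: Y_eq[symmetric] Y_domain[OF z])
      finally show "norm (E n (J n z) r - E n (J n z) t) \<le> norm (A z) * \<bar>s - t\<bar>" .
    qed
    finally show "norm (- E n (Y n x) r - - E n (Y n x) t) \<le> 2 * norm (A x - z) + norm (A z) * \<bar>s - t\<bar>"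
      by (simp add: norm_minus_commute)
  qed (auto simp: I_def)
  then show ?thesis by (simp add: mult.commute)
qed

lemma S_deriv_dA:
  assumes x: "x \<in> dA" and t: "t \<ge> 0"
  shows "((\<lambda>t. S t x) has_vector_derivative - S t (A x)) (at t within {0..})"
proof -
  have key: "norm (S s x - S t x + (s - t) *\<^sub>R S t (A x)) \<le> (2 * norm (A x - z) + norm (A z) * \<bar>s - t\<bar>) * \<bar>s - t\<bar>"
    if z: "z \<in> dA" and s: "s \<ge> 0" for z s
  proof (rule LIMSEQ_le_const2)
    have "(\<lambda>n. E n (Y n x) t) \<longlonglongrightarrow> S t (A x)"
      unfolding Y_domain[OF x] by (rule E_tendsto_compose[OF t J_tendsto])
    then show "(\<lambda>n. norm (E n x s - E n x t + (s - t) *\<^sub>R E n (Y n x) t)) \<longlonglongrightarrow> norm (S s x - S t x + (s - t) *\<^sub>R S t (A x))"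
      by (intro tendsto_intros E_tendsto s t)
  qed (use E_taylor[OF x z t s] in auto)
  show ?thesis
    unfolding has_vector_derivative_def has_derivative_within_alt
  proof (intro conjI allI impI)
    show "bounded_linear (\<lambda>h. h *\<^sub>R (- S t (A x)))" by (rule bounded_linear_scaleR_left)
    fix e :: real assume e: "e > 0"
    obtain z where z: "z \<in> dA" "norm (A x - z) < e / 4" using approx_dA[of "e/4" "A x"] e by auto
    define d where "d = e / (2 * (norm (A z) + 1))"
    have d: "d > 0" using e by (simp add: d_def add_nonneg_pos)
    have "norm (S s x - S t x - (s - t) *\<^sub>R (- S t (A x))) \<le> e * norm (s - t)"
      if s: "s \<in> {0..}" "norm (s - t) < d" for s
    proof -
      have "norm (A z) * \<bar>s - t\<bar> \<le> norm (A z) * d" using s by (intro mult_left_mono) auto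
      also have "\<dots> \<le> e / 2" using e by (simp add: d_def field_simps add_pos_nonneg)
      finally have "2 * norm (A x - z) + norm (A z) * \<bar>s - t\<bar> \<le> e" using z(2) by linarith
      then have "(2 * norm (A x - z) + norm (A z) * \<bar>s - t\<bar>) * \<bar>s - t\<bar> \<le> e * \<bar>s - t\<bar>"
        by (intro mult_right_mono) auto
      then show ?thesis using key[OF z(1), of s] s by simp
    qed
    then show "\<exists>d>0. \<forall>y\<in>{0..}. norm (y - t) < d \<longrightarrow>
      norm (S y x - S t x - (y - t) *\<^sub>R (- S t (A x))) \<le> e * norm (y - t)" using d by blast
  qed
qed

end


section \<open>Analytic smoothing\<close>

lemma inner_has_derivative:
  fixes f g :: "real \<Rightarrow> 'a::real_inner"
  assumes "(f has_vector_derivative f') (at t within T)" "(g has_vector_derivative g') (at t within T)"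
  shows "((\<lambda>t. inner (f t) (g t)) has_real_derivative inner f' (g t) + inner (f t) g') (at t within T)"
  using has_derivative_inner[OF assms[unfolded has_vector_derivative_def]]
  unfolding has_field_derivative_def
  by (rule has_derivative_eq_rhs) (auto simp: algebra_simps)

lemma young_product: "2 * (a * b) \<le> a\<^sup>2 + (b::real)\<^sup>2"
  using sum_squares_bound[of a b] by (simp add: mult.assoc)

text \<open>Young's inequality, used throughout to absorb drift terms.\<close>

lemma abs_inner_le: "\<bar>2 * inner x y\<bar> \<le> (norm x)\<^sup>2 + (norm y)\<^sup>2"
  using Cauchy_Schwarz_ineq2[of x y] young_product[of "norm x" "norm y"] by (simp add: abs_mult)

text \<open>The abstract form of \<open>- \<partial>\<^sup>2 - c \<partial> + Q\<close> with Dirichlet condition. The model for \<open>D\<close> is the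
  weak derivative on \<open>H1_0\<close>: it is closed and antisymmetric, and \<open>D* D\<close> is the Dirichlet
  Laplacian up to sign.\<close>

locale drift_operator =
  fixes V :: "'a::{real_inner,banach} set" and D Q :: "'a \<Rightarrow> 'a" and c q :: real
  assumes V_subspace: "subspace V"
    and D_add: "x \<in> V \<Longrightarrow> y \<in> V \<Longrightarrow> D (x + y) = D x + D y"
    and D_scale: "x \<in> V \<Longrightarrow> D (r *\<^sub>R x) = r *\<^sub>R D x"
    and D_closed: "\<And>f x y. (\<And>n. f n \<in> V) \<Longrightarrow> f \<longlonglongrightarrow> x \<Longrightarrow> (\<lambda>n. D (f n)) \<longlonglongrightarrow> y \<Longrightarrow> x \<in> V \<and> D x = y"
    and D_antisym: "x \<in> V \<Longrightarrow> y \<in> V \<Longrightarrow> inner (D x) y = - inner x (D y)"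
    and V_dense: "closure V = UNIV"
    and Q_linear: "linear Q" and Q_sym: "inner (Q x) y = inner x (Q y)"
    and Q_ge: "inner (Q x) x \<ge> (norm x)\<^sup>2" and Q_le: "norm (Q x) \<le> q * norm x"
    and q: "q \<ge> 0"
begin

lemma D_diff: "x \<in> V \<Longrightarrow> y \<in> V \<Longrightarrow> D (x - y) = D x - D y"
  using D_add[of x "(-1) *\<^sub>R y"] D_scale[of y "-1"] subspace_scale[OF V_subspace, of y "-1"] by simp

lemma D_inner_self: "x \<in> V \<Longrightarrow> inner (D x) x = 0"
  using D_antisym[of x x] by (simp add: inner_commute)

lemma eq_if_inner_V:
  assumes "\<And>p. p \<in> V \<Longrightarrow> inner f p = inner g p" shows "f = g"
proof -
  have "f - g \<in> closure V" using V_dense by simp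
  then obtain s where s: "\<And>n. s n \<in> V" "s \<longlonglongrightarrow> f - g" unfolding closure_sequential by blast
  have "(\<lambda>n. inner (f - g) (s n)) \<longlonglongrightarrow> inner (f - g) (f - g)" by (intro tendsto_intros s)
  moreover have "inner (f - g) (s n) = 0" for n using assms[OF s(1)] by (simp add: inner_diff_left)
  ultimately have "inner (f - g) (f - g) = 0" by (simp add: LIMSEQ_const_iff)
  then show ?thesis by simp
qed

text \<open>The operator \<open>A\<close> is defined variationally; density of \<open>V\<close> makes the representing element of the
  functional \<open>form x\<close> unique.\<close>

definition form :: "'a \<Rightarrow> 'a \<Rightarrow> real" where
  "form x p = inner (D x) (D p) - c * inner (D x) p + inner (Q x) p"

definition dA :: "'a set" where "dA = {x \<in> V. \<exists>f. \<forall>p\<in>V. form x p = inner f p}"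

definition A :: "'a \<Rightarrow> 'a" where "A x = (SOME f. \<forall>p\<in>V. form x p = inner f p)"

lemma dA_V: "x \<in> dA \<Longrightarrow> x \<in> V" by (simp add: dA_def)

lemma A_form: assumes "x \<in> dA" "p \<in> V" shows "inner (A x) p = form x p"
proof -
  have "\<exists>f. \<forall>p\<in>V. form x p = inner f p" using assms by (auto simp: dA_def)
  from someI_ex[OF this] show ?thesis using assms unfolding A_def by simp
qed

lemma A_eqI:
  assumes "x \<in> V" "\<And>p. p \<in> V \<Longrightarrow> form x p = inner f p"
  shows "x \<in> dA" "A x = f"
proof -
  show x: "x \<in> dA" using assms by (auto simp: dA_def)
  show "A x = f" by (rule eq_if_inner_V) (simp add: A_form[OF x] assms)
qed

lemma A_energy: assumes "x \<in> dA" shows "inner (A x) x = (norm (D x))\<^sup>2 + inner (Q x) x"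
  using A_form[OF assms dA_V[OF assms]] D_inner_self[OF dA_V[OF assms]]
  by (simp add: form_def power2_norm_eq_inner)

lemma A_coercive: "x \<in> dA \<Longrightarrow> inner (A x) x \<ge> (norm (D x))\<^sup>2 + (norm x)\<^sup>2"
  using A_energy Q_ge by simp

lemma graph_closed:
  assumes r: "r \<noteq> 0" shows "subspace ((\<lambda>x. (r *\<^sub>R x, D x)) ` V)" "closed ((\<lambda>x. (r *\<^sub>R x, D x)) ` V)"
proof -
  show "subspace ((\<lambda>x. (r *\<^sub>R x, D x)) ` V)"
  proof (rule subspaceI)
    have "D 0 = 0" using D_scale[OF subspace_0[OF V_subspace], of 0] by simp
    then show "0 \<in> (\<lambda>x. (r *\<^sub>R x, D x)) ` V"
      using subspace_0[OF V_subspace] by (intro image_eqI[of _ _ 0]) (auto simp: zero_prod_def)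
  next
    fix x y assume "x \<in> (\<lambda>x. (r *\<^sub>R x, D x)) ` V" "y \<in> (\<lambda>x. (r *\<^sub>R x, D x)) ` V"
    then obtain a b where "a \<in> V" "x = (r *\<^sub>R a, D a)" "b \<in> V" "y = (r *\<^sub>R b, D b)" by auto
    then show "x + y \<in> (\<lambda>x. (r *\<^sub>R x, D x)) ` V"
      using subspace_add[OF V_subspace] by (intro image_eqI[of _ _ "a + b"]) (auto simp: D_add scaleR_add_right)
  next
    fix k :: real and x assume "x \<in> (\<lambda>x. (r *\<^sub>R x, D x)) ` V"
    then obtain a where "a \<in> V" "x = (r *\<^sub>R a, D a)" by auto
    then show "k *\<^sub>R x \<in> (\<lambda>x. (r *\<^sub>R x, D x)) ` V"
      using subspace_scale[OF V_subspace] by (intro image_eqI[of _ _ "k *\<^sub>R a"]) (auto simp: D_scale)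
  qed
  show "closed ((\<lambda>x. (r *\<^sub>R x, D x)) ` V)"
    unfolding closed_sequential_limits
  proof (intro allI impI, elim conjE)
    fix g l assume "\<forall>n. g n \<in> (\<lambda>x. (r *\<^sub>R x, D x)) ` V" and l: "g \<longlonglongrightarrow> l"
    then have "\<forall>n. \<exists>a\<in>V. g n = (r *\<^sub>R a, D a)" by blast
    then obtain a where a: "\<And>n. a n \<in> V" "\<And>n. g n = (r *\<^sub>R a n, D (a n))" by metis
    have "(\<lambda>n. (1/r) *\<^sub>R fst (g n)) \<longlonglongrightarrow> (1/r) *\<^sub>R fst l" by (intro tendsto_intros l)
    then have 1: "a \<longlonglongrightarrow> (1/r) *\<^sub>R fst l" using r by (simp add: a)
    have "(\<lambda>n. snd (g n)) \<longlonglongrightarrow> snd l" by (intro tendsto_intros l)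
    then have 2: "(\<lambda>n. D (a n)) \<longlonglongrightarrow> snd l" by (simp add: a)
    have "(1/r) *\<^sub>R fst l \<in> V \<and> D ((1/r) *\<^sub>R fst l) = snd l" by (rule D_closed[OF a(1) 1 2])
    then show "l \<in> (\<lambda>x. (r *\<^sub>R x, D x)) ` V"
      using r by (intro image_eqI[of _ _ "(1/r) *\<^sub>R fst l"]) (auto simp: prod_eq_iff)
  qed
qed

text \<open>The orthogonal projection of \<open>(f / sqrt l, 0)\<close> onto the closed subspace of all
  \<open>(sqrt l x, D x)\<close> is characterized by exactly this variational equation.\<close>

lemma symmetric_resolvent_exists:
  assumes l: "l > 0"
  shows "\<exists>x\<in>V. \<forall>p\<in>V. l * inner x p + inner (D x) (D p) = inner f p"
proof -
  define r where "r = sqrt l"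
  have r: "r \<noteq> 0" "r * r = l" using l by (auto simp: r_def)
  \<comment> \<open>Projection in the product space, with r = sqrt l.\<close>
  obtain x where x: "x \<in> V" "\<And>p. p \<in> V \<Longrightarrow> inner (((1/r) *\<^sub>R f, 0) - (r *\<^sub>R x, D x)) (r *\<^sub>R p, D p) = 0"
    using orthogonal_projection_exists[OF graph_closed[OF r(1)], of "((1/r) *\<^sub>R f, 0)"] by blast
  have "l * inner x p + inner (D x) (D p) = inner f p" if p: "p \<in> V" for p
  proof -
    have "inner ((1/r) *\<^sub>R f - r *\<^sub>R x) (r *\<^sub>R p) = inner (D x) (D p)"
      using x(2)[OF p] by (simp add: inner_Pair)
    moreover have "inner ((1/r) *\<^sub>R f - r *\<^sub>R x) (r *\<^sub>R p) = inner f p - (r * r) * inner x p"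
      using r(1) by (simp add: inner_diff_left algebra_simps)
    ultimately show ?thesis by (simp add: r(2))
  qed
  then show ?thesis using x(1) by blast
qed

text \<open>The resolvent of \<open>D* D\<close>, without drift and potential.\<close>

definition R :: "real \<Rightarrow> 'a \<Rightarrow> 'a" where
  "R l f = (SOME x. x \<in> V \<and> (\<forall>p\<in>V. l * inner x p + inner (D x) (D p) = inner f p))"

lemma R:
  assumes "l > 0"
  shows R_in: "R l f \<in> V" and R_form: "p \<in> V \<Longrightarrow> l * inner (R l f) p + inner (D (R l f)) (D p) = inner f p"
proof -
  have "\<exists>x. x \<in> V \<and> (\<forall>p\<in>V. l * inner x p + inner (D x) (D p) = inner f p)"
    using symmetric_resolvent_exists[OF assms] by blast
  from someI_ex[OF this] show "R l f \<in> V"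
    "p \<in> V \<Longrightarrow> l * inner (R l f) p + inner (D (R l f)) (D p) = inner f p"
    unfolding R_def by auto
qed

lemma R_diff_bounds:
  assumes l: "l > 0"
  shows "l * norm (R l f - R l g) \<le> norm (f - g)"
    and "sqrt l * norm (D (R l f) - D (R l g)) \<le> norm (f - g)"
proof -
  define z where "z = R l f - R l g"
  have zV: "z \<in> V" unfolding z_def by (intro subspace_diff[OF V_subspace] R_in l)
  have Dz: "D z = D (R l f) - D (R l g)" unfolding z_def by (intro D_diff R_in l)
  have e: "l * (norm z)\<^sup>2 + (norm (D z))\<^sup>2 = inner (f - g) z"
    using R_form[OF l zV, of f] R_form[OF l zV, of g]
    unfolding Dz power2_norm_eq_inner by (simp add: inner_diff_left algebra_simps z_def inner_diff_right)
  have cs: "inner (f - g) z \<le> norm (f - g) * norm z" by (rule norm_cauchy_schwarz)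
  show 1: "l * norm (R l f - R l g) \<le> norm (f - g)"
  proof (cases "z = 0")
    case False
    have "l * norm z * norm z \<le> norm (f - g) * norm z"
    proof -
      have "l * norm z * norm z = l * (norm z)\<^sup>2" by (simp add: power2_eq_square)
      moreover have "(norm (D z))\<^sup>2 \<ge> 0" by simp
      ultimately show ?thesis using e cs by linarith
    qed
    then show ?thesis using False unfolding z_def[symmetric] by simp
  qed (simp add: z_def[symmetric])
  have "(norm (D z))\<^sup>2 \<le> norm (f - g) * norm z"
  proof -
    have "l * (norm z)\<^sup>2 \<ge> 0" using l by simp
    then show ?thesis using e cs by linarith
  qed
  then have "l * (norm (D z))\<^sup>2 \<le> l * (norm (f - g) * norm z)" using l by (intro mult_left_mono) auto
  also have "\<dots> = norm (f - g) * (l * norm z)" by simp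
  also have "\<dots> \<le> norm (f - g) * norm (f - g)" using 1 unfolding z_def[symmetric] by (intro mult_left_mono) auto
  finally have "l * (norm (D z))\<^sup>2 \<le> (norm (f - g))\<^sup>2" by (simp only: power2_eq_square)
  moreover have "(sqrt l * norm (D z))\<^sup>2 = l * (norm (D z))\<^sup>2" using l by (simp add: power_mult_distrib)
  ultimately have "(sqrt l * norm (D z))\<^sup>2 \<le> (norm (f - g))\<^sup>2" by simp
  then show "sqrt l * norm (D (R l f) - D (R l g)) \<le> norm (f - g)"
    unfolding Dz[symmetric] using norm_ge_zero power2_le_imp_le by blast
qed

definition l0 :: real where "l0 = 16 * c\<^sup>2 + 4 * q + 1"

text \<open>For \<open>l \<ge> l0\<close> drift and potential are perturbations of \<open>l + D* D\<close> of relative size at most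
  \<open>1/2\<close>; the constants in \<open>l0\<close> are chosen for this. The fixed point \<open>g\<close> of the contraction is the
  right-hand side for which \<open>R l g\<close> solves the full equation.\<close>

lemma A_range:
  assumes l: "l \<ge> l0" shows "\<exists>x\<in>dA. l *\<^sub>R x + A x = f"
proof -
  have lpos: "l > 0" and lc: "16 * c\<^sup>2 \<le> l" and lq: "4 * q \<le> l"
    using l q zero_le_power2[of c] unfolding l0_def by linarith+
  have sc: "4 * \<bar>c\<bar> \<le> sqrt l"
    using real_sqrt_le_mono[OF lc] by (simp add: real_sqrt_mult)
  define T where "T g = f + c *\<^sub>R D (R l g) - Q (R l g)" for g
  have "dist (T g) (T h) \<le> (1/2) * dist g h" for g h
  proof -
    have "T g - T h = c *\<^sub>R (D (R l g) - D (R l h)) - Q (R l g - R l h)"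
      by (simp add: T_def linear_diff[OF Q_linear] scaleR_diff_right)
    then have "norm (T g - T h) \<le> \<bar>c\<bar> * norm (D (R l g) - D (R l h)) + q * norm (R l g - R l h)"
      using norm_triangle_ineq4[of "c *\<^sub>R (D (R l g) - D (R l h))" "Q (R l g - R l h)"] Q_le[of "R l g - R l h"]
      by simp
    moreover have "4 * \<bar>c\<bar> * norm (D (R l g) - D (R l h)) \<le> sqrt l * norm (D (R l g) - D (R l h))"
      using sc by (intro mult_right_mono) auto
    moreover have "4 * q * norm (R l g - R l h) \<le> l * norm (R l g - R l h)"
      using lq by (intro mult_right_mono) auto
    ultimately show ?thesis using R_diff_bounds[OF lpos, of g h] unfolding dist_norm by argo
  qed
  then obtain g where g: "T g = g" using banach_fix_type[of "1/2" T] by auto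
  define x where "x = R l g"
  have xV: "x \<in> V" by (simp add: x_def R_in lpos)
  have "form x p = inner (f - l *\<^sub>R x) p" if p: "p \<in> V" for p
  proof -
    have "l * inner x p + inner (D x) (D p) = inner (T g) p" using R_form[OF lpos p, of g] g by (simp add: x_def)
    then show ?thesis unfolding T_def form_def x_def[symmetric]
      by (simp add: inner_diff_left inner_add_left)
  qed
  from A_eqI[OF xV this] show ?thesis by (intro bexI[of _ x]) auto
qed

lemma R1_dA: "R 1 z \<in> dA"
proof (rule A_eqI(1)[of _ "z - R 1 z - c *\<^sub>R D (R 1 z) + Q (R 1 z)"])
  show "form (R 1 z) p = inner (z - R 1 z - c *\<^sub>R D (R 1 z) + Q (R 1 z)) p" if "p \<in> V" for p
    using R_form[OF zero_less_one that, of z] by (simp add: form_def inner_diff_left inner_add_left)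
qed (simp add: R_in)

lemma dA_subspace: "subspace dA"
proof (rule subspaceI)
  have "D 0 = 0" using D_scale[OF subspace_0[OF V_subspace], of 0] by simp
  then show "0 \<in> dA" by (intro A_eqI(1)[of 0 0] subspace_0[OF V_subspace]) (simp add: form_def linear_0[OF Q_linear])
next
  fix x y assume xy: "x \<in> dA" "y \<in> dA"
  show "x + y \<in> dA"
    by (rule A_eqI(1)[of _ "A x + A y"])
       (use xy in \<open>auto simp: dA_V subspace_add[OF V_subspace] form_def D_add linear_add[OF Q_linear] inner_add_left A_form algebra_simps\<close>)
next
  fix k x assume x: "x \<in> dA"
  show "k *\<^sub>R x \<in> dA"
    by (rule A_eqI(1)[of _ "k *\<^sub>R A x"])
       (use x in \<open>auto simp: dA_V subspace_scale[OF V_subspace] form_def D_scale linear_scale[OF Q_linear] A_form algebra_simps\<close>)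
qed

text \<open>The domain is dense in \<open>V\<close> for the graph norm of \<open>D\<close>. If \<open>(z, D z)\<close> is orthogonal to all
  \<open>(a, D a)\<close> with \<open>a\<close> in the domain, then pairing it with \<open>a = R 1 z\<close> gives \<open>\<parallel>z\<parallel>\<^sup>2 = 0\<close>.\<close>

lemma dA_core:
  assumes x: "x \<in> V"
  obtains f where "\<And>n. f n \<in> dA" "f \<longlonglongrightarrow> x" "(\<lambda>n. D (f n)) \<longlonglongrightarrow> D x"
proof -
  define G where "G = (\<lambda>x. (1 *\<^sub>R x, D x)) ` V"
  define M where "M = (\<lambda>x. (x, D x)) ` dA"
  have G: "subspace G" "closed G" unfolding G_def by (rule graph_closed; simp)+
  have MG: "M \<subseteq> G" unfolding M_def G_def using dA_V by auto
  have subM: "subspace M"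
  proof (rule subspaceI)
    have "D 0 = 0" using D_scale[OF subspace_0[OF V_subspace], of 0] by simp
    then show "0 \<in> M" using subspace_0[OF dA_subspace] unfolding M_def
      by (intro image_eqI[of _ _ 0]) (auto simp: zero_prod_def)
    show "\<And>x y. x \<in> M \<Longrightarrow> y \<in> M \<Longrightarrow> x + y \<in> M" unfolding M_def
      using subspace_add[OF dA_subspace] by (auto simp: D_add dA_V image_iff)
    show "\<And>k x. x \<in> M \<Longrightarrow> k *\<^sub>R x \<in> M" unfolding M_def
      using subspace_scale[OF dA_subspace] by (auto simp: D_scale dA_V image_iff)
  qed
  obtain y where y: "y \<in> closure M" "\<And>s. s \<in> closure M \<Longrightarrow> inner ((x, D x) - y) s = 0"
    using orthogonal_projection_exists[OF subspace_closure[OF subM] closed_closure, of "(x, D x)"] by blast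
  have "closure M \<subseteq> G" using G(2) MG closure_minimal by blast
  then have "(x, D x) - y \<in> G" using x y(1) by (intro subspace_diff[OF G(1)]) (auto simp: G_def)
  then obtain z where z: "z \<in> V" "(x, D x) - y = (z, D z)" unfolding G_def by auto
  have "(R 1 z, D (R 1 z)) \<in> M" unfolding M_def by (rule image_eqI[OF refl R1_dA])
  then have "(R 1 z, D (R 1 z)) \<in> closure M" using closure_subset[of M] by (rule rev_subsetD)
  from y(2)[OF this] have "inner z (R 1 z) + inner (D z) (D (R 1 z)) = 0" unfolding z(2) by (simp add: inner_Pair)
  then have "inner z z = 0" using R_form[OF zero_less_one z(1), of z] by (simp add: inner_commute)
  then have "z = 0" by simp
  moreover have "D 0 = 0" using D_scale[OF subspace_0[OF V_subspace], of 0] by simp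
  ultimately have "(x, D x) - y = 0" using z(2) by (simp add: zero_prod_def)
  then have "y = (x, D x)" by simp
  then obtain g where g: "\<And>n. g n \<in> M" "g \<longlonglongrightarrow> (x, D x)" using y(1) unfolding closure_sequential by blast
  then have "\<forall>n. \<exists>a\<in>dA. g n = (a, D a)" unfolding M_def by blast
  then obtain a where a: "\<And>n. a n \<in> dA" "\<And>n. g n = (a n, D (a n))" by metis
  show ?thesis
    using that[of a] a tendsto_fst[OF g(2)] tendsto_snd[OF g(2)] by simp
qed

sublocale m_accretive dA A l0
proof
  show "subspace dA" by (rule dA_subspace)
  show "A (x + y) = A x + A y" if "x \<in> dA" "y \<in> dA" for x y
    by (rule A_eqI(2)) (use that in \<open>auto simp: dA_V subspace_add[OF V_subspace] form_def D_add linear_add[OF Q_linear] inner_add_left A_form algebra_simps\<close>)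
  show "A (k *\<^sub>R x) = k *\<^sub>R A x" if "x \<in> dA" for x k
    by (rule A_eqI(2)) (use that in \<open>auto simp: dA_V subspace_scale[OF V_subspace] form_def D_scale linear_scale[OF Q_linear] A_form algebra_simps\<close>)
  show "0 \<le> inner (A x) x" if "x \<in> dA" for x
    using A_coercive[OF that] by (meson add_nonneg_nonneg order_trans zero_le_power2)
  have "V \<subseteq> closure dA"
  proof
    fix x assume "x \<in> V"
    then obtain f where "\<And>n. f n \<in> dA" "f \<longlonglongrightarrow> x" using dA_core by blast
    then show "x \<in> closure dA" unfolding closure_sequential by blast
  qed
  then have "closure V \<subseteq> closure dA" by (simp add: closure_minimal)
  then show "closure dA = UNIV" using V_dense by auto
  show "\<exists>x\<in>dA. l *\<^sub>R x + A x = f" if "l0 \<le> l" for l f by (rule A_range[OF that])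
  show "0 < l0" unfolding l0_def using q by (simp add: add_nonneg_pos)
qed

text \<open>\<open>A + c D\<close> is symmetric, so that moving \<open>A\<close> across the inner product only costs a drift term.\<close>

lemma A_swap:
  assumes y: "y \<in> dA" and z: "A y \<in> dA"
  shows "inner (A (A y)) y = (norm (A y))\<^sup>2 + 2 * c * inner (D y) (A y)"
  using A_form[OF z dA_V[OF y]] A_form[OF y dA_V[OF z]] D_antisym[OF dA_V[OF z] dA_V[OF y]] Q_sym[of "A y" y]
  by (simp add: form_def power2_norm_eq_inner inner_commute algebra_simps)

definition CA :: real where "CA = 1 + \<bar>c\<bar>"

lemma CA: "CA > 0" by (simp add: CA_def add_pos_nonneg)

text \<open>The function \<open>a \<parallel>y\<parallel>\<^sup>2 + t \<langle>A y, y\<rangle> + t\<^sup>2 \<parallel>A y\<parallel>\<^sup>2\<close> does not increase along orbits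
  \<open>y t = S t x\<close>. With \<open>a = (1 + c\<^sup>2) / 2\<close> the dissipation of the first term absorbs the derivative of
  the factor \<open>t\<close> and the drift term from \<open>A_swap\<close>; the dissipation of the last one absorbs the rest.
  Two orders of regularity of \<open>x\<close> are assumed to make \<open>A y\<close> differentiable.\<close>

lemma smoothing_dA2:
  assumes x: "x \<in> dA" and z: "A x \<in> dA" and t: "t \<ge> 0"
  shows "t * norm (A (S t x)) \<le> CA * norm x"
proof -
  define a where "a = (1 + c\<^sup>2) / 2"
  define y where "y t = S t x" for t
  define w where "w t = S t (A x)" for t
  define F where "F t = a * inner (y t) (y t) + t * inner (w t) (y t) + t\<^sup>2 * inner (w t) (w t)" for t
  have dy: "(y has_vector_derivative - w t) (at t within {0..})" if "t \<ge> 0" for t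
    unfolding y_def w_def by (rule S_deriv_dA[OF x that])
  have dw: "(w has_vector_derivative - A (w t)) (at t within {0..})" if "t \<ge> 0" for t
    unfolding w_def using S_deriv_dA[OF z that] by (simp add: A_S[OF z that])
  have yA: "y t \<in> dA" "A (y t) = w t" "w t \<in> dA" if "t \<ge> 0" for t
    unfolding y_def w_def using S_in[OF x that] A_S[OF x that] S_in[OF z that] by auto
  define F' where "F' t = a * (inner (- w t) (y t) + inner (y t) (- w t)) + (inner (w t) (y t)
     + t * (inner (- A (w t)) (y t) + inner (w t) (- w t)))
     + (2 * t * inner (w t) (w t) + t\<^sup>2 * (inner (- A (w t)) (w t) + inner (w t) (- A (w t))))" for t
  have dF: "(F has_real_derivative F' t) (at t within {0..})" if "t \<ge> 0" for t
    unfolding F_def F'_def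
    by (rule derivative_eq_intros inner_has_derivative dy dw that refl)+ (simp add: algebra_simps)
  have "F t \<le> F 0"
  proof (rule DERIV_nonpos_imp_decreasing_open[OF t])
    fix s assume s: "0 < s" "s < t"
    have "F' s = (1 - 2 * a) * inner (w s) (y s) - 2 * s * c * inner (D (y s)) (w s) - 2 * s\<^sup>2 * inner (A (w s)) (w s)"
    proof -
      have "inner (A (w s)) (y s) = inner (w s) (w s) + 2 * c * inner (D (y s)) (w s)"
        using A_swap[of "y s"] yA[of s] s by (simp add: power2_norm_eq_inner)
      then show ?thesis
        unfolding F'_def by (simp add: inner_commute algebra_simps)
    qed
    also have "\<dots> \<le> 0"
    proof -
      have e1: "inner (w s) (y s) \<ge> (norm (D (y s)))\<^sup>2"
        using A_coercive[OF yA(1), of s] yA(2)[of s] s by (smt (verit) zero_le_power2)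
      have e2: "inner (A (w s)) (w s) \<ge> (norm (w s))\<^sup>2"
        using A_coercive[OF yA(3), of s] s by (smt (verit) zero_le_power2)
      have "\<bar>2 * inner (c *\<^sub>R D (y s)) (s *\<^sub>R w s)\<bar> \<le> (norm (c *\<^sub>R D (y s)))\<^sup>2 + (norm (s *\<^sub>R w s))\<^sup>2"
        by (rule abs_inner_le)
      then have e3: "- (2 * s * c * inner (D (y s)) (w s)) \<le> c\<^sup>2 * (norm (D (y s)))\<^sup>2 + s\<^sup>2 * (norm (w s))\<^sup>2"
        by (simp add: power_mult_distrib abs_le_iff algebra_simps)
      have "c\<^sup>2 * (norm (D (y s)))\<^sup>2 \<le> c\<^sup>2 * inner (w s) (y s)" using e1 by (intro mult_left_mono) auto
      moreover have "s\<^sup>2 * (norm (w s))\<^sup>2 \<le> s\<^sup>2 * inner (A (w s)) (w s)" using e2 by (intro mult_left_mono) auto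
      moreover have "0 \<le> s\<^sup>2 * (norm (w s))\<^sup>2" by simp
      moreover have "(1 - 2 * a) * inner (w s) (y s) = - (c\<^sup>2 * inner (w s) (y s))"
        by (simp add: a_def algebra_simps)
      ultimately show ?thesis using e3 by linarith
    qed
    finally have "F' s \<le> 0" .
    moreover have "(F has_real_derivative F' s) (at s)"
      using dF[of s] s at_within_interior[of s "{0..}"] by (simp add: interior_Ici[where b="-1"])
    ultimately show "\<exists>d. (F has_real_derivative d) (at s) \<and> d \<le> 0" by blast
  next
    show "continuous_on {0..t} F"
    proof (rule DERIV_continuous_on)
      show "(F has_real_derivative F' s) (at s within {0..t})" if "s \<in> {0..t}" for s
        using that by (intro DERIV_subset[OF dF]) auto
    qed
  qed
  moreover have "F 0 = a * (norm x)\<^sup>2" by (simp add: F_def y_def S_0 power2_norm_eq_inner)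
  moreover have "F t \<ge> (t * norm (A (S t x)))\<^sup>2"
  proof -
    have "inner (w t) (y t) \<ge> 0" using accretive[OF yA(1)[OF t]] yA(2)[OF t] by simp
    moreover have "A (S t x) = w t" using yA(2)[OF t] by (simp add: y_def)
    ultimately show ?thesis using t unfolding F_def
      by (simp add: power_mult_distrib power2_norm_eq_inner a_def)
  qed
  ultimately have "(t * norm (A (S t x)))\<^sup>2 \<le> a * (norm x)\<^sup>2" by linarith
  also have "\<dots> \<le> (CA * norm x)\<^sup>2"
  proof -
    have "a \<le> CA\<^sup>2" by (simp add: a_def CA_def power2_eq_square algebra_simps)
    then show ?thesis by (simp add: power_mult_distrib mult_right_mono)
  qed
  finally show ?thesis using CA by (meson less_imp_le mult_nonneg_nonneg norm_ge_zero power2_le_imp_le)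
qed

text \<open>The points \<open>J n (J n x)\<close> have the regularity required by \<open>smoothing_dA2\<close> and tend to \<open>x\<close>;
  the estimate there has no derivatives on its right-hand side and \<open>A\<close> is closed.\<close>

lemma
  assumes t: "t > 0"
  shows smoothing: "S t x \<in> dA" and norm_A_S: "norm (A (S t x)) \<le> CA / t * norm x"
proof -
  define f where "f n = J n (J n x)" for n
  have f1: "f n \<in> dA" for n by (simp add: f_def J_in)
  have f2: "A (f n) \<in> dA" for n unfolding f_def by (metis J_in Y_domain Y_eq)
  have f: "f \<longlonglongrightarrow> x"
  proof -
    have "(\<lambda>n. J n (J n x - x)) \<longlonglongrightarrow> 0"
      by (rule Lim_null_comparison[of _ "\<lambda>n. norm (J n x - x)"])
         (use J_tendsto[of x] in \<open>auto simp: norm_J LIM_zero tendsto_norm_zero\<close>)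
    from tendsto_add[OF this J_tendsto[of x]] show ?thesis unfolding f_def by (simp add: linear_diff[OF linear_J])
  qed
  have bound: "norm (A (S t (f n))) \<le> CA / t * norm (f n)" for n
    using smoothing_dA2[OF f1 f2, of t n] t by (simp add: field_simps)
  have "Cauchy (\<lambda>n. A (S t (f n)))"
  proof (rule CauchyI)
    fix e :: real assume e: "e > 0"
    have "Cauchy f" using f LIMSEQ_imp_Cauchy by blast
    then obtain K where K: "\<And>m n. m \<ge> K \<Longrightarrow> n \<ge> K \<Longrightarrow> norm (f m - f n) < e * t / CA"
      using CauchyD[of f "e * t / CA"] e t CA by auto
    have "norm (A (S t (f m)) - A (S t (f n))) < e" if mn: "m \<ge> K" "n \<ge> K" for m n
    proof -
      have "f m - f n \<in> dA" "A (f m - f n) \<in> dA"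
        using f1 f2 by (auto simp: A_diff intro: subspace_diff[OF dA_subspace])
      from smoothing_dA2[OF this, of t]
      have "t * norm (A (S t (f m)) - A (S t (f n))) \<le> CA * norm (f m - f n)"
        using t by (simp add: linear_diff[OF linear_S] A_diff S_in f1)
      also have "\<dots> < CA * (e * t / CA)" using K[OF mn] CA by (intro mult_strict_left_mono) auto
      finally show ?thesis using t CA by (simp add: mult.commute)
    qed
    then show "\<exists>M. \<forall>m\<ge>M. \<forall>n\<ge>M. norm (A (S t (f m)) - A (S t (f n))) < e" by blast
  qed
  then obtain z where z: "(\<lambda>n. A (S t (f n))) \<longlonglongrightarrow> z" using Cauchy_convergent convergent_def by blast
  have St: "(\<lambda>n. S t (f n)) \<longlonglongrightarrow> S t x"
    using bounded_linear.tendsto[OF bounded_linear_S f] t by simp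
  have cg: "S t x \<in> dA" "A (S t x) = z"
    using closed_graph[of "\<lambda>n. S t (f n)", OF S_in St z] f1 t by auto
  show "S t x \<in> dA" by fact
  show "norm (A (S t x)) \<le> CA / t * norm x"
    unfolding cg(2) by (rule LIMSEQ_le[OF tendsto_norm[OF z] tendsto_mult[OF tendsto_const tendsto_norm[OF f]]])
      (use bound in auto)
qed

lemma S_deriv:
  assumes t: "t > 0"
  shows "((\<lambda>t. S t x) has_vector_derivative - A (S t x)) (at t)"
proof -
  define y where "y = S (t/2) x"
  have y: "y \<in> dA" unfolding y_def using t by (intro smoothing) simp
  have eq: "S s x = S (s - t/2) y" if "s \<ge> t/2" for s
    using S_semigroup[of "s - t/2" "t/2" x] that t by (simp add: y_def)
  have "((\<lambda>r. S r y) has_vector_derivative - S (t/2) (A y)) (at (t/2) within {0..})"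
    using t by (intro S_deriv_dA y) simp
  then have "((\<lambda>r. S r y) has_vector_derivative - S (t/2) (A y)) (at (t/2))"
    using t at_within_interior[of "t/2" "{0..}"] by (simp add: interior_Ici[where b="-1"])
  then have "(((\<lambda>r. S r y) \<circ> (\<lambda>s. s - t/2)) has_vector_derivative 1 *\<^sub>R (- S (t/2) (A y))) (at t)"
    by (intro vector_diff_chain_at) (auto intro!: derivative_eq_intros)
  moreover have "S (t/2) (A y) = A (S t x)" using A_S[OF y, of "t/2"] eq[of t] t by simp
  ultimately have d: "((\<lambda>s. S (s - t/2) y) has_vector_derivative - A (S t x)) (at t)" by (simp add: o_def)
  show ?thesis
    by (rule has_vector_derivative_transform_within_open[OF d, of "{t/2<..}"]) (use t eq in auto)
qed

definition CV :: real where "CV = 1 + c\<^sup>2 + 4 * q"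

text \<open>The derivative of \<open>\<parallel>S t x - x\<parallel>\<^sup>2\<close> is \<open>- 2 \<langle>A y, y - x\<rangle>\<close> at \<open>y = S t x\<close>. Its leading part
  \<open>- 2 \<parallel>D y\<parallel>\<^sup>2\<close> absorbs all terms that are not controlled by the norm of \<open>x\<close> in \<open>V\<close>.\<close>

lemma S_sqrt_continuity:
  assumes x: "x \<in> V" and t: "t \<ge> 0"
  shows "(norm (S t x - x))\<^sup>2 \<le> CV * ((norm x)\<^sup>2 + (norm (D x))\<^sup>2) * t"
proof -
  define k where "k = CV * ((norm x)\<^sup>2 + (norm (D x))\<^sup>2)"
  define g where "g t = inner (S t x - x) (S t x - x) - k * t" for t
  have "g t \<le> g 0"
  proof (rule DERIV_nonpos_imp_decreasing_open[OF t])
    fix s :: real assume s: "0 < s" "s < t"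
    define y where "y = S s x"
    have y: "y \<in> dA" unfolding y_def by (rule smoothing[OF s(1)])
    have dy: "((\<lambda>s. S s x - x) has_vector_derivative - A y) (at s)"
      unfolding y_def by (rule has_vector_derivative_eq_rhs, rule has_vector_derivative_diff[OF S_deriv[OF s(1)] has_vector_derivative_const]) simp
    have "(g has_real_derivative (inner (- A y) (S s x - x) + inner (S s x - x) (- A y)) - k) (at s)"
      unfolding g_def by (rule derivative_eq_intros inner_has_derivative dy refl)+ simp
    moreover have "(inner (- A y) (S s x - x) + inner (S s x - x) (- A y)) - k \<le> 0"
    proof -
      have "inner (A y) (y - x) = (norm (D y))\<^sup>2 - inner (D y) (D x) + inner (D y) (c *\<^sub>R x) + inner (Q y) (y - x)"
        using A_form[OF y, of "y - x"] dA_V[OF y] x D_inner_self[OF dA_V[OF y]]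
        by (simp add: form_def subspace_diff[OF V_subspace] D_diff inner_diff_right power2_norm_eq_inner algebra_simps)
      moreover have "\<bar>2 * inner (D y) (D x)\<bar> \<le> (norm (D y))\<^sup>2 + (norm (D x))\<^sup>2" by (rule abs_inner_le)
      moreover have "\<bar>2 * inner (D y) (c *\<^sub>R x)\<bar> \<le> (norm (D y))\<^sup>2 + c\<^sup>2 * (norm x)\<^sup>2"
        using abs_inner_le[of "D y" "c *\<^sub>R x"] by (simp add: power_mult_distrib)
      moreover have "\<bar>inner (Q y) (y - x)\<bar> \<le> 2 * q * (norm x)\<^sup>2"
      proof -
        have ny: "norm y \<le> norm x" unfolding y_def using norm_S s by simp
        have "\<bar>inner (Q y) (y - x)\<bar> \<le> norm (Q y) * norm (y - x)" by (rule Cauchy_Schwarz_ineq2)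
        also have "\<dots> \<le> (q * norm x) * (2 * norm x)"
        proof (intro mult_mono)
          show "norm (Q y) \<le> q * norm x" using Q_le[of y] ny q by (meson mult_left_mono order_trans)
          show "norm (y - x) \<le> 2 * norm x" using norm_triangle_ineq4[of y x] ny by linarith
        qed (use q in auto)
        finally show ?thesis by (simp add: power2_eq_square algebra_simps)
      qed
      moreover have "(norm (D x))\<^sup>2 + c\<^sup>2 * (norm x)\<^sup>2 + 4 * q * (norm x)\<^sup>2 \<le> k"
      proof -
        have "k = (norm (D x))\<^sup>2 + c\<^sup>2 * (norm x)\<^sup>2 + 4 * q * (norm x)\<^sup>2 + (norm x)\<^sup>2 + (c\<^sup>2 + 4 * q) * (norm (D x))\<^sup>2"
          by (simp add: k_def CV_def algebra_simps)
        moreover have "(c\<^sup>2 + 4 * q) * (norm (D x))\<^sup>2 \<ge> 0" "(norm x)\<^sup>2 \<ge> 0" using q by auto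
        ultimately show ?thesis by linarith
      qed
      ultimately have "- 2 * inner (A y) (y - x) - k \<le> 0" by argo
      then show ?thesis by (simp add: y_def[symmetric] inner_commute)
    qed
    ultimately show "\<exists>d. (g has_real_derivative d) (at s) \<and> d \<le> 0" by blast
  next
    have "continuous_on {0..t} (\<lambda>t. S t x)" by (rule continuous_on_subset[OF cont]) auto
    then show "continuous_on {0..t} g" unfolding g_def by (intro continuous_intros)
  qed
  then show ?thesis by (simp add: g_def k_def S_0 power2_norm_eq_inner)
qed

lemma S_in_V: "x \<in> V \<Longrightarrow> t \<ge> 0 \<Longrightarrow> S t x \<in> V"
  by (cases "t = 0") (auto simp: S_0 dA_V[OF smoothing])

definition CB :: real where "CB = exp (c\<^sup>2 / 2) * (1 + q)"

lemma CB: "CB \<ge> 1" unfolding CB_def using q by (simp add: mult_ge1_I)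

text \<open>The derivative of \<open>\<langle>A y, y\<rangle>\<close> along an orbit is \<open>- 2 \<parallel>A y\<parallel>\<^sup>2\<close> plus a drift term, so this
  quantity grows at most like \<open>exp (c\<^sup>2 t / 2)\<close>; it bounds \<open>\<parallel>D y\<parallel>\<^sup>2\<close> by coercivity.\<close>

lemma V_bound_dA:
  assumes x: "x \<in> dA" and t: "0 \<le> t" "t \<le> 1"
  shows "(norm (D (S t x)))\<^sup>2 \<le> CB * ((norm x)\<^sup>2 + (norm (D x))\<^sup>2)"
proof -
  define e where "e t = inner (S t (A x)) (S t x)" for t
  have "e t \<le> exp (c\<^sup>2 / 2 * t) * e 0"
  proof (rule gronwall_derivative[OF _ _ t(1)])
    show "continuous_on {0..t} e" unfolding e_def by (intro continuous_intros continuous_on_subset[OF cont]) auto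
  next
    fix s :: real assume s: "s > 0"
    define y where "y = S s x"
    have y: "y \<in> dA" "A y = S s (A x)" "A y \<in> dA"
      unfolding y_def using s S_in[OF x] A_S[OF x] smoothing[OF s] by auto
    have "(e has_real_derivative inner (- A (A y)) y + inner (A y) (- A y)) (at s)"
      unfolding e_def
      by (rule DERIV_cong, rule inner_has_derivative[OF S_deriv[OF s] S_deriv[OF s]])
         (simp add: y y_def[symmetric])
    moreover have "inner (- A (A y)) y + inner (A y) (- A y) \<le> c\<^sup>2 / 2 * e s"
    proof -
      have 1: "inner (- A (A y)) y + inner (A y) (- A y) = - 2 * (norm (A y))\<^sup>2 - 2 * inner (c *\<^sub>R D y) (A y)"
        using A_swap[OF y(1,3)] by (simp add: power2_norm_eq_inner)
      have "\<bar>2 * inner ((c/2) *\<^sub>R D y) (A y)\<bar> \<le> (norm ((c/2) *\<^sub>R D y))\<^sup>2 + (norm (A y))\<^sup>2" by (rule abs_inner_le)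
      then have "\<bar>2 * inner (c *\<^sub>R D y) (A y)\<bar> \<le> c\<^sup>2 / 2 * (norm (D y))\<^sup>2 + 2 * (norm (A y))\<^sup>2"
        by (simp add: power_mult_distrib power_divide abs_mult algebra_simps)
      moreover have "c\<^sup>2 / 2 * (norm (D y))\<^sup>2 \<le> c\<^sup>2 / 2 * e s"
      proof (intro mult_left_mono)
        have "e s = inner (A y) y" unfolding e_def y(2)[symmetric] y_def[symmetric] ..
        then show "(norm (D y))\<^sup>2 \<le> e s" using A_coercive[OF y(1)] by (smt (verit) zero_le_power2)
      qed simp
      ultimately show ?thesis unfolding 1 by argo
    qed
    ultimately show "\<exists>d. (e has_real_derivative d) (at s) \<and> d \<le> c\<^sup>2 / 2 * e s" by blast
  qed
  moreover have "(norm (D (S t x)))\<^sup>2 \<le> e t"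
    using A_coercive[OF S_in[OF x t(1)]] A_S[OF x t(1)] unfolding e_def by (smt (verit) zero_le_power2)
  moreover have "e 0 \<le> (1 + q) * ((norm x)\<^sup>2 + (norm (D x))\<^sup>2)"
  proof -
    have "inner (Q x) x \<le> q * norm x * norm x"
      using norm_cauchy_schwarz[of "Q x" x] Q_le[of x] by (meson mult_right_mono norm_ge_zero order_trans)
    then have "inner (Q x) x \<le> q * (norm x)\<^sup>2" by (simp add: power2_eq_square mult.assoc)
    moreover have "e 0 = (norm (D x))\<^sup>2 + inner (Q x) x" using A_energy[OF x] by (simp add: e_def S_0)
    moreover have "0 \<le> q * (norm (D x))\<^sup>2" "0 \<le> (norm x)\<^sup>2" using q by auto
    moreover have "(1 + q) * ((norm x)\<^sup>2 + (norm (D x))\<^sup>2)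
        = (norm x)\<^sup>2 + q * (norm x)\<^sup>2 + (norm (D x))\<^sup>2 + q * (norm (D x))\<^sup>2" by (simp add: algebra_simps)
    ultimately show ?thesis by linarith
  qed
  moreover have "exp (c\<^sup>2 / 2 * t) \<le> exp (c\<^sup>2 / 2)" using t by (simp add: mult_left_le)
  moreover have "e 0 \<ge> 0" using accretive[OF x] by (simp add: e_def S_0)
  ultimately have "(norm (D (S t x)))\<^sup>2 \<le> exp (c\<^sup>2 / 2) * ((1 + q) * ((norm x)\<^sup>2 + (norm (D x))\<^sup>2))"
    by (meson exp_ge_zero mult_mono order_trans)
  then show ?thesis by (simp add: CB_def mult.assoc)
qed

lemma V_bound:
  assumes x: "x \<in> V" and t: "0 \<le> t" "t \<le> 1"
  shows "(norm (D (S t x)))\<^sup>2 \<le> CB * ((norm x)\<^sup>2 + (norm (D x))\<^sup>2)"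
proof -
  obtain f where f: "\<And>n. f n \<in> dA" "f \<longlonglongrightarrow> x" "(\<lambda>n. D (f n)) \<longlonglongrightarrow> D x" using dA_core[OF x] by blast
  have SV: "S t (f n) \<in> V" for n using f(1) S_in_V dA_V t by blast
  have "Cauchy (\<lambda>n. D (S t (f n)))"
  proof (rule CauchyI)
    fix e :: real assume e: "e > 0"
    define d where "d = e / (2 * CB)"
    have d: "d > 0" using e CB by (simp add: d_def)
    obtain K1 where K1: "\<And>m n. m \<ge> K1 \<Longrightarrow> n \<ge> K1 \<Longrightarrow> norm (f m - f n) < d"
      using CauchyD[OF LIMSEQ_imp_Cauchy[OF f(2)] d] by auto
    obtain K2 where K2: "\<And>m n. m \<ge> K2 \<Longrightarrow> n \<ge> K2 \<Longrightarrow> norm (D (f m) - D (f n)) < d"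
      using CauchyD[OF LIMSEQ_imp_Cauchy[OF f(3)] d] by auto
    have "norm (D (S t (f m)) - D (S t (f n))) < e" if "m \<ge> max K1 K2" "n \<ge> max K1 K2" for m n
    proof -
      have "(norm (D (S t (f m - f n))))\<^sup>2 \<le> CB * ((norm (f m - f n))\<^sup>2 + (norm (D (f m - f n)))\<^sup>2)"
        by (intro V_bound_dA subspace_diff[OF dA_subspace] f t)
      also have "\<dots> \<le> CB * (d\<^sup>2 + d\<^sup>2)"
        using K1[of m n] K2[of m n] that CB
        by (intro mult_left_mono add_mono power_mono) (auto simp: D_diff dA_V f(1))
      also have "\<dots> \<le> CB * CB * (d\<^sup>2 + d\<^sup>2)" using CB by (intro mult_right_mono) auto
      also have "\<dots> < e\<^sup>2" using CB e by (simp add: d_def power_divide field_simps power2_eq_square)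
      finally have "norm (D (S t (f m - f n))) < e" using e power2_less_imp_less less_imp_le by blast
      then show ?thesis using t by (simp add: linear_diff[OF linear_S] D_diff SV)
    qed
    then show "\<exists>M. \<forall>m\<ge>M. \<forall>n\<ge>M. norm (D (S t (f m)) - D (S t (f n))) < e" by blast
  qed
  then obtain z where z: "(\<lambda>n. D (S t (f n))) \<longlonglongrightarrow> z" using Cauchy_convergent convergent_def by blast
  have "(\<lambda>n. S t (f n)) \<longlonglongrightarrow> S t x" by (rule bounded_linear.tendsto[OF bounded_linear_S[OF t(1)] f(2)])
  then have "D (S t x) = z" using D_closed[OF SV _ z] by blast
  then have "(\<lambda>n. (norm (D (S t (f n))))\<^sup>2) \<longlonglongrightarrow> (norm (D (S t x)))\<^sup>2" using z by (intro tendsto_intros) simp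
  moreover have "(\<lambda>n. CB * ((norm (f n))\<^sup>2 + (norm (D (f n)))\<^sup>2)) \<longlonglongrightarrow> CB * ((norm x)\<^sup>2 + (norm (D x))\<^sup>2)"
    by (intro tendsto_intros f)
  ultimately show ?thesis by (rule LIMSEQ_le) (use V_bound_dA[OF f(1) t] in auto)
qed

text \<open>Continuity at time \<open>0\<close> in the norm of \<open>V\<close>. For \<open>z\<close> in the domain it follows from coercivity,
  \<open>\<parallel>D (S t z - z)\<parallel>\<^sup>2 \<le> \<parallel>A (S t z - z)\<parallel> \<parallel>S t z - z\<parallel>\<close>; \<open>V_bound\<close> extends it to \<open>V\<close> by density.\<close>

lemma S_tendsto_V:
  assumes x: "x \<in> V"
  shows "((\<lambda>t. D (S t x)) \<longlongrightarrow> D x) (at_right 0)"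
proof (rule tendstoI)
  fix e :: real assume e: "e > 0"
  obtain f where f: "\<And>n. f n \<in> dA" "f \<longlonglongrightarrow> x" "(\<lambda>n. D (f n)) \<longlonglongrightarrow> D x" using dA_core[OF x] by blast
  have "(\<lambda>n. CB * ((norm (x - f n))\<^sup>2 + (norm (D x - D (f n)))\<^sup>2)) \<longlonglongrightarrow> CB * ((norm (x - x))\<^sup>2 + (norm (D x - D x))\<^sup>2)"
    by (intro tendsto_intros f)
  then have "\<forall>\<^sub>F n in sequentially. CB * ((norm (x - f n))\<^sup>2 + (norm (D x - D (f n)))\<^sup>2) < (e/3)\<^sup>2"
    by (rule order_tendstoD) (use e in auto)
  then obtain n where n: "CB * ((norm (x - f n))\<^sup>2 + (norm (D x - D (f n)))\<^sup>2) < (e/3)\<^sup>2"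
    using eventually_happens'[OF sequentially_bot] by blast
  define z where "z = f n"
  have z: "z \<in> dA" "z \<in> V" using f(1) dA_V by (auto simp: z_def)
  have nz: "CB * ((norm (x - z))\<^sup>2 + (norm (D (x - z)))\<^sup>2) < (e/3)\<^sup>2" using n x z by (simp add: z_def D_diff)
  have Dxz: "norm (D z - D x) < e / 3"
  proof -
    have "1 * (norm (D (x - z)))\<^sup>2 \<le> CB * ((norm (x - z))\<^sup>2 + (norm (D (x - z)))\<^sup>2)"
      using CB by (intro mult_mono) auto
    then have "(norm (D (x - z)))\<^sup>2 < (e/3)\<^sup>2" using nz by linarith
    then have "norm (D (x - z)) < e/3" using e by (intro power2_less_imp_less[of _ "e/3"]) auto
    then show ?thesis using x z by (simp add: D_diff norm_minus_commute)
  qed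
  have lim: "((\<lambda>t. sqrt (2 * norm (A z) * norm (S t z - z))) \<longlongrightarrow> sqrt (2 * norm (A z) * norm (S 0 z - z))) (at_right 0)"
  proof (intro tendsto_intros)
    show "((\<lambda>t. S t z) \<longlongrightarrow> S 0 z) (at_right 0)"
      using cont[of z] unfolding continuous_on_def by (auto intro: tendsto_within_subset)
  qed
  have "\<forall>\<^sub>F t in at_right 0. sqrt (2 * norm (A z) * norm (S t z - z)) < e/3"
    by (rule order_tendstoD[OF lim]) (use e in \<open>simp add: S_0\<close>)
  moreover have "\<forall>\<^sub>F t in at_right (0::real). 0 < t \<and> t \<le> 1"
    unfolding eventually_at_right_field by (intro exI[of _ 1]) auto
  ultimately show "\<forall>\<^sub>F t in at_right 0. dist (D (S t x)) (D x) < e"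
  proof eventually_elim
    fix t :: real assume t1: "sqrt (2 * norm (A z) * norm (S t z - z)) < e/3" and t: "0 < t \<and> t \<le> 1"
    have t0: "t \<ge> 0" using t by simp
    have "(norm (D (S t (x - z))))\<^sup>2 \<le> CB * ((norm (x - z))\<^sup>2 + (norm (D (x - z)))\<^sup>2)"
      using t by (intro V_bound subspace_diff[OF V_subspace] x z) auto
    then have "(norm (D (S t (x - z))))\<^sup>2 < (e/3)\<^sup>2" using nz by linarith
    then have a: "norm (D (S t (x - z))) < e/3" using e by (intro power2_less_imp_less[of _ "e/3"]) auto
    have b: "norm (D (S t z) - D z) < e/3"
    proof -
      have d: "S t z - z \<in> dA" by (intro subspace_diff[OF dA_subspace] S_in z t0)
      have "(norm (D (S t z - z)))\<^sup>2 \<le> inner (A (S t z - z)) (S t z - z)"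
        using A_coercive[OF d] by (smt (verit) zero_le_power2)
      also have "\<dots> \<le> norm (A (S t z - z)) * norm (S t z - z)" by (rule norm_cauchy_schwarz)
      also have "\<dots> \<le> 2 * norm (A z) * norm (S t z - z)"
      proof (intro mult_right_mono)
        show "norm (A (S t z - z)) \<le> 2 * norm (A z)"
          using norm_triangle_ineq4[of "S t (A z)" "A z"] norm_S[OF t0, of "A z"]
          by (simp add: A_diff S_in A_S z t0)
      qed simp
      finally have "norm (D (S t z - z)) \<le> sqrt (2 * norm (A z) * norm (S t z - z))"
        by (simp add: real_le_rsqrt)
      then show ?thesis using t1 by (simp add: D_diff dA_V S_in z t0)
    qed
    have "D (S t x) - D x = D (S t (x - z)) + (D (S t z) - D z) + (D z - D x)"
      using x z t0 by (simp add: linear_diff[OF linear_S] D_diff S_in_V)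
    then have "norm (D (S t x) - D x) \<le> norm (D (S t (x - z))) + norm (D (S t z) - D z) + norm (D z - D x)"
      by (metis norm_triangle_ineq norm_triangle_le add_right_mono)
    then show "dist (D (S t x)) (D x) < e" using a b Dxz by (simp add: dist_norm)
  qed
qed

end


section \<open>Strong solutions of the semilinear equation\<close>

context drift_operator
begin

lemma duhamel_shift:
  assumes f: "continuous_on {0..} f" and t: "t \<ge> 0" and h: "h \<ge> 0"
  shows "duhamel f (h + t) = S t (duhamel f h) + duhamel (\<lambda>s. f (h + s)) t"
proof -
  have fi: "(\<lambda>s. S (h + t - s) (f s)) integrable_on {a..b}" if "0 \<le> a" "b \<le> h + t" for a b
    using duhamel_integrable[of "h + t" f a b] continuous_on_subset[OF f] that by auto
  have fh: "(\<lambda>s. S (h - s) (f s)) integrable_on {0..h}"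
    using duhamel_integrable[of h f 0 h] continuous_on_subset[OF f] by auto
  have "duhamel f (h + t) = integral {0..h} (\<lambda>s. S (h + t - s) (f s)) + integral {h..h + t} (\<lambda>s. S (h + t - s) (f s))"
    unfolding duhamel_def using t h
    by (intro Henstock_Kurzweil_Integration.integral_combine[symmetric] fi) auto
  also have "integral {0..h} (\<lambda>s. S (h + t - s) (f s)) = integral {0..h} (S t \<circ> (\<lambda>s. S (h - s) (f s)))"
  proof (rule Henstock_Kurzweil_Integration.integral_cong)
    fix s assume "s \<in> {0..h}"
    then have "S (t + (h - s)) (f s) = S t (S (h - s) (f s))" using t by (intro S_semigroup) auto
    then show "S (h + t - s) (f s) = (S t \<circ> (\<lambda>s. S (h - s) (f s))) s" by (simp add: algebra_simps)
  qed
  also have "\<dots> = S t (duhamel f h)"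
    unfolding duhamel_def by (rule integral_linear[OF fh bounded_linear_S[OF t]])
  also have "integral {h..h + t} (\<lambda>s. S (h + t - s) (f s)) = duhamel (\<lambda>s. f (h + s)) t"
  proof -
    have "((\<lambda>s. S (h + t - s) (f s)) has_integral integral {h..h + t} (\<lambda>s. S (h + t - s) (f s))) (cbox h (h + t))"
      using fi[of h "h + t"] h by (simp add: has_integral_integral)
    from has_integral_affinity'[OF this, of 1 h]
    have "((\<lambda>s. S (t - s) (f (h + s))) has_integral integral {h..h + t} (\<lambda>s. S (h + t - s) (f s))) {0..t}"
      by (simp add: algebra_simps)
    then show ?thesis unfolding duhamel_def by (simp add: integral_unique)
  qed
  finally show ?thesis .
qed

lemma continuous_on_shift:
  assumes "continuous_on {0..} (f :: real \<Rightarrow> 'b::topological_space)" "h \<ge> 0"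
  shows "continuous_on {0..} (\<lambda>s. f (h + s))"
  by (rule continuous_on_compose2[OF assms(1)]) (use assms(2) in \<open>auto intro!: continuous_intros\<close>)

lemma duhamel_le_const:
  assumes "continuous_on {0..} f" "t \<ge> 0" "\<And>s. 0 \<le> s \<Longrightarrow> s \<le> t \<Longrightarrow> norm (f s) \<le> K"
  shows "norm (duhamel f t) \<le> K * t"
  using duhamel_norm_le[of f t "\<lambda>_. K"] assms by (simp add: mult.commute)

lemma semigroup_increment:
  assumes y: "y \<in> dA" and h: "h \<ge> 0"
    and le: "\<And>r. 0 \<le> r \<Longrightarrow> r \<le> h \<Longrightarrow> norm (S r (A y) - z) \<le> K"
  shows "norm (S h y - y + h *\<^sub>R z) \<le> K * h"
proof -
  have "norm ((S h y + h *\<^sub>R z) - (S 0 y + 0 *\<^sub>R z)) \<le> K * norm (h - 0)"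
  proof (rule differentiable_bound[of "{0..h}"])
    fix r assume r: "r \<in> {0..h}"
    have "((\<lambda>r. S r y + r *\<^sub>R z) has_vector_derivative - S r (A y) + 1 *\<^sub>R z) (at r within {0..h})"
      using r by (intro has_vector_derivative_add has_vector_derivative_within_subset[OF S_deriv_dA[OF y]])
        (auto intro!: derivative_eq_intros)
    then show "((\<lambda>r. S r y + r *\<^sub>R z) has_derivative (\<lambda>k. k *\<^sub>R (- S r (A y) + 1 *\<^sub>R z))) (at r within {0..h})"
      by (simp add: has_vector_derivative_def)
    have "norm (- S r (A y) + 1 *\<^sub>R z) \<le> K" using le[of r] r by (simp add: norm_minus_commute)
    then show "onorm (\<lambda>k. k *\<^sub>R (- S r (A y) + 1 *\<^sub>R z)) \<le> K"
      by (intro onorm_le) (metis abs_ge_zero mult.commute mult_left_mono norm_scaleR real_norm_def)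
  qed (use h in auto)
  moreover have "(S h y + h *\<^sub>R z) - (S 0 y + 0 *\<^sub>R z) = S h y - y + h *\<^sub>R z" by (simp add: S_0)
  ultimately have "norm (S h y - y + h *\<^sub>R z) \<le> K * norm (h - 0)" by (simp only:)
  then show ?thesis using h by simp
qed

text \<open>A continuous \<open>A u\<close> makes a mild solution differentiable. For the left derivative the increment
  starts at a time \<open>a < t\<close>, hence the estimate \<open>main\<close> is uniform over all starting times near \<open>t\<close>.\<close>

lemma mild_differentiable:
  assumes f: "continuous_on {0..} f"
    and mild: "\<And>t h. t \<ge> 0 \<Longrightarrow> h \<ge> 0 \<Longrightarrow> u (t + h) = S h (u t) + duhamel (\<lambda>s. f (t + s)) h"
    and dom: "\<And>t. t > 0 \<Longrightarrow> u t \<in> dA"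
    and Au: "continuous_on {0<..} (\<lambda>t. A (u t))"
    and t: "t > 0"
  shows "(u has_vector_derivative f t - A (u t)) (at t)"
proof -
  define z where "z = A (u t)"
  have incr: "\<exists>d>0. \<forall>s. \<bar>s - t\<bar> < d \<longrightarrow> norm (u s - u t - (s - t) *\<^sub>R (f t - z)) \<le> e * \<bar>s - t\<bar>" if e: "e > 0" for e
  proof -
    have fa: "continuous_on {0<..} f" by (rule continuous_on_subset[OF f]) auto
    have e4: "e / 4 > 0" using e by simp
    obtain d1 where d1: "d1 > 0" "\<And>s. s > 0 \<Longrightarrow> \<bar>s - t\<bar> < d1 \<Longrightarrow> norm (f s - f t) < e / 4"
      using fa t e4 unfolding continuous_on_iff dist_norm real_norm_def by (metis greaterThan_iff)
    obtain d2 where d2: "d2 > 0" "\<And>s. s > 0 \<Longrightarrow> \<bar>s - t\<bar> < d2 \<Longrightarrow> norm (A (u s) - A (u t)) < e / 4"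
      using Au t e4 unfolding continuous_on_iff dist_norm real_norm_def by (metis greaterThan_iff)
    obtain d3 where d3: "d3 > 0" "\<And>t s. t \<ge> 0 \<Longrightarrow> s \<ge> 0 \<Longrightarrow> \<bar>t - s\<bar> < d3 \<Longrightarrow> norm (S t z - S s z) < e / 4"
      using S_uniform[OF e4] by blast
    obtain d4 where d4: "d4 > 0" "\<And>r s. r \<ge> 0 \<Longrightarrow> s \<ge> 0 \<Longrightarrow> \<bar>r - s\<bar> < d4 \<Longrightarrow> norm (S r (f t) - S s (f t)) < e / 4"
      using S_uniform[OF e4] by blast
    define d where "d = Min {d1, d2, d3, d4, t}"
    have d: "d > 0" "d \<le> d1" "d \<le> d2" "d \<le> d3" "d \<le> d4" "d \<le> t"
      unfolding d_def using d1(1) d2(1) d3(1) d4(1) t by (auto simp: min_less_iff_conj)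
    have main: "norm (u (a + h) - u a - h *\<^sub>R (f t - z)) \<le> e * h"
      if a: "\<bar>a - t\<bar> < d" "\<bar>a + h - t\<bar> < d" "h \<ge> 0" "h < d" for a h
    proof -
      have a0: "a > 0" using a d by linarith
      have 1: "norm (S h (u a) - u a + h *\<^sub>R z) \<le> (e/2) * h"
      proof (rule semigroup_increment[OF dom[OF a0] a(3)])
        fix r assume r: "0 \<le> r" "r \<le> h"
        have "S r (A (u a)) - z = S r (A (u a) - z) + (S r z - S 0 z)"
          using r by (simp add: linear_diff[OF linear_S] S_0)
        then have "norm (S r (A (u a)) - z) \<le> norm (S r (A (u a) - z)) + norm (S r z - S 0 z)"
          by (metis norm_triangle_ineq)
        moreover have "norm (S r (A (u a) - z)) \<le> e/4"
          using norm_S[OF r(1), of "A (u a) - z"] d2(2)[OF a0] a(1) d by (simp add: z_def)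
        moreover have "norm (S r z - S 0 z) < e/4" using d3(2)[of r 0] r a d by simp
        ultimately show "norm (S r (A (u a)) - z) \<le> e/2" by linarith
      qed
      have ca: "continuous_on {0..} (\<lambda>s. f (a + s))" by (rule continuous_on_shift[OF f]) (use a0 in simp)
      have 2: "norm (duhamel (\<lambda>s. f (a + s)) h - h *\<^sub>R f t) \<le> (e/2) * h"
      proof -
        have i: "(\<lambda>s. S (h - s) (f (a + s))) integrable_on {0..h}"
          using duhamel_integrable[of h "\<lambda>s. f (a + s)" 0 h] continuous_on_subset[OF ca] by auto
        have "duhamel (\<lambda>s. f (a + s)) h - h *\<^sub>R f t = integral {0..h} (\<lambda>s. S (h - s) (f (a + s)) - f t)"
          unfolding duhamel_def using i a(3)
          by (subst Henstock_Kurzweil_Integration.integral_diff) auto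
        also have "norm \<dots> \<le> integral {0..h} (\<lambda>_. e/2)"
        proof (rule integral_norm_bound_integral)
          show "(\<lambda>s. S (h - s) (f (a + s)) - f t) integrable_on {0..h}"
            using i by (intro Henstock_Kurzweil_Integration.integrable_diff) auto
          fix s assume s: "s \<in> {0..h}"
          have hs: "h - s \<ge> 0" using s by simp
          have "S (h - s) (f (a + s)) - f t = S (h - s) (f (a + s) - f t) + (S (h - s) (f t) - S 0 (f t))"
            using hs by (simp add: linear_diff[OF linear_S] S_0)
          then have "norm (S (h - s) (f (a + s)) - f t) \<le> norm (S (h - s) (f (a + s) - f t)) + norm (S (h - s) (f t) - S 0 (f t))"
            by (metis norm_triangle_ineq)
          moreover have "norm (S (h - s) (f (a + s) - f t)) \<le> e/4"
          proof -
            have "\<bar>a + s - t\<bar> < d1" using a s d(2) by (auto simp: abs_less_iff)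
            then show ?thesis using norm_S[OF hs, of "f (a + s) - f t"] d1(2)[of "a + s"] a0 s by simp
          qed
          moreover have "norm (S (h - s) (f t) - S 0 (f t)) < e/4" using d4(2)[of "h - s" 0] s a d by simp
          ultimately show "norm (S (h - s) (f (a + s)) - f t) \<le> e/2" by linarith
        qed auto
        finally show ?thesis using a(3) by (simp add: mult.commute)
      qed
      have "u (a + h) - u a - h *\<^sub>R (f t - z) = (S h (u a) - u a + h *\<^sub>R z) + (duhamel (\<lambda>s. f (a + s)) h - h *\<^sub>R f t)"
        using mild[of a h] a0 a(3) by (simp add: algebra_simps)
      moreover have "norm ((S h (u a) - u a + h *\<^sub>R z) + (duhamel (\<lambda>s. f (a + s)) h - h *\<^sub>R f t)) \<le> (e/2) * h + (e/2) * h"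
        by (rule norm_triangle_le) (use 1 2 in linarith)
      ultimately have "norm (u (a + h) - u a - h *\<^sub>R (f t - z)) \<le> (e/2) * h + (e/2) * h"
        by (simp only:)
      then show ?thesis by (simp add: field_simps)
    qed
    have "norm (u s - u t - (s - t) *\<^sub>R (f t - z)) \<le> e * \<bar>s - t\<bar>" if s: "\<bar>s - t\<bar> < d" for s
    proof (cases "s \<ge> t")
      case True
      then show ?thesis using main[of t "s - t"] s d by simp
    next
      case False
      then have "norm (u t - u s - (t - s) *\<^sub>R (f t - z)) \<le> e * (t - s)"
        using main[of s "t - s"] s d by simp
      moreover have "u t - u s - (t - s) *\<^sub>R (f t - z) = - (u s - u t - (s - t) *\<^sub>R (f t - z))"
        by (simp add: algebra_simps)
      ultimately show ?thesis using False by (simp only: norm_minus_cancel) simp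
    qed
    then show ?thesis using d by blast
  qed
  show ?thesis
    unfolding has_vector_derivative_def has_derivative_within_alt z_def[symmetric] real_norm_def
    using incr by (auto intro: bounded_linear_scaleR_left)
qed

lemma bounded_linear_A_S:
  assumes t: "t > 0" shows "bounded_linear (\<lambda>x. A (S t x))"
proof (rule bounded_linear_intro)
  show "norm (A (S t x)) \<le> norm x * (CA / t)" for x using norm_A_S[OF t, of x] by (simp add: mult.commute)
qed (use t in \<open>auto simp: linear_add[OF linear_S] linear_scale[OF linear_S] A_add A_scale smoothing\<close>)

lemma A_S_integral:
  assumes d: "0 < d" "d \<le> e"
  shows "((\<lambda>s. A (S (e - s) x)) has_integral S d x - S e x) {0..e - d}"
proof -
  have "((\<lambda>s. A (S (e - s) x)) has_integral S (e - (e - d)) x - S (e - 0) x) {0..e - d}"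
  proof (rule fundamental_theorem_of_calculus)
    fix s assume s: "s \<in> {0..e - d}"
    then have "((\<lambda>t. S t x) has_vector_derivative - A (S (e - s) x)) (at (e - s))" using d by (intro S_deriv) auto
    then have "(((\<lambda>t. S t x) \<circ> (\<lambda>s. e - s)) has_vector_derivative (- 1) *\<^sub>R (- A (S (e - s) x))) (at s)"
      by (intro vector_diff_chain_at) (auto intro!: derivative_eq_intros)
    then show "((\<lambda>s. S (e - s) x) has_vector_derivative A (S (e - s) x)) (at s within {0..e - d})"
      by (simp add: o_def has_vector_derivative_at_within)
  qed (use d in simp)
  then show ?thesis by simp
qed

lemma inverse_sqrt_integral:
  assumes d: "0 < d" "d \<le> e"
  shows "((\<lambda>s. K / sqrt (e - s)) has_integral 2 * K * (sqrt e - sqrt d)) {0..e - d}"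
proof -
  have "((\<lambda>s. K / sqrt (e - s)) has_integral (- 2 * K * sqrt (e - (e - d)) - (- 2 * K * sqrt (e - 0)))) {0..e - d}"
  proof (rule fundamental_theorem_of_calculus)
    fix s assume "s \<in> {0..e - d}"
    then show "((\<lambda>s. - 2 * K * sqrt (e - s)) has_vector_derivative K / sqrt (e - s)) (at s within {0..e - d})"
      using d unfolding has_real_derivative_iff_has_vector_derivative[symmetric]
      by (auto intro!: derivative_eq_intros simp: field_simps)
  qed (use d in simp)
  then show ?thesis by (simp add: algebra_simps)
qed

text \<open>The bound \<open>1 / (e - s)\<close> for \<open>A (S (e - s))\<close> is not integrable up to \<open>e\<close>. For the constant
  function \<open>x\<close> the integral is known exactly, and after subtracting it the Hoelder condition leaves
  the integrable singularity \<open>1 / sqrt (e - s)\<close>. The bound is uniform in \<open>d\<close>.\<close>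

lemma singular_estimate:
  assumes g: "continuous_on {0..} g" and d: "0 < d" "d \<le> e" and C: "C \<ge> 0"
    and holder: "\<And>s. 0 \<le> s \<Longrightarrow> s \<le> e \<Longrightarrow> norm (g s - x) \<le> C * sqrt (e - s)"
  shows "norm (A (S d (duhamel g (e - d)))) \<le> 2 * CA * C * sqrt e + norm (S d x - S e x)"
proof -
  define B where "B y = A (S d y)" for y
  have B: "bounded_linear B" unfolding B_def by (rule bounded_linear_A_S[OF d(1)])
  have gi: "(\<lambda>s. S (e - d - s) (g s)) integrable_on {0..e - d}"
    using duhamel_integrable[of "e - d" g 0 "e - d"] continuous_on_subset[OF g] by auto
  have BS: "B (S (e - d - s) y) = A (S (e - s) y)" if "s \<in> {0..e - d}" for s y
    using S_semigroup[of d "e - d - s" y] that d by (simp add: B_def)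
  have "(B \<circ> (\<lambda>s. S (e - d - s) (g s))) integrable_on {0..e - d}" by (rule integrable_linear[OF gi B])
  then have i: "(\<lambda>s. A (S (e - s) (g s))) integrable_on {0..e - d}"
    by (rule integrable_eq) (simp add: BS)
  have "A (S d (duhamel g (e - d))) = integral {0..e - d} (B \<circ> (\<lambda>s. S (e - d - s) (g s)))"
    unfolding duhamel_def B_def[symmetric] by (rule integral_linear[OF gi B, symmetric])
  also have "\<dots> = integral {0..e - d} (\<lambda>s. A (S (e - s) (g s)))"
    by (rule Henstock_Kurzweil_Integration.integral_cong) (simp add: BS)
  finally have 1: "((\<lambda>s. A (S (e - s) (g s))) has_integral A (S d (duhamel g (e - d)))) {0..e - d}"
    using i by (simp add: has_integral_integral)
  have "((\<lambda>s. A (S (e - s) (g s)) - A (S (e - s) x)) has_integral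
      (A (S d (duhamel g (e - d))) - (S d x - S e x))) {0..e - d}"
    by (rule has_integral_diff[OF 1 A_S_integral[OF d]])
  note 2 = this
  have "norm (integral {0..e - d} (\<lambda>s. A (S (e - s) (g s)) - A (S (e - s) x))) \<le> integral {0..e - d} (\<lambda>s. CA * C / sqrt (e - s))"
  proof (rule integral_norm_bound_integral)
    show "(\<lambda>s. A (S (e - s) (g s)) - A (S (e - s) x)) integrable_on {0..e - d}" using 2 by blast
    show "(\<lambda>s. CA * C / sqrt (e - s)) integrable_on {0..e - d}"
      using inverse_sqrt_integral[OF d] by blast
    fix s assume s: "s \<in> {0..e - d}"
    have es: "e - s > 0" using s d by simp
    have "norm (A (S (e - s) (g s)) - A (S (e - s) x)) = norm (A (S (e - s) (g s - x)))"
      using es by (simp add: linear_diff[OF linear_S] A_diff smoothing)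
    also have "\<dots> \<le> CA / (e - s) * norm (g s - x)" by (rule norm_A_S[OF es])
    also have "\<dots> \<le> CA / (e - s) * (C * sqrt (e - s))"
      using holder[of s] s d CA es by (intro mult_left_mono) auto
    also have "\<dots> = CA * C / sqrt (e - s)"
      using es by (simp add: field_simps)
    finally show "norm (A (S (e - s) (g s)) - A (S (e - s) x)) \<le> CA * C / sqrt (e - s)" .
  qed
  then have "norm (A (S d (duhamel g (e - d))) - (S d x - S e x)) \<le> integral {0..e - d} (\<lambda>s. CA * C / sqrt (e - s))"
    unfolding integral_unique[OF 2] .
  also have "\<dots> = 2 * (CA * C) * (sqrt e - sqrt d)" using inverse_sqrt_integral[OF d] by (rule integral_unique)
  also have "\<dots> \<le> 2 * (CA * C) * sqrt e" using CA C d by (intro mult_left_mono) auto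
  finally have "norm (A (S d (duhamel g (e - d))) - (S d x - S e x)) \<le> 2 * CA * C * sqrt e" by simp
  then show ?thesis
    using norm_triangle_ineq[of "A (S d (duhamel g (e - d))) - (S d x - S e x)" "S d x - S e x"] by simp
qed

context
  fixes f :: "real \<Rightarrow> 'a" and T C :: real
  assumes f: "continuous_on {0..} f" and C: "C \<ge> 0"
    and holder: "\<And>s t. 0 \<le> s \<Longrightarrow> s \<le> t \<Longrightarrow> t \<le> T \<Longrightarrow> norm (f s - f t) \<le> C * sqrt (t - s)"
begin

text \<open>\<open>S d (duhamel f (t - d))\<close> is the Duhamel integral cut off at time \<open>t - d\<close>. Two cut-offs differ by
  an integral over a short interval before \<open>t\<close>, to which \<open>singular_estimate\<close> applies.\<close>

lemma truncated_difference:
  assumes d: "0 < d" "d \<le> e" and t: "e \<le> t" "t \<le> T"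
  shows "norm (A (S d (duhamel f (t - d))) - A (S e (duhamel f (t - e))))
    \<le> 2 * CA * C * sqrt e + norm (S d (f t) - S e (f t))"
proof -
  define g where "g s = f (t - e + s)" for s
  have g: "continuous_on {0..} g" unfolding g_def by (rule continuous_on_shift[OF f]) (use t in simp)
  have "duhamel f (t - d) = S (e - d) (duhamel f (t - e)) + duhamel g (e - d)"
    using duhamel_shift[OF f, of "e - d" "t - e"] d t by (simp add: g_def[abs_def])
  then have "S d (duhamel f (t - d)) = S e (duhamel f (t - e)) + S d (duhamel g (e - d))"
    using S_semigroup[of d "e - d" "duhamel f (t - e)"] d by (simp add: linear_add[OF linear_S])
  then have "A (S d (duhamel f (t - d))) - A (S e (duhamel f (t - e))) = A (S d (duhamel g (e - d)))"
    using d by (simp add: A_add smoothing)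
  moreover have "norm (A (S d (duhamel g (e - d)))) \<le> 2 * CA * C * sqrt e + norm (S d (f t) - S e (f t))"
  proof (rule singular_estimate[OF g d C])
    fix s assume "0 \<le> s" "s \<le> e"
    then show "norm (g s - f t) \<le> C * sqrt (e - s)"
      using holder[of "t - e + s" t] t by (simp add: g_def)
  qed
  ultimately show ?thesis by simp
qed

text \<open>The cut-off integrals lie in the domain by smoothing, and their images under the closed operator
  \<open>A\<close> form a Cauchy sequence as the cut-off tends to \<open>0\<close>.\<close>

lemma
  assumes t: "0 < t" "t \<le> T"
  shows duhamel_in: "duhamel f t \<in> dA"
    and A_duhamel_approx: "0 < e \<Longrightarrow> e \<le> t \<Longrightarrow> norm (A (duhamel f t) - A (S e (duhamel f (t - e))))
       \<le> 2 * CA * C * sqrt e + norm (f t - S e (f t))"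
proof -
  define d where "d n = t / real (Suc n)" for n
  have d: "0 < d n" "d n \<le> t" for n using t by (auto simp: d_def field_simps)
  have dlim: "d \<longlonglongrightarrow> 0" unfolding d_def
    using tendsto_mult[OF tendsto_const[of t] LIMSEQ_inverse_real_of_nat] by (simp add: divide_inverse)
  define v where "v n = S (d n) (duhamel f (t - d n))" for n
  have vA: "v n \<in> dA" for n unfolding v_def by (rule smoothing[OF d(1)])
  have vlim: "v \<longlonglongrightarrow> duhamel f t"
  proof -
    have "(\<lambda>n. t - d n) \<longlonglongrightarrow> t - 0" by (intro tendsto_intros dlim)
    then have "(\<lambda>n. duhamel f (t - d n)) \<longlonglongrightarrow> duhamel f t"
      by (intro continuous_on_tendsto_compose[OF duhamel_continuous[OF f]]) (use d t in auto)
    then have "v \<longlonglongrightarrow> S 0 (duhamel f t)" unfolding v_def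
      by (intro S_tendsto dlim) (use d(1)[THEN less_imp_le] in auto)
    then show ?thesis by (simp add: S_0)
  qed
  have Sd: "(\<lambda>n. S (d n) (f t)) \<longlonglongrightarrow> f t"
    using S_tendsto[OF dlim tendsto_const, of "f t"] d(1)[THEN less_imp_le] by (auto simp: S_0)
  have bound: "norm (A (v n) - A (S e (duhamel f (t - e)))) \<le> 2 * CA * C * sqrt e + norm (S (d n) (f t) - S e (f t))"
    if "d n \<le> e" "e \<le> t" for n e
    unfolding v_def by (rule truncated_difference) (use d that t in auto)
  have "Cauchy (\<lambda>n. A (v n))"
  proof (rule CauchyI)
    fix e :: real assume e: "e > 0"
    have "(\<lambda>n. 2 * CA * C * sqrt (d n)) \<longlonglongrightarrow> 2 * CA * C * sqrt 0" by (intro tendsto_intros dlim)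
    then have "\<forall>\<^sub>F n in sequentially. 2 * CA * C * sqrt (d n) < e/2" by (rule order_tendstoD) (use e in simp)
    then obtain K1 where K1: "\<And>n. n \<ge> K1 \<Longrightarrow> 2 * CA * C * sqrt (d n) < e/2" by (auto simp: eventually_sequentially)
    obtain K2 where K2: "\<And>m n. m \<ge> K2 \<Longrightarrow> n \<ge> K2 \<Longrightarrow> norm (S (d m) (f t) - S (d n) (f t)) < e/2"
      using CauchyD[OF LIMSEQ_imp_Cauchy[OF Sd], of "e/2"] e by auto
    have main: "norm (A (v m) - A (v n)) < e" if "m \<ge> n" "n \<ge> max K1 K2" for m n
    proof -
      have "d m \<le> d n" using that t by (auto simp: d_def field_simps)
      from bound[OF this d(2)] show ?thesis using K1[of n] K2[of m n] that unfolding v_def[of n] by fastforce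
    qed
    have "norm (A (v m) - A (v n)) < e" if "m \<ge> max K1 K2" "n \<ge> max K1 K2" for m n
      using main[of n m] main[of m n] that by (cases "m \<ge> n") (auto simp: norm_minus_commute)
    then show "\<exists>M. \<forall>m\<ge>M. \<forall>n\<ge>M. norm (A (v m) - A (v n)) < e" by blast
  qed
  then obtain z where z: "(\<lambda>n. A (v n)) \<longlonglongrightarrow> z" using Cauchy_convergent convergent_def by blast
  have cg: "duhamel f t \<in> dA" "A (duhamel f t) = z" using closed_graph[of v, OF vA vlim z] by auto
  show "duhamel f t \<in> dA" by fact
  assume e: "0 < e" "e \<le> t"
  have "\<forall>\<^sub>F n in sequentially. d n < e" by (rule order_tendstoD(2)[OF dlim e(1)])
  then have ev: "\<forall>\<^sub>F n in sequentially. norm (A (v n) - A (S e (duhamel f (t - e)))) \<le> 2 * CA * C * sqrt e + norm (S (d n) (f t) - S e (f t))"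
    by eventually_elim (use bound e in auto)
  show "norm (A (duhamel f t) - A (S e (duhamel f (t - e)))) \<le> 2 * CA * C * sqrt e + norm (f t - S e (f t))"
    unfolding cg(2)
    by (rule tendsto_le[OF sequentially_bot _ _ ev]) (intro tendsto_intros Sd z)+
qed

lemma norm_A_duhamel:
  assumes t: "0 < t" "t \<le> T"
  shows "norm (A (duhamel f t)) \<le> 2 * CA * C * sqrt t + 2 * norm (f t)"
proof -
  have "duhamel f 0 = 0" by (simp add: duhamel_def)
  moreover have "A 0 = 0" using A_scale[OF subspace_0[OF dA_subspace], of 0] by simp
  ultimately have "norm (A (duhamel f t)) \<le> 2 * CA * C * sqrt t + norm (f t - S t (f t))"
    using A_duhamel_approx[OF t t(1) order_refl] t(1) by (simp add: linear_0[OF linear_S])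
  moreover have "norm (f t - S t (f t)) \<le> norm (f t) + norm (f t)"
    using norm_triangle_ineq4[of "f t" "S t (f t)"] norm_S[of t "f t"] t(1) by linarith
  ultimately show ?thesis by linarith
qed

text \<open>By \<open>A_duhamel_approx\<close>, \<open>A (duhamel f t)\<close> is a locally uniform limit of
  \<open>A (S e (duhamel f (t - e)))\<close>, which are continuous in \<open>t\<close>.\<close>

lemma A_duhamel_continuous:
  "continuous_on {0<..<T} (\<lambda>t. A (duhamel f t))"
  unfolding continuous_on_def
proof
  fix t assume t: "t \<in> {0<..<T}"
  show "((\<lambda>t. A (duhamel f t)) \<longlongrightarrow> A (duhamel f t)) (at t within {0<..<T})"
  proof (rule tendstoI)
    fix r :: real assume r: "r > 0"
    have lim: "((\<lambda>e. 2 * CA * C * sqrt e + norm (f t - S e (f t))) \<longlongrightarrow> 2 * CA * C * sqrt 0 + norm (f t - S 0 (f t))) (at_right 0)"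
    proof (intro tendsto_intros)
      show "((\<lambda>e. S e (f t)) \<longlongrightarrow> S 0 (f t)) (at_right 0)"
        using cont[of "f t"] unfolding continuous_on_def by (auto intro: tendsto_within_subset)
    qed
    have "\<forall>\<^sub>F e in at_right 0. 2 * CA * C * sqrt e + norm (f t - S e (f t)) < r/6"
      by (rule order_tendstoD[OF lim]) (use r in \<open>simp add: S_0\<close>)
    moreover have "\<forall>\<^sub>F e in at_right (0::real). 0 < e \<and> e < t"
      unfolding eventually_at_right_field using t by (intro exI[of _ t]) auto
    ultimately have "\<forall>\<^sub>F e in at_right 0. 2 * CA * C * sqrt e + norm (f t - S e (f t)) < r/6 \<and> 0 < e \<and> e < t"
      by eventually_elim auto
    then obtain e where e: "2 * CA * C * sqrt e + norm (f t - S e (f t)) < r/6" "0 < e" "e < t"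
      using eventually_happens'[OF trivial_limit_at_right_real] by blast
    have c1: "((\<lambda>s. A (S e (duhamel f (s - e)))) \<longlongrightarrow> A (S e (duhamel f (t - e)))) (at t within {0<..<T})"
    proof (rule bounded_linear.tendsto[OF bounded_linear_A_S[OF e(2)]])
      have "((\<lambda>s. s - e) \<longlongrightarrow> t - e) (at t within {0<..<T})" by (intro tendsto_intros)
      moreover have "\<forall>\<^sub>F s in at t within {0<..<T}. s > e"
        using e by (intro order_tendstoD(1)[OF tendsto_ident_at])
      then have "\<forall>\<^sub>F s in at t within {0<..<T}. s - e \<in> {0..}" by eventually_elim simp
      ultimately show "((\<lambda>s. duhamel f (s - e)) \<longlongrightarrow> duhamel f (t - e)) (at t within {0<..<T})"
        using e by (intro continuous_on_tendsto_compose[OF duhamel_continuous[OF f]]) auto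
    qed
    have "(f \<longlongrightarrow> f t) (at t within {0..})" using f t by (simp add: continuous_on_def)
    then have c2: "(f \<longlongrightarrow> f t) (at t within {0<..<T})" by (rule tendsto_within_subset) auto
    have "\<forall>\<^sub>F s in at t within {0<..<T}. dist (A (S e (duhamel f (s - e)))) (A (S e (duhamel f (t - e)))) < r/6"
      by (rule tendstoD[OF c1]) (use r in simp)
    moreover have "\<forall>\<^sub>F s in at t within {0<..<T}. dist (f s) (f t) < r/6"
      by (rule tendstoD[OF c2]) (use r in simp)
    moreover have "\<forall>\<^sub>F s in at t within {0<..<T}. s > e"
      using e by (intro order_tendstoD(1)[OF tendsto_ident_at])
    moreover have "\<forall>\<^sub>F s in at t within {0<..<T}. s \<in> {0<..<T}" by (simp add: eventually_at_filter)
    ultimately show "\<forall>\<^sub>F s in at t within {0<..<T}. dist (A (duhamel f s)) (A (duhamel f t)) < r"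
    proof eventually_elim
      fix s assume s1: "dist (A (S e (duhamel f (s - e)))) (A (S e (duhamel f (t - e)))) < r/6"
        and s2: "dist (f s) (f t) < r/6" and s3: "s > e" and s4: "s \<in> {0<..<T}"
      have a: "norm (A (duhamel f s) - A (S e (duhamel f (s - e)))) \<le> 2 * CA * C * sqrt e + norm (f s - S e (f s))"
        by (rule A_duhamel_approx) (use s3 s4 e in auto)
      have b: "norm (A (duhamel f t) - A (S e (duhamel f (t - e)))) \<le> 2 * CA * C * sqrt e + norm (f t - S e (f t))"
        by (rule A_duhamel_approx) (use t e in auto)
      have "f s - S e (f s) = (f s - f t) + ((f t - S e (f t)) - S e (f s - f t))"
        using e by (simp add: linear_diff[OF linear_S])
      moreover have "norm ((f s - f t) + ((f t - S e (f t)) - S e (f s - f t)))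
          \<le> norm (f s - f t) + (norm (f t - S e (f t)) + norm (S e (f s - f t)))"
        by (intro norm_triangle_le add_left_mono norm_triangle_ineq4)
      ultimately have "norm (f s - S e (f s)) \<le> norm (f s - f t) + (norm (f t - S e (f t)) + norm (S e (f s - f t)))"
        by (simp only:)
      moreover have "norm (S e (f s - f t)) \<le> norm (f s - f t)" using e by (intro norm_S) simp
      ultimately have c: "norm (f s - S e (f s)) \<le> 2 * norm (f s - f t) + norm (f t - S e (f t))" by linarith
      have "A (duhamel f s) - A (duhamel f t) = (A (duhamel f s) - A (S e (duhamel f (s - e))))
          + (A (S e (duhamel f (s - e))) - A (S e (duhamel f (t - e)))) - (A (duhamel f t) - A (S e (duhamel f (t - e))))"
        by simp
      then have "norm (A (duhamel f s) - A (duhamel f t)) \<le> norm (A (duhamel f s) - A (S e (duhamel f (s - e))))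
          + norm (A (S e (duhamel f (s - e))) - A (S e (duhamel f (t - e)))) + norm (A (duhamel f t) - A (S e (duhamel f (t - e))))"
        by (metis norm_triangle_ineq norm_triangle_le_diff add_right_mono)
      then show "dist (A (duhamel f s)) (A (duhamel f t)) < r"
        using a b c e(1) s1 s2 r unfolding dist_norm by linarith
    qed
  qed
qed

end

text \<open>The increment over the first time step is estimated by \<open>S_sqrt_continuity\<close>, where the initial
  value in \<open>V\<close> enters; Gronwall's inequality for \<open>w (h + t) - w t\<close> transports it to later times.\<close>

lemma mild_holder:
  assumes w: "continuous_on {0..} w"
    and mild: "\<And>t. t \<ge> 0 \<Longrightarrow> w t = S t x + duhamel (\<lambda>s. N (w s)) t"
    and shift: "\<And>t h. t \<ge> 0 \<Longrightarrow> h \<ge> 0 \<Longrightarrow> w (t + h) = S h (w t) + duhamel (\<lambda>s. N (w (t + s))) h"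
    and L: "L > 0" and Lip: "\<And>x y. norm (N x - N y) \<le> L * norm (x - y)"
    and cN: "continuous_on {0..} (\<lambda>s. N (w s))"
    and x: "x \<in> V" and T: "T > 0"
  shows "\<exists>K\<ge>0. \<forall>s t. 0 \<le> s \<longrightarrow> s \<le> t \<longrightarrow> t \<le> T \<longrightarrow> norm (w s - w t) \<le> K * sqrt (t - s)"
proof -
  have "bounded ((\<lambda>s. N (w s)) ` {0..T})"
    by (intro compact_imp_bounded compact_continuous_image continuous_on_subset[OF cN]) auto
  then obtain F where F: "F > 0" "\<And>s. 0 \<le> s \<Longrightarrow> s \<le> T \<Longrightarrow> norm (N (w s)) \<le> F"
    unfolding bounded_pos by auto
  define k where "k = sqrt (CV * ((norm x)\<^sup>2 + (norm (D x))\<^sup>2)) + F * sqrt T"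
  have CV0: "CV \<ge> 0" using q by (simp add: CV_def)
  have k0: "k \<ge> 0" unfolding k_def using CV0 F(1) T by (intro add_nonneg_nonneg) auto
  have start: "norm (w h - w 0) \<le> k * sqrt h" if h: "0 \<le> h" "h \<le> T" for h
  proof -
    have w0: "w 0 = x" using mild[of 0] by (simp add: S_0 duhamel_def)
    have "w h - w 0 = (S h x - x) + duhamel (\<lambda>s. N (w s)) h"
      using mild[OF h(1)] unfolding w0 by (simp add: algebra_simps)
    then have "norm (w h - w 0) \<le> norm (S h x - x) + norm (duhamel (\<lambda>s. N (w s)) h)"
      by (simp only: norm_triangle_ineq)
    moreover have "norm (S h x - x) \<le> sqrt (CV * ((norm x)\<^sup>2 + (norm (D x))\<^sup>2)) * sqrt h"
      using S_sqrt_continuity[OF x h(1)] by (simp add: real_le_rsqrt flip: real_sqrt_mult)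
    moreover have "norm (duhamel (\<lambda>s. N (w s)) h) \<le> F * h"
      using h F by (intro duhamel_le_const cN) auto
    moreover have "F * h \<le> F * sqrt T * sqrt h"
    proof -
      have "h = sqrt h * sqrt h" using h by simp
      also have "\<dots> \<le> sqrt T * sqrt h" using h by (intro mult_right_mono) auto
      finally show ?thesis using F(1) by (simp add: mult.assoc)
    qed
    ultimately show ?thesis by (simp add: k_def algebra_simps)
  qed
  have "norm (w (t + h) - w t) \<le> k * exp (L * T) * sqrt h" if th: "0 \<le> t" "0 \<le> h" "t + h \<le> T" for t h
  proof -
    define p where "p t = norm (w (h + t) - w t)" for t
    have cs: "continuous_on {0..} (\<lambda>s. N (w (h + s)))" by (rule continuous_on_shift[OF cN th(2)])
    have cp: "continuous_on {0..} p" unfolding p_def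
      by (intro continuous_intros continuous_on_shift[OF w th(2)] w)
    have "p t \<le> k * sqrt h * exp (L * t)"
    proof (rule gronwall_integral[OF cp less_imp_le[OF L] _ th(1)])
      fix t :: real assume t: "0 \<le> t"
      have "w (h + t) - w t = S t (w h - w 0) + duhamel (\<lambda>s. N (w (h + s)) - N (w s)) t"
        using shift[OF th(2) t] mild[OF t] mild[of 0] duhamel_diff[OF cs cN t] t
        by (simp add: S_0 duhamel_def linear_diff[OF linear_S] algebra_simps)
      then have "p t \<le> norm (S t (w h - w 0)) + norm (duhamel (\<lambda>s. N (w (h + s)) - N (w s)) t)"
        unfolding p_def by (metis norm_triangle_ineq)
      moreover have "norm (S t (w h - w 0)) \<le> k * sqrt h"
        using norm_S[OF t, of "w h - w 0"] start[of h] th by linarith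
      moreover have "norm (duhamel (\<lambda>s. N (w (h + s)) - N (w s)) t) \<le> integral {0..t} (\<lambda>s. L * p s)"
        using t Lip by (intro duhamel_norm_le continuous_intros cs cN continuous_on_subset[OF cp]) (auto simp: p_def)
      ultimately show "p t \<le> k * sqrt h + L * integral {0..t} p" by simp
    qed
    also have "\<dots> \<le> k * sqrt h * exp (L * T)" using k0 th L by (intro mult_left_mono) auto
    finally show ?thesis by (simp add: p_def algebra_simps)
  qed
  note * = this
  have "norm (w s - w t) \<le> k * exp (L * T) * sqrt (t - s)" if "0 \<le> s" "s \<le> t" "t \<le> T" for s t
    using *[of s "t - s"] that by (simp add: norm_minus_commute)
  then show ?thesis using k0 by (intro exI[of _ "k * exp (L * T)"]) auto
qed

text \<open>Interpolation: \<open>\<parallel>D y\<parallel>\<^sup>2 \<le> \<langle>A y, y\<rangle> \<le> \<parallel>A y\<parallel> \<parallel>y\<parallel>\<close>.\<close>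

lemma tendsto_D_if_A_bounded:
  assumes ev: "eventually (\<lambda>s. v s \<in> dA \<and> norm (A (v s)) \<le> K) F" and v: "(v \<longlongrightarrow> 0) F"
  shows "((\<lambda>s. D (v s)) \<longlongrightarrow> 0) F"
proof (rule Lim_null_comparison)
  show "\<forall>\<^sub>F s in F. norm (D (v s)) \<le> sqrt (K * norm (v s))"
    using ev
  proof eventually_elim
    fix s assume s: "v s \<in> dA \<and> norm (A (v s)) \<le> K"
    have "(norm (D (v s)))\<^sup>2 \<le> inner (A (v s)) (v s)" using A_coercive[of "v s"] s by (smt (verit) zero_le_power2)
    also have "\<dots> \<le> norm (A (v s)) * norm (v s)" by (rule norm_cauchy_schwarz)
    also have "\<dots> \<le> K * norm (v s)" using s by (intro mult_right_mono) auto
    finally show "norm (D (v s)) \<le> sqrt (K * norm (v s))" by (rule real_le_rsqrt)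
  qed
  have "((\<lambda>s. sqrt (K * norm (v s))) \<longlongrightarrow> sqrt (K * norm (0::'a))) F" by (intro tendsto_intros v)
  then show "((\<lambda>s. sqrt (K * norm (v s))) \<longlongrightarrow> 0) F" by simp
qed

text \<open>The mild solution is Hoelder continuous in time, and so is its nonlinear term; hence \<open>A\<close> applied
  to the Duhamel integral is continuous, which gives the equation for \<open>t > 0\<close>. Continuity of \<open>D w\<close>
  at \<open>0\<close> combines \<open>S_tendsto_V\<close> with the boundedness of \<open>A (duhamel f t)\<close> as \<open>t\<close> tends to \<open>0\<close>.\<close>

lemma strong_solution_exists:
  assumes N0: "N 0 = 0" and L: "L > 0" and Lip: "\<And>x y. norm (N x - N y) \<le> L * norm (x - y)"
    and x: "x \<in> V"
  obtains w where "w 0 = x" "continuous_on {0..} w" "\<And>t. t \<ge> 0 \<Longrightarrow> w t \<in> V" "continuous_on {0..} (\<lambda>t. D (w t))"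
    "\<And>t. t > 0 \<Longrightarrow> w t \<in> dA" "continuous_on {0<..} (\<lambda>t. A (w t))"
    "\<And>t. t > 0 \<Longrightarrow> (w has_vector_derivative N (w t) - A (w t)) (at t)"
proof -
  from mild_solution_exists[OF N0 L Lip, of x] obtain w where w: "continuous_on {0..} w"
    and mild: "\<And>t. t \<ge> 0 \<Longrightarrow> w t = S t x + duhamel (\<lambda>s. N (w s)) t" by (elim exE conjE) blast
  define f where "f s = N (w s)" for s
  have contN: "continuous_on UNIV N"
    using Lip by (intro lipschitz_on_continuous_on[of L]) (auto simp: lipschitz_on_def dist_norm L[THEN less_imp_le])
  have f: "continuous_on {0..} f" unfolding f_def
    by (rule continuous_on_compose2[OF contN w]) auto
  have w0: "w 0 = x" using mild[of 0] by (simp add: S_0 duhamel_def)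
  have shift: "w (t + h) = S h (w t) + duhamel (\<lambda>s. f (t + s)) h" if "t \<ge> 0" "h \<ge> 0" for t h
    using mild[of "t + h"] mild[of t] that duhamel_shift[OF f that(2,1)] S_semigroup[OF that(2,1), of x]
    unfolding f_def by (simp add: linear_add[OF linear_S] add.commute)
  have hol: "\<exists>K\<ge>0. \<forall>s t. 0 \<le> s \<longrightarrow> s \<le> t \<longrightarrow> t \<le> T \<longrightarrow> norm (f s - f t) \<le> K * sqrt (t - s)" if T: "T > 0" for T
  proof -
    obtain K where K: "K \<ge> 0" "\<And>s t. 0 \<le> s \<Longrightarrow> s \<le> t \<Longrightarrow> t \<le> T \<Longrightarrow> norm (w s - w t) \<le> K * sqrt (t - s)"
      using mild_holder[OF w mild shift[unfolded f_def] L Lip f[unfolded f_def] x T] by blast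
    have "norm (f s - f t) \<le> L * K * sqrt (t - s)" if "0 \<le> s" "s \<le> t" "t \<le> T" for s t
    proof -
      have "norm (f s - f t) \<le> L * norm (w s - w t)" unfolding f_def by (rule Lip)
      also have "\<dots> \<le> L * (K * sqrt (t - s))" using K(2)[OF that] L by (intro mult_left_mono) auto
      finally show ?thesis by (simp add: mult.assoc)
    qed
    then show ?thesis using K(1) L by (intro exI[of _ "L * K"]) auto
  qed
  have domv: "duhamel f t \<in> dA" if "t > 0" for t
    using hol[OF that] duhamel_in[OF f] that by (metis order_refl)
  have dom: "w t \<in> dA" if "t > 0" for t
    using mild[of t] that domv[OF that] smoothing[OF that] unfolding f_def[symmetric]
    by (simp add: subspace_add[OF dA_subspace])
  have Aw: "A (w t) = A (S t x) + A (duhamel f t)" if "t > 0" for t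
    using mild[of t] that A_add[OF smoothing[OF that] domv[OF that], of x] unfolding f_def[symmetric] by simp
  have cAS: "continuous_on {a<..} (\<lambda>t. A (S t x))" if a: "a > 0" for a
  proof -
    have "continuous_on {a<..} (\<lambda>t. S (t - a) (A (S a x)))"
      by (intro continuous_on_S continuous_intros) auto
    then show ?thesis
    proof (rule continuous_on_eq)
      fix t assume t: "t \<in> {a<..}"
      then show "S (t - a) (A (S a x)) = A (S t x)"
        using A_S[OF smoothing[OF a], of "t - a" x] S_semigroup[of "t - a" a x] a by simp
    qed
  qed
  have cA: "continuous_on {0<..} (\<lambda>t. A (w t))"
  proof (rule continuous_at_imp_continuous_on, rule ballI)
    fix t :: real assume t: "t \<in> {0<..}"
    obtain K where "K \<ge> 0" "\<And>s r. 0 \<le> s \<Longrightarrow> s \<le> r \<Longrightarrow> r \<le> t + 1 \<Longrightarrow> norm (f s - f r) \<le> K * sqrt (r - s)"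
      using hol[of "t + 1"] t by auto
    then have "continuous_on {0<..<t + 1} (\<lambda>t. A (duhamel f t))" by (rule A_duhamel_continuous[OF f])
    moreover have "continuous_on {t/2<..} (\<lambda>t. A (S t x))" using t by (intro cAS) simp
    ultimately have "continuous_on {t/2<..<t+1} (\<lambda>t. A (S t x) + A (duhamel f t))"
      using t by (intro continuous_on_add) (auto elim: continuous_on_subset)
    then have "continuous_on {t/2<..<t+1} (\<lambda>t. A (w t))"
      by (rule continuous_on_eq) (use t Aw in auto)
    then show "isCont (\<lambda>t. A (w t)) t"
      using t by (subst (asm) continuous_on_eq_continuous_at) auto
  qed
  have der: "(w has_vector_derivative N (w t) - A (w t)) (at t)" if "t > 0" for t
    using mild_differentiable[OF f shift dom cA that] by (simp add: f_def)
  have wV: "w t \<in> V" if "t \<ge> 0" for t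
    using dom[of t] dA_V x w0 that by (cases "t = 0") auto
  have cD: "continuous_on {0..} (\<lambda>t. D (w t))"
    unfolding continuous_on_def
  proof
    fix t :: real assume t: "t \<in> {0..}"
    show "((\<lambda>t. D (w t)) \<longlongrightarrow> D (w t)) (at t within {0..})"
    proof (cases "t = 0")
      case False
      then have t0: "t > 0" using t by simp
      have c1: "((\<lambda>s. A (w s)) \<longlongrightarrow> A (w t)) (at t)"
        using cA t0 by (simp add: continuous_on_eq_continuous_at isCont_def)
      have c2: "(w \<longlongrightarrow> w t) (at t)"
        using has_vector_derivative_continuous[OF der[OF t0]] by (simp add: isCont_def)
      have pos: "\<forall>\<^sub>F s in at t. s > 0" using t0 order_tendstoD(1)[OF tendsto_ident_at t0] by simp
      have "((\<lambda>s. norm (A (w s) - A (w t))) \<longlongrightarrow> norm (A (w t) - A (w t))) (at t)" by (intro tendsto_intros c1)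
      then have "\<forall>\<^sub>F s in at t. norm (A (w s) - A (w t)) < 1" by (rule order_tendstoD) simp
      with pos have ev: "\<forall>\<^sub>F s in at t. w s - w t \<in> dA \<and> norm (A (w s - w t)) \<le> 1"
        by eventually_elim (use dom t0 in \<open>auto simp: A_diff subspace_diff[OF dA_subspace]\<close>)
      have "((\<lambda>s. w s - w t) \<longlongrightarrow> 0) (at t)" using c2 by (rule LIM_zero)
      from tendsto_D_if_A_bounded[OF ev this] have l: "((\<lambda>s. D (w s - w t)) \<longlongrightarrow> 0) (at t)" .
      have "\<forall>\<^sub>F s in at t. D (w s - w t) = D (w s) - D (w t)"
        using pos by eventually_elim (use t0 in \<open>simp add: D_diff wV\<close>)
      then have "((\<lambda>s. D (w s) - D (w t)) \<longlongrightarrow> 0) (at t)" using l by (rule Lim_transform_eventually[rotated])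
      then have "((\<lambda>s. D (w s)) \<longlongrightarrow> D (w t)) (at t)" by (rule LIM_zero_cancel)
      then show ?thesis by (rule tendsto_within_subset) simp
    next
      case True
      obtain K where K: "K \<ge> 0" "\<And>s r. 0 \<le> s \<Longrightarrow> s \<le> r \<Longrightarrow> r \<le> 1 \<Longrightarrow> norm (f s - f r) \<le> K * sqrt (r - s)"
        using hol[of 1] by auto
      have "bounded (f ` {0..1})"
        by (intro compact_imp_bounded compact_continuous_image continuous_on_subset[OF f]) auto
      then obtain F where F: "\<And>s. 0 \<le> s \<Longrightarrow> s \<le> 1 \<Longrightarrow> norm (f s) \<le> F"
        unfolding bounded_pos by (metis atLeastAtMost_iff imageI)
      have ev1: "\<forall>\<^sub>F s in at_right (0::real). 0 < s \<and> s \<le> 1"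
        unfolding eventually_at_right_field by (intro exI[of _ 1]) auto
      have ev: "\<forall>\<^sub>F s in at_right 0. duhamel f s \<in> dA \<and> norm (A (duhamel f s)) \<le> 2 * CA * K + 2 * F"
        using ev1
      proof eventually_elim
        fix s :: real assume s: "0 < s \<and> s \<le> 1"
        have "norm (A (duhamel f s)) \<le> 2 * CA * K * sqrt s + 2 * norm (f s)"
          using s by (intro norm_A_duhamel[OF f K]) auto
        also have "\<dots> \<le> 2 * CA * K * 1 + 2 * F"
          using s F[of s] CA K(1) by (intro add_mono mult_left_mono) auto
        finally show "duhamel f s \<in> dA \<and> norm (A (duhamel f s)) \<le> 2 * CA * K + 2 * F" using domv s by simp
      qed
      have "(duhamel f \<longlongrightarrow> duhamel f 0) (at 0 within {0..})"
        using duhamel_continuous[OF f] by (simp add: continuous_on_def)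
      then have "(duhamel f \<longlongrightarrow> 0) (at_right 0)"
        by (auto simp: duhamel_def intro: tendsto_within_subset)
      from tendsto_add[OF S_tendsto_V[OF x] tendsto_D_if_A_bounded[OF ev this]]
      have l: "((\<lambda>s. D (S s x) + D (duhamel f s)) \<longlongrightarrow> D x) (at_right 0)" by simp
      have "\<forall>\<^sub>F s in at_right 0. D (S s x) + D (duhamel f s) = D (w s)"
        using ev1 by eventually_elim
          (use mild domv dA_V x in \<open>simp add: f_def[symmetric] D_add S_in_V\<close>)
      then have "((\<lambda>s. D (w s)) \<longlongrightarrow> D x) (at_right 0)" using l by (rule Lim_transform_eventually[rotated])
      moreover have "at 0 within {0..} = at_right (0::real)"
        by (metis at_within_Ici_at_right)
      ultimately show ?thesis using True w0 by simp
    qed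
  qed
  show ?thesis using that[OF w0 w wV cD dom cA der] by blast
qed

end


section \<open>The Hilbert space of square integrable functions\<close>

lemma L2_measurable [measurable_dest]: "f \<in> L2 \<Longrightarrow> f \<in> borel_measurable half_line"
  and L2_integrable: "f \<in> L2 \<Longrightarrow> integrable half_line (\<lambda>z. (f z)\<^sup>2)"
  by (auto simp: L2_def)

lemma L2_mult_integrable:
  assumes f: "f \<in> L2" and g: "g \<in> L2"
  shows "integrable half_line (\<lambda>z. f z * g z)"
proof (rule Bochner_Integration.integrable_bound)
  show "integrable half_line (\<lambda>z. (f z)\<^sup>2 + (g z)\<^sup>2)" using f g by (intro Bochner_Integration.integrable_add L2_integrable)
  show "(\<lambda>z. f z * g z) \<in> borel_measurable half_line" using f g by measurable
  have "\<bar>a * b\<bar> \<le> a\<^sup>2 + b\<^sup>2" for a b :: real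
  proof -
    have "2 * (\<bar>a\<bar> * \<bar>b\<bar>) \<le> a\<^sup>2 + b\<^sup>2" using sum_squares_bound[of "\<bar>a\<bar>" "\<bar>b\<bar>"] by (simp add: mult.assoc)
    moreover have "0 \<le> \<bar>a\<bar> * \<bar>b\<bar>" by simp
    ultimately show ?thesis unfolding abs_mult by linarith
  qed
  then show "AE z in half_line. norm (f z * g z) \<le> norm ((f z)\<^sup>2 + (g z)\<^sup>2)" by simp
qed

lemma L2_add: assumes f: "f \<in> L2" and g: "g \<in> L2" shows "(\<lambda>z. f z + g z) \<in> L2"
proof -
  have "integrable half_line (\<lambda>z. (f z)\<^sup>2 + (g z)\<^sup>2 + 2 * (f z * g z))"
    using f g by (intro Bochner_Integration.integrable_add L2_integrable L2_mult_integrable Bochner_Integration.integrable_mult_right) auto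
  then show ?thesis using f g by (simp add: L2_def power2_sum mult.assoc borel_measurable_add)
qed

lemma L2_scale: assumes f: "f \<in> L2" shows "(\<lambda>z. r * f z) \<in> L2"
  using f by (simp add: L2_def power_mult_distrib borel_measurable_times)

lemma L2_minus: assumes f: "f \<in> L2" shows "(\<lambda>z. - f z) \<in> L2"
  using L2_scale[OF f, of "-1"] by simp

lemma L2_diff: assumes f: "f \<in> L2" and g: "g \<in> L2" shows "(\<lambda>z. f z - g z) \<in> L2"
  using L2_add[OF f L2_minus[OF g]] by simp

lemma L2_zero: "(\<lambda>_. 0) \<in> L2" by (simp add: L2_def)

lemma L2_cong_AE:
  assumes f: "f \<in> L2" and g: "g \<in> borel_measurable half_line" and eq: "AE z in half_line. f z = g z"
  shows "g \<in> L2"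
proof -
  have "integrable half_line (\<lambda>z. (g z)\<^sup>2)"
    by (rule integrable_cong_AE_imp[OF L2_integrable[OF f]]) (use g eq in auto)
  then show ?thesis using g by (simp add: L2_def)
qed

lemma L2_dominated:
  assumes g: "g \<in> L2" and f: "f \<in> borel_measurable half_line" and le: "AE z in half_line. \<bar>f z\<bar> \<le> K * \<bar>g z\<bar>"
  shows "f \<in> L2"
proof -
  have "integrable half_line (\<lambda>z. (f z)\<^sup>2)"
  proof (rule Bochner_Integration.integrable_bound)
    show "integrable half_line (\<lambda>z. (K * g z)\<^sup>2)" using L2_integrable[OF L2_scale[OF g]] .
    show "AE z in half_line. norm ((f z)\<^sup>2) \<le> norm ((K * g z)\<^sup>2)"
      using le
    proof eventually_elim
      fix z assume a: "\<bar>f z\<bar> \<le> K * \<bar>g z\<bar>"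
      then have "\<bar>f z\<bar> \<le> \<bar>K * g z\<bar>" by (metis abs_ge_self abs_mult abs_abs order_trans mult_right_mono abs_ge_zero)
      then show "norm ((f z)\<^sup>2) \<le> norm ((K * g z)\<^sup>2)" by (simp add: abs_le_square_iff)
    qed
  qed (use f in measurable)
  then show ?thesis using f by (simp add: L2_def)
qed

definition L2_eq :: "(real \<Rightarrow> real) \<Rightarrow> (real \<Rightarrow> real) \<Rightarrow> bool" where
  "L2_eq f g \<longleftrightarrow> f \<in> L2 \<and> g \<in> L2 \<and> (AE z in half_line. f z = g z)"

text \<open>The semigroup theory above lives on types of class \<open>{real_inner, banach}\<close>, so square integrable
  functions modulo null sets are made into such a type. The quotient is partial: functions outside
  \<open>L2\<close> belong to no class.\<close>

quotient_type L2h = "real \<Rightarrow> real" / partial: L2_eq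
proof (rule part_equivpI)
  show "\<exists>x. L2_eq x x" by (rule exI[of _ "\<lambda>_. 0"]) (simp add: L2_eq_def L2_zero)
  show "symp L2_eq" by (auto simp: symp_def L2_eq_def)
  show "transp L2_eq" unfolding transp_def L2_eq_def by auto
qed

abbreviation rep :: "L2h \<Rightarrow> real \<Rightarrow> real" where "rep \<equiv> rep_L2h"
abbreviation cls :: "(real \<Rightarrow> real) \<Rightarrow> L2h" where "cls \<equiv> abs_L2h"

lemma rep_in [simp, intro]: "rep x \<in> L2"
  using Quotient3_rep_reflp[OF Quotient3_L2h, of x] by (simp add: L2_eq_def)

lemma rep_measurable [measurable]: "rep x \<in> borel_measurable half_line"
  by (rule L2_measurable[OF rep_in])

lemma cls_rep [simp]: "cls (rep x) = x"
  by (rule Quotient3_abs_rep[OF Quotient3_L2h])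

lemma cls_eqI:
  assumes "f \<in> L2" "g \<in> L2" "AE z in half_line. f z = g z" shows "cls f = cls g"
  using Quotient3_rel_abs[OF Quotient3_L2h, of f g] assms by (simp add: L2_eq_def)

lemma rep_cls:
  assumes "f \<in> L2" shows "AE z in half_line. rep (cls f) z = f z"
  using rep_abs_rsp_left[OF Quotient3_L2h, of f f] assms by (simp add: L2_eq_def)

lemma L2h_eqI: assumes "AE z in half_line. rep x z = rep y z" shows "x = y"
  using cls_eqI[OF rep_in rep_in assms] by simp

instantiation L2h :: real_inner
begin

definition "0 = cls (\<lambda>_. 0)"
definition "x + y = cls (\<lambda>z. rep x z + rep y z)"
definition "- x = cls (\<lambda>z. - rep x z)"
definition "x - y = x + - (y :: L2h)"
definition "r *\<^sub>R x = cls (\<lambda>z. r * rep x z)"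
definition "inner x y = integral\<^sup>L half_line (\<lambda>z. rep x z * rep y z)"
definition "norm (x :: L2h) = sqrt (inner x x)"
definition "sgn (x :: L2h) = inverse (norm x) *\<^sub>R x"
definition "dist (x :: L2h) y = norm (x - y)"
definition uniformity_L2h :: "(L2h \<times> L2h) filter" where
  "uniformity = (INF e\<in>{0 <..}. principal {(x, y :: L2h). dist x y < e})"
definition open_L2h :: "L2h set \<Rightarrow> bool" where
  "open_L2h U \<longleftrightarrow> (\<forall>x\<in>U. eventually (\<lambda>(x', y). x' = x \<longrightarrow> y \<in> U) uniformity)"

lemma rep_0: "AE z in half_line. rep 0 z = 0"
  unfolding zero_L2h_def by (rule rep_cls[OF L2_zero])

lemma rep_add: "AE z in half_line. rep (x + y) z = rep x z + rep y z"
  unfolding plus_L2h_def by (intro rep_cls L2_add rep_in)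

lemma rep_uminus: "AE z in half_line. rep (- x) z = - rep x z"
  unfolding uminus_L2h_def by (intro rep_cls L2_minus rep_in)

lemma rep_scaleR: "AE z in half_line. rep (r *\<^sub>R x) z = r * rep x z"
  unfolding scaleR_L2h_def by (intro rep_cls L2_scale rep_in)

lemma inner_cong:
  assumes "AE z in half_line. rep x z * rep y z = g z" "g \<in> borel_measurable half_line"
  shows "inner x y = integral\<^sup>L half_line g"
  unfolding inner_L2h_def by (rule integral_cong_AE) (use assms in measurable)

instance
proof
  fix x y z :: L2h and r s :: real
  show "dist x y = norm (x - y)" "sgn x = inverse (norm x) *\<^sub>R x" "norm x = sqrt (inner x x)" "x - y = x + - y"
    by (simp_all add: dist_L2h_def sgn_L2h_def norm_L2h_def minus_L2h_def)
  show "uniformity = (INF e\<in>{0 <..}. principal {(x, y :: L2h). dist x y < e})" by (rule uniformity_L2h_def)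
  show "open U \<longleftrightarrow> (\<forall>x\<in>U. eventually (\<lambda>(x', y). x' = x \<longrightarrow> y \<in> U) uniformity)" for U :: "L2h set"
    by (rule open_L2h_def)
  show "x + y + z = x + (y + z)"
  proof (rule L2h_eqI)
    show "AE t in half_line. rep (x + y + z) t = rep (x + (y + z)) t"
      using rep_add[of "x + y" z] rep_add[of x y] rep_add[of x "y + z"] rep_add[of y z]
      by eventually_elim simp
  qed
  show "x + y = y + x"
    by (rule L2h_eqI) (use rep_add[of x y] rep_add[of y x] in \<open>eventually_elim, simp\<close>)
  show "0 + x = x"
    by (rule L2h_eqI) (use rep_add[of 0 x] rep_0 in \<open>eventually_elim, simp\<close>)
  show "- x + x = 0"
    by (rule L2h_eqI) (use rep_add[of "- x" x] rep_0 rep_uminus[of x] in \<open>eventually_elim, simp\<close>)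
  show "r *\<^sub>R (x + y) = r *\<^sub>R x + r *\<^sub>R y"
    by (rule L2h_eqI) (use rep_add[of x y] rep_scaleR[of r "x + y"] rep_add[of "r *\<^sub>R x" "r *\<^sub>R y"] rep_scaleR[of r x] rep_scaleR[of r y]
      in \<open>eventually_elim, simp add: algebra_simps\<close>)
  show "(r + s) *\<^sub>R x = r *\<^sub>R x + s *\<^sub>R x"
    by (rule L2h_eqI) (use rep_scaleR[of "r + s" x] rep_add[of "r *\<^sub>R x" "s *\<^sub>R x"] rep_scaleR[of r x] rep_scaleR[of s x]
      in \<open>eventually_elim, simp add: algebra_simps\<close>)
  show "r *\<^sub>R s *\<^sub>R x = (r * s) *\<^sub>R x"
    by (rule L2h_eqI) (use rep_scaleR[of r "s *\<^sub>R x"] rep_scaleR[of s x] rep_scaleR[of "r * s" x]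
      in \<open>eventually_elim, simp add: algebra_simps\<close>)
  show "1 *\<^sub>R x = x"
    by (rule L2h_eqI) (use rep_scaleR[of 1 x] in \<open>eventually_elim, simp\<close>)
  show "inner x y = inner y x" by (simp add: inner_L2h_def mult.commute)
  have "inner (x + y) z = integral\<^sup>L half_line (\<lambda>t. rep x t * rep z t + rep y t * rep z t)"
  proof (rule inner_cong)
    show "AE t in half_line. rep (x + y) t * rep z t = rep x t * rep z t + rep y t * rep z t"
      using rep_add[of x y] by eventually_elim (simp add: algebra_simps)
  qed measurable
  then show "inner (x + y) z = inner x z + inner y z"
    by (simp add: inner_L2h_def L2_mult_integrable)
  have "inner (r *\<^sub>R x) y = integral\<^sup>L half_line (\<lambda>t. r * (rep x t * rep y t))"
  proof (rule inner_cong)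
    show "AE t in half_line. rep (r *\<^sub>R x) t * rep y t = r * (rep x t * rep y t)"
      using rep_scaleR[of r x] by eventually_elim simp
  qed measurable
  then show "inner (r *\<^sub>R x) y = r * inner x y" by (simp add: inner_L2h_def)
  show "0 \<le> inner x x" by (simp add: inner_L2h_def)
  show "inner x x = 0 \<longleftrightarrow> x = 0"
  proof -
    have "inner x x = 0 \<longleftrightarrow> (AE t in half_line. rep x t * rep x t = 0)"
      unfolding inner_L2h_def by (rule integral_nonneg_eq_0_iff_AE) (auto intro: L2_mult_integrable)
    also have "\<dots> \<longleftrightarrow> (AE t in half_line. rep x t = 0)" by simp
    also have "\<dots> \<longleftrightarrow> x = 0"
    proof
      assume "AE t in half_line. rep x t = 0"
      then have "AE t in half_line. rep x t = rep 0 t" using rep_0 by eventually_elim simp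
      then show "x = 0" by (rule L2h_eqI)
    qed (use rep_0 in simp)
    finally show ?thesis .
  qed
qed

end

lemma rep_diff: "AE z in half_line. rep (x - y) z = rep x z - rep y z"
  unfolding minus_L2h_def using rep_add[of x "- y"] rep_uminus[of y] by eventually_elim simp

lemma cls_add:
  assumes f: "f \<in> L2" and g: "g \<in> L2"
  shows "cls (\<lambda>z. f z + g z) = cls f + cls g"
  by (rule L2h_eqI) (use rep_cls[OF f] rep_cls[OF g] rep_cls[OF L2_add[OF f g]] rep_add[of "cls f" "cls g"]
     in \<open>eventually_elim, simp\<close>)

lemma cls_diff:
  assumes f: "f \<in> L2" and g: "g \<in> L2"
  shows "cls (\<lambda>z. f z - g z) = cls f - cls g"
  by (rule L2h_eqI) (use rep_cls[OF f] rep_cls[OF g] rep_cls[OF L2_diff[OF f g]] rep_diff[of "cls f" "cls g"]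
     in \<open>eventually_elim, simp\<close>)

lemma cls_scale:
  assumes f: "f \<in> L2"
  shows "cls (\<lambda>z. r * f z) = r *\<^sub>R cls f"
  by (rule L2h_eqI) (use rep_cls[OF f] rep_cls[OF L2_scale[OF f]] rep_scaleR[of r "cls f"]
     in \<open>eventually_elim, simp\<close>)

lemma inner_cls:
  assumes "f \<in> L2" "g \<in> L2" shows "inner (cls f) (cls g) = integral\<^sup>L half_line (\<lambda>z. f z * g z)"
proof (rule inner_cong)
  show "AE z in half_line. rep (cls f) z * rep (cls g) z = f z * g z"
    using rep_cls[OF assms(1)] rep_cls[OF assms(2)] by eventually_elim simp
qed (use assms in measurable)

lemma norm_cls: assumes f: "f \<in> L2" shows "norm (cls f) = L2_norm f"
  unfolding norm_eq_sqrt_inner L2_norm_def inner_cls[OF f f] power2_eq_square ..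

lemma nn_integral_L2:
  assumes "f \<in> L2" shows "(\<integral>\<^sup>+ z. ennreal ((f z)\<^sup>2) \<partial>half_line) = ennreal ((norm (cls f))\<^sup>2)"
proof -
  have "(norm (cls f))\<^sup>2 = integral\<^sup>L half_line (\<lambda>z. (f z)\<^sup>2)"
    by (simp only: power2_norm_eq_inner inner_cls[OF assms assms]) (simp add: power2_eq_square)
  then show ?thesis using assms by (simp add: nn_integral_eq_integral L2_integrable)
qed

text \<open>The pointwise part of the Riesz-Fischer theorem: the weights \<open>2 ^ n\<close> keep
  \<open>\<Sum>n. 2 ^ n (f (Suc n) z - f n z)\<^sup>2\<close> integrable, and its finiteness at a point makes the increments
  there summable.\<close>

lemma fast_Cauchy_converges_AE:
  assumes f: "\<And>n. f n \<in> L2" and le: "\<And>n. norm (cls (f (Suc n)) - cls (f n)) \<le> (1/2) ^ n"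
  shows "AE z in half_line. convergent (\<lambda>n. f n z)"
proof -
  define d where "d n z = f (Suc n) z - f n z" for n z
  have dL: "d n \<in> L2" for n unfolding d_def by (intro L2_diff f)
  have [measurable]: "d n \<in> borel_measurable half_line" for n by (rule L2_measurable[OF dL])
  have nd: "(\<integral>\<^sup>+ z. ennreal (2 ^ n * (d n z)\<^sup>2) \<partial>half_line) \<le> ennreal ((1/2) ^ n)" for n
  proof -
    have "cls (d n) = cls (f (Suc n)) - cls (f n)" unfolding d_def by (intro cls_diff f)
    then have "(norm (cls (d n)))\<^sup>2 \<le> ((1/2) ^ n)\<^sup>2" using le[of n] by (intro power_mono) auto
    then have "2 ^ n * (norm (cls (d n)))\<^sup>2 \<le> 2 ^ n * ((1/2) ^ n)\<^sup>2" by (intro mult_left_mono) auto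
    also have "\<dots> = (1/2) ^ n" by (simp add: power2_eq_square power_one_over)
    finally have "2 ^ n * (norm (cls (d n)))\<^sup>2 \<le> (1/2) ^ n" .
    moreover have "(\<integral>\<^sup>+ z. ennreal (2 ^ n * (d n z)\<^sup>2) \<partial>half_line) = ennreal (2 ^ n * (norm (cls (d n)))\<^sup>2)"
      by (simp add: ennreal_mult' nn_integral_cmult nn_integral_L2[OF dL])
    ultimately show ?thesis by (simp add: ennreal_leI)
  qed
  have "(\<integral>\<^sup>+ z. (\<Sum>n. ennreal (2 ^ n * (d n z)\<^sup>2)) \<partial>half_line) = (\<Sum>n. \<integral>\<^sup>+ z. ennreal (2 ^ n * (d n z)\<^sup>2) \<partial>half_line)"
    by (rule nn_integral_suminf) measurable
  also have "\<dots> \<le> (\<Sum>n. ennreal ((1/2) ^ n))" by (intro suminf_le nd) auto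
  also have "\<dots> = ennreal (\<Sum>n. (1/2) ^ n)" by (intro suminf_ennreal_eq) (auto intro: summable_sums)
  also have "\<dots> < \<infinity>" by simp
  finally have "(\<integral>\<^sup>+ z. (\<Sum>n. ennreal (2 ^ n * (d n z)\<^sup>2)) \<partial>half_line) \<noteq> \<infinity>" by simp
  then have "AE z in half_line. (\<Sum>n. ennreal (2 ^ n * (d n z)\<^sup>2)) \<noteq> \<infinity>"
    by (intro nn_integral_noteq_infinite) measurable
  then show ?thesis
  proof eventually_elim
    fix z assume "(\<Sum>n. ennreal (2 ^ n * (d n z)\<^sup>2)) \<noteq> \<infinity>"
    then have "summable (\<lambda>n. 2 ^ n * (d n z)\<^sup>2)" by (intro summable_suminf_not_top) auto
    then have "summable (\<lambda>n. (1/2) ^ n + 2 ^ n * (d n z)\<^sup>2)" by (intro summable_add) auto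
    then have "summable (\<lambda>n. d n z)"
    proof (rule summable_comparison_test'[where N = 0])
      fix n :: nat
      have "2 * ((1/2) ^ n * (2 ^ n * \<bar>d n z\<bar>)) \<le> ((1/2) ^ n) * 1 + (2 ^ n * (d n z)\<^sup>2) + \<bar>d n z\<bar>"
      proof -
        define p :: real where "p = 2 ^ n"
        have p: "p > 0" by (simp add: p_def)
        have "0 \<le> (1 / p) * (1 - p * \<bar>d n z\<bar>)\<^sup>2" using p by simp
        also have "\<dots> = 1 / p - 2 * \<bar>d n z\<bar> + p * (d n z)\<^sup>2"
          using p by (simp add: power2_eq_square field_simps abs_mult_self_eq)
        finally have "2 * \<bar>d n z\<bar> \<le> 1 / p + p * (d n z)\<^sup>2" by simp
        moreover have "(1/2 :: real) ^ n = 1 / p" by (simp add: p_def power_one_over)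
        ultimately show ?thesis using p by (simp add: p_def)
      qed
      moreover have "(1/2 :: real) ^ n * (2 ^ n * \<bar>d n z\<bar>) = \<bar>d n z\<bar>" by (simp add: power_one_over)
      ultimately show "norm (d n z) \<le> (1/2) ^ n + 2 ^ n * (d n z)\<^sup>2" by simp
    qed
    then have "convergent (\<lambda>n. \<Sum>i<n. d i z)" by (simp add: summable_iff_convergent)
    then have "convergent (\<lambda>n. f 0 z + (\<Sum>i<n. d i z))" by (intro convergent_add convergent_const)
    moreover have "f 0 z + (\<Sum>i<n. d i z) = f n z" for n
      by (induction n) (auto simp: d_def)
    ultimately show "convergent (\<lambda>n. f n z)" by simp
  qed
qed

instance L2h :: banach
proof
  fix X :: "nat \<Rightarrow> L2h" assume C: "Cauchy X"
  have "\<exists>M. \<forall>m\<ge>M. \<forall>n\<ge>M. norm (X m - X n) < (1/2) ^ k" for k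
    using CauchyD[OF C, of "(1/2) ^ k"] by simp
  then obtain M where M: "\<And>k m n. m \<ge> M k \<Longrightarrow> n \<ge> M k \<Longrightarrow> norm (X m - X n) < (1/2) ^ k" by metis
  define r where "r n = (\<Sum>k\<le>n. M k) + n" for n
  have rM: "r n \<ge> M n" for n unfolding r_def by (simp add: trans_le_add1 member_le_sum)
  have rS: "r n < r (Suc n)" for n by (simp add: r_def)
  have sm: "strict_mono r" using rS by (simp add: strict_mono_Suc_iff)
  have rmon: "m \<le> n \<Longrightarrow> r m \<le> r n" for m n using sm by (simp add: strict_mono_less_eq)
  define f where "f n = rep (X (r n))" for n
  have fL: "f n \<in> L2" for n by (simp add: f_def)
  have [measurable]: "f n \<in> borel_measurable half_line" for n by (rule L2_measurable[OF fL])
  have clsf: "cls (f n) = X (r n)" for n by (simp add: f_def)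
  have near: "norm (cls (f m) - cls (f n)) \<le> (1/2) ^ k" if "m \<ge> k" "n \<ge> k" for m n k
    unfolding clsf using M[of k "r m" "r n"] rM[of k] rmon[OF that(1)] rmon[OF that(2)]
    by (meson less_imp_le order_trans)
  have AEc: "AE z in half_line. convergent (\<lambda>n. f n z)"
    by (rule fast_Cauchy_converges_AE[OF fL near]) auto
  define g where "g z = lim (\<lambda>n. f n z)" for z
  have [measurable]: "g \<in> borel_measurable half_line" unfolding g_def by measurable
  have AElim: "AE z in half_line. (\<lambda>n. f n z) \<longlonglongrightarrow> g z"
    using AEc by eventually_elim (simp add: g_def convergent_LIMSEQ_iff)
  have fatou: "(\<integral>\<^sup>+ z. ennreal ((f k z - g z)\<^sup>2) \<partial>half_line) \<le> ennreal (((1/2) ^ k)\<^sup>2)" for k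
  proof -
    have "(\<integral>\<^sup>+ z. ennreal ((f k z - g z)\<^sup>2) \<partial>half_line) = (\<integral>\<^sup>+ z. liminf (\<lambda>n. ennreal ((f k z - f n z)\<^sup>2)) \<partial>half_line)"
    proof (rule nn_integral_cong_AE)
      show "AE z in half_line. ennreal ((f k z - g z)\<^sup>2) = liminf (\<lambda>n. ennreal ((f k z - f n z)\<^sup>2))"
        using AElim
      proof eventually_elim
        fix z assume l: "(\<lambda>n. f n z) \<longlonglongrightarrow> g z"
        have "(\<lambda>n. ennreal ((f k z - f n z)\<^sup>2)) \<longlonglongrightarrow> ennreal ((f k z - g z)\<^sup>2)"
          by (intro tendsto_ennrealI tendsto_intros l)
        then show "ennreal ((f k z - g z)\<^sup>2) = liminf (\<lambda>n. ennreal ((f k z - f n z)\<^sup>2))"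
          by (rule lim_imp_Liminf[symmetric, rotated]) simp
      qed
    qed
    also have "\<dots> \<le> liminf (\<lambda>n. \<integral>\<^sup>+ z. ennreal ((f k z - f n z)\<^sup>2) \<partial>half_line)"
      by (rule nn_integral_liminf) measurable
    also have "\<dots> \<le> liminf (\<lambda>n::nat. ennreal (((1/2) ^ k)\<^sup>2))"
    proof (rule Liminf_mono)
      have "(\<integral>\<^sup>+ z. ennreal ((f k z - f n z)\<^sup>2) \<partial>half_line) \<le> ennreal (((1/2) ^ k)\<^sup>2)" if "n \<ge> k" for n
        unfolding nn_integral_L2[OF L2_diff[OF fL fL]] cls_diff[OF fL fL]
        using near[of k k n] that by (intro ennreal_leI power_mono) auto
      then show "\<forall>\<^sub>F n in sequentially. (\<integral>\<^sup>+ z. ennreal ((f k z - f n z)\<^sup>2) \<partial>half_line) \<le> ennreal (((1/2) ^ k)\<^sup>2)"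
        unfolding eventually_sequentially by blast
    qed
    also have "\<dots> = ennreal (((1/2) ^ k)\<^sup>2)" by (simp add: Liminf_const)
    finally show ?thesis .
  qed
  have dL: "(\<lambda>z. f k z - g z) \<in> L2" for k
  proof -
    have "(\<integral>\<^sup>+ z. ennreal ((f k z - g z)\<^sup>2) \<partial>half_line) < \<infinity>"
      using fatou[of k] by (simp add: le_less_trans)
    then have "integrable half_line (\<lambda>z. (f k z - g z)\<^sup>2)"
      by (intro integrableI_nonneg) auto
    then show ?thesis by (simp add: L2_def)
  qed
  have gL: "g \<in> L2" using L2_diff[OF fL[of 0] dL[of 0]] by simp
  have "norm (X (r k) - cls g) \<le> (1/2) ^ k" for k
  proof -
    have "ennreal ((norm (cls (f k) - cls g))\<^sup>2) \<le> ennreal (((1/2) ^ k)\<^sup>2)"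
      using fatou[of k] unfolding nn_integral_L2[OF dL] cls_diff[OF fL gL] .
    then have "(norm (cls (f k) - cls g))\<^sup>2 \<le> ((1/2) ^ k)\<^sup>2" by (simp add: ennreal_le_iff)
    then show ?thesis unfolding clsf by (rule power2_le_imp_le) simp
  qed
  then have "(\<lambda>k. norm (X (r k) - cls g)) \<longlonglongrightarrow> 0"
    by (intro tendsto_sandwich[OF _ _ tendsto_const LIMSEQ_power_zero[of "1/2 :: real"]]) auto
  then have "(\<lambda>k. X (r k) - cls g) \<longlonglongrightarrow> 0" by (rule tendsto_norm_zero_cancel)
  then have "(X \<circ> r) \<longlonglongrightarrow> cls g" unfolding o_def by (rule LIM_zero_cancel)
  then show "convergent X" using Cauchy_converges_subseq[OF C sm] unfolding convergent_def by blast
qed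

subsection \<open>Pointwise operations\<close>

definition mul :: "(real \<Rightarrow> real) \<Rightarrow> L2h \<Rightarrow> L2h" where "mul b x = cls (\<lambda>z. b z * rep x z)"

lemma mul:
  assumes b: "b \<in> borel_measurable half_line" and le: "\<And>z. z < 0 \<Longrightarrow> \<bar>b z\<bar> \<le> K"
  shows mul_L2: "f \<in> L2 \<Longrightarrow> (\<lambda>z. b z * f z) \<in> L2"
    and mul_cls: "f \<in> L2 \<Longrightarrow> mul b (cls f) = cls (\<lambda>z. b z * f z)"
    and linear_mul: "linear (mul b)"
    and norm_mul: "norm (mul b x) \<le> K * norm x"
    and inner_mul: "inner (mul b x) y = inner x (mul b y)"
proof -
  have AEle: "AE z in half_line. \<bar>b z\<bar> \<le> K" by (rule AE_I2) (use le in simp)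
  show L: "(\<lambda>z. b z * f z) \<in> L2" if f: "f \<in> L2" for f
  proof (rule L2_dominated[OF f])
    show "AE z in half_line. \<bar>b z * f z\<bar> \<le> K * \<bar>f z\<bar>"
      using AEle by eventually_elim (simp add: abs_mult mult_right_mono)
  qed (use b f in measurable)
  show C: "mul b (cls f) = cls (\<lambda>z. b z * f z)" if f: "f \<in> L2" for f
    unfolding mul_def
  proof (rule cls_eqI[OF L L])
    show "AE z in half_line. b z * rep (cls f) z = b z * f z" using rep_cls[OF f] by eventually_elim simp
  qed (use f in auto)
  show "linear (mul b)"
  proof (rule linearI)
    fix x y :: L2h
    have "mul b (cls (\<lambda>z. rep x z + rep y z)) = cls (\<lambda>z. b z * rep x z + b z * rep y z)"
      by (simp add: C L2_add distrib_left)
    then show "mul b (x + y) = mul b x + mul b y" by (simp add: cls_add L mul_def)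
  next
    fix r and x :: L2h
    have "mul b (cls (\<lambda>z. r * rep x z)) = cls (\<lambda>z. r * (b z * rep x z))"
      by (simp add: C L2_scale mult.left_commute)
    then show "mul b (r *\<^sub>R x) = r *\<^sub>R mul b x" by (simp add: cls_scale L mul_def)
  qed
  show "inner (mul b x) y = inner x (mul b y)"
    using inner_cls[OF L[OF rep_in] rep_in, of x y] inner_cls[OF rep_in L[OF rep_in], of x y]
    by (simp add: mul_def mult.assoc mult.left_commute)
  have K: "K \<ge> 0" using le[of "-1"] by simp
  have "(norm (mul b x))\<^sup>2 \<le> (K * norm x)\<^sup>2"
  proof -
    have "(norm (mul b x))\<^sup>2 = integral\<^sup>L half_line (\<lambda>z. (b z * rep x z) * (b z * rep x z))"
      unfolding mul_def by (simp add: power2_norm_eq_inner inner_cls L)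
    also have "\<dots> \<le> integral\<^sup>L half_line (\<lambda>z. K\<^sup>2 * (rep x z * rep x z))"
    proof (rule integral_mono_AE)
      show "AE z in half_line. b z * rep x z * (b z * rep x z) \<le> K\<^sup>2 * (rep x z * rep x z)"
        using AEle
      proof eventually_elim
        fix z assume "\<bar>b z\<bar> \<le> K"
        then have "(b z)\<^sup>2 \<le> K\<^sup>2" using K by (simp add: abs_le_square_iff[symmetric])
        then have "(b z)\<^sup>2 * (rep x z)\<^sup>2 \<le> K\<^sup>2 * (rep x z)\<^sup>2" by (intro mult_right_mono) auto
        then show "b z * rep x z * (b z * rep x z) \<le> K\<^sup>2 * (rep x z * rep x z)"
          by (simp add: power2_eq_square mult_ac)
      qed
    qed (auto intro!: L2_mult_integrable L)
    also have "\<dots> = (K * norm x)\<^sup>2" by (simp add: inner_L2h_def[symmetric] power_mult_distrib power2_norm_eq_inner)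
    finally show ?thesis .
  qed
  then show "norm (mul b x) \<le> K * norm x" by (rule power2_le_imp_le) (use K in simp)
qed

lemma norm_cls_le:
  assumes f: "f \<in> borel_measurable half_line" and g: "g \<in> L2" and K: "K \<ge> 0"
    and le: "AE z in half_line. \<bar>f z\<bar> \<le> K * \<bar>g z\<bar>"
  shows "norm (cls f) \<le> K * norm (cls g)"
proof -
  have fL: "f \<in> L2" by (rule L2_dominated[OF g f le])
  have "ennreal ((norm (cls f))\<^sup>2) \<le> ennreal ((norm (cls (\<lambda>z. K * g z)))\<^sup>2)"
    unfolding nn_integral_L2[OF fL, symmetric] nn_integral_L2[OF L2_scale[OF g], symmetric]
  proof (rule nn_integral_mono_AE)
    show "AE z in half_line. ennreal ((f z)\<^sup>2) \<le> ennreal ((K * g z)\<^sup>2)"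
      using le
    proof eventually_elim
      fix z assume "\<bar>f z\<bar> \<le> K * \<bar>g z\<bar>"
      then have "\<bar>f z\<bar> \<le> \<bar>K * g z\<bar>" using K by (simp add: abs_mult)
      then show "ennreal ((f z)\<^sup>2) \<le> ennreal ((K * g z)\<^sup>2)" by (intro ennreal_leI) (simp add: abs_le_square_iff)
    qed
  qed
  then have "(norm (cls f))\<^sup>2 \<le> (K * norm (cls g))\<^sup>2" using K by (simp add: cls_scale[OF g] ennreal_le_iff)
  then show ?thesis by (rule power2_le_imp_le) (use K in simp)
qed

definition nemytskii :: "(real \<Rightarrow> real) \<Rightarrow> L2h \<Rightarrow> L2h" where "nemytskii F x = cls (\<lambda>z. F (rep x z))"

lemma nemytskii:
  assumes F0: "F 0 = 0" and K: "K \<ge> 0" and Lip: "\<And>a b. \<bar>F a - F b\<bar> \<le> K * \<bar>a - b\<bar>"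
  shows nemytskii_L2: "f \<in> L2 \<Longrightarrow> (\<lambda>z. F (f z)) \<in> L2"
    and nemytskii_cls: "f \<in> L2 \<Longrightarrow> nemytskii F (cls f) = cls (\<lambda>z. F (f z))"
    and nemytskii_zero: "nemytskii F 0 = 0"
    and nemytskii_lipschitz: "norm (nemytskii F x - nemytskii F y) \<le> K * norm (x - y)"
proof -
  have "continuous_on UNIV F"
    using Lip by (intro lipschitz_on_continuous_on[of K]) (auto simp: lipschitz_on_def dist_norm K)
  then have [measurable]: "F \<in> borel_measurable borel" by (rule borel_measurable_continuous_onI)
  show L: "(\<lambda>z. F (f z)) \<in> L2" if f: "f \<in> L2" for f
    by (rule L2_dominated[OF f, of _ K]) (use f Lip[of _ 0] F0 in \<open>auto intro: measurable_compose\<close>)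
  show C: "nemytskii F (cls f) = cls (\<lambda>z. F (f z))" if f: "f \<in> L2" for f
    unfolding nemytskii_def
  proof (rule cls_eqI[OF L L])
    show "AE z in half_line. F (rep (cls f) z) = F (f z)" using rep_cls[OF f] by eventually_elim simp
  qed (use f in auto)
  show "nemytskii F 0 = 0" unfolding zero_L2h_def by (simp add: C L2_zero F0)
  have "nemytskii F x - nemytskii F y = cls (\<lambda>z. F (rep x z) - F (rep y z))"
    by (simp add: nemytskii_def cls_diff L)
  also have "norm \<dots> \<le> K * norm (cls (\<lambda>z. rep x z - rep y z))"
    by (rule norm_cls_le) (use Lip K in \<open>auto intro!: L2_diff borel_measurable_diff L2_measurable L\<close>)
  finally show "norm (nemytskii F x - nemytskii F y) \<le> K * norm (x - y)" by (simp add: cls_diff)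
qed


section \<open>Absolutely continuous functions on the half-line\<close>

lemma sets_half_line: "S \<in> sets borel \<Longrightarrow> S \<inter> {..<0} \<in> sets half_line"
  unfolding sets_restrict_space by (rule image_eqI[of _ _ S]) auto

lemma ident_half_line [measurable]: "(\<lambda>x. x) \<in> measurable half_line borel"
  by (intro measurable_restrict_space1 measurable_completion) simp

lemma emeasure_half_line: "a < 0 \<Longrightarrow> emeasure half_line {a..<0} = ennreal (- a)"
  by (subst emeasure_restrict_space) auto

lemma sigma_finite_half_line: "sigma_finite_measure half_line"
proof -
  have "emeasure half_line {- real (Suc n)..<0} \<noteq> \<infinity>" for n by (subst emeasure_half_line) auto
  moreover have "(\<Union>n. {- real (Suc n)..<0}) = {..<0}"
  proof (intro equalityI subsetI)
    fix x :: real assume "x \<in> {..<0}"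
    obtain n where "- x \<le> real n" using real_arch_simple by blast
    then show "x \<in> (\<Union>n. {- real (Suc n)..<0})" using \<open>x \<in> {..<0}\<close> by (intro UN_I[of n]) auto
  qed auto
  moreover have "{- real (Suc n)..<0} \<in> sets half_line" for n
    using sets_half_line[of "{- real (Suc n)..<0}"] by (simp add: Int_absorb2 subset_iff)
  ultimately have "\<exists>A. countable A \<and> A \<subseteq> sets half_line \<and> \<Union> A = space half_line \<and> (\<forall>a\<in>A. emeasure half_line a \<noteq> \<infinity>)"
    by (intro exI[of _ "range (\<lambda>n. {- real (Suc n)..<0})"]) auto
  then show ?thesis by (simp add: sigma_finite_measure_def)
qed

interpretation hl: sigma_finite_measure half_line by (rule sigma_finite_half_line)
interpretation hlp: pair_sigma_finite half_line half_line ..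

text \<open>Fubini's theorem on the triangle \<open>s < t < 0\<close>, the source of the product rule \<open>ac_mult\<close>.\<close>

lemma half_line_triangle_swap:
  fixes g k :: "real \<Rightarrow> real"
  assumes g: "integrable half_line g" and k: "integrable half_line k"
  shows "(\<integral>s. g s * (\<integral>t. (if s < t then k t else 0) \<partial>half_line) \<partial>half_line)
       = (\<integral>t. k t * (\<integral>s. (if s < t then g s else 0) \<partial>half_line) \<partial>half_line)"
proof -
  have [measurable]: "g \<in> borel_measurable half_line" "k \<in> borel_measurable half_line" using g k by auto
  define F where "F p = (if fst p < snd p then g (fst p) * k (snd p) else 0)" for p :: "real \<times> real"
  have [measurable]: "F \<in> borel_measurable (half_line \<Otimes>\<^sub>M half_line)" unfolding F_def by measurable
  have Feq: "F (s, t) = (if s < t then g s * k t else 0)" for s t by (auto simp: F_def)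
  have Fi: "integrable (half_line \<Otimes>\<^sub>M half_line) F"
  proof (rule hlp.Fubini_integrable)
    have ib: "integrable half_line (\<lambda>t. if s < t then g s * k t else 0)" for s
      by (rule Bochner_Integration.integrable_bound[of _ "\<lambda>t. g s * k t"]) (use k in auto)
    show "AE s in half_line. integrable half_line (\<lambda>t. F (s, t))" by (simp add: Feq ib)
    show "integrable half_line (\<lambda>s. \<integral>t. norm (F (s, t)) \<partial>half_line)"
    proof (rule Bochner_Integration.integrable_bound)
      show "integrable half_line (\<lambda>s. \<bar>g s\<bar> * (\<integral>t. \<bar>k t\<bar> \<partial>half_line))" using g by (intro integrable_mult_left integrable_abs)
      show "AE s in half_line. norm (\<integral>t. norm (F (s, t)) \<partial>half_line) \<le> norm (\<bar>g s\<bar> * (\<integral>t. \<bar>k t\<bar> \<partial>half_line))"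
      proof (rule AE_I2)
        fix s
        have "(\<integral>t. norm (F (s, t)) \<partial>half_line) \<le> (\<integral>t. \<bar>g s\<bar> * \<bar>k t\<bar> \<partial>half_line)"
        proof (rule integral_mono)
          show "integrable half_line (\<lambda>t. norm (F (s, t)))" unfolding Feq by (intro integrable_norm ib)
          show "integrable half_line (\<lambda>t. \<bar>g s\<bar> * \<bar>k t\<bar>)" using k by simp
        qed (auto simp: Feq abs_mult)
        moreover have "(\<integral>t. norm (F (s, t)) \<partial>half_line) \<ge> 0" by simp
        ultimately show "norm (\<integral>t. norm (F (s, t)) \<partial>half_line) \<le> norm (\<bar>g s\<bar> * (\<integral>t. \<bar>k t\<bar> \<partial>half_line))" by simp
      qed
    qed measurable
  qed measurable
  have "(\<integral>s. (\<integral>t. F (s, t) \<partial>half_line) \<partial>half_line) = (\<integral>t. (\<integral>s. F (s, t) \<partial>half_line) \<partial>half_line)"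
    using hlp.Fubini_integral[of "\<lambda>s t. F (s, t)"] Fi by (simp add: case_prod_unfold)
  moreover have "(\<integral>t. F (s, t) \<partial>half_line) = g s * (\<integral>t. (if s < t then k t else 0) \<partial>half_line)" for s
    unfolding integral_mult_right_zero[symmetric] by (rule Bochner_Integration.integral_cong) (auto simp: Feq)
  moreover have "(\<integral>s. F (s, t) \<partial>half_line) = k t * (\<integral>s. (if s < t then g s else 0) \<partial>half_line)" for t
    unfolding integral_mult_right_zero[symmetric] by (rule Bochner_Integration.integral_cong) (auto simp: Feq)
  ultimately show ?thesis by simp
qed

text \<open>Absolute continuity with derivative: \<open>ac f g\<close> says that \<open>f\<close> is the primitive of \<open>g\<close>, written as an
  integral up to the boundary point \<open>0\<close>. The interval of integration is cut out by \<open>cutl\<close>, so that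
  all integrals refer to the one measure \<open>half_line\<close>.\<close>

definition cutl :: "real \<Rightarrow> (real \<Rightarrow> real) \<Rightarrow> real \<Rightarrow> real" where
  "cutl z g = (\<lambda>s. if z \<le> s then g s else 0)"

definition loc_int :: "(real \<Rightarrow> real) \<Rightarrow> bool" where
  "loc_int g \<longleftrightarrow> g \<in> borel_measurable half_line \<and> (\<forall>z\<le>0. integrable half_line (cutl z g))"

definition ac :: "(real \<Rightarrow> real) \<Rightarrow> (real \<Rightarrow> real) \<Rightarrow> bool" where
  "ac f g \<longleftrightarrow> continuous_on {..0} f \<and> loc_int g \<and> (\<forall>z\<le>0. f z = f 0 - integral\<^sup>L half_line (cutl z g))"

lemma cutl_measurable [measurable]:
  assumes [measurable]: "g \<in> borel_measurable half_line" shows "cutl z g \<in> borel_measurable half_line"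
  unfolding cutl_def by measurable

lemma loc_int_bound:
  assumes "loc_int g" "f \<in> borel_measurable half_line"
    and "\<And>z. z \<le> 0 \<Longrightarrow> \<exists>K. \<forall>s. z \<le> s \<longrightarrow> s < 0 \<longrightarrow> \<bar>f s\<bar> \<le> K * \<bar>g s\<bar>"
  shows "loc_int f"
  unfolding loc_int_def
proof (intro conjI allI impI)
  fix z :: real assume z: "z \<le> 0"
  obtain K where K: "\<And>s. z \<le> s \<Longrightarrow> s < 0 \<Longrightarrow> \<bar>f s\<bar> \<le> K * \<bar>g s\<bar>" using assms(3)[OF z] by blast
  show "integrable half_line (cutl z f)"
  proof (rule Bochner_Integration.integrable_bound)
    show "integrable half_line (\<lambda>s. K * cutl z g s)" using assms(1) z by (simp add: loc_int_def)
    show "AE s in half_line. norm (cutl z f s) \<le> norm (K * cutl z g s)"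
    proof (rule AE_I2)
      fix s assume "s \<in> space half_line"
      then show "norm (cutl z f s) \<le> norm (K * cutl z g s)"
        using K[of s] by (auto simp: cutl_def abs_mult) (meson abs_ge_self abs_ge_zero mult_right_mono order_trans)
    qed
  qed (use assms(2) in measurable)
qed (rule assms(2))

lemma loc_int_add: "loc_int f \<Longrightarrow> loc_int g \<Longrightarrow> loc_int (\<lambda>s. f s + g s)"
  unfolding loc_int_def
proof (intro conjI allI impI)
  fix z :: real assume a: "f \<in> borel_measurable half_line \<and> (\<forall>z\<le>0. integrable half_line (cutl z f))"
    "g \<in> borel_measurable half_line \<and> (\<forall>z\<le>0. integrable half_line (cutl z g))" "z \<le> 0"
  have "cutl z (\<lambda>s. f s + g s) = (\<lambda>s. cutl z f s + cutl z g s)" by (auto simp: cutl_def)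
  then show "integrable half_line (cutl z (\<lambda>s. f s + g s))" using a by simp
qed auto

lemma loc_int_scale: "loc_int f \<Longrightarrow> loc_int (\<lambda>s. r * f s)"
  by (rule loc_int_bound[of f]) (auto simp: loc_int_def abs_mult intro!: exI[of _ "\<bar>r\<bar>"])

lemma const_integrable_cutl: "z \<le> 0 \<Longrightarrow> integrable half_line (cutl z (\<lambda>_. r))"
proof -
  assume z: "z \<le> 0"
  have "integrable half_line (\<lambda>s. r * indicator {z..<0} s)"
  proof (cases "z = 0")
    case False
    have "{z..<0} \<in> sets half_line" using sets_half_line[of "{z..<0}"] by (simp add: Int_absorb2 subset_iff)
    then show ?thesis using False z
      by (intro integrable_mult_right integrable_real_indicator) (auto simp: emeasure_half_line)
  qed simp
  moreover have "integrable half_line (\<lambda>s. r * indicator {z..<0} s) \<longleftrightarrow> integrable half_line (cutl z (\<lambda>_. r))"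
    by (rule Bochner_Integration.integrable_cong) (auto simp: cutl_def)
  ultimately show ?thesis by simp
qed

lemma continuous_measurable_half_line: "continuous_on {..0} f \<Longrightarrow> f \<in> borel_measurable half_line"
  by (rule continuous_imp_measurable_on_sets_lebesgue) (auto elim: continuous_on_subset)

lemma continuous_locally_bounded:
  assumes "continuous_on {..0} (f :: real \<Rightarrow> real)" "z \<le> 0"
  shows "\<exists>K. \<forall>s. z \<le> s \<longrightarrow> s \<le> 0 \<longrightarrow> \<bar>f s\<bar> \<le> K"
proof -
  have "bounded (f ` {z..0})"
    by (intro compact_imp_bounded compact_continuous_image continuous_on_subset[OF assms(1)]) auto
  then obtain K where "\<And>y. y \<in> f ` {z..0} \<Longrightarrow> norm y \<le> K" unfolding bounded_iff by blast
  then show ?thesis by (intro exI[of _ K]) auto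
qed

lemma loc_int_const: "loc_int (\<lambda>_. r)"
  by (simp add: loc_int_def const_integrable_cutl)

lemma loc_int_mult_continuous:
  assumes g: "loc_int g" and f: "continuous_on {..0} f"
  shows "loc_int (\<lambda>s. f s * g s)"
proof (rule loc_int_bound[OF g])
  show "(\<lambda>s. f s * g s) \<in> borel_measurable half_line"
    using g continuous_measurable_half_line[OF f] by (auto simp: loc_int_def)
  fix z :: real assume "z \<le> 0"
  from continuous_locally_bounded[OF f this] obtain K where "\<And>s. z \<le> s \<Longrightarrow> s \<le> 0 \<Longrightarrow> \<bar>f s\<bar> \<le> K" by blast
  then show "\<exists>K. \<forall>s\<ge>z. s < 0 \<longrightarrow> \<bar>f s * g s\<bar> \<le> K * \<bar>g s\<bar>"
    by (intro exI[of _ K]) (auto simp: abs_mult intro!: mult_right_mono)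
qed

lemma loc_int_continuous: "continuous_on {..0} f \<Longrightarrow> loc_int f"
  using loc_int_mult_continuous[OF loc_int_const[of 1]] by simp

lemma singleton_null_half_line: "AE s in half_line. s \<noteq> t"
proof -
  have "AE s in lebesgue. s \<noteq> t" by (intro AE_completion AE_lborel_singleton)
  then show ?thesis by (subst AE_restrict_space_iff) auto
qed

text \<open>Inserting the integral representations of both factors, the double integral over \<open>{z..<0}\<close> squared
  is split along the diagonal into the two terms of the product rule.\<close>

lemma ac_mult:
  assumes fg: "ac f g" and hk: "ac h k"
  shows "ac (\<lambda>z. f z * h z) (\<lambda>z. f z * k z + g z * h z)"
  unfolding ac_def
proof (intro conjI allI impI)
  have f: "continuous_on {..0} f" and h: "continuous_on {..0} h" and g: "loc_int g" and k: "loc_int k"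
    using fg hk by (auto simp: ac_def)
  have f1: "f z = f 0 - integral\<^sup>L half_line (cutl z g)" and h1: "h z = h 0 - integral\<^sup>L half_line (cutl z k)" if "z \<le> 0" for z
    using fg hk that unfolding ac_def by blast+
  have fk: "loc_int (\<lambda>z. f z * k z)" by (rule loc_int_mult_continuous[OF k f])
  have gh: "loc_int (\<lambda>z. g z * h z)" using loc_int_mult_continuous[OF g h] by (simp add: mult.commute)
  show "continuous_on {..0} (\<lambda>z. f z * h z)" using f h by (intro continuous_intros)
  show "loc_int (\<lambda>z. f z * k z + g z * h z)" by (intro loc_int_add fk gh)
  fix z :: real assume z: "z \<le> 0"
  define G where "G = integral\<^sup>L half_line (cutl z g)"
  define K where "K = integral\<^sup>L half_line (cutl z k)"
  have gz: "integrable half_line (cutl z g)" and kz: "integrable half_line (cutl z k)" using g k z by (auto simp: loc_int_def)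
  have fkz: "integrable half_line (cutl z (\<lambda>z. f z * k z))" and ghz: "integrable half_line (cutl z (\<lambda>z. g z * h z))"
    using fk gh z by (auto simp: loc_int_def)
  have [measurable]: "g \<in> borel_measurable half_line" "k \<in> borel_measurable half_line" using g k by (auto simp: loc_int_def)
  have fs: "f s = f 0 - (\<integral>t. (if s < t then cutl z g t else 0) \<partial>half_line)" if "z \<le> s" "s < 0" for s
  proof -
    have "integral\<^sup>L half_line (cutl s g) = (\<integral>t. (if s < t then cutl z g t else 0) \<partial>half_line)"
      using singleton_null_half_line[of s] that
      by (intro integral_cong_AE) (measurable, auto simp: cutl_def elim!: eventually_mono)
    then show ?thesis using f1[of s] that by simp
  qed
  have hs: "h s = h 0 - (\<integral>t. (if s < t then cutl z k t else 0) \<partial>half_line)" if "z \<le> s" "s < 0" for s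
  proof -
    have "integral\<^sup>L half_line (cutl s k) = (\<integral>t. (if s < t then cutl z k t else 0) \<partial>half_line)"
      using singleton_null_half_line[of s] that
      by (intro integral_cong_AE) (measurable, auto simp: cutl_def elim!: eventually_mono)
    then show ?thesis using h1[of s] that by simp
  qed
  define A where "A s = (\<integral>t. (if s < t then cutl z g t else 0) \<partial>half_line)" for s
  define B where "B t = (\<integral>s. (if s < t then cutl z g s else 0) \<partial>half_line)" for t
  define C where "C s = (\<integral>t. (if s < t then cutl z k t else 0) \<partial>half_line)" for s
  have AB: "A t + B t = G" for t
  proof -
    have i: "integrable half_line (\<lambda>s. if s < t then cutl z g s else 0)" "integrable half_line (\<lambda>s. if t < s then cutl z g s else 0)"
      by (rule Bochner_Integration.integrable_bound[OF gz]; auto)+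
    have "A t + B t = (\<integral>s. (if t < s then cutl z g s else 0) + (if s < t then cutl z g s else 0) \<partial>half_line)"
      unfolding A_def B_def using i by simp
    also have "\<dots> = G" unfolding G_def
      using singleton_null_half_line[of t] by (intro integral_cong_AE) (measurable, auto elim!: eventually_mono)
    finally show ?thesis .
  qed
  have I1: "integral\<^sup>L half_line (cutl z (\<lambda>z. f z * k z)) = f 0 * K - (\<integral>t. cutl z k t * A t \<partial>half_line)"
    and i1: "integrable half_line (\<lambda>t. cutl z k t * A t)"
  proof -
    have eq: "cutl z k t * A t = f 0 * cutl z k t - cutl z (\<lambda>z. f z * k z) t" if "t \<in> space half_line" for t
    proof (cases "z \<le> t")
      case True
      then have eq: "f t = f 0 - A t" using fs[of t] that by (simp add: A_def)
      show ?thesis using True by (simp add: cutl_def eq algebra_simps)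
    qed (simp add: cutl_def)
    show i1: "integrable half_line (\<lambda>t. cutl z k t * A t)"
      using kz fkz by (subst Bochner_Integration.integrable_cong[OF refl eq]) auto
    have "(\<integral>t. cutl z k t * A t \<partial>half_line) = f 0 * K - integral\<^sup>L half_line (cutl z (\<lambda>z. f z * k z))"
      using kz fkz by (subst Bochner_Integration.integral_cong[OF refl eq]) (auto simp: K_def)
    then show "integral\<^sup>L half_line (cutl z (\<lambda>z. f z * k z)) = f 0 * K - (\<integral>t. cutl z k t * A t \<partial>half_line)" by simp
  qed
  have I2: "integral\<^sup>L half_line (cutl z (\<lambda>z. g z * h z)) = h 0 * G - (\<integral>t. cutl z g t * C t \<partial>half_line)"
  proof -
    have eq: "cutl z g t * C t = h 0 * cutl z g t - cutl z (\<lambda>z. g z * h z) t" if "t \<in> space half_line" for t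
    proof (cases "z \<le> t")
      case True
      then have eq: "h t = h 0 - C t" using hs[of t] that by (simp add: C_def)
      show ?thesis using True by (simp add: cutl_def eq algebra_simps)
    qed (simp add: cutl_def)
    have "(\<integral>t. cutl z g t * C t \<partial>half_line) = h 0 * G - integral\<^sup>L half_line (cutl z (\<lambda>z. g z * h z))"
      using gz ghz by (subst Bochner_Integration.integral_cong[OF refl eq]) (auto simp: G_def)
    then show ?thesis by simp
  qed
  have "(\<integral>t. cutl z g t * C t \<partial>half_line) = (\<integral>t. cutl z k t * B t \<partial>half_line)"
    unfolding C_def B_def by (rule half_line_triangle_swap[OF gz kz])
  also have "\<dots> = (\<integral>t. G * cutl z k t - cutl z k t * A t \<partial>half_line)"
  proof (rule Bochner_Integration.integral_cong[OF refl])
    fix t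
    have eq: "B t = G - A t" using AB[of t] by simp
    show "cutl z k t * B t = G * cutl z k t - cutl z k t * A t" by (simp add: eq algebra_simps)
  qed
  also have "\<dots> = G * K - (\<integral>t. cutl z k t * A t \<partial>half_line)" using kz i1 by (simp add: K_def)
  finally have sw: "(\<integral>t. cutl z g t * C t \<partial>half_line) = G * K - (\<integral>t. cutl z k t * A t \<partial>half_line)" .
  have "cutl z (\<lambda>z. f z * k z + g z * h z) = (\<lambda>s. cutl z (\<lambda>z. f z * k z) s + cutl z (\<lambda>z. g z * h z) s)"
    by (auto simp: cutl_def)
  then have "integral\<^sup>L half_line (cutl z (\<lambda>z. f z * k z + g z * h z)) = f 0 * K + h 0 * G - G * K"
    using fkz ghz I1 I2 sw by simp
  moreover have "f z = f 0 - G" "h z = h 0 - K" using f1[OF z] h1[OF z] by (auto simp: G_def K_def)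
  moreover have "f z * h z = (f 0 - G) * (h 0 - K)" using f1[OF z] h1[OF z] by (simp add: G_def K_def)
  ultimately show "f z * h z = f 0 * h 0 - integral\<^sup>L half_line (cutl z (\<lambda>z. f z * k z + g z * h z))"
    by (simp add: algebra_simps)
qed

lemma ac_add:
  assumes "ac f g" "ac h k" shows "ac (\<lambda>z. f z + h z) (\<lambda>z. g z + k z)"
  unfolding ac_def
proof (intro conjI allI impI)
  show "continuous_on {..0} (\<lambda>z. f z + h z)" using assms by (auto simp: ac_def intro: continuous_intros)
  show "loc_int (\<lambda>z. g z + k z)" using assms by (auto simp: ac_def intro: loc_int_add)
  fix z :: real assume z: "z \<le> 0"
  have "cutl z (\<lambda>z. g z + k z) = (\<lambda>s. cutl z g s + cutl z k s)" by (auto simp: cutl_def)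
  moreover have "integrable half_line (cutl z g)" "integrable half_line (cutl z k)"
    using assms z by (auto simp: ac_def loc_int_def)
  moreover have "f z = f 0 - integral\<^sup>L half_line (cutl z g)" "h z = h 0 - integral\<^sup>L half_line (cutl z k)"
    using assms z unfolding ac_def by blast+
  ultimately show "f z + h z = f 0 + h 0 - integral\<^sup>L half_line (cutl z (\<lambda>z. g z + k z))" by simp
qed

lemma ac_scale:
  assumes "ac f g" shows "ac (\<lambda>z. r * f z) (\<lambda>z. r * g z)"
  unfolding ac_def
proof (intro conjI allI impI)
  show "continuous_on {..0} (\<lambda>z. r * f z)" using assms by (auto simp: ac_def intro: continuous_intros)
  show "loc_int (\<lambda>z. r * g z)" using assms by (auto simp: ac_def intro: loc_int_scale)
  fix z :: real assume z: "z \<le> 0"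
  have "cutl z (\<lambda>z. r * g z) = (\<lambda>s. r * cutl z g s)" by (auto simp: cutl_def)
  moreover have "f z = f 0 - integral\<^sup>L half_line (cutl z g)" using assms z unfolding ac_def by blast
  ultimately show "r * f z = r * f 0 - integral\<^sup>L half_line (cutl z (\<lambda>z. r * g z))" by (simp add: right_diff_distrib)
qed

lemma ac_diff:
  assumes "ac f g" "ac h k" shows "ac (\<lambda>z. f z - h z) (\<lambda>z. g z - k z)"
  using ac_add[OF assms(1) ac_scale[OF assms(2), of "-1"]] by simp

lemma ac_C1:
  assumes d: "\<And>z. z \<le> 0 \<Longrightarrow> (b has_real_derivative b' z) (at z within {..0})" and c: "continuous_on {..0} b'"
  shows "ac b b'"
  unfolding ac_def
proof (intro conjI allI impI)
  show "continuous_on {..0} b" using d by (intro DERIV_continuous_on) auto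
  show "loc_int b'" by (rule loc_int_continuous[OF c])
  fix z :: real assume z: "z \<le> 0"
  have i: "integrable half_line (cutl z b')" using loc_int_continuous[OF c] z by (simp add: loc_int_def)
  have "(b' has_integral (b 0 - b z)) {z..0}"
  proof (rule fundamental_theorem_of_calculus[OF z])
    fix s assume "s \<in> {z..0}"
    then show "(b has_vector_derivative b' s) (at s within {z..0})"
      using d[of s] by (auto simp: has_real_derivative_iff_has_vector_derivative[symmetric] intro: DERIV_subset)
  qed
  then have "((\<lambda>s. if s \<in> {z..0} then b' s else 0) has_integral (b 0 - b z)) UNIV"
    by (simp only: has_integral_restrict_UNIV)
  then have "((\<lambda>s. if s \<in> {..<0} then cutl z b' s else 0) has_integral (b 0 - b z)) UNIV"
    by (rule has_integral_spike[of "{0}", rotated 2]) (auto simp: cutl_def)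
  then have "(cutl z b' has_integral (b 0 - b z)) {..<0}" by (simp only: has_integral_restrict_UNIV)
  moreover have "integral\<^sup>L half_line (cutl z b') = integral {..<0} (cutl z b')"
    by (rule lebesgue_integral_eq_integral[OF i]) simp
  ultimately have "integral\<^sup>L half_line (cutl z b') = b 0 - b z" by (simp add: integral_unique)
  then show "b z = b 0 - integral\<^sup>L half_line (cutl z b')" by simp
qed

lemma L2_loc_int: assumes g: "g \<in> L2" shows "loc_int g"
  unfolding loc_int_def
proof (intro conjI allI impI)
  show gm: "g \<in> borel_measurable half_line" using g by measurable
  fix z :: real assume z: "z \<le> 0"
  show "integrable half_line (cutl z g)"
  proof (rule Bochner_Integration.integrable_bound)
    show "integrable half_line (\<lambda>s. cutl z (\<lambda>_. 1) s + (g s)\<^sup>2)"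
      by (intro Bochner_Integration.integrable_add const_integrable_cutl z L2_integrable g)
    have "\<bar>a\<bar> \<le> 1 + a\<^sup>2" for a :: real
      using zero_le_power2[of "\<bar>a\<bar> - 1"] abs_ge_zero[of a] by (simp add: power2_eq_square algebra_simps)
    then show "AE s in half_line. norm (cutl z g s) \<le> norm (cutl z (\<lambda>_. 1) s + (g s)\<^sup>2)"
      by (intro AE_I2) (auto simp: cutl_def)
  qed (use gm in measurable)
qed


section \<open>Weak derivatives\<close>

lemma acD:
  assumes "ac f g" "z \<le> 0" shows "f z = f 0 - integral\<^sup>L half_line (cutl z g)"
  using assms unfolding ac_def by blast

lemma ac_continuous: "ac f g \<Longrightarrow> continuous_on {..0} f"
  by (simp add: ac_def)

lemma test_functionsI:
  assumes "\<And>z. (\<psi> has_real_derivative \<psi>' z) (at z)" "continuous_on UNIV \<psi>'" "b < 0"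
    "\<And>z. z \<notin> {a..b} \<Longrightarrow> \<psi> z = 0"
  shows "\<psi> \<in> test_functions"
  unfolding test_functions_def C1_differentiable_on_def
  using assms by (auto simp: has_real_derivative_iff_has_vector_derivative[symmetric])

lemma test_functionsE:
  assumes "\<psi> \<in> test_functions"
  obtains \<psi>' a b where "\<And>z. (\<psi> has_real_derivative \<psi>' z) (at z)" "continuous_on UNIV \<psi>'" "deriv \<psi> = \<psi>'" "b < 0" "a \<le> b"
    "\<And>z. z \<notin> {a..b} \<Longrightarrow> \<psi> z = 0" "\<And>z. z \<notin> {a..b} \<Longrightarrow> \<psi>' z = 0"
proof -
  obtain \<psi>' where d: "\<And>z. (\<psi> has_real_derivative \<psi>' z) (at z)" and c: "continuous_on UNIV \<psi>'"
    using assms unfolding test_functions_def C1_differentiable_on_def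
    by (auto simp: has_real_derivative_iff_has_vector_derivative[symmetric])
  obtain a b where b: "b < 0" and v: "\<And>z. z \<notin> {a..b} \<Longrightarrow> \<psi> z = 0" using assms unfolding test_functions_def by auto
  have v': "z \<notin> {min a b..b} \<Longrightarrow> \<psi> z = 0" for z using v by auto
  have "\<psi>' z = 0" if z: "z \<notin> {min a b..b}" for z
  proof -
    have "((\<lambda>_. 0) has_real_derivative \<psi>' z) (at z)"
      by (rule has_field_derivative_transform_within_open[OF d, of "- {min a b..b}"]) (use z v' in \<open>auto simp: open_Compl\<close>)
    then show ?thesis using DERIV_const DERIV_unique by blast
  qed
  moreover have "deriv \<psi> = \<psi>'" using d DERIV_imp_deriv by blast
  ultimately show ?thesis using that[of \<psi>' b "min a b"] d c b v' by auto
qed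

lemma positive_part_square_deriv: "((\<lambda>x. (max 0 x)\<^sup>2) has_real_derivative 2 * max 0 x) (at (x::real))"
proof (cases "x = 0")
  case False
  show ?thesis
  proof (cases "x > 0")
    case True
    have "((\<lambda>x. x\<^sup>2) has_real_derivative 2 * max 0 x) (at x)" using True by (auto intro!: derivative_eq_intros)
    then show ?thesis
      by (rule has_field_derivative_transform_within_open[of _ _ _ "{0<..}"]) (use True in auto)
  next
    case neg: False
    have "((\<lambda>x. 0) has_real_derivative 2 * max 0 x) (at x)" using False neg by (auto intro!: derivative_eq_intros)
    then show ?thesis
      by (rule has_field_derivative_transform_within_open[of _ _ _ "{..<0}"]) (use False neg in auto)
  qed
next
  case True
  have "((\<lambda>h. (max 0 h)\<^sup>2 / h) \<longlongrightarrow> 0) (at (0::real))"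
  proof (rule Lim_null_comparison)
    have "norm ((max 0 h)\<^sup>2 / h) \<le> \<bar>h\<bar>" for h :: real
      by (cases "h > 0") (auto simp: max_def power2_eq_square)
    then show "\<forall>\<^sub>F h in at (0::real). norm ((max 0 h)\<^sup>2 / h) \<le> \<bar>h\<bar>" by simp
    show "((\<lambda>h. \<bar>h\<bar>) \<longlongrightarrow> 0) (at (0::real))" by (rule tendsto_rabs_zero) (rule tendsto_ident_at)
  qed
  then show ?thesis using True by (simp add: DERIV_def)
qed

text \<open>A nonnegative piecewise polynomial with support \<open>{a..b}\<close>; it is continuously differentiable, which
  is the regularity of the test functions.\<close>

definition bump :: "real \<Rightarrow> real \<Rightarrow> real \<Rightarrow> real" where
  "bump a b z = (max 0 (z - a))\<^sup>2 * (max 0 (b - z))\<^sup>2"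

definition bump' :: "real \<Rightarrow> real \<Rightarrow> real \<Rightarrow> real" where
  "bump' a b z = 2 * max 0 (z - a) * (max 0 (b - z))\<^sup>2 - (max 0 (z - a))\<^sup>2 * (2 * max 0 (b - z))"

lemma bump_deriv: "(bump a b has_real_derivative bump' a b z) (at z)"
proof -
  have 1: "((\<lambda>z. (max 0 (z - a))\<^sup>2) has_real_derivative 2 * max 0 (z - a)) (at z)"
    by (rule DERIV_cong[OF DERIV_chain2[OF positive_part_square_deriv], of _ 1]) (auto intro!: derivative_eq_intros)
  have 2: "((\<lambda>z. (max 0 (b - z))\<^sup>2) has_real_derivative 2 * max 0 (b - z) * (-1)) (at z)"
    by (rule DERIV_chain2[OF positive_part_square_deriv]) (auto intro!: derivative_eq_intros)
  show ?thesis unfolding bump_def[abs_def] bump'_def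
    by (rule DERIV_cong[OF DERIV_mult[OF 1 2]]) simp
qed

lemma bump'_continuous: "continuous_on S (bump' a b)"
  unfolding bump'_def[abs_def] by (intro continuous_intros)

lemma bump_continuous: "continuous_on S (bump a b)"
  unfolding bump_def[abs_def] by (intro continuous_intros)

lemma bump_nonneg: "bump a b z \<ge> 0" by (simp add: bump_def)

lemma bump_pos: "a < z \<Longrightarrow> z < b \<Longrightarrow> bump a b z > 0" by (simp add: bump_def)

lemma bump_zero: "z \<notin> {a..b} \<Longrightarrow> bump a b z = 0" by (auto simp: bump_def max_def)

lemma vanishing_cutl:
  assumes "\<And>z. z \<notin> {a..b} \<Longrightarrow> f z = 0" shows "cutl a f = f"
  using assms by (auto simp: cutl_def)

lemma compact_support_L2:
  assumes c: "continuous_on UNIV (\<psi> :: real \<Rightarrow> real)" and b: "b < 0" and a: "a \<le> b"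
    and v: "\<And>z. z \<notin> {a..b} \<Longrightarrow> \<psi> z = 0"
  shows "\<psi> \<in> L2"
proof -
  have "continuous_on {..0} (\<lambda>z. (\<psi> z)\<^sup>2)" by (intro continuous_intros continuous_on_subset[OF c]) auto
  from loc_int_continuous[OF this] a b have "integrable half_line (cutl a (\<lambda>z. (\<psi> z)\<^sup>2))"
    by (auto simp: loc_int_def)
  moreover have "cutl a (\<lambda>z. (\<psi> z)\<^sup>2) = (\<lambda>z. (\<psi> z)\<^sup>2)" by (rule vanishing_cutl[of _ b]) (use v in auto)
  moreover have "\<psi> \<in> borel_measurable half_line"
    by (rule continuous_measurable_half_line) (rule continuous_on_subset[OF c], auto)
  ultimately show ?thesis by (simp add: L2_def)
qed

lemma loc_int_mult_compact_support:
  assumes h: "loc_int h" and c: "continuous_on UNIV (\<psi> :: real \<Rightarrow> real)" and b: "b < 0" and a: "a \<le> b"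
    and v: "\<And>z. z \<notin> {a..b} \<Longrightarrow> \<psi> z = 0"
  shows "integrable half_line (\<lambda>z. h z * \<psi> z)"
proof -
  have "continuous_on {..0} \<psi>" by (rule continuous_on_subset[OF c]) auto
  from loc_int_mult_continuous[OF h this] a b have "integrable half_line (cutl a (\<lambda>z. \<psi> z * h z))"
    by (auto simp: loc_int_def)
  moreover have "cutl a (\<lambda>z. \<psi> z * h z) = (\<lambda>z. \<psi> z * h z)" by (rule vanishing_cutl[of _ b]) (use v in auto)
  ultimately show ?thesis by (simp add: mult.commute)
qed

text \<open>Testing with \<open>bump a b\<close> times polynomials that converge boundedly to the sign of \<open>h\<close> gives
  \<open>\<integral> \<bar>h\<bar> bump = 0\<close> in the limit. The polynomials come from Weierstrass' theorem applied to
  continuous approximations of the measurable function \<open>sgn h\<close>.\<close>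

lemma fundamental_lemma_interval:
  assumes h: "loc_int h" and z: "\<And>\<psi>. \<psi> \<in> test_functions \<Longrightarrow> integral\<^sup>L half_line (\<lambda>z. h z * \<psi> z) = 0"
    and ab: "a < b" "b < 0"
  shows "AE z in half_line. a < z \<longrightarrow> z < b \<longrightarrow> h z = 0"
proof -
  have hm [measurable]: "h \<in> borel_measurable half_line" using h by (simp add: loc_int_def)
  define u where "u z = (if z \<in> {..<0} then sgn (h z) else 0)" for z
  have "(\<lambda>z. sgn (h z)) \<in> borel_measurable half_line" by measurable
  then have "u \<in> borel_measurable lebesgue" unfolding u_def by (subst borel_measurable_if) auto
  then have "u measurable_on UNIV" by (rule lebesgue_measurable_imp_measurable_on_real) simp
  then obtain N g where N: "negligible N" and g: "\<And>n. continuous_on UNIV (g n)"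
    and gl: "\<And>x. x \<notin> N \<Longrightarrow> (\<lambda>n. g n x) \<longlonglongrightarrow> u x"
    unfolding measurable_on_def by auto
  define k where "k n x = max (-1) (min 1 (g n x))" for n :: nat and x
  have kc: "continuous_on {a..b} (k n)" for n
    unfolding k_def by (intro continuous_intros continuous_on_subset[OF g]) auto
  have "\<exists>p. real_polynomial_function p \<and> (\<forall>x\<in>{a..b}. \<bar>k n x - p x\<bar> < 1 / real (Suc n))" for n
    using Stone_Weierstrass_real_polynomial_function[OF compact_Icc kc[of n], of "1 / real (Suc n)"] by (metis of_nat_0_less_iff zero_less_Suc zero_less_divide_1_iff)
  then obtain p where p: "\<And>n. real_polynomial_function (p n)" and pk: "\<And>n x. x \<in> {a..b} \<Longrightarrow> \<bar>k n x - p n x\<bar> < 1 / real (Suc n)"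
    by metis
  have kl: "(\<lambda>n. k n x) \<longlonglongrightarrow> u x" if "x \<notin> N" for x
  proof -
    have "(\<lambda>n. k n x) \<longlonglongrightarrow> max (-1) (min 1 (u x))" unfolding k_def by (intro tendsto_intros gl that)
    moreover have "max (-1) (min 1 (u x)) = u x" by (auto simp: u_def sgn_if)
    ultimately show ?thesis by simp
  qed
  have pl: "(\<lambda>n. p n x) \<longlonglongrightarrow> u x" if "x \<notin> N" "x \<in> {a..b}" for x
  proof -
    have "(\<lambda>n. p n x - k n x) \<longlonglongrightarrow> 0"
    proof (rule Lim_null_comparison)
      show "\<forall>\<^sub>F n in sequentially. norm (p n x - k n x) \<le> 1 / real (Suc n)"
        using pk[OF that(2)] by (intro always_eventually allI) (simp add: abs_minus_commute less_imp_le)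
      show "(\<lambda>n. 1 / real (Suc n)) \<longlonglongrightarrow> 0" using LIMSEQ_inverse_real_of_nat by (simp add: inverse_eq_divide)
    qed
    from tendsto_add[OF this kl[OF that(1)]] show ?thesis by simp
  qed
  have pb: "\<bar>p n x\<bar> \<le> 2" if "x \<in> {a..b}" for n x
  proof -
    have "\<bar>k n x\<bar> \<le> 1" by (auto simp: k_def)
    moreover have "1 / real (Suc n) \<le> 1" by simp
    ultimately show ?thesis using pk[OF that, of n] by linarith
  qed
  have I0: "integral\<^sup>L half_line (\<lambda>z. h z * (bump a b z * p n z)) = 0" for n
  proof (rule z)
    obtain p' where p': "real_polynomial_function p'" "\<And>x. (p n has_real_derivative p' x) (at x)"
      using has_real_derivative_polynomial_function[OF p[of n]] by blast
    have "continuous_on UNIV p'" "continuous_on UNIV (p n)"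
      using p'(1) p[of n] by (auto intro: continuous_on_polymonial_function simp: real_polynomial_function_eq)
    then show "(\<lambda>z. bump a b z * p n z) \<in> test_functions"
      using DERIV_mult[OF bump_deriv p'(2)] ab
      by (intro test_functionsI[where \<psi>' = "\<lambda>x. bump' a b x * p n x + p' x * bump a b x" and a = a and b = b])
         (auto intro!: continuous_intros bump_continuous bump'_continuous simp: bump_zero)
  qed
  have pm: "p n \<in> borel_measurable half_line" for n
    using continuous_on_polymonial_function[of "p n" "{..0}"] p[of n]
    by (intro continuous_measurable_half_line) (simp add: real_polynomial_function_eq)
  have [measurable]: "bump a b \<in> borel_measurable half_line" by (rule continuous_measurable_half_line[OF bump_continuous])
  have [measurable]: "u \<in> borel_measurable half_line"
    using \<open>u \<in> borel_measurable lebesgue\<close> by (rule measurable_restrict_space1)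
  have hb: "integrable half_line (\<lambda>z. h z * bump a b z)"
    by (rule loc_int_mult_compact_support[OF h bump_continuous ab(2) less_imp_le[OF ab(1)] bump_zero])
  have Nae: "AE z in half_line. z \<notin> N"
  proof -
    have "N \<in> null_sets lebesgue" using N by (simp add: negligible_iff_null_sets)
    then have "AE z in lebesgue. z \<notin> N" by (rule AE_not_in)
    then show ?thesis by (subst AE_restrict_space_iff) (auto elim: eventually_mono)
  qed
  have "(\<lambda>n. integral\<^sup>L half_line (\<lambda>z. h z * (bump a b z * p n z))) \<longlonglongrightarrow> integral\<^sup>L half_line (\<lambda>z. h z * (bump a b z * u z))"
  proof (rule integral_dominated_convergence[where w = "\<lambda>z. 2 * \<bar>h z * bump a b z\<bar>"])
    show "integrable half_line (\<lambda>z. 2 * \<bar>h z * bump a b z\<bar>)" using hb by simp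
    show "AE z in half_line. (\<lambda>n. h z * (bump a b z * p n z)) \<longlonglongrightarrow> h z * (bump a b z * u z)"
      using Nae
    proof eventually_elim
      fix z assume "z \<notin> N"
      then show "(\<lambda>n. h z * (bump a b z * p n z)) \<longlonglongrightarrow> h z * (bump a b z * u z)"
        using pl[of z] by (cases "z \<in> {a..b}") (auto intro!: tendsto_intros simp: bump_zero)
    qed
    fix n
    show "AE z in half_line. norm (h z * (bump a b z * p n z)) \<le> 2 * \<bar>h z * bump a b z\<bar>"
    proof (rule AE_I2)
      fix z
      show "norm (h z * (bump a b z * p n z)) \<le> 2 * \<bar>h z * bump a b z\<bar>"
      proof (cases "z \<in> {a..b}")
        case True
        have "\<bar>h z * bump a b z\<bar> * \<bar>p n z\<bar> \<le> \<bar>h z * bump a b z\<bar> * 2" by (intro mult_left_mono pb True) auto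
        then show ?thesis by (simp add: abs_mult mult_ac)
      qed (simp add: bump_zero)
    qed
  qed (use pm in measurable)
  then have "integral\<^sup>L half_line (\<lambda>z. h z * (bump a b z * u z)) = 0" by (simp add: I0 LIMSEQ_const_iff)
  moreover have "integral\<^sup>L half_line (\<lambda>z. h z * (bump a b z * u z)) = integral\<^sup>L half_line (\<lambda>z. \<bar>h z\<bar> * bump a b z)"
    by (rule Bochner_Integration.integral_cong) (auto simp: u_def sgn_if)
  moreover have "integrable half_line (\<lambda>z. \<bar>h z\<bar> * bump a b z)"
    using integrable_abs[OF hb] by (simp add: abs_mult bump_nonneg)
  moreover from this have "integral\<^sup>L half_line (\<lambda>z. \<bar>h z\<bar> * bump a b z) = 0 \<longleftrightarrow> (AE z in half_line. \<bar>h z\<bar> * bump a b z = 0)"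
    by (rule integral_nonneg_eq_0_iff_AE) (simp add: bump_nonneg)
  ultimately have "AE z in half_line. \<bar>h z\<bar> * bump a b z = 0" by simp
  then show ?thesis
    by eventually_elim (use bump_pos[of a _ b] in force)
qed

lemma fundamental_lemma:
  assumes h: "loc_int h" and z: "\<And>\<psi>. \<psi> \<in> test_functions \<Longrightarrow> integral\<^sup>L half_line (\<lambda>z. h z * \<psi> z) = 0"
  shows "AE z in half_line. h z = 0"
proof -
  define b where "b n = - (1 / real (Suc n))" for n
  have "AE z in half_line. b n - real (Suc n) < z \<longrightarrow> z < b n \<longrightarrow> h z = 0" for n
    by (rule fundamental_lemma_interval[OF h z]) (auto simp: b_def)
  then have "AE z in half_line. \<forall>n. b n - real (Suc n) < z \<longrightarrow> z < b n \<longrightarrow> h z = 0"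
    by (simp add: AE_all_countable)
  moreover have "AE z in half_line. z < 0" by (rule AE_I2) simp
  ultimately show ?thesis
  proof eventually_elim
    fix z :: real assume a: "\<forall>n. b n - real (Suc n) < z \<longrightarrow> z < b n \<longrightarrow> h z = 0" and z: "z < 0"
    obtain m where m: "1 / real (Suc m) < - z" using z nat_approx_posE[of "- z"] by auto
    obtain k where k: "- z < real k" using reals_Archimedean2 by blast
    define n where "n = max m k"
    have "1 / real (Suc n) \<le> 1 / real (Suc m)" by (simp add: n_def field_simps)
    then have "z < b n" using m by (simp add: b_def)
    moreover have "b n - real (Suc n) < z"
    proof -
      have "b n \<le> 0" "real k \<le> real (Suc n)" by (auto simp: b_def n_def)
      then show ?thesis using k by linarith
    qed
    ultimately show "h z = 0" using a by blast
  qed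
qed

text \<open>A test function of integral \<open>0\<close> is the derivative of a test function, and every test function has
  integral \<open>0\<close> after subtracting a multiple of the fixed function \<open>e0\<close> of integral \<open>1\<close>.\<close>

lemma du_bois_reymond:
  assumes k: "loc_int k" and z: "\<And>\<psi>. \<psi> \<in> test_functions \<Longrightarrow> integral\<^sup>L half_line (\<lambda>z. k z * deriv \<psi> z) = 0"
  shows "\<exists>C. AE z in half_line. k z = C"
proof -
  define I where "I = integral\<^sup>L half_line (bump (-2) (-1))"
  have bi: "integrable half_line (bump (-2) (-1))"
    using loc_int_mult_compact_support[OF loc_int_const[of 1] bump_continuous _ _ bump_zero, of "-1" "-2"] by simp
  have I: "I \<noteq> 0"
  proof
    assume "I = 0"
    then have "AE z in half_line. bump (-2) (-1) z = 0"
      unfolding I_def using bi by (subst (asm) integral_nonneg_eq_0_iff_AE) (auto simp: bump_nonneg)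
    then have "AE z in lebesgue. z < 0 \<longrightarrow> bump (-2) (-1) z = 0" by (subst (asm) AE_restrict_space_iff) auto
    then have "AE z in lborel. z < 0 \<longrightarrow> bump (-2) (-1) z = 0" by (simp add: AE_completion_iff)
    then have "AE z in lborel. z \<notin> {-2<..<-1::real}" by eventually_elim (use bump_pos[of "-2" _ "-1"] in fastforce)
    then have "emeasure lborel {-2<..<-1::real} = 0" by (subst (asm) AE_iff_measurable[of "{-2<..<-1}"]) auto
    then show False by simp
  qed
  define e0 where "e0 z = bump (-2) (-1) z / I" for z
  define C where "C = integral\<^sup>L half_line (\<lambda>z. k z * e0 z)"
  have e0c: "continuous_on UNIV e0" unfolding e0_def using I by (intro continuous_intros bump_continuous) auto
  have e0z: "z \<notin> {-2..-1} \<Longrightarrow> e0 z = 0" for z by (simp add: e0_def bump_zero)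
  have e0I: "integral\<^sup>L half_line e0 = 1" unfolding e0_def using I by (simp add: I_def)
  have e0i: "integrable half_line e0" unfolding e0_def using bi by simp
  have ke0: "integrable half_line (\<lambda>z. k z * e0 z)"
    by (rule loc_int_mult_compact_support[OF k e0c _ _ e0z]) auto
  have "AE z in half_line. k z - C = 0"
  proof (rule fundamental_lemma)
    show "loc_int (\<lambda>z. k z - C)" using loc_int_add[OF k loc_int_const[of "- C"]] by simp
    fix \<theta> assume "\<theta> \<in> test_functions"
    then obtain \<theta>' a b where t: "\<And>z. (\<theta> has_real_derivative \<theta>' z) (at z)" "b < 0" "a \<le> b" "\<And>z. z \<notin> {a..b} \<Longrightarrow> \<theta> z = 0"
      by (rule test_functionsE) blast
    have tc: "continuous_on UNIV \<theta>" using t(1) by (intro DERIV_continuous_on) (auto simp: has_field_derivative_at_within)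
    have ti: "integrable half_line \<theta>"
      using loc_int_mult_compact_support[OF loc_int_const[of 1] tc t(2,3,4)] by simp
    have kt: "integrable half_line (\<lambda>z. k z * \<theta> z)"
      by (rule loc_int_mult_compact_support[OF k tc t(2,3,4)])
    define J where "J = integral\<^sup>L half_line \<theta>"
    define \<omega> where "\<omega> z = \<theta> z - J * e0 z" for z
    have wc: "continuous_on UNIV \<omega>" unfolding \<omega>_def by (intro continuous_intros tc e0c)
    define a1 where "a1 = min a (-2)"
    define b1 where "b1 = max b (-1)"
    have ab1: "a1 \<le> b1" "b1 < 0" using t(2,3) by (auto simp: a1_def b1_def)
    have wz: "\<omega> z = 0" if "z \<notin> {a1..b1}" for z
    proof -
      have "z < a1 \<or> b1 < z" using that by auto
      then have "z \<notin> {a..b}" "z \<notin> {-2..-1}" by (auto simp: a1_def b1_def)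
      then show ?thesis using t(4)[of z] e0z[of z] by (simp add: \<omega>_def)
    qed
    have wi: "integrable half_line \<omega>" unfolding \<omega>_def using ti e0i by simp
    have wI: "integral\<^sup>L half_line \<omega> = 0" unfolding \<omega>_def using ti e0i e0I by (simp add: J_def)
    define \<psi> where "\<psi> z = integral {a1 - 1..z} \<omega>" for z
    have w0: "integral {a1 - 1..z} \<omega> = 0" if "z \<ge> b1" for z
    proof -
      have "integral {..<0} \<omega> = 0" using lebesgue_integral_eq_integral[OF wi] wI by simp
      then have "integral UNIV (\<lambda>x. if x \<in> {..<0} then \<omega> x else 0) = 0" by (simp only: integral_restrict_UNIV)
      moreover have "(\<lambda>x. if x \<in> {..<0} then \<omega> x else 0) = (\<lambda>x. if x \<in> {a1 - 1..z} then \<omega> x else 0)"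
        using wz ab1 that by (intro ext) (auto simp: not_le)
      ultimately show ?thesis by (simp only: integral_restrict_UNIV)
    qed
    have psd: "(\<psi> has_real_derivative \<omega> z) (at z)" for z
    proof (cases "z > a1 - 1")
      case True
      have "(\<psi> has_real_derivative \<omega> z) (at z within {a1 - 1..z + 1})"
        unfolding \<psi>_def using True by (intro integral_has_real_derivative continuous_on_subset[OF wc]) auto
      then show ?thesis using True at_within_Icc_at[of "a1 - 1" z "z + 1"] by simp
    next
      case False
      have "((\<lambda>_. 0) has_real_derivative \<omega> z) (at z)" using wz[of z] False by simp
      then show ?thesis
      proof (rule has_field_derivative_transform_within_open[of _ _ _ "{..<a1}"])
        fix x assume x: "x \<in> {..<a1}"
        have "integral {a1 - 1..x} \<omega> = integral {a1 - 1..x} (\<lambda>_. 0)"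
          by (rule Henstock_Kurzweil_Integration.integral_cong) (use wz x in auto)
        then show "0 = \<psi> x" by (simp add: \<psi>_def)
      qed (use False in auto)
    qed
    have "\<psi> \<in> test_functions"
    proof (rule test_functionsI[OF psd wc ab1(2)])
      fix z assume "z \<notin> {a1 - 1..b1}"
      then consider "z < a1 - 1" | "z \<ge> b1" by fastforce
      then show "\<psi> z = 0" by cases (auto simp: \<psi>_def w0)
    qed
    moreover have "deriv \<psi> = \<omega>" using psd DERIV_imp_deriv by blast
    ultimately have "integral\<^sup>L half_line (\<lambda>s. k s * \<omega> s) = 0" using z by metis
    moreover have "(\<lambda>s. k s * \<omega> s) = (\<lambda>s. k s * \<theta> s - J * (k s * e0 s))" by (auto simp: \<omega>_def algebra_simps)
    ultimately have "integral\<^sup>L half_line (\<lambda>s. k s * \<theta> s) = J * C" using kt ke0 by (simp add: C_def)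
    moreover have "(\<lambda>s. (k s - C) * \<theta> s) = (\<lambda>s. k s * \<theta> s - C * \<theta> s)" by (auto simp: algebra_simps)
    ultimately show "integral\<^sup>L half_line (\<lambda>s. (k s - C) * \<theta> s) = 0" using kt ti by (simp add: J_def)
  qed
  then show ?thesis by (intro exI[of _ C]) (auto elim: eventually_mono)
qed

lemma test_L2:
  assumes "\<psi> \<in> test_functions" shows "\<psi> \<in> L2" "deriv \<psi> \<in> L2" "\<psi> 0 = 0" "ac \<psi> (deriv \<psi>)"
proof -
  obtain \<psi>' a b where t: "\<And>z. (\<psi> has_real_derivative \<psi>' z) (at z)" "continuous_on UNIV \<psi>'" "deriv \<psi> = \<psi>'" "b < 0" "a \<le> b"
    "\<And>z. z \<notin> {a..b} \<Longrightarrow> \<psi> z = 0" "\<And>z. z \<notin> {a..b} \<Longrightarrow> \<psi>' z = 0"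
    using test_functionsE[OF assms] by metis
  have c: "continuous_on UNIV \<psi>" using t(1) by (intro DERIV_continuous_on) (auto simp: has_field_derivative_at_within)
  show "\<psi> \<in> L2" by (rule compact_support_L2[OF c t(4-6)])
  show "deriv \<psi> \<in> L2" unfolding t(3) by (rule compact_support_L2[OF t(2,4,5,7)])
  show "\<psi> 0 = 0" using t(4) by (intro t(6)) auto
  show "ac \<psi> (deriv \<psi>)" unfolding t(3)
    using t(1) by (intro ac_C1 continuous_on_subset[OF t(2)]) (auto simp: has_field_derivative_at_within)
qed

lemma weak_deriv_unique:
  assumes "g \<in> L2" "g' \<in> L2" "has_weak_deriv f g" "has_weak_deriv f g'"
  shows "AE z in half_line. g z = g' z"
proof -
  have "AE z in half_line. g z - g' z = 0"
  proof (rule fundamental_lemma)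
    show "loc_int (\<lambda>z. g z - g' z)" by (intro L2_loc_int L2_diff assms)
    fix \<psi> assume p: "\<psi> \<in> test_functions"
    have "integral\<^sup>L half_line (\<lambda>z. g z * \<psi> z) = integral\<^sup>L half_line (\<lambda>z. g' z * \<psi> z)"
      using assms(3,4) p unfolding has_weak_deriv_def by fastforce
    then show "integral\<^sup>L half_line (\<lambda>z. (g z - g' z) * \<psi> z) = 0"
      using L2_mult_integrable[OF assms(1) test_L2(1)[OF p]] L2_mult_integrable[OF assms(2) test_L2(1)[OF p]]
      by (simp add: left_diff_distrib)
  qed
  then show ?thesis by (auto elim: eventually_mono)
qed

lemma ac_imp_weak:
  assumes fg: "ac f g"
  shows "has_weak_deriv f g"
  unfolding has_weak_deriv_def
proof
  fix \<psi> assume p: "\<psi> \<in> test_functions"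
  obtain \<psi>' a b where t: "\<And>z. (\<psi> has_real_derivative \<psi>' z) (at z)" "continuous_on UNIV \<psi>'" "deriv \<psi> = \<psi>'" "b < 0" "a \<le> b"
    "\<And>z. z \<notin> {a..b} \<Longrightarrow> \<psi> z = 0" "\<And>z. z \<notin> {a..b} \<Longrightarrow> \<psi>' z = 0"
    using test_functionsE[OF p] by metis
  have c: "continuous_on UNIV \<psi>" using t(1) by (intro DERIV_continuous_on) (auto simp: has_field_derivative_at_within)
  have f: "loc_int f" and g: "loc_int g" using fg by (auto simp: ac_def loc_int_continuous)
  define P where "P z = f z * \<psi>' z + g z * \<psi> z" for z
  have "ac (\<lambda>z. f z * \<psi> z) P" unfolding P_def using ac_mult[OF fg test_L2(4)[OF p]] by (simp add: t(3))
  then have eq: "f (a - 1) * \<psi> (a - 1) = f 0 * \<psi> 0 - integral\<^sup>L half_line (cutl (a - 1) P)"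
    by (rule acD) (use t(4,5) in simp)
  have "cutl (a - 1) P = P" by (rule vanishing_cutl[of _ b]) (use t(6,7) in \<open>auto simp: P_def\<close>)
  moreover have "\<psi> (a - 1) = 0" "\<psi> 0 = 0" using t(4,5) by (auto intro!: t(6))
  ultimately have "integral\<^sup>L half_line P = 0" using eq by simp
  moreover have "integrable half_line (\<lambda>z. f z * \<psi>' z)" by (rule loc_int_mult_compact_support[OF f t(2,4,5,7)])
  moreover have "integrable half_line (\<lambda>z. g z * \<psi> z)" by (rule loc_int_mult_compact_support[OF g c t(4-6)])
  ultimately show "integral\<^sup>L half_line (\<lambda>z. f z * deriv \<psi> z) = - integral\<^sup>L half_line (\<lambda>z. g z * \<psi> z)"
    by (simp add: P_def[abs_def] t(3))
qed

text \<open>The mass of \<open>g\<^sup>2\<close> to the left of \<open>z\<close>. Pointwise estimates in terms of tails give the supremum bound and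
  the limit \<open>0\<close> at \<open>-\<infinity>\<close> at the same time.\<close>

definition tail :: "(real \<Rightarrow> real) \<Rightarrow> real \<Rightarrow> real" where
  "tail g z = integral\<^sup>L half_line (\<lambda>s. if s < z then (g s)\<^sup>2 else 0)"

lemma tail_integrable: "g \<in> L2 \<Longrightarrow> integrable half_line (\<lambda>s. if s < z then (g s)\<^sup>2 else 0)"
  by (rule Bochner_Integration.integrable_bound[OF L2_integrable[of g]]) auto

lemma tail_mono: "g \<in> L2 \<Longrightarrow> y \<le> z \<Longrightarrow> tail g y \<le> tail g z"
  unfolding tail_def by (intro integral_mono tail_integrable) auto

lemma tail_le: "g \<in> L2 \<Longrightarrow> tail g z \<le> (norm (cls g))\<^sup>2"
proof -
  assume g: "g \<in> L2"
  have "tail g z \<le> integral\<^sup>L half_line (\<lambda>s. (g s)\<^sup>2)"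
    unfolding tail_def by (intro integral_mono tail_integrable g L2_integrable) auto
  also have "\<dots> = inner (cls g) (cls g)" by (simp only: inner_cls[OF g g] power2_eq_square)
  finally show ?thesis by (simp add: power2_norm_eq_inner)
qed

lemma tail_nonneg: "tail g z \<ge> 0" by (simp add: tail_def)

lemma tail_tendsto: assumes g: "g \<in> L2" shows "(tail g \<longlongrightarrow> 0) at_bot"
proof (rule tendstoI)
  fix e :: real assume e: "e > 0"
  have "(\<lambda>n. tail g (- real n)) \<longlonglongrightarrow> integral\<^sup>L half_line (\<lambda>s. 0)"
    unfolding tail_def
  proof (rule integral_dominated_convergence[where w = "\<lambda>s. (g s)\<^sup>2"])
    show "AE s in half_line. (\<lambda>n. if s < - real n then (g s)\<^sup>2 else 0) \<longlonglongrightarrow> 0"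
    proof (rule AE_I2)
      fix s :: real
      obtain N where N: "- s < real N" using reals_Archimedean2 by blast
      have "\<forall>\<^sub>F n in sequentially. 0 = (if s < - real n then (g s)\<^sup>2 else 0)"
        using eventually_ge_at_top[of N]
      proof eventually_elim
        fix n assume "N \<le> n"
        then have "real N \<le> real n" by simp
        then show "0 = (if s < - real n then (g s)\<^sup>2 else 0)" using N by auto
      qed
      then show "(\<lambda>n. if s < - real n then (g s)\<^sup>2 else 0) \<longlonglongrightarrow> 0"
        by (rule Lim_transform_eventually[OF tendsto_const])
    qed
  qed (use g in \<open>auto simp: L2_integrable tail_integrable borel_measurable_integrable\<close>)
  then have "\<forall>\<^sub>F n in sequentially. tail g (- real n) < e" using e by (intro order_tendstoD) auto
  then obtain n where "tail g (- real n) < e" using eventually_happens'[OF sequentially_bot] by blast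
  then have "\<forall>z\<le>- real n. dist (tail g z) 0 < e"
    using tail_mono[OF g] tail_nonneg[of g] by (auto simp: abs_of_nonneg) (meson le_less_trans)
  then show "\<forall>\<^sub>F z in at_bot. dist (tail g z) 0 < e" unfolding eventually_at_bot_linorder by blast
qed

lemma interval_indicator_L2:
  assumes "x \<le> y" "y \<le> 0"
  shows "(indicator {x..<y} :: real \<Rightarrow> real) \<in> L2"
    "integral\<^sup>L half_line (indicator {x..<y} :: real \<Rightarrow> real) = y - x"
proof -
  have m: "{x..<y} \<in> sets half_line" using sets_half_line[of "{x..<y}"] assms by (simp add: Int_absorb2 subset_iff)
  have e: "emeasure half_line {x..<y} = ennreal (y - x)"
    using assms by (subst emeasure_restrict_space) auto
  have i: "integrable half_line (indicator {x..<y} :: real \<Rightarrow> real)"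
    using m e by (intro integrable_real_indicator) auto
  have "(\<lambda>z. (indicator {x..<y} z :: real)\<^sup>2) = indicator {x..<y}" by (auto simp: indicator_def)
  then show "indicator {x..<y} \<in> L2" using i by (simp add: L2_def borel_measurable_integrable)
  show "integral\<^sup>L half_line (indicator {x..<y} :: real \<Rightarrow> real) = y - x"
  proof -
    have "{x..<y} \<inter> {..<0} = {x..<y}" using assms by auto
    then show ?thesis using e assms by (simp add: measure_def)
  qed
qed

lemma primitive_holder:
  assumes g: "g \<in> L2" and xy: "x \<le> y" "y \<le> 0"
  shows "\<bar>integral\<^sup>L half_line (cutl x g) - integral\<^sup>L half_line (cutl y g)\<bar> \<le> sqrt (y - x) * sqrt (tail g y)"
proof -
  define h where "h s = (if s < y then g s else 0)" for s
  have "h \<in> borel_measurable half_line" unfolding h_def[abs_def] using L2_measurable[OF g] by measurable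
  then have hL: "h \<in> L2"
    by (intro L2_dominated[OF g, of _ 1]) (use g in \<open>auto simp: h_def\<close>)
  note iL = interval_indicator_L2[OF xy]
  have li: "loc_int g" by (rule L2_loc_int[OF g])
  have "integral\<^sup>L half_line (cutl x g) - integral\<^sup>L half_line (cutl y g) = integral\<^sup>L half_line (\<lambda>s. cutl x g s - cutl y g s)"
    using li xy by (simp add: loc_int_def)
  also have "\<dots> = integral\<^sup>L half_line (\<lambda>s. indicator {x..<y} s * h s)"
    by (rule Bochner_Integration.integral_cong) (use xy in \<open>auto simp: cutl_def h_def indicator_def\<close>)
  also have "\<dots> = inner (cls (indicator {x..<y})) (cls h)" by (simp add: inner_cls iL hL)
  also have "\<bar>\<dots>\<bar> \<le> norm (cls (indicator {x..<y})) * norm (cls h)" by (rule Cauchy_Schwarz_ineq2)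
  also have "norm (cls (indicator {x..<y})) = sqrt (y - x)"
  proof -
    have "(\<lambda>z. (indicator {x..<y} z :: real)\<^sup>2) = indicator {x..<y}" by (auto simp: indicator_def)
    then show ?thesis using iL by (simp add: norm_cls L2_norm_def)
  qed
  also have "norm (cls h) = sqrt (tail g y)"
  proof -
    have "(\<lambda>s. (h s)\<^sup>2) = (\<lambda>s. if s < y then (g s)\<^sup>2 else 0)" by (auto simp: h_def)
    then show ?thesis by (simp add: norm_cls hL L2_norm_def tail_def)
  qed
  finally show ?thesis .
qed

lemma primitive_ac:
  assumes g: "g \<in> L2"
  shows "ac (\<lambda>z. K - integral\<^sup>L half_line (cutl z g)) g"
  unfolding ac_def
proof (intro conjI allI impI)
  define P where "P z = integral\<^sup>L half_line (cutl z g)" for z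
  define B where "B = norm (cls g)"
  have hol: "\<bar>P x - P y\<bar> \<le> sqrt \<bar>y - x\<bar> * B" if "x \<le> 0" "y \<le> 0" for x y
  proof -
    have *: "\<bar>P x - P y\<bar> \<le> sqrt (y - x) * B" if "x \<le> y" "y \<le> 0" for x y
    proof -
      have "\<bar>P x - P y\<bar> \<le> sqrt (y - x) * sqrt (tail g y)" unfolding P_def by (rule primitive_holder[OF g that])
      also have "\<dots> \<le> sqrt (y - x) * B"
        using tail_le[OF g, of y] that by (intro mult_left_mono) (auto simp: B_def real_le_lsqrt)
      finally show ?thesis .
    qed
    show ?thesis using *[of x y] *[of y x] that by (cases "x \<le> y") (auto simp: abs_minus_commute)
  qed
  have "continuous_on {..0} P"
    unfolding continuous_on_def
  proof
    fix x :: real assume x: "x \<in> {..0}"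
    have "((\<lambda>y. P y - P x) \<longlongrightarrow> 0) (at x within {..0})"
    proof (rule Lim_null_comparison)
      show "\<forall>\<^sub>F y in at x within {..0}. norm (P y - P x) \<le> sqrt \<bar>x - y\<bar> * B"
        using x hol by (auto simp: eventually_at_filter)
      have "((\<lambda>y. sqrt \<bar>x - y\<bar> * B) \<longlongrightarrow> sqrt \<bar>x - x\<bar> * B) (at x within {..0})" by (intro tendsto_intros)
      then show "((\<lambda>y. sqrt \<bar>x - y\<bar> * B) \<longlongrightarrow> 0) (at x within {..0})" by simp
    qed
    then show "(P \<longlongrightarrow> P x) (at x within {..0})" by (rule LIM_zero_cancel)
  qed
  then show "continuous_on {..0} (\<lambda>z. K - integral\<^sup>L half_line (cutl z g))"
    unfolding P_def by (intro continuous_intros)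
  show "loc_int g" by (rule L2_loc_int[OF g])
  have "integral\<^sup>L half_line (cutl 0 g) = integral\<^sup>L half_line (\<lambda>_. 0)"
    by (rule Bochner_Integration.integral_cong) (auto simp: cutl_def)
  then show "K - integral\<^sup>L half_line (cutl z g) = K - integral\<^sup>L half_line (cutl 0 g) - integral\<^sup>L half_line (cutl z g)" for z
    by simp
qed

text \<open>The difference of \<open>f\<close> and the primitive of \<open>g\<close> has weak derivative \<open>0\<close>, hence is constant.\<close>

lemma weak_imp_AE_ac:
  assumes f: "loc_int f" and g: "g \<in> L2" and w: "has_weak_deriv f g"
  shows "\<exists>F. ac F g \<and> (AE z in half_line. f z = F z)"
proof -
  define P where "P z = 0 - integral\<^sup>L half_line (cutl z g)" for z
  have P: "ac P g" unfolding P_def by (rule primitive_ac[OF g])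
  have Pl: "loc_int P" using P by (auto simp: ac_def loc_int_continuous)
  have "\<exists>C. AE z in half_line. f z - P z = C"
  proof (rule du_bois_reymond)
    show "loc_int (\<lambda>z. f z - P z)" using loc_int_add[OF f loc_int_scale[OF Pl, of "-1"]] by simp
    fix \<psi> assume p: "\<psi> \<in> test_functions"
    obtain \<psi>' a b where t: "continuous_on UNIV \<psi>'" "deriv \<psi> = \<psi>'" "b < 0" "a \<le> b" "\<And>z. z \<notin> {a..b} \<Longrightarrow> \<psi>' z = 0"
      using test_functionsE[OF p] by metis
    have "integrable half_line (\<lambda>z. f z * deriv \<psi> z)" "integrable half_line (\<lambda>z. P z * deriv \<psi> z)"
      unfolding t(2) by (intro loc_int_mult_compact_support[OF _ t(1,3,4,5)] f Pl; simp)+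
    moreover have "integral\<^sup>L half_line (\<lambda>z. f z * deriv \<psi> z) = integral\<^sup>L half_line (\<lambda>z. P z * deriv \<psi> z)"
      using w ac_imp_weak[OF P] p unfolding has_weak_deriv_def by fastforce
    ultimately show "integral\<^sup>L half_line (\<lambda>z. (f z - P z) * deriv \<psi> z) = 0" by (simp add: left_diff_distrib)
  qed
  then obtain C where C: "AE z in half_line. f z - P z = C" by blast
  have "ac (\<lambda>z. C - integral\<^sup>L half_line (cutl z g)) g" by (rule primitive_ac[OF g])
  moreover have "AE z in half_line. f z = C - integral\<^sup>L half_line (cutl z g)"
    using C by eventually_elim (simp add: P_def)
  ultimately show ?thesis by blast
qed

lemma continuous_AE_eq:
  assumes f: "continuous_on {..0} f" and g: "continuous_on {..0} (g :: real \<Rightarrow> real)"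
    and eq: "AE z in half_line. f z = g z" and z: "z \<le> 0"
  shows "f z = g z"
proof -
  define h where "h z = f z - g z" for z
  have hc: "continuous_on {..0} h" unfolding h_def by (intro continuous_intros f g)
  define U where "U = h -` (- {0}) \<inter> {..<0}"
  have "open U" unfolding U_def Int_commute[of "h -` _"]
    by (intro continuous_open_preimage[OF continuous_on_subset[OF hc]] ) auto
  have "AE z in lebesgue. z < 0 \<longrightarrow> f z = g z" using eq by (subst (asm) AE_restrict_space_iff) auto
  then have "AE z in lebesgue. z \<notin> U" by eventually_elim (auto simp: U_def h_def)
  then have "U \<in> null_sets lebesgue"
    using \<open>open U\<close> by (subst (asm) AE_iff_null_sets[symmetric]) (auto simp: borel_open sets_completionI_sets)
  then have "negligible U" by (simp add: negligible_iff_null_sets)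
  then have "U = {}" using open_not_negligible \<open>open U\<close> by blast
  then have h0: "z < 0 \<Longrightarrow> h z = 0" for z unfolding U_def by auto
  have "h 0 = 0"
  proof (rule tendsto_unique)
    show "(h \<longlongrightarrow> h 0) (at_left 0)" using hc unfolding continuous_on_def by (auto intro: tendsto_within_subset)
    have "\<forall>\<^sub>F z in at_left (0::real). 0 = h z" using h0 by (auto simp: eventually_at_filter)
    then show "(h \<longlongrightarrow> 0) (at_left 0)" by (rule Lim_transform_eventually[OF tendsto_const])
  qed simp
  then show ?thesis using h0[of z] z by (cases "z = 0") (auto simp: h_def)
qed

lemma ac_eqI: "ac f g \<Longrightarrow> continuous_on {..0} h \<Longrightarrow> (\<And>z. z \<le> 0 \<Longrightarrow> f z = h z) \<Longrightarrow> ac h g"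
  unfolding ac_def by (metis order_refl)

lemma H1_weak_imp_ac:
  assumes f: "continuous_on {..0} f" and g: "g \<in> L2" and w: "has_weak_deriv f g"
  shows "ac f g"
proof -
  obtain F where F: "ac F g" "AE z in half_line. f z = F z"
    using weak_imp_AE_ac[OF loc_int_continuous[OF f] g w] by blast
  have "f z = F z" if "z \<le> 0" for z
    using continuous_AE_eq[OF f ac_continuous[OF F(1)] F(2) that] .
  then show ?thesis using ac_eqI[OF F(1) f] by simp
qed

lemma H1_iff: "f \<in> H1 \<longleftrightarrow> f \<in> L2 \<and> (\<exists>g\<in>L2. ac f g)"
  unfolding H1_def using H1_weak_imp_ac ac_imp_weak ac_continuous by blast

lemma weak_deriv_AE:
  assumes "ac f g" "g \<in> L2"
  shows "weak_deriv f \<in> L2" "AE z in half_line. weak_deriv f z = g z"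
proof -
  have "\<exists>g. g \<in> L2 \<and> has_weak_deriv f g" using assms ac_imp_weak by blast
  from someI_ex[OF this] have w: "weak_deriv f \<in> L2" "has_weak_deriv f (weak_deriv f)" unfolding weak_deriv_def by auto
  show "weak_deriv f \<in> L2" by fact
  show "AE z in half_line. weak_deriv f z = g z"
    by (rule weak_deriv_unique[OF w(1) assms(2) w(2) ac_imp_weak[OF assms(1)]])
qed

subsection \<open>Pointwise bounds and integration by parts\<close>

text \<open>Average \<open>f z = f s + (f z - f s)\<close> over \<open>s\<close> in \<open>{z - 1..<z}\<close> and bound the increment by
  Cauchy-Schwarz.\<close>

lemma ac_pointwise:
  assumes fg: "ac f g" and f: "f \<in> L2" and g: "g \<in> L2" and z: "z \<le> 0"
  shows "(f z)\<^sup>2 \<le> 2 * tail f z + 2 * tail g z"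
proof -
  have i: "(indicator {z - 1..<z} :: real \<Rightarrow> real) \<in> L2" "integral\<^sup>L half_line (indicator {z - 1..<z} :: real \<Rightarrow> real) = z - (z - 1)"
    by (rule interval_indicator_L2; use z in simp)+
  have ii: "integrable half_line (indicator {z - 1..<z} :: real \<Rightarrow> real)"
    using L2_integrable[OF i(1)] by (rule back_subst[of "integrable half_line"]) (auto simp: indicator_def)
  have le: "indicator {z - 1..<z} s * ((f z)\<^sup>2 - 2 * tail g z) \<le> 2 * (if s < z then (f s)\<^sup>2 else 0)" for s
  proof (cases "s \<in> {z - 1..<z}")
    case True
    have "s \<le> 0" using True z by simp
    have "f z - f s = (f 0 - integral\<^sup>L half_line (cutl z g)) - (f 0 - integral\<^sup>L half_line (cutl s g))"
      using acD[OF fg z] acD[OF fg \<open>s \<le> 0\<close>] by (simp only:)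
    then have "f z - f s = integral\<^sup>L half_line (cutl s g) - integral\<^sup>L half_line (cutl z g)" by simp
    then have "\<bar>f z - f s\<bar> \<le> sqrt (z - s) * sqrt (tail g z)" using primitive_holder[OF g, of s z] True z by auto
    also have "\<dots> \<le> 1 * sqrt (tail g z)" using True by (intro mult_right_mono) (auto simp: tail_nonneg)
    finally have "\<bar>f z - f s\<bar>\<^sup>2 \<le> (sqrt (tail g z))\<^sup>2" by (intro power_mono) auto
    then have "(f z - f s)\<^sup>2 \<le> tail g z" by (simp add: tail_nonneg)
    moreover have "(f z)\<^sup>2 \<le> 2 * (f s)\<^sup>2 + 2 * (f z - f s)\<^sup>2"
      using zero_le_power2[of "2 * f s - f z"] by (simp add: power2_eq_square algebra_simps)
    ultimately show ?thesis using True by simp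
  qed auto
  have "(f z)\<^sup>2 - 2 * tail g z = integral\<^sup>L half_line (\<lambda>s. indicator {z - 1..<z} s * ((f z)\<^sup>2 - 2 * tail g z))"
    by (simp only: integral_mult_left_zero i) simp
  also have "\<dots> \<le> integral\<^sup>L half_line (\<lambda>s. 2 * (if s < z then (f s)\<^sup>2 else 0))"
    using ii tail_integrable[OF f] le by (intro integral_mono) auto
  also have "\<dots> = 2 * tail f z" by (simp add: tail_def)
  finally show ?thesis by simp
qed

lemma ac_sup_bound:
  assumes fg: "ac f g" and f: "f \<in> L2" and g: "g \<in> L2" and z: "z \<le> 0"
  shows "(f z)\<^sup>2 \<le> 2 * ((norm (cls f))\<^sup>2 + (norm (cls g))\<^sup>2)"
proof -
  have "2 * tail f z + 2 * tail g z \<le> 2 * (norm (cls f))\<^sup>2 + 2 * (norm (cls g))\<^sup>2"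
    by (intro add_mono mult_left_mono tail_le f g) auto
  then show ?thesis using ac_pointwise[OF assms] by (simp add: distrib_left)
qed

lemma ac_tendsto_0:
  assumes fg: "ac f g" and f: "f \<in> L2" and g: "g \<in> L2"
  shows "(f \<longlongrightarrow> 0) at_bot"
proof -
  have "((\<lambda>z. (f z)\<^sup>2) \<longlongrightarrow> 0) at_bot"
  proof (rule tendsto_sandwich[of "\<lambda>_. 0" _ _ "\<lambda>z. 2 * tail f z + 2 * tail g z"])
    show "\<forall>\<^sub>F z in at_bot. (f z)\<^sup>2 \<le> 2 * tail f z + 2 * tail g z"
      using eventually_le_at_bot[of 0] by eventually_elim (rule ac_pointwise[OF fg f g])
    have "((\<lambda>z. 2 * tail f z + 2 * tail g z) \<longlongrightarrow> 2 * 0 + 2 * 0) at_bot" by (intro tendsto_intros tail_tendsto f g)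
    then show "((\<lambda>z. 2 * tail f z + 2 * tail g z) \<longlongrightarrow> 0) at_bot" by simp
  qed auto
  then have "((\<lambda>z. sqrt ((f z)\<^sup>2)) \<longlongrightarrow> sqrt 0) at_bot" by (intro tendsto_intros)
  then show ?thesis by (simp add: tendsto_rabs_zero_iff)
qed

lemma integration_by_parts:
  assumes fg: "ac f g" "f \<in> L2" "g \<in> L2" and hk: "ac h k" "h \<in> L2" "k \<in> L2"
  shows "integral\<^sup>L half_line (\<lambda>z. f z * k z) + integral\<^sup>L half_line (\<lambda>z. g z * h z) = f 0 * h 0"
proof -
  define p where "p z = f z * k z + g z * h z" for z
  have p: "ac (\<lambda>z. f z * h z) p" unfolding p_def by (rule ac_mult[OF fg(1) hk(1)])
  have pi: "integrable half_line p" unfolding p_def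
    by (intro Bochner_Integration.integrable_add L2_mult_integrable fg hk)
  have neg: "filterlim (\<lambda>n. - real n) at_bot sequentially"
    by (rule filterlim_compose[OF filterlim_uminus_at_bot_at_top filterlim_real_sequentially])
  have "(\<lambda>n. f (- real n) * h (- real n)) \<longlonglongrightarrow> 0 * 0"
    by (intro tendsto_mult filterlim_compose[OF ac_tendsto_0[OF fg] neg] filterlim_compose[OF ac_tendsto_0[OF hk] neg])
  moreover have "f (- real n) * h (- real n) = f 0 * h 0 - integral\<^sup>L half_line (cutl (- real n) p)" for n
    using acD[OF p, of "- real n"] by simp
  moreover have "(\<lambda>n. integral\<^sup>L half_line (cutl (- real n) p)) \<longlonglongrightarrow> integral\<^sup>L half_line p"
  proof (rule integral_dominated_convergence[where w = "\<lambda>s. \<bar>p s\<bar>"])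
    show "AE s in half_line. (\<lambda>n. cutl (- real n) p s) \<longlonglongrightarrow> p s"
    proof (rule AE_I2)
      fix s :: real
      obtain N where N: "- s < real N" using reals_Archimedean2 by blast
      have "\<forall>\<^sub>F n in sequentially. p s = cutl (- real n) p s"
        using eventually_ge_at_top[of N]
      proof eventually_elim
        fix n assume "N \<le> n"
        then have "real N \<le> real n" by simp
        then show "p s = cutl (- real n) p s" using N by (auto simp: cutl_def)
      qed
      then show "(\<lambda>n. cutl (- real n) p s) \<longlonglongrightarrow> p s" by (rule Lim_transform_eventually[OF tendsto_const])
    qed
  qed (use pi in \<open>auto simp: cutl_def[abs_def] borel_measurable_integrable intro!: cutl_measurable[unfolded cutl_def]\<close>)
  ultimately have "(\<lambda>n. f 0 * h 0 - integral\<^sup>L half_line (cutl (- real n) p)) \<longlonglongrightarrow> 0"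
    and "(\<lambda>n. f 0 * h 0 - integral\<^sup>L half_line (cutl (- real n) p)) \<longlonglongrightarrow> f 0 * h 0 - integral\<^sup>L half_line p"
    by (auto intro!: tendsto_intros)
  then have "f 0 * h 0 - integral\<^sup>L half_line p = 0" using LIMSEQ_unique by blast
  then show ?thesis unfolding p_def using fg hk by (simp add: L2_mult_integrable)
qed


section \<open>The linear operator on the half-line\<close>

lemma has_weak_deriv_cong:
  assumes "f \<in> borel_measurable half_line" "f' \<in> borel_measurable half_line" "AE z in half_line. f z = f' z"
  shows "has_weak_deriv f g \<longleftrightarrow> has_weak_deriv f' g"
proof -
  have "integral\<^sup>L half_line (\<lambda>z. f z * deriv \<psi> z) = integral\<^sup>L half_line (\<lambda>z. f' z * deriv \<psi> z)" if "\<psi> \<in> test_functions" for \<psi>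
  proof (rule integral_cong_AE)
    have m: "deriv \<psi> \<in> borel_measurable half_line" by (rule L2_measurable[OF test_L2(2)[OF that]])
    show "(\<lambda>z. f z * deriv \<psi> z) \<in> borel_measurable half_line" "(\<lambda>z. f' z * deriv \<psi> z) \<in> borel_measurable half_line"
      using assms(1,2) m by measurable
    show "AE z in half_line. f z * deriv \<psi> z = f' z * deriv \<psi> z" using assms(3) by eventually_elim simp
  qed
  then show ?thesis unfolding has_weak_deriv_def by auto
qed

lemma weak_deriv_cong:
  assumes "f \<in> borel_measurable half_line" "f' \<in> borel_measurable half_line" "AE z in half_line. f z = f' z"
  shows "weak_deriv f = weak_deriv f'"
  unfolding weak_deriv_def using has_weak_deriv_cong[OF assms] by simp

lemma ac_cong_AE:
  assumes fg: "ac f g" and g': "g' \<in> borel_measurable half_line" and eq: "AE z in half_line. g z = g' z"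
  shows "ac f g'"
proof -
  have gm: "g \<in> borel_measurable half_line" using fg by (auto simp: ac_def loc_int_def)
  have c: "AE s in half_line. cutl z g s = cutl z g' s" for z using eq by eventually_elim (simp add: cutl_def)
  have "loc_int g'" unfolding loc_int_def
  proof (intro conjI allI impI g')
    fix z :: real assume "z \<le> 0"
    then have "integrable half_line (cutl z g)" using fg by (auto simp: ac_def loc_int_def)
    then show "integrable half_line (cutl z g')" by (rule integrable_cong_AE_imp) (use g' c in \<open>auto elim: eventually_mono\<close>)
  qed
  moreover have "integral\<^sup>L half_line (cutl z g) = integral\<^sup>L half_line (cutl z g')" for z
    by (rule integral_cong_AE) (use gm g' c in auto)
  ultimately show ?thesis using ac_continuous[OF fg] acD[OF fg] unfolding ac_def by presburger
qed

text \<open>\<open>H1_0\<close> and the weak derivative as objects on \<open>L2h\<close>.\<close>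

definition Vsp :: "L2h set" where "Vsp = cls ` H1_0"

definition Dw :: "L2h \<Rightarrow> L2h" where "Dw x = cls (weak_deriv (rep x))"

lemma Vsp_I: "ac f g \<Longrightarrow> f \<in> L2 \<Longrightarrow> g \<in> L2 \<Longrightarrow> f 0 = 0 \<Longrightarrow> cls f \<in> Vsp"
  unfolding Vsp_def H1_0_def by (auto simp: H1_iff)

lemma Dw_cls:
  assumes "ac f g" "f \<in> L2" "g \<in> L2" shows "Dw (cls f) = cls g"
proof -
  have "weak_deriv (rep (cls f)) = weak_deriv f"
    by (rule weak_deriv_cong[OF rep_measurable L2_measurable[OF assms(2)] rep_cls[OF assms(2)]])
  then show ?thesis unfolding Dw_def using weak_deriv_AE[OF assms(1,3)] assms(3) by (auto intro: cls_eqI)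
qed

lemma Vsp_E:
  assumes "x \<in> Vsp"
  obtains f g where "ac f g" "f \<in> L2" "g \<in> L2" "f 0 = 0" "x = cls f" "Dw x = cls g"
proof -
  obtain f where f: "f \<in> H1" "f 0 = 0" "x = cls f" using assms unfolding Vsp_def H1_0_def by auto
  obtain g where "ac f g" "f \<in> L2" "g \<in> L2" using f(1) H1_iff by auto
  then show ?thesis using that[of f g] f Dw_cls[of f g] by simp
qed

lemma H1_norm_eq:
  assumes "ac f g" "f \<in> L2" "g \<in> L2"
  shows "H1_norm f = sqrt ((norm (cls f))\<^sup>2 + (norm (cls g))\<^sup>2)"
proof -
  have "L2_norm (weak_deriv f) = norm (cls g)"
    using norm_cls[OF weak_deriv_AE(1)[OF assms(1,3)]] cls_eqI[OF weak_deriv_AE(1)[OF assms(1,3)] assms(3) weak_deriv_AE(2)[OF assms(1,3)]]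
    by simp
  then show ?thesis by (simp add: H1_norm_def norm_cls assms(2))
qed

lemma Vsp_subspace: "subspace Vsp"
proof (rule subspaceI)
  have "ac (\<lambda>_. 0) (\<lambda>_. 0)" by (rule ac_C1) auto
  then show "0 \<in> Vsp" unfolding zero_L2h_def by (rule Vsp_I[OF _ L2_zero L2_zero]) simp
next
  fix x y assume "x \<in> Vsp" "y \<in> Vsp"
  then obtain f g h k where a: "ac f g" "f \<in> L2" "g \<in> L2" "f 0 = 0" "x = cls f" "ac h k" "h \<in> L2" "k \<in> L2" "h 0 = 0" "y = cls h"
    by (metis Vsp_E)
  then show "x + y \<in> Vsp" using Vsp_I[OF ac_add[OF a(1,6)] L2_add[OF a(2,7)] L2_add[OF a(3,8)]] by (simp add: cls_add)
next
  fix r :: real and x assume "x \<in> Vsp"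
  then obtain f g where a: "ac f g" "f \<in> L2" "g \<in> L2" "f 0 = 0" "x = cls f" by (metis Vsp_E)
  then show "r *\<^sub>R x \<in> Vsp" using Vsp_I[OF ac_scale[OF a(1)] L2_scale[OF a(2)] L2_scale[OF a(3)], of r] by (simp add: cls_scale)
qed

lemma Dw_add: assumes "x \<in> Vsp" "y \<in> Vsp" shows "Dw (x + y) = Dw x + Dw y"
proof -
  obtain f g where a: "ac f g" "f \<in> L2" "g \<in> L2" "f 0 = 0" "x = cls f" "Dw x = cls g" using Vsp_E[OF assms(1)] .
  obtain h k where b: "ac h k" "h \<in> L2" "k \<in> L2" "h 0 = 0" "y = cls h" "Dw y = cls k" using Vsp_E[OF assms(2)] .
  show ?thesis using Dw_cls[OF ac_add[OF a(1) b(1)] L2_add[OF a(2) b(2)] L2_add[OF a(3) b(3)]] a b by (simp add: cls_add)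
qed

lemma Dw_scale: assumes "x \<in> Vsp" shows "Dw (r *\<^sub>R x) = r *\<^sub>R Dw x"
proof -
  obtain f g where a: "ac f g" "f \<in> L2" "g \<in> L2" "f 0 = 0" "x = cls f" "Dw x = cls g" using Vsp_E[OF assms] .
  show ?thesis using Dw_cls[OF ac_scale[OF a(1), of r] L2_scale[OF a(2)] L2_scale[OF a(3)]] a by (simp add: cls_scale)
qed

lemma Dw_antisym: assumes "x \<in> Vsp" "y \<in> Vsp" shows "inner (Dw x) y = - inner x (Dw y)"
proof -
  obtain f g where a: "ac f g" "f \<in> L2" "g \<in> L2" "f 0 = 0" "x = cls f" "Dw x = cls g" using Vsp_E[OF assms(1)] .
  obtain h k where b: "ac h k" "h \<in> L2" "k \<in> L2" "h 0 = 0" "y = cls h" "Dw y = cls k" using Vsp_E[OF assms(2)] .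
  show ?thesis using integration_by_parts[OF a(1-3) b(1-3)] a b by (simp add: inner_cls)
qed

lemma test_in_Vsp:
  assumes p: "\<psi> \<in> test_functions" shows "cls \<psi> \<in> Vsp \<and> Dw (cls \<psi>) = cls (deriv \<psi>)"
  using Vsp_I[of \<psi> "deriv \<psi>"] Dw_cls[of \<psi> "deriv \<psi>"] test_L2[OF p] by blast

lemma Vsp_dense: "closure Vsp = UNIV"
proof (rule subspace_dense_if_no_orthogonal[OF Vsp_subspace])
  fix z assume z: "\<And>s. s \<in> Vsp \<Longrightarrow> inner z s = 0"
  have "AE t in half_line. rep z t = 0"
  proof (rule fundamental_lemma[OF L2_loc_int[OF rep_in]])
    fix \<psi> assume "\<psi> \<in> test_functions"
    then show "integral\<^sup>L half_line (\<lambda>t. rep z t * \<psi> t) = 0"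
      using z[of "cls \<psi>"] test_in_Vsp[of \<psi>] inner_cls[OF rep_in test_L2(1)[of \<psi>], of z] by simp
  qed
  then have "AE t in half_line. rep z t = rep 0 t" using rep_0 by eventually_elim simp
  then show "z = 0" by (rule L2h_eqI)
qed

text \<open>The boundary condition survives the limit because the supremum norm is bounded by the \<open>H1\<close> norm.\<close>

lemma Dw_closed:
  assumes X: "\<And>n. X n \<in> Vsp" "X \<longlonglongrightarrow> x" "(\<lambda>n. Dw (X n)) \<longlonglongrightarrow> y"
  shows "x \<in> Vsp \<and> Dw x = y"
proof -
  have w: "has_weak_deriv (rep x) (rep y)" unfolding has_weak_deriv_def
  proof
    fix \<psi> assume p: "\<psi> \<in> test_functions"
    have "inner (Dw (X n)) (cls \<psi>) = - inner (X n) (cls (deriv \<psi>))" for n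
      using Dw_antisym[OF X(1), of "cls \<psi>" n] test_in_Vsp[OF p] by simp
    moreover have "(\<lambda>n. inner (Dw (X n)) (cls \<psi>)) \<longlonglongrightarrow> inner y (cls \<psi>)" by (intro tendsto_intros X)
    moreover have "(\<lambda>n. - inner (X n) (cls (deriv \<psi>))) \<longlonglongrightarrow> - inner x (cls (deriv \<psi>))" by (intro tendsto_intros X)
    ultimately have "inner y (cls \<psi>) = - inner x (cls (deriv \<psi>))" using LIMSEQ_unique by auto
    then show "integral\<^sup>L half_line (\<lambda>z. rep x z * deriv \<psi> z) = - integral\<^sup>L half_line (\<lambda>z. rep y z * \<psi> z)"
      using inner_cls[OF rep_in test_L2(1)[OF p], of y] inner_cls[OF rep_in test_L2(2)[OF p], of x] by simp
  qed
  obtain F where F: "ac F (rep y)" "AE z in half_line. rep x z = F z"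
    using weak_imp_AE_ac[OF L2_loc_int[OF rep_in] rep_in w] by blast
  have FL: "F \<in> L2" by (rule L2_cong_AE[OF rep_in continuous_measurable_half_line[OF ac_continuous[OF F(1)]] F(2)])
  have clsF: "cls F = x" using cls_eqI[OF rep_in FL F(2)] by simp
  have "(F 0)\<^sup>2 \<le> 2 * ((norm (x - X n))\<^sup>2 + (norm (y - Dw (X n)))\<^sup>2)" for n
  proof -
    obtain f g where a: "ac f g" "f \<in> L2" "g \<in> L2" "f 0 = 0" "X n = cls f" "Dw (X n) = cls g" using Vsp_E[OF X(1)] .
    show ?thesis
      using ac_sup_bound[OF ac_diff[OF F(1) a(1)] L2_diff[OF FL a(2)] L2_diff[OF rep_in a(3)], of 0] a
      by (simp add: cls_diff FL clsF)
  qed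
  moreover have "(\<lambda>n. 2 * ((norm (x - X n))\<^sup>2 + (norm (y - Dw (X n)))\<^sup>2)) \<longlonglongrightarrow> 2 * ((norm (x - x))\<^sup>2 + (norm (y - y))\<^sup>2)"
    by (intro tendsto_intros X)
  ultimately have "(F 0)\<^sup>2 \<le> 2 * ((norm (x - x))\<^sup>2 + (norm (y - y))\<^sup>2)"
    by (intro LIMSEQ_le_const) auto
  then have "F 0 = 0" by simp
  then show ?thesis using Vsp_I[OF F(1) FL rep_in] Dw_cls[OF F(1) FL rep_in] by (simp add: clsF)
qed

text \<open>The potential \<open>1 - 2 u\<close> of the linearization is shifted by \<open>2\<close> so that \<open>A = 2 - L\<close> has the potential
  \<open>1 + 2 u \<ge> 1\<close>, as coercivity in \<open>drift_operator\<close> demands.\<close>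

locale bounded_profile =
  fixes c :: real and u :: "real \<Rightarrow> real"
  assumes u_cont: "continuous_on {..0} u" and u_ge: "z \<le> 0 \<Longrightarrow> 0 \<le> u z" and u_le: "z \<le> 0 \<Longrightarrow> u z \<le> 1"
begin

definition pot :: "real \<Rightarrow> real" where "pot z = 1 + 2 * u z"

lemma pot: "pot \<in> borel_measurable half_line" "z < 0 \<Longrightarrow> \<bar>pot z\<bar> \<le> 3" "z < 0 \<Longrightarrow> pot z \<ge> 1"
proof -
  show "pot \<in> borel_measurable half_line" unfolding pot_def[abs_def]
    by (intro continuous_measurable_half_line continuous_intros u_cont)
qed (use u_ge[of z] u_le[of z] in \<open>auto simp: pot_def\<close>)

lemma pot_L2: "f \<in> L2 \<Longrightarrow> (\<lambda>z. pot z * f z) \<in> L2" by (rule mul_L2[OF pot(1,2)])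

sublocale drift_operator Vsp Dw "mul pot" c 3
proof
  show "subspace Vsp" by (rule Vsp_subspace)
  show "x \<in> Vsp \<Longrightarrow> y \<in> Vsp \<Longrightarrow> Dw (x + y) = Dw x + Dw y" for x y by (rule Dw_add)
  show "x \<in> Vsp \<Longrightarrow> Dw (r *\<^sub>R x) = r *\<^sub>R Dw x" for x r by (rule Dw_scale)
  show "x \<in> Vsp \<and> Dw x = y" if "\<And>n. f n \<in> Vsp" "f \<longlonglongrightarrow> x" "(\<lambda>n. Dw (f n)) \<longlonglongrightarrow> y" for f x y
    by (rule Dw_closed[OF that])
  show "x \<in> Vsp \<Longrightarrow> y \<in> Vsp \<Longrightarrow> inner (Dw x) y = - inner x (Dw y)" for x y by (rule Dw_antisym)
  show "closure Vsp = UNIV" by (rule Vsp_dense)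
  show "mul pot (x + y) = mul pot x + mul pot y" "mul pot (r *\<^sub>R x) = r *\<^sub>R mul pot x" for x y r
    using linear_mul[OF pot(1,2)] by (auto simp: linear_add linear_scale)
  show "inner (mul pot x) y = inner x (mul pot y)" for x y by (rule inner_mul[OF pot(1,2)])
  show "norm (mul pot x) \<le> 3 * norm x" for x by (rule norm_mul[OF pot(1,2)])
  show "(norm x)\<^sup>2 \<le> inner (mul pot x) x" for x
  proof -
    have "(norm x)\<^sup>2 = integral\<^sup>L half_line (\<lambda>z. rep x z * rep x z)" by (simp add: power2_norm_eq_inner inner_L2h_def)
    also have "\<dots> \<le> integral\<^sup>L half_line (\<lambda>z. pot z * rep x z * rep x z)"
    proof (rule integral_mono)
      show "rep x z * rep x z \<le> pot z * rep x z * rep x z" if "z \<in> space half_line" for z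
        using that pot(3)[of z] mult_right_mono[of 1 "pot z" "rep x z * rep x z"] by (simp add: mult.assoc)
    qed (intro L2_mult_integrable pot_L2 rep_in)+
    also have "\<dots> = inner (mul pot x) x" unfolding mul_def
      using inner_cls[OF pot_L2[OF rep_in] rep_in, of x x] by simp
    finally show ?thesis .
  qed
qed simp

text \<open>Testing the form with test functions shows that \<open>r = Q x - c D x - A x\<close> is the weak derivative of
  \<open>D x\<close>; elements of the abstract domain therefore have two weak derivatives.\<close>

lemma dA_E:
  assumes x: "x \<in> dA"
  obtains f g k where "ac f g" "ac g k" "f \<in> L2" "g \<in> L2" "k \<in> L2" "f 0 = 0" "x = cls f" "Dw x = cls g"
    "A x = cls (\<lambda>z. pot z * f z - c * g z - k z)"
proof -
  obtain f g where a: "ac f g" "f \<in> L2" "g \<in> L2" "f 0 = 0" "x = cls f" "Dw x = cls g" using Vsp_E[OF dA_V[OF x]] .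
  define r where "r = mul pot x - c *\<^sub>R Dw x - A x"
  have "has_weak_deriv g (rep r)" unfolding has_weak_deriv_def
  proof
    fix \<psi> assume p: "\<psi> \<in> test_functions"
    have "inner (A x) (cls \<psi>) = form x (cls \<psi>)" using A_form[OF x] test_in_Vsp[OF p] by blast
    then have "inner (cls g) (cls (deriv \<psi>)) = - inner r (cls \<psi>)"
      using test_in_Vsp[OF p] a(6) by (simp add: form_def r_def inner_diff_left)
    then show "integral\<^sup>L half_line (\<lambda>z. g z * deriv \<psi> z) = - integral\<^sup>L half_line (\<lambda>z. rep r z * \<psi> z)"
      using inner_cls[OF rep_in test_L2(1)[OF p], of r] inner_cls[OF a(3) test_L2(2)[OF p]] by simp
  qed
  from weak_imp_AE_ac[OF L2_loc_int[OF a(3)] rep_in this]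
  obtain G where G: "ac G (rep r)" "AE z in half_line. g z = G z" by blast
  have Gm: "G \<in> borel_measurable half_line" by (rule continuous_measurable_half_line[OF ac_continuous[OF G(1)]])
  have GL: "G \<in> L2" by (rule L2_cong_AE[OF a(3) Gm G(2)])
  have fG: "ac f G" by (rule ac_cong_AE[OF a(1) Gm G(2)])
  have DG: "Dw x = cls G" using Dw_cls[OF fG a(2) GL] a(5) by simp
  have "A x = mul pot x - c *\<^sub>R Dw x - r" by (simp add: r_def)
  also have "\<dots> = cls (\<lambda>z. pot z * f z - c * G z - rep r z)"
    unfolding DG unfolding a(5)
    by (simp add: mul_cls[OF pot(1,2) a(2)] cls_diff cls_scale pot_L2 L2_scale L2_diff a(2) GL)
  finally show ?thesis using that[OF fG G(1) a(2) GL rep_in a(4,5) DG] by blast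
qed

lemma linop_AE:
  assumes "ac f g" "ac g k" "f \<in> L2" "g \<in> L2" "k \<in> L2"
  shows "linop c u f \<in> L2" "AE z in half_line. linop c u f z = k z + c * g z + (1 - 2 * u z) * f z"
    "cls (linop c u f) = cls (\<lambda>z. k z + c * g z + (1 - 2 * u z) * f z)"
proof -
  note w = weak_deriv_AE[OF assms(1,4)]
  have "weak_deriv (weak_deriv f) = weak_deriv g"
    by (rule weak_deriv_cong[OF L2_measurable[OF w(1)] L2_measurable[OF assms(4)] w(2)])
  note ww = weak_deriv_AE[OF assms(2,5)]
  show AE: "AE z in half_line. linop c u f z = k z + c * g z + (1 - 2 * u z) * f z"
    using w(2) ww(2) by eventually_elim (simp add: linop_def \<open>weak_deriv (weak_deriv f) = weak_deriv g\<close>)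
  have b: "(\<lambda>z. 1 - 2 * u z) \<in> borel_measurable half_line"
    by (intro continuous_measurable_half_line continuous_intros u_cont)
  have b1: "\<bar>1 - 2 * u z\<bar> \<le> 1" if "z < 0" for z using u_ge[of z] u_le[of z] that by auto
  have uf: "(\<lambda>z. (1 - 2 * u z) * f z) \<in> L2" by (rule mul_L2[OF b b1 assms(3)])
  have R: "(\<lambda>z. k z + c * g z + (1 - 2 * u z) * f z) \<in> L2" by (intro L2_add L2_scale uf assms)
  show L: "linop c u f \<in> L2" unfolding linop_def
    using L2_add[OF L2_add[OF ww(1) L2_scale[OF w(1), of c]] uf] \<open>weak_deriv (weak_deriv f) = weak_deriv g\<close> by simp
  show "cls (linop c u f) = cls (\<lambda>z. k z + c * g z + (1 - 2 * u z) * f z)" by (rule cls_eqI[OF L R AE])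
qed

lemma linop_domainI:
  assumes "ac f g" "ac g k" "f \<in> L2" "g \<in> L2" "k \<in> L2" "f 0 = 0" shows "f \<in> linop_domain"
  unfolding linop_domain_def H2_def using assms ac_imp_weak[OF assms(1)] ac_imp_weak[OF assms(2)]
  by (auto simp: H1_iff)

lemma linop_domain_E:
  assumes "f \<in> linop_domain"
  obtains g k where "ac f g" "ac g k" "f \<in> L2" "g \<in> L2" "k \<in> L2" "f 0 = 0"
proof -
  obtain g k where a: "f \<in> H1" "f 0 = 0" "g \<in> L2" "has_weak_deriv f g" "k \<in> L2" "has_weak_deriv g k"
    using assms unfolding linop_domain_def H2_def by auto
  have f: "f \<in> L2" "continuous_on {..0} f" using a(1) by (auto simp: H1_def)
  have fg: "ac f g" by (rule H1_weak_imp_ac[OF f(2) a(3,4)])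
  obtain G where G: "ac G k" "AE z in half_line. g z = G z" using weak_imp_AE_ac[OF L2_loc_int[OF a(3)] a(5,6)] by blast
  have Gm: "G \<in> borel_measurable half_line" by (rule continuous_measurable_half_line[OF ac_continuous[OF G(1)]])
  show ?thesis
    using that[OF ac_cong_AE[OF fg Gm G(2)] G(1) f(1) L2_cong_AE[OF a(3) Gm G(2)] a(5,2)] .
qed

text \<open>Together with \<open>dA_E\<close> this identifies the domain of \<open>linop\<close> with the abstract domain, and \<open>linop\<close> with
  \<open>2 - A\<close>.\<close>

lemma linop_domain_dA:
  assumes "f \<in> linop_domain"
  shows "cls f \<in> dA" "A (cls f) = 2 *\<^sub>R cls f - cls (linop c u f)" "linop c u f \<in> L2"
proof -
  obtain g k where a: "ac f g" "ac g k" "f \<in> L2" "g \<in> L2" "k \<in> L2" "f 0 = 0" using linop_domain_E[OF assms] .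
  define R where "R = cls (\<lambda>z. pot z * f z - c * g z - k z)"
  have RL: "(\<lambda>z. pot z * f z - c * g z - k z) \<in> L2" by (intro L2_diff L2_scale pot_L2 a)
  have V: "cls f \<in> Vsp" by (rule Vsp_I[OF a(1,3,4,6)])
  have form: "form (cls f) p = inner R p" if p: "p \<in> Vsp" for p
  proof -
    obtain h l where b: "ac h l" "h \<in> L2" "l \<in> L2" "h 0 = 0" "p = cls h" "Dw p = cls l" using Vsp_E[OF p] .
    have "inner (cls g) (cls l) = - inner (cls k) (cls h)"
      using integration_by_parts[OF a(2,4,5) b(1-3)] b(4) by (simp add: inner_cls a b)
    moreover have "R = mul pot (cls f) - c *\<^sub>R cls g - cls k"
      unfolding R_def by (simp add: mul_cls[OF pot(1,2) a(3)] cls_diff cls_scale pot_L2 L2_scale L2_diff a)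
    ultimately show ?thesis using b(5,6) by (simp add: form_def Dw_cls[OF a(1,3,4)] inner_diff_left)
  qed
  show "cls f \<in> dA" by (rule A_eqI(1)[OF V form])
  show "linop c u f \<in> L2" by (rule linop_AE(1)[OF a(1-5)])
  have "A (cls f) = R" by (rule A_eqI(2)[OF V form])
  also have "R = cls (\<lambda>z. 2 * f z - linop c u f z)" unfolding R_def
  proof (rule cls_eqI[OF RL L2_diff[OF L2_scale[OF a(3)] linop_AE(1)[OF a(1-5)]]])
    show "AE z in half_line. pot z * f z - c * g z - k z = 2 * f z - linop c u f z"
      using linop_AE(2)[OF a(1-5)] by eventually_elim (simp add: pot_def algebra_simps)
  qed
  also have "\<dots> = 2 *\<^sub>R cls f - cls (linop c u f)" by (simp add: cls_diff cls_scale a L2_scale linop_AE(1)[OF a(1-5)])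
  finally show "A (cls f) = 2 *\<^sub>R cls f - cls (linop c u f)" .
qed

end


section \<open>A weighted coercivity estimate for the linearization\<close>

text \<open>Bounded continuous coefficients: the functions by which integrands may be multiplied without
  leaving \<open>L2\<close>.\<close>

definition bdd_cont :: "(real \<Rightarrow> real) \<Rightarrow> bool" where
  "bdd_cont b \<longleftrightarrow> continuous_on {..0} b \<and> (\<exists>K. \<forall>z\<le>0. \<bar>b z\<bar> \<le> K)"

lemma bdd_contI:
  assumes c: "continuous_on {..0} b" and K: "\<And>z. z \<le> a \<Longrightarrow> \<bar>b z\<bar> \<le> K" and a: "a \<le> 0"
  shows "bdd_cont b"
proof -
  obtain K' where "\<And>s. a \<le> s \<Longrightarrow> s \<le> 0 \<Longrightarrow> \<bar>b s\<bar> \<le> K'" using continuous_locally_bounded[OF c a] by blast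
  then have "\<bar>b z\<bar> \<le> max K K'" if "z \<le> 0" for z using K[of z] that by (cases "z \<le> a") (auto simp: le_max_iff_disj)
  then show ?thesis unfolding bdd_cont_def using c by blast
qed

lemma bdd_cont_const: "bdd_cont (\<lambda>_. r)" unfolding bdd_cont_def by auto

lemma bdd_cont_add: assumes "bdd_cont a" "bdd_cont b" shows "bdd_cont (\<lambda>z. a z + b z)"
proof -
  obtain K L where "\<And>z. z \<le> 0 \<Longrightarrow> \<bar>a z\<bar> \<le> K" "\<And>z. z \<le> 0 \<Longrightarrow> \<bar>b z\<bar> \<le> L" using assms unfolding bdd_cont_def by blast
  then have "\<bar>a z + b z\<bar> \<le> K + L" if "z \<le> 0" for z using abs_triangle_ineq[of "a z" "b z"] that by (meson add_mono order_trans)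
  then show ?thesis using assms unfolding bdd_cont_def by (auto intro: continuous_intros)
qed

lemma bdd_cont_mult: assumes "bdd_cont a" "bdd_cont b" shows "bdd_cont (\<lambda>z. a z * b z)"
proof -
  obtain K L where K: "\<And>z. z \<le> 0 \<Longrightarrow> \<bar>a z\<bar> \<le> K" and L: "\<And>z. z \<le> 0 \<Longrightarrow> \<bar>b z\<bar> \<le> L" using assms unfolding bdd_cont_def by blast
  have "\<bar>a z * b z\<bar> \<le> K * L" if "z \<le> 0" for z
    using K[OF that] L[OF that] unfolding abs_mult by (intro mult_mono) (auto intro: order_trans[OF abs_ge_zero])
  then show ?thesis using assms unfolding bdd_cont_def by (auto intro: continuous_intros)
qed

lemma bdd_cont_diff: assumes "bdd_cont a" "bdd_cont b" shows "bdd_cont (\<lambda>z. a z - b z)"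
  using bdd_cont_add[OF assms(1) bdd_cont_mult[OF bdd_cont_const[of "-1"] assms(2)]] by simp

lemma bdd_cont_power2: "bdd_cont a \<Longrightarrow> bdd_cont (\<lambda>z. (a z)\<^sup>2)"
  unfolding power2_eq_square by (rule bdd_cont_mult)

lemmas bdd_cont_intros = bdd_cont_const bdd_cont_add bdd_cont_mult bdd_cont_diff bdd_cont_power2

lemma bdd_cont_L2: assumes "bdd_cont b" "f \<in> L2" shows "(\<lambda>z. b z * f z) \<in> L2"
proof -
  obtain K where K: "\<And>z. z \<le> 0 \<Longrightarrow> \<bar>b z\<bar> \<le> K" using assms unfolding bdd_cont_def by blast
  show ?thesis
    by (rule mul_L2[of b K, OF _ _ assms(2)]) (use assms K in \<open>auto simp: bdd_cont_def continuous_measurable_half_line\<close>)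
qed

lemma bdd_cont_ac:
  assumes "\<And>z. z \<le> 0 \<Longrightarrow> (b has_real_derivative b' z) (at z within {..0})" "bdd_cont b" "bdd_cont b'"
    and f: "ac f g" "f \<in> L2" "g \<in> L2"
  shows "ac (\<lambda>z. b z * f z) (\<lambda>z. b z * g z + b' z * f z)" "(\<lambda>z. b z * f z) \<in> L2" "(\<lambda>z. b z * g z + b' z * f z) \<in> L2"
proof -
  have "ac b b'" using assms by (intro ac_C1) (auto simp: bdd_cont_def)
  from ac_mult[OF this f(1)] show "ac (\<lambda>z. b z * f z) (\<lambda>z. b z * g z + b' z * f z)" .
qed (intro L2_add bdd_cont_L2 assms)+

text \<open>\<open>v\<close> is the derivative of the profile \<open>u\<close>.\<close>

locale profile =
  fixes c :: real and u v :: "real \<Rightarrow> real"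
  assumes c0: "0 \<le> c" and c2: "c < 2"
    and du: "z \<le> 0 \<Longrightarrow> (u has_real_derivative v z) (at z within {..0})"
    and dv: "z \<le> 0 \<Longrightarrow> (v has_real_derivative (- c * v z - u z * (1 - u z))) (at z within {..0})"
    and v_lim: "(v \<longlongrightarrow> 0) at_bot"
    and u_lim: "(u \<longlongrightarrow> 1) at_bot"
    and u0: "u 0 = 0" and u_pos: "z < 0 \<Longrightarrow> 0 < u z" and u_lt: "z \<le> 0 \<Longrightarrow> u z < 1"
    and u_anti: "strict_antimono_on {..0} u"
begin

lemma u_ge: "z \<le> 0 \<Longrightarrow> 0 \<le> u z"
  using u0 u_pos[of z] by (cases "z = 0") auto

lemma u_cont: "continuous_on {..0} u" using du by (intro DERIV_continuous_on) auto
lemma v_cont: "continuous_on {..0} v" using dv by (intro DERIV_continuous_on) auto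

lemma v_nonpos: assumes z: "z \<le> 0" shows "v z \<le> 0"
proof (rule tendsto_upperbound)
  have "((\<lambda>y. (u y - u z) / (y - z)) \<longlongrightarrow> v z) (at z within {..0})"
    using du[OF z] by (simp add: has_field_derivative_iff)
  then show "((\<lambda>y. (u y - u z) / (y - z)) \<longlongrightarrow> v z) (at_left z)"
    by (rule tendsto_within_subset) (use z in auto)
  have "(u y - u z) / (y - z) \<le> 0" if "y < z" for y
    using u_anti that z by (auto simp: monotone_on_def divide_le_0_iff less_imp_le)
  then show "\<forall>\<^sub>F y in at_left z. (u y - u z) / (y - z) \<le> 0" by (auto simp: eventually_at_filter)
qed simp

text \<open>\<open>exp (c z) v z\<close> is strictly decreasing by the profile equation and \<open>v\<close> is nonpositive by monotonicity
  of \<open>u\<close>, so that \<open>v\<close> has no zero, not even at the boundary.\<close>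

lemma v_neg: assumes z: "z \<le> 0" shows "v z < 0"
proof -
  define G where "G y = exp (c * y) * v y" for y
  have dG: "(G has_real_derivative - (exp (c * y) * (u y * (1 - u y)))) (at y within {..0})" if "y \<le> 0" for y
    unfolding G_def using dv[OF that] by (auto intro!: derivative_eq_intros simp: algebra_simps)
  have "G z < G (z - 1)"
  proof (rule DERIV_neg_imp_decreasing_open[of "z - 1" z G])
    show "continuous_on {z - 1..z} G"
    proof (rule DERIV_continuous_on)
      show "(G has_real_derivative - (exp (c * x) * (u x * (1 - u x)))) (at x within {z - 1..z})" if "x \<in> {z - 1..z}" for x
        using that z by (intro DERIV_subset[OF dG]) auto
    qed
    fix y assume y: "z - 1 < y" "y < z"
    have "(G has_real_derivative - (exp (c * y) * (u y * (1 - u y)))) (at y)"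
      using dG[of y] y z at_within_interior[of y "{..0}"] by (simp add: interior_Iic[where b = 1])
    moreover have "u y * (1 - u y) > 0" using y z u_pos[of y] u_lt[of y] by simp
    ultimately show "\<exists>d. (G has_real_derivative d) (at y) \<and> d < 0" by (intro exI conjI) auto
  qed simp
  moreover have "G (z - 1) \<le> 0" using v_nonpos[of "z - 1"] z by (simp add: G_def mult_le_0_iff)
  ultimately have "exp (c * z) * v z < 0" by (simp add: G_def)
  then show ?thesis by (simp add: mult_less_0_iff)
qed

lemma saturation: obtains R where "R > 0" "\<And>z. z \<le> - R \<Longrightarrow> u z \<ge> 3/4"
proof -
  have "\<forall>\<^sub>F z in at_bot. u z > 3/4" by (rule order_tendstoD(1)[OF u_lim]) simp
  then obtain N where "\<And>z. z \<le> N \<Longrightarrow> u z > 3/4" unfolding eventually_at_bot_linorder by blast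
  then show ?thesis using that[of "max 1 (- N)"] by (force simp: less_imp_le)
qed

text \<open>The orbit leaves the saddle \<open>(1, 0)\<close> in the unstable direction, along which the slope is comparable to
  the defect \<open>1 - u\<close>. Instead of the unstable manifold the proof uses that
  \<open>exp ((c + k) z) (- v - k (1 - u))\<close> is nondecreasing where \<open>u \<ge> k (c + k)\<close> and tends to \<open>0\<close> at \<open>-\<infinity>\<close>;
  \<open>k = 1/6\<close> satisfies this for \<open>u \<ge> 3/4\<close> and \<open>c < 2\<close>.\<close>

lemma defect_le_slope:
  assumes R: "R > 0" "\<And>z. z \<le> - R \<Longrightarrow> u z \<ge> 3/4" and z: "z \<le> - R"
  shows "1 - u z \<le> 6 * \<bar>v z\<bar>"
proof -
  define k :: real where "k = 1/6"
  define G where "G y = exp ((c + k) * y) * (- v y - k * (1 - u y))" for y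
  define G' where "G' y = exp ((c + k) * y) * ((1 - u y) * (u y - k * (c + k)))" for y
  have dG: "(G has_real_derivative G' y) (at y within {..0})" if "y \<le> 0" for y
    unfolding G_def G'_def using dv[OF that] du[OF that] by (auto intro!: derivative_eq_intros simp: algebra_simps)
  have mono: "G y \<le> G z" if y: "y \<le> z" for y
  proof (rule DERIV_nonneg_imp_increasing_open[OF y])
    show "continuous_on {y..z} G"
    proof (rule DERIV_continuous_on)
      show "(G has_real_derivative G' x) (at x within {y..z})" if "x \<in> {y..z}" for x
        using that z R by (intro DERIV_subset[OF dG]) auto
    qed
    fix x assume x: "y < x" "x < z"
    have "(G has_real_derivative G' x) (at x)"
      using dG[of x] x z R at_within_interior[of x "{..0}"] by (simp add: interior_Iic[where b = 1])
    moreover have "k * (c + k) \<le> u x" using R(2)[of x] x z c2 by (simp add: k_def)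
    then have "G' x \<ge> 0" unfolding G'_def using u_lt[of x] x z R by (intro mult_nonneg_nonneg) auto
    ultimately show "\<exists>d. (G has_real_derivative d) (at x) \<and> d \<ge> 0" by blast
  qed
  have "(G \<longlongrightarrow> 0 * (- 0 - k * (1 - 1))) at_bot"
    unfolding G_def
  proof (intro tendsto_intros v_lim u_lim)
    have "filterlim (\<lambda>y. (c + k) * y) at_bot at_bot"
      by (rule filterlim_tendsto_pos_mult_at_bot[OF tendsto_const]) (use c0 in \<open>auto simp: k_def filterlim_ident\<close>)
    then show "((\<lambda>y. exp ((c + k) * y)) \<longlongrightarrow> 0) at_bot" by (rule filterlim_compose[OF exp_at_bot])
  qed
  then have "0 \<le> G z"
    by (intro tendsto_upperbound[of G 0 at_bot]) (auto intro: mono eventually_mono[OF eventually_le_at_bot[of z]])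
  then have "- v z - k * (1 - u z) \<ge> 0" by (simp add: G_def zero_le_mult_iff)
  then show ?thesis using v_nonpos[of z] z R by (simp add: k_def)
qed

text \<open>The logarithmic derivative of \<open>v\<close>, with the derivative of \<open>v\<close> taken from the profile equation. As
  \<open>v\<close> solves the linearized equation, \<open>dlog\<close> solves the Riccati equation
  \<open>r' = - c r - (1 - 2 u) - r\<^sup>2\<close>.\<close>

definition dlog :: "real \<Rightarrow> real" where "dlog z = (- c * v z - u z * (1 - u z)) / v z"

lemma dlog_cont: "continuous_on {..0} dlog"
  unfolding dlog_def using v_neg by (intro continuous_intros v_cont u_cont) force

lemma bdd_u: "bdd_cont u"
  by (rule bdd_contI[OF u_cont, of 0 1]) (use u_ge u_lt in \<open>auto simp: abs_of_nonneg less_imp_le\<close>)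

lemma bdd_v: "bdd_cont v"
proof -
  have "\<forall>\<^sub>F z in at_bot. \<bar>v z\<bar> < 1"
    using tendsto_rabs[OF v_lim] by (intro order_tendstoD(2)) auto
  then obtain N where "\<And>z. z \<le> N \<Longrightarrow> \<bar>v z\<bar> < 1" unfolding eventually_at_bot_linorder by blast
  then show ?thesis by (intro bdd_contI[OF v_cont, of "min N 0" 1]) (auto simp: less_imp_le)
qed

lemma bdd_dlog: "bdd_cont dlog"
proof -
  obtain R where R: "R > 0" "\<And>z. z \<le> - R \<Longrightarrow> u z \<ge> 3/4" using saturation by blast
  have "\<bar>dlog z\<bar> \<le> c + 6" if z: "z \<le> - R" for z
  proof -
    have z0: "z \<le> 0" using z R by simp
    have v: "v z < 0" by (rule v_neg[OF z0])
    have "dlog z = - c - u z * (1 - u z) / v z" using v by (simp add: dlog_def field_simps)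
    moreover have "\<bar>u z * (1 - u z) / v z\<bar> \<le> 6"
    proof -
      have "\<bar>u z * (1 - u z)\<bar> \<le> 1 * (1 - u z)"
        unfolding abs_mult using u_ge[OF z0] u_lt[OF z0] by (intro mult_mono) auto
      also have "\<dots> \<le> 6 * \<bar>v z\<bar>" using defect_le_slope[OF R z] by simp
      finally have "\<bar>u z * (1 - u z)\<bar> \<le> 6 * \<bar>v z\<bar>" .
      moreover have "\<bar>v z\<bar> > 0" using v by simp
      ultimately show ?thesis unfolding abs_divide by (subst pos_divide_le_eq)
    qed
    ultimately show ?thesis using c0 by linarith
  qed
  then show ?thesis by (rule bdd_contI[OF dlog_cont]) (use R in auto)
qed

lemma bdd_exp: "bdd_cont (\<lambda>z. exp (c * z))"
proof (rule bdd_contI[of _ 0 1])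
  show "continuous_on {..0} (\<lambda>z. exp (c * z))" by (intro continuous_intros)
  show "\<bar>exp (c * z)\<bar> \<le> 1" if "z \<le> 0" for z using that c0 by (simp add: mult_nonneg_nonpos)
qed simp

text \<open>With \<open>b = \<rho> r\<close> for a bounded function \<open>r\<close>, integrating \<open>\<rho> (g - r f)\<^sup>2 \<ge> 0\<close> by parts gives
  \<open>0 \<le> \<integral> \<rho> g\<^sup>2 + \<integral> (b' + \<rho> r\<^sup>2) f\<^sup>2\<close>, where the boundary term vanishes because \<open>f 0 = 0\<close>. For
  \<open>r = dlog\<close> the bracket equals \<open>- \<rho> (1 - 2 u)\<close>. The correction \<open>- \<delta> \<tau>\<^sup>2 / (v\<^sup>2 \<rho>)\<close> of \<open>r\<close> improves
  this by \<open>\<delta> \<tau> / v\<^sup>2\<close>, which is positive for \<open>z > - (R + 1)\<close>. For \<open>z \<le> - R\<close> the potential itself is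
  negative, \<open>1 - 2 u \<le> - 1/2\<close>. Multiplying the weighted estimate by \<open>K\<close> and adding the unweighted form
  covers both regions, and the weight \<open>m = K \<rho> + 1\<close> is comparable to \<open>1\<close>.\<close>

lemma weighted_coercivity:
  obtains m K where "m \<in> borel_measurable half_line" "K \<ge> 0" "\<And>z. z \<le> 0 \<Longrightarrow> 1 \<le> m z" "\<And>z. z \<le> 0 \<Longrightarrow> m z \<le> 1 + K"
    "\<And>f g k. ac f g \<Longrightarrow> ac g k \<Longrightarrow> f \<in> L2 \<Longrightarrow> g \<in> L2 \<Longrightarrow> k \<in> L2 \<Longrightarrow> f 0 = 0 \<Longrightarrow>
      integral\<^sup>L half_line (\<lambda>z. (m z * f z) * (k z + c * g z + (1 - 2 * u z) * f z))
        \<le> - ((1/2) * (norm (cls f))\<^sup>2 + (norm (cls g))\<^sup>2)"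
proof -
  obtain R where R: "R > 0" "\<And>z. z \<le> - R \<Longrightarrow> u z \<ge> 3/4" using saturation by blast
  define \<rho> where "\<rho> z = exp (c * z)" for z
  have \<rho>pos: "\<rho> z > 0" for z by (simp add: \<rho>_def)
  define \<tau> where "\<tau> z = max 0 (z + (R + 1))" for z
  have \<tau>0: "\<tau> z = 0" if "z \<le> - (R + 1)" for z using that by (simp add: \<tau>_def)
  have \<tau>c: "continuous_on S \<tau>" for S unfolding \<tau>_def by (intro continuous_intros)
  have vne: "v z \<noteq> 0" if "z \<le> 0" for z using v_neg[OF that] by simp
  have \<rho>c: "continuous_on S \<rho>" for S unfolding \<rho>_def by (intro continuous_intros)
  have "\<exists>\<mu>>0. \<forall>z\<in>{- (R + 1)..0}. \<mu> \<le> (v z)\<^sup>2 * \<rho> z"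
  proof -
    have "\<exists>x\<in>{- (R + 1)..0}. \<forall>y\<in>{- (R + 1)..0}. (v x)\<^sup>2 * \<rho> x \<le> (v y)\<^sup>2 * \<rho> y"
      using R by (intro continuous_attains_inf continuous_intros continuous_on_subset[OF v_cont] \<rho>c) auto
    then obtain x where "x \<in> {- (R + 1)..0}" "\<And>y. y \<in> {- (R + 1)..0} \<Longrightarrow> (v x)\<^sup>2 * \<rho> x \<le> (v y)\<^sup>2 * \<rho> y" by blast
    moreover from this have "(v x)\<^sup>2 * \<rho> x > 0" using vne[of x] \<rho>pos by simp
    ultimately show ?thesis by blast
  qed
  then obtain \<mu> where \<mu>: "\<mu> > 0" "\<And>z. - (R + 1) \<le> z \<Longrightarrow> z \<le> 0 \<Longrightarrow> \<mu> \<le> (v z)\<^sup>2 * \<rho> z" by auto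
  \<comment> \<open>Makes the term quadratic in the correction at most half of the linear gain.\<close>
  define \<delta> where "\<delta> = \<mu> / (R + 1) ^ 3"
  have \<delta>: "\<delta> > 0" using \<mu> R by (simp add: \<delta>_def)
  define r where "r z = dlog z - \<delta> * ((\<tau> z)\<^sup>2 / ((v z)\<^sup>2 * \<rho> z))" for z
  define b where "b z = \<rho> z * dlog z - \<delta> * ((\<tau> z)\<^sup>2 / (v z)\<^sup>2)" for z
  define b' where "b' z = - (\<rho> z * (1 - 2 * u z)) - \<rho> z * (dlog z)\<^sup>2 - \<delta> * (2 * (\<tau> z / (v z)\<^sup>2) - 2 * ((\<tau> z)\<^sup>2 / (v z)\<^sup>2 * dlog z))" for z
  have b_eq: "b z = \<rho> z * r z" for z using \<rho>pos[of z] by (simp add: b_def r_def algebra_simps)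
  have comp: "bdd_cont h" if "continuous_on {..0} h" "\<And>z. z \<le> - (R + 1) \<Longrightarrow> h z = 0" for h
    using that R by (intro bdd_contI[of h "- (R + 1)" 0]) auto
  have bd1: "bdd_cont (\<lambda>z. (\<tau> z)\<^sup>2 / (v z)\<^sup>2)"
    by (rule comp) (use vne in \<open>auto intro!: continuous_intros \<tau>c v_cont simp: \<tau>0\<close>)
  have bd2: "bdd_cont (\<lambda>z. \<tau> z / (v z)\<^sup>2)"
    by (rule comp) (use vne in \<open>auto intro!: continuous_intros \<tau>c v_cont simp: \<tau>0\<close>)
  have bd3: "bdd_cont (\<lambda>z. (\<tau> z)\<^sup>2 / ((v z)\<^sup>2 * \<rho> z))"
    by (rule comp) (use vne \<rho>pos in \<open>auto intro!: continuous_intros \<tau>c v_cont \<rho>c simp: \<tau>0 less_imp_neq[symmetric]\<close>)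
  have bdr: "bdd_cont \<rho>" using bdd_exp by (simp add: \<rho>_def[abs_def])
  have br: "bdd_cont r" unfolding r_def by (intro bdd_cont_intros bdd_dlog bd3)
  have bb: "bdd_cont b" unfolding b_def by (intro bdd_cont_intros bdd_dlog bd1 bdr)
  have bb': "bdd_cont b'" unfolding b'_def
    using bdd_cont_diff[OF bdd_cont_diff[OF bdd_cont_mult[OF bdd_cont_const[of "-1"] bdd_cont_mult[OF bdr bdd_cont_diff[OF bdd_cont_const bdd_cont_mult[OF bdd_cont_const bdd_u]]]] bdd_cont_mult[OF bdr bdd_cont_power2[OF bdd_dlog]]]
      bdd_cont_mult[OF bdd_cont_const bdd_cont_diff[OF bdd_cont_mult[OF bdd_cont_const bd2] bdd_cont_mult[OF bdd_cont_const bdd_cont_mult[OF bd1 bdd_dlog]]]], of 1 2 \<delta> 2 2]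
    by simp
  have ddlog: "(dlog has_real_derivative - c * dlog z - (1 - 2 * u z) - (dlog z)\<^sup>2) (at z within {..0})" if z: "z \<le> 0" for z
  proof -
    have "(dlog has_real_derivative ((- c * (- c * v z - u z * (1 - u z)) - v z * (1 - 2 * u z)) * v z
        - (- c * v z - u z * (1 - u z)) * (- c * v z - u z * (1 - u z))) / (v z * v z)) (at z within {..0})"
      unfolding dlog_def[abs_def]
      using vne[OF z] by (auto intro!: derivative_eq_intros dv[OF z] du[OF z] simp: algebra_simps)
    then show ?thesis
      by (rule DERIV_cong) (use vne[OF z] in \<open>simp add: dlog_def field_simps power2_eq_square\<close>)
  qed
  have d\<tau>: "((\<lambda>z. (\<tau> z)\<^sup>2) has_real_derivative 2 * \<tau> z) (at z within S)" for z S
    unfolding \<tau>_def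
    by (rule has_field_derivative_at_within, rule DERIV_cong[OF DERIV_chain2[OF positive_part_square_deriv], of _ 1])
       (auto intro!: derivative_eq_intros)
  have db: "(b has_real_derivative b' z) (at z within {..0})" if z: "z \<le> 0" for z
  proof -
    have d\<rho>: "(\<rho> has_real_derivative c * \<rho> z) (at z within {..0})"
      unfolding \<rho>_def[abs_def] by (auto intro!: derivative_eq_intros)
    have "v z * dlog z = - c * v z - u z * (1 - u z)" using vne[OF z] by (simp add: dlog_def)
    then have dv': "(v has_real_derivative v z * dlog z) (at z within {..0})" using dv[OF z] by simp
    have dt: "((\<lambda>z. (\<tau> z)\<^sup>2 / (v z)\<^sup>2) has_real_derivative 2 * (\<tau> z / (v z)\<^sup>2) - 2 * ((\<tau> z)\<^sup>2 / (v z)\<^sup>2 * dlog z)) (at z within {..0})"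
      by (rule DERIV_cong[OF DERIV_divide[OF d\<tau> DERIV_power[OF dv', of 2]]])
         (use vne[OF z] in \<open>simp_all add: field_simps power2_eq_square\<close>)
    show ?thesis unfolding b_def[abs_def] b'_def
      by (rule DERIV_cong[OF DERIV_diff[OF DERIV_mult[OF d\<rho> ddlog[OF z]] DERIV_cmult[OF dt]]])
         (simp add: algebra_simps power2_eq_square)
  qed
  have riccati: "b' z + \<rho> z * (r z)\<^sup>2 \<le> - (\<rho> z * (1 - 2 * u z)) - \<delta> * (\<tau> z / (v z)\<^sup>2)" if z: "z \<le> 0" for z
  proof -
    have v2: "(v z)\<^sup>2 > 0" using vne[OF z] by simp
    have "\<rho> z * (r z)\<^sup>2 = \<rho> z * (dlog z)\<^sup>2 - 2 * \<delta> * ((\<tau> z)\<^sup>2 / (v z)\<^sup>2 * dlog z) + \<delta>\<^sup>2 * (((\<tau> z)\<^sup>2)\<^sup>2 / ((v z)\<^sup>2 * (v z)\<^sup>2 * \<rho> z))"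
      using \<rho>pos[of z] vne[OF z] unfolding r_def by (simp add: field_simps power2_eq_square)
    then have "b' z + \<rho> z * (r z)\<^sup>2 = - (\<rho> z * (1 - 2 * u z)) - 2 * \<delta> * (\<tau> z / (v z)\<^sup>2) + \<delta>\<^sup>2 * (((\<tau> z)\<^sup>2)\<^sup>2 / ((v z)\<^sup>2 * (v z)\<^sup>2 * \<rho> z))"
      by (simp add: b'_def algebra_simps)
    moreover have "\<delta>\<^sup>2 * (((\<tau> z)\<^sup>2)\<^sup>2 / ((v z)\<^sup>2 * (v z)\<^sup>2 * \<rho> z)) \<le> \<delta> * (\<tau> z / (v z)\<^sup>2)"
    proof (cases "z \<le> - (R + 1)")
      case False
      have t: "0 \<le> \<tau> z" "\<tau> z \<le> R + 1" using z R by (auto simp: \<tau>_def)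
      have "\<delta> * (\<tau> z) ^ 3 \<le> \<delta> * (R + 1) ^ 3" using t \<delta> by (intro mult_left_mono power_mono) auto
      also have "\<dots> = \<mu>" using R by (simp add: \<delta>_def)
      also have "\<dots> \<le> (v z)\<^sup>2 * \<rho> z" using \<mu>(2)[of z] False z by simp
      finally have "\<delta> * (\<tau> z) ^ 3 / ((v z)\<^sup>2 * \<rho> z) \<le> 1" using v2 \<rho>pos[of z] by (simp add: divide_le_eq)
      then have "(\<delta> * (\<tau> z / (v z)\<^sup>2)) * (\<delta> * (\<tau> z) ^ 3 / ((v z)\<^sup>2 * \<rho> z)) \<le> (\<delta> * (\<tau> z / (v z)\<^sup>2)) * 1"
        using \<delta> t v2 by (intro mult_left_mono) auto
      then show ?thesis by (simp add: power2_eq_square power3_eq_cube mult_ac)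
    qed (simp add: \<tau>0)
    ultimately show ?thesis by linarith
  qed
  obtain B where B: "\<And>z. z \<le> 0 \<Longrightarrow> \<bar>v z\<bar> \<le> B" using bdd_v unfolding bdd_cont_def by blast
  have Bpos: "B > 0" using B[of 0] v_neg[of 0] by auto
  \<comment> \<open>On the region where 1 - 2 u may be positive, tau is at least 1 and the gain K delta tau / v^2 at least 2.\<close>
  define K where "K = 2 * B\<^sup>2 / \<delta>"
  have K: "K > 0" using Bpos \<delta> by (simp add: K_def)
  define m where "m z = K * \<rho> z + 1" for z
  have \<rho>1: "\<rho> z \<le> 1" if "z \<le> 0" for z using that c0 by (simp add: \<rho>_def mult_nonneg_nonpos)
  have bm: "bdd_cont m" unfolding m_def by (intro bdd_cont_intros bdr)
  have dm: "(m has_real_derivative c * (m z - 1)) (at z within {..0})" for z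
    unfolding m_def[abs_def] \<rho>_def by (auto intro!: derivative_eq_intros)
  have bm': "bdd_cont (\<lambda>z. c * (m z - 1))" by (intro bdd_cont_intros bm)
  have gain: "K * (\<delta> * (\<tau> z / (v z)\<^sup>2)) - (1 - 2 * u z) \<ge> 1/2" if z: "z \<le> 0" for z
  proof (cases "z \<le> - R")
    case True
    have "K * (\<delta> * (\<tau> z / (v z)\<^sup>2)) \<ge> 0" using K \<delta> by (simp add: \<tau>_def)
    then show ?thesis using R(2)[OF True] by linarith
  next
    case False
    have t: "\<tau> z \<ge> 1" using False by (simp add: \<tau>_def)
    have "(v z)\<^sup>2 \<le> B\<^sup>2" using B[OF z] Bpos by (simp add: abs_le_square_iff[symmetric])
    moreover have "(v z)\<^sup>2 > 0" using vne[OF z] by simp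
    ultimately have "1 \<le> B\<^sup>2 / (v z)\<^sup>2" by simp
    then have "1 * 1 \<le> B\<^sup>2 / (v z)\<^sup>2 * \<tau> z" using t by (intro mult_mono) auto
    then have "2 * 1 \<le> 2 * (B\<^sup>2 / (v z)\<^sup>2 * \<tau> z)" by simp
    also have "\<dots> = K * (\<delta> * (\<tau> z / (v z)\<^sup>2))" using \<delta> by (simp add: K_def)
    finally show ?thesis using u_ge[OF z] by linarith
  qed
  show ?thesis
  proof (rule that[of m K])
    show "m \<in> borel_measurable half_line" using bm continuous_measurable_half_line by (auto simp: bdd_cont_def)
    show "0 \<le> K" using K by simp
    show "1 \<le> m z" if "z \<le> 0" for z using K \<rho>pos[of z] by (simp add: m_def)
    show "m z \<le> 1 + K" if "z \<le> 0" for z using K \<rho>1[OF that] by (simp add: m_def mult_left_le)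
    fix f g k assume f: "ac f g" "ac g k" "f \<in> L2" "g \<in> L2" "k \<in> L2" "f 0 = 0"
    have L: "(\<lambda>z. h z * f z) \<in> L2" "(\<lambda>z. h z * g z) \<in> L2" if "bdd_cont h" for h
      using that f(3,4) by (auto intro: bdd_cont_L2)
    have i: "integrable half_line (\<lambda>z. h z * f z * f z)" "integrable half_line (\<lambda>z. h z * f z * g z)" "integrable half_line (\<lambda>z. h z * g z * g z)" if "bdd_cont h" for h
      using L[OF that] f(3,4) by (auto intro: L2_mult_integrable)
    \<comment> \<open>The drift does not contribute to the unweighted form.\<close>
    have b0: "integral\<^sup>L half_line (\<lambda>z. f z * g z) = 0"
      using integration_by_parts[OF f(1,3,4) f(1,3,4)] f(6) by (simp add: mult.commute)
    note bf = bdd_cont_ac[OF db bb bb' f(1,3,4)]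
    have fb: "2 * integral\<^sup>L half_line (\<lambda>z. b z * f z * g z) + integral\<^sup>L half_line (\<lambda>z. b' z * f z * f z) = 0"
    proof -
      have "integral\<^sup>L half_line (\<lambda>z. f z * (b z * g z + b' z * f z)) + integral\<^sup>L half_line (\<lambda>z. g z * (b z * f z)) = 0"
        using integration_by_parts[OF f(1,3,4) bf] f(6) by simp
      moreover have "(\<lambda>z. f z * (b z * g z + b' z * f z)) = (\<lambda>z. b z * f z * g z + b' z * f z * f z)" by (auto simp: algebra_simps)
      moreover have "(\<lambda>z. g z * (b z * f z)) = (\<lambda>z. b z * f z * g z)" by (auto simp: algebra_simps)
      ultimately show ?thesis using i(2)[OF bb] i(1)[OF bb'] by simp
    qed
    have "0 \<le> integral\<^sup>L half_line (\<lambda>z. \<rho> z * (g z - r z * f z)\<^sup>2)" by (intro Bochner_Integration.integral_nonneg mult_nonneg_nonneg less_imp_le[OF \<rho>pos]) auto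
    also have "(\<lambda>z. \<rho> z * (g z - r z * f z)\<^sup>2) = (\<lambda>z. \<rho> z * g z * g z - 2 * (b z * f z * g z) + (\<rho> z * (r z)\<^sup>2) * f z * f z)"
      by (auto simp: b_eq power2_eq_square algebra_simps)
    also have "integral\<^sup>L half_line \<dots> = integral\<^sup>L half_line (\<lambda>z. \<rho> z * g z * g z) - 2 * integral\<^sup>L half_line (\<lambda>z. b z * f z * g z)
        + integral\<^sup>L half_line (\<lambda>z. (\<rho> z * (r z)\<^sup>2) * f z * f z)"
      using i(3)[OF bdr] i(2)[OF bb] i(1)[OF bdd_cont_mult[OF bdr bdd_cont_power2[OF br]]] by simp
    also have "\<dots> = integral\<^sup>L half_line (\<lambda>z. \<rho> z * g z * g z) + integral\<^sup>L half_line (\<lambda>z. b' z * f z * f z)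
        + integral\<^sup>L half_line (\<lambda>z. (\<rho> z * (r z)\<^sup>2) * f z * f z)" using fb by simp
    also have "\<dots> = integral\<^sup>L half_line (\<lambda>z. \<rho> z * g z * g z + (b' z * f z * f z + (\<rho> z * (r z)\<^sup>2) * f z * f z))"
      using i(3)[OF bdr] i(1)[OF bb'] i(1)[OF bdd_cont_mult[OF bdr bdd_cont_power2[OF br]]] by simp
    finally have s1: "0 \<le> integral\<^sup>L half_line (\<lambda>z. \<rho> z * g z * g z + (b' z * f z * f z + (\<rho> z * (r z)\<^sup>2) * f z * f z))" .
    define w where "w z = 1 - 2 * u z" for z
    have bw: "bdd_cont w" unfolding w_def by (intro bdd_cont_intros bdd_u)
    have bmw: "bdd_cont (\<lambda>z. m z * w z)" by (intro bdd_cont_intros bm bw)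
    have "K * integral\<^sup>L half_line (\<lambda>z. \<rho> z * g z * g z + (b' z * f z * f z + (\<rho> z * (r z)\<^sup>2) * f z * f z))
       \<le> integral\<^sup>L half_line (\<lambda>z. m z * g z * g z - (m z * w z) * f z * f z - g z * g z - (1/2) * (f z * f z))"
      unfolding integral_mult_right_zero[symmetric]
    proof (rule integral_mono)
      show "integrable half_line (\<lambda>z. K * (\<rho> z * g z * g z + (b' z * f z * f z + (\<rho> z * (r z)\<^sup>2) * f z * f z)))"
        using i(3)[OF bdr] i(1)[OF bb'] i(1)[OF bdd_cont_mult[OF bdr bdd_cont_power2[OF br]]] by simp
      show "integrable half_line (\<lambda>z. m z * g z * g z - (m z * w z) * f z * f z - g z * g z - (1/2) * (f z * f z))"
        using i(3)[OF bm] i(1)[OF bmw] L2_mult_integrable[OF f(3) f(3)] L2_mult_integrable[OF f(4) f(4)] by simp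
      fix z assume "z \<in> space half_line"
      then have z: "z \<le> 0" by simp
      have "K * (b' z + \<rho> z * (r z)\<^sup>2) \<le> K * (- (\<rho> z * w z) - \<delta> * (\<tau> z / (v z)\<^sup>2))"
        using riccati[OF z] K unfolding w_def by (intro mult_left_mono) auto
      also have "\<dots> = - (K * \<rho> z * w z) - K * (\<delta> * (\<tau> z / (v z)\<^sup>2))" by (simp add: right_diff_distrib)
      also have "\<dots> \<le> - (m z * w z) - 1/2"
      proof -
        have "m z * w z = K * \<rho> z * w z + w z" by (simp add: m_def distrib_right)
        moreover have "K * (\<delta> * (\<tau> z / (v z)\<^sup>2)) - w z \<ge> 1/2" using gain[OF z] unfolding w_def .
        ultimately show ?thesis by linarith
      qed
      finally have "K * (b' z + \<rho> z * (r z)\<^sup>2) * (f z * f z) \<le> (- (m z * w z) - 1/2) * (f z * f z)"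
        by (intro mult_right_mono) auto
      then show "K * (\<rho> z * g z * g z + (b' z * f z * f z + (\<rho> z * (r z)\<^sup>2) * f z * f z))
        \<le> m z * g z * g z - (m z * w z) * f z * f z - g z * g z - (1/2) * (f z * f z)"
        by (simp add: m_def algebra_simps)
    qed
    moreover have "0 \<le> K * integral\<^sup>L half_line (\<lambda>z. \<rho> z * g z * g z + (b' z * f z * f z + (\<rho> z * (r z)\<^sup>2) * f z * f z))"
      using s1 K by simp
    ultimately have "0 \<le> integral\<^sup>L half_line (\<lambda>z. m z * g z * g z - (m z * w z) * f z * f z - g z * g z - (1/2) * (f z * f z))"
      by linarith
    then have s2: "0 \<le> integral\<^sup>L half_line (\<lambda>z. m z * g z * g z) - integral\<^sup>L half_line (\<lambda>z. (m z * w z) * f z * f z)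
        - (norm (cls g))\<^sup>2 - (1/2) * (norm (cls f))\<^sup>2"
      using i(3)[OF bm] i(1)[OF bmw] L2_mult_integrable[OF f(3) f(3)] L2_mult_integrable[OF f(4) f(4)]
      by (simp add: power2_norm_eq_inner inner_cls f(3,4))
    note mf = bdd_cont_ac[OF dm bm bm' f(1,3,4)]
    have s3: "integral\<^sup>L half_line (\<lambda>z. m z * g z * g z) + c * integral\<^sup>L half_line (\<lambda>z. m z * f z * g z)
       + integral\<^sup>L half_line (\<lambda>z. m z * f z * k z) = 0"
    proof -
      have "integral\<^sup>L half_line (\<lambda>z. g z * (m z * g z + c * (m z - 1) * f z)) + integral\<^sup>L half_line (\<lambda>z. k z * (m z * f z)) = 0"
        using integration_by_parts[OF f(2,4,5) mf] f(6) by simp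
      moreover have "(\<lambda>z. g z * (m z * g z + c * (m z - 1) * f z)) = (\<lambda>z. m z * g z * g z + c * (m z * f z * g z) - c * (f z * g z))"
        by (auto simp: algebra_simps)
      moreover have "(\<lambda>z. k z * (m z * f z)) = (\<lambda>z. m z * f z * k z)" by (auto simp: algebra_simps)
      ultimately show ?thesis using i(3)[OF bm] i(2)[OF bm] L2_mult_integrable[OF f(3) f(4)] b0 by simp
    qed
    have "(\<lambda>z. (m z * f z) * (k z + c * g z + (1 - 2 * u z) * f z)) = (\<lambda>z. m z * f z * k z + c * (m z * f z * g z) + (m z * w z) * f z * f z)"
      by (auto simp: w_def algebra_simps)
    then have "integral\<^sup>L half_line (\<lambda>z. (m z * f z) * (k z + c * g z + (1 - 2 * u z) * f z))
      = integral\<^sup>L half_line (\<lambda>z. m z * f z * k z) + c * integral\<^sup>L half_line (\<lambda>z. m z * f z * g z) + integral\<^sup>L half_line (\<lambda>z. (m z * w z) * f z * f z)"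
      using L2_mult_integrable[OF L(1)[OF bm] f(5)] i(2)[OF bm] i(1)[OF bmw] by simp
    then show "integral\<^sup>L half_line (\<lambda>z. (m z * f z) * (k z + c * g z + (1 - 2 * u z) * f z)) \<le> - ((1/2) * (norm (cls f))\<^sup>2 + (norm (cls g))\<^sup>2)"
      using s2 s3 by linarith
  qed
qed

end


section \<open>Decay, uniqueness and the stability theorem\<close>

lemma difference_quotient_vector_derivative:
  fixes f :: "real \<Rightarrow> 'a::real_normed_vector"
  shows "((\<lambda>h. (f (x + h) - f x) /\<^sub>R h) \<longlongrightarrow> d) (at 0) \<longleftrightarrow> (f has_vector_derivative d) (at x)"
proof -
  have "((\<lambda>h. norm (f (x + h) - f x - h *\<^sub>R d) / norm h) \<longlongrightarrow> 0) (at 0) \<longleftrightarrow> ((\<lambda>h. (f (x + h) - f x) /\<^sub>R h) \<longlongrightarrow> d) (at 0)"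
  proof -
    have "\<forall>\<^sub>F h in at (0::real). norm (f (x + h) - f x - h *\<^sub>R d) / norm h = norm ((f (x + h) - f x) /\<^sub>R h - d)"
    proof -
      have "norm (f (x + h) - f x - h *\<^sub>R d) / norm h = norm ((f (x + h) - f x) /\<^sub>R h - d)" if "h \<noteq> 0" for h
      proof -
        have "(f (x + h) - f x) /\<^sub>R h - d = (1 / h) *\<^sub>R (f (x + h) - f x - h *\<^sub>R d)"
          using that by (simp add: scaleR_diff_right inverse_eq_divide)
        then show ?thesis by simp
      qed
      then show ?thesis by (auto simp: eventually_at_filter)
    qed
    then have "((\<lambda>h. norm (f (x + h) - f x - h *\<^sub>R d) / norm h) \<longlongrightarrow> 0) (at 0)
        \<longleftrightarrow> ((\<lambda>h. norm ((f (x + h) - f x) /\<^sub>R h - d)) \<longlongrightarrow> 0) (at 0)"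
      by (rule tendsto_cong)
    also have "\<dots> \<longleftrightarrow> ((\<lambda>h. (f (x + h) - f x) /\<^sub>R h) \<longlongrightarrow> d) (at 0)"
      by (simp add: tendsto_norm_zero_iff LIM_zero_iff)
    finally show ?thesis .
  qed
  then show ?thesis
    unfolding has_vector_derivative_def has_derivative_at by (simp add: bounded_linear_scaleR_left)
qed

context drift_operator
begin

text \<open>The quadratic form of \<open>A\<close>, to which the drift does not contribute; it is equivalent to the squared
  norm of \<open>V\<close>.\<close>

definition energy :: "'a \<Rightarrow> real" where "energy x = (norm (D x))\<^sup>2 + inner (Q x) x"

text \<open>The curve \<open>w\<close> is differentiable only in the norm of the ambient space, in which the energy is not
  even continuous. The polarization identity
  \<open>energy y - energy x = \<langle>(A + c D) (y + x), y - x\<rangle>\<close>, valid on the domain since \<open>A + c D\<close> is symmetric,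
  moves all derivatives to one side, where continuity of \<open>A w\<close> and \<open>D w\<close> suffices.\<close>

lemma energy_derivative:
  assumes dom: "\<And>t. t > 0 \<Longrightarrow> w t \<in> dA" and cA: "continuous_on {0<..} (\<lambda>t. A (w t))"
    and cD: "continuous_on {0..} (\<lambda>t. D (w t))"
    and d: "(w has_vector_derivative w') (at t)" and t: "t > 0"
  shows "((\<lambda>t. energy (w t)) has_real_derivative 2 * inner (A (w t) + c *\<^sub>R D (w t)) w') (at t)"
proof -
  define h where "h s = A (w s) + A (w t) + c *\<^sub>R (D (w s) + D (w t))" for s
  have diff: "energy y - energy x = inner (A y + A x + c *\<^sub>R (D y + D x)) (y - x)" if x: "x \<in> dA" and y: "y \<in> dA" for x y
  proof -
    note V = dA_V[OF x] dA_V[OF y]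
    have sym: "inner (A z + c *\<^sub>R D z) p = inner (D z) (D p) + inner (Q z) p" if "z \<in> dA" "p \<in> V" for z p
      using A_form[OF that] by (simp add: form_def inner_add_left)
    have "inner (A y + A x + c *\<^sub>R (D y + D x)) (y - x) = inner (A y + c *\<^sub>R D y) (y - x) + inner (A x + c *\<^sub>R D x) (y - x)"
      by (simp add: inner_add_left scaleR_add_right)
    also have "\<dots> = (inner (D y) (D y) - inner (D y) (D x) + inner (Q y) y - inner (Q y) x)
        + (inner (D x) (D y) - inner (D x) (D x) + inner (Q x) y - inner (Q x) x)"
      using V x y by (simp add: sym subspace_diff[OF V_subspace] D_diff inner_diff_right)
    also have "\<dots> = energy y - energy x"
      using Q_sym[of x y] by (simp add: energy_def power2_norm_eq_inner inner_commute)
    finally show ?thesis ..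
  qed
  have lA: "((\<lambda>s. A (w s)) \<longlongrightarrow> A (w t)) (at t)"
    using cA t by (simp add: continuous_on_eq_continuous_at isCont_def)
  have "continuous_on {0<..} (\<lambda>t. D (w t))" by (rule continuous_on_subset[OF cD]) auto
  then have lD: "((\<lambda>s. D (w s)) \<longlongrightarrow> D (w t)) (at t)"
    using t by (simp add: continuous_on_eq_continuous_at isCont_def)
  have h: "(h \<longlongrightarrow> A (w t) + A (w t) + c *\<^sub>R (D (w t) + D (w t))) (at t)"
    unfolding h_def by (intro tendsto_intros lA lD)
  have q: "((\<lambda>s. (w s - w t) /\<^sub>R (s - t)) \<longlongrightarrow> w') (at t)"
    using difference_quotient_vector_derivative[THEN iffD2, OF d] LIM_offset_zero_cancel[of "\<lambda>s. (w s - w t) /\<^sub>R (s - t)" t w'] by simp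
  have l: "((\<lambda>s. inner (h s) ((w s - w t) /\<^sub>R (s - t))) \<longlongrightarrow> inner (A (w t) + A (w t) + c *\<^sub>R (D (w t) + D (w t))) w') (at t)"
    by (intro tendsto_intros h q)
  have eq: "inner (A (w t) + A (w t) + c *\<^sub>R (D (w t) + D (w t))) w' = 2 * inner (A (w t) + c *\<^sub>R D (w t)) w'"
    by (simp add: inner_add_left scaleR_add_right)
  have ev: "\<forall>\<^sub>F s in at t. inner (h s) ((w s - w t) /\<^sub>R (s - t)) = (energy (w s) - energy (w t)) / (s - t)"
  proof -
    have "\<forall>\<^sub>F s in at t. s > 0" using t order_tendstoD(1)[OF tendsto_ident_at t] by simp
    then show ?thesis
      by eventually_elim (use dom t diff in \<open>simp add: h_def divide_inverse mult.commute\<close>)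
  qed
  have "((\<lambda>s. (energy (w s) - energy (w t)) / (s - t)) \<longlongrightarrow> 2 * inner (A (w t) + c *\<^sub>R D (w t)) w') (at t)"
    by (rule Lim_transform_eventually[OF l[unfolded eq] ev])
  then show ?thesis by (simp add: has_field_derivative_iff)
qed

end

text \<open>Replacing \<open>s\<^sup>2\<close> by \<open>s * clip \<sigma> s\<close> leaves the nonlinearity unchanged for \<open>\<bar>s\<bar> \<le> \<sigma>\<close> and makes it globally
  Lipschitz.\<close>

definition clip :: "real \<Rightarrow> real \<Rightarrow> real" where "clip \<sigma> s = max (- \<sigma>) (min \<sigma> s)"

lemma clip:
  assumes "\<sigma> \<ge> 0"
  shows clip_bound: "\<bar>clip \<sigma> s\<bar> \<le> \<sigma>" and clip_id: "\<bar>s\<bar> \<le> \<sigma> \<Longrightarrow> clip \<sigma> s = s"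
    and clip_lipschitz: "\<bar>clip \<sigma> a - clip \<sigma> b\<bar> \<le> \<bar>a - b\<bar>"
  using assms by (auto simp: clip_def max_def min_def)

lemma clipped_square_lipschitz:
  assumes s: "\<sigma> \<ge> 0"
  shows "\<bar>a * clip \<sigma> a - b * clip \<sigma> b\<bar> \<le> 2 * \<sigma> * \<bar>a - b\<bar>"
proof -
  have half: "\<bar>a * clip \<sigma> a - b * clip \<sigma> b\<bar> \<le> 2 * \<sigma> * \<bar>a - b\<bar>" if b: "\<bar>b\<bar> \<le> \<sigma>" for a b
  proof -
    have "a * clip \<sigma> a - b * clip \<sigma> b = (a - b) * clip \<sigma> a + b * (clip \<sigma> a - clip \<sigma> b)" by (simp add: algebra_simps)
    then have "\<bar>a * clip \<sigma> a - b * clip \<sigma> b\<bar> \<le> \<bar>a - b\<bar> * \<bar>clip \<sigma> a\<bar> + \<bar>b\<bar> * \<bar>clip \<sigma> a - clip \<sigma> b\<bar>"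
      by (metis abs_mult abs_triangle_ineq)
    also have "\<dots> \<le> \<bar>a - b\<bar> * \<sigma> + \<sigma> * \<bar>a - b\<bar>"
      using b clip_bound[OF s, of a] clip_lipschitz[OF s, of a b] s by (intro add_mono mult_mono) auto
    finally show ?thesis by (simp add: algebra_simps)
  qed
  consider "\<bar>b\<bar> \<le> \<sigma>" | "\<bar>a\<bar> \<le> \<sigma>" | "\<bar>a\<bar> > \<sigma>" "\<bar>b\<bar> > \<sigma>" by linarith
  then show ?thesis
  proof cases
    case 1 then show ?thesis by (rule half)
  next
    case 2 then show ?thesis using half[of a b] by (simp add: abs_minus_commute)
  next
    case 3
    have e: "x * clip \<sigma> x = \<sigma> * \<bar>x\<bar>" if "\<bar>x\<bar> > \<sigma>" for x
      using that s by (cases "x \<ge> 0") (auto simp: clip_def)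
    have "\<bar>a * clip \<sigma> a - b * clip \<sigma> b\<bar> = \<sigma> * \<bar>\<bar>a\<bar> - \<bar>b\<bar>\<bar>"
      using s by (simp add: e[OF 3(1)] e[OF 3(2)] right_diff_distrib[symmetric] abs_mult)
    also have "\<dots> \<le> \<sigma> * \<bar>a - b\<bar>" using s by (intro mult_left_mono) auto
    also have "\<dots> \<le> 2 * \<sigma> * \<bar>a - b\<bar>" using s by (intro mult_right_mono) auto
    finally show ?thesis .
  qed
qed

lemma H1_0_L2: "f \<in> H1_0 \<Longrightarrow> f \<in> L2"
  unfolding H1_0_def H1_def by auto

lemma H1_0_E:
  assumes "f \<in> H1_0"
  obtains g where "ac f g" "f \<in> L2" "g \<in> L2" "f 0 = 0" "cls f \<in> Vsp" "Dw (cls f) = cls g"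
    "H1_norm f = sqrt ((norm (cls f))\<^sup>2 + (norm (Dw (cls f)))\<^sup>2)"
proof -
  obtain g where g: "ac f g" "f \<in> L2" "g \<in> L2" "f 0 = 0" using assms unfolding H1_0_def by (auto simp: H1_iff)
  then show ?thesis using that[of g] Vsp_I[of f g] Dw_cls[of f g] H1_norm_eq[of f g] by simp
qed

lemma H1_0_diff: assumes "f \<in> H1_0" "h \<in> H1_0"
  shows "(\<lambda>z. f z - h z) \<in> H1_0" "cls (\<lambda>z. f z - h z) = cls f - cls h"
    "H1_norm (\<lambda>z. f z - h z) = sqrt ((norm (cls f - cls h))\<^sup>2 + (norm (Dw (cls f) - Dw (cls h)))\<^sup>2)"
proof -
  obtain g where f: "ac f g" "f \<in> L2" "g \<in> L2" "f 0 = 0" "Dw (cls f) = cls g" using H1_0_E[OF assms(1)] by metis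
  obtain k where h: "ac h k" "h \<in> L2" "k \<in> L2" "h 0 = 0" "Dw (cls h) = cls k" using H1_0_E[OF assms(2)] by metis
  note d = ac_diff[OF f(1) h(1)] L2_diff[OF f(2) h(2)] L2_diff[OF f(3) h(3)]
  show "(\<lambda>z. f z - h z) \<in> H1_0" using d f(4) h(4) unfolding H1_0_def by (auto simp: H1_iff)
  show "cls (\<lambda>z. f z - h z) = cls f - cls h" by (rule cls_diff[OF f(2) h(2)])
  show "H1_norm (\<lambda>z. f z - h z) = sqrt ((norm (cls f - cls h))\<^sup>2 + (norm (Dw (cls f) - Dw (cls h)))\<^sup>2)"
    using H1_norm_eq[OF d] by (simp add: cls_diff f h)
qed

lemma H1_0_sup:
  assumes "f \<in> H1_0" "z \<le> 0"
  shows "(f z)\<^sup>2 \<le> 2 * ((norm (cls f))\<^sup>2 + (norm (Dw (cls f)))\<^sup>2)"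
proof -
  obtain g where "ac f g" "f \<in> L2" "g \<in> L2" "Dw (cls f) = cls g" using H1_0_E[OF assms(1)] by metis
  then show ?thesis using ac_sup_bound[of f g z] assms(2) by simp
qed

lemma H1_0_eqI:
  assumes "f \<in> H1_0" "h \<in> H1_0" "cls f = cls h" "z \<le> 0" shows "f z = h z"
proof -
  have "((\<lambda>z. f z - h z) z)\<^sup>2 \<le> 2 * ((norm (cls f - cls h))\<^sup>2 + (norm (Dw (cls f) - Dw (cls h)))\<^sup>2)"
    using H1_0_sup[OF H1_0_diff(1)[OF assms(1,2)] assms(4)] H1_0_diff(2)[OF assms(1,2)]
      assms(3) Dw_scale[OF subspace_0[OF Vsp_subspace], of 0] by simp
  then show ?thesis using assms(3) by simp
qed

lemma bounded_square_L2:
  assumes "f \<in> H1_0" "h \<in> L2" shows "(\<lambda>z. f z * h z) \<in> L2"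
proof (rule mul_L2[OF _ _ assms(2)])
  define B where "B = sqrt (2 * ((norm (cls f))\<^sup>2 + (norm (Dw (cls f)))\<^sup>2))"
  show "f \<in> borel_measurable half_line" using H1_0_E[OF assms(1)] L2_measurable by metis
  show "\<bar>f z\<bar> \<le> B" if "z < 0" for z
    using H1_0_sup[OF assms(1), of z] that unfolding B_def by (simp add: real_le_rsqrt)
qed

text \<open>The boundary condition at \<open>-\<infinity>\<close> in the statement refers to classical derivatives.\<close>

lemma ac_deriv:
  assumes fg: "ac f g" and g: "continuous_on {..0} g" and z: "z < 0"
  shows "(f has_real_derivative g z) (at z)"
proof -
  define H where "H y = - integral {y..0} g" for y
  have gi: "g integrable_on {a..b}" if "b \<le> 0" for a b
    using that by (intro integrable_continuous_real continuous_on_subset[OF g]) auto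
  have dH: "(H has_real_derivative g y) (at y within {..0})" if y: "y \<le> 0" for y
  proof -
    define a where "a = y - 1"
    have "((\<lambda>x. integral {a..x} g) has_real_derivative g y) (at y within {a..0})"
      using y by (intro integral_has_real_derivative continuous_on_subset[OF g]) (auto simp: a_def)
    then have "((\<lambda>x. integral {a..x} g - integral {a..0} g) has_real_derivative g y) (at y within {a..0})"
      by (auto intro!: derivative_eq_intros)
    then have "(H has_real_derivative g y) (at y within {a..0})"
    proof (rule has_field_derivative_transform_within[OF _ zero_less_one])
      show "y \<in> {a..0}" using y by (simp add: a_def)
      fix x assume "x \<in> {a..0}"
      then have "integral {a..x} g + integral {x..0} g = integral {a..0} g"
        by (intro Henstock_Kurzweil_Integration.integral_combine gi) auto
      then show "integral {a..x} g - integral {a..0} g = H x" by (simp add: H_def)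
    qed
    moreover have "at y within {a..0} = at y within {..0}"
      by (rule at_within_nhd[of y "{a<..}"]) (auto simp: a_def)
    ultimately show ?thesis by simp
  qed
  have H: "ac H g" by (rule ac_C1[OF dH g])
  have eq: "H y + (f 0 - H 0) = f y" if "y \<le> 0" for y using acD[OF H that] acD[OF fg that] by simp
  have "(H has_real_derivative g z) (at z)"
    using dH[of z] z at_within_interior[of z "{..0}"] by (simp add: interior_Iic[where b = 1])
  then have "((\<lambda>y. H y + (f 0 - H 0)) has_real_derivative g z) (at z)" by (auto intro!: derivative_eq_intros)
  then show ?thesis
    by (rule has_field_derivative_transform_within_open[of _ _ _ "{..<0}"]) (use z eq in auto)
qed

context bounded_profile
begin

lemma linop_domain_H1_0: "f \<in> linop_domain \<Longrightarrow> f \<in> H1_0"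
  unfolding linop_domain_def H2_def H1_0_def by auto

lemma dA_rep:
  assumes "x \<in> dA" shows "\<exists>f. f \<in> linop_domain \<and> cls f = x"
proof -
  obtain f g k where f: "ac f g" "ac g k" "f \<in> L2" "g \<in> L2" "k \<in> L2" "f 0 = 0" and x: "x = cls f"
    by (rule dA_E[OF assms]) blast
  have "f \<in> linop_domain" by (rule linop_domainI[OF f])
  then show ?thesis using x by blast
qed

text \<open>Solutions in the sense of \<open>evolution_solution\<close>, read in \<open>L2h\<close>: there the difference quotients
  converge in norm, which is differentiability as a curve.\<close>

lemma evolution_solution_cls:
  assumes W: "evolution_solution c u W"
  shows "\<And>\<tau>. \<tau> \<ge> 0 \<Longrightarrow> W \<tau> \<in> H1_0"
    and "continuous_on {0..} (\<lambda>\<tau>. cls (W \<tau>))" and "continuous_on {0..} (\<lambda>\<tau>. Dw (cls (W \<tau>)))"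
    and "\<And>\<tau>. \<tau> > 0 \<Longrightarrow> cls (W \<tau>) \<in> dA \<and>
      ((\<lambda>\<tau>. cls (W \<tau>)) has_vector_derivative 2 *\<^sub>R cls (W \<tau>) - A (cls (W \<tau>)) - cls (\<lambda>z. W \<tau> z * W \<tau> z)) (at \<tau>)"
proof -
  show H: "W \<tau> \<in> H1_0" if "\<tau> \<ge> 0" for \<tau> using W that unfolding evolution_solution_def by blast
  have lim: "((\<lambda>s. sqrt ((norm (cls (W s) - cls (W \<tau>)))\<^sup>2 + (norm (Dw (cls (W s)) - Dw (cls (W \<tau>))))\<^sup>2)) \<longlongrightarrow> 0) (at \<tau> within {0..})"
    if "\<tau> \<ge> 0" for \<tau>
  proof -
    have "((\<lambda>s. H1_norm (\<lambda>z. W s z - W \<tau> z)) \<longlongrightarrow> 0) (at \<tau> within {0..})"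
      using W that unfolding evolution_solution_def by blast
    moreover have "\<forall>\<^sub>F s in at \<tau> within {0..}. H1_norm (\<lambda>z. W s z - W \<tau> z)
       = sqrt ((norm (cls (W s) - cls (W \<tau>)))\<^sup>2 + (norm (Dw (cls (W s)) - Dw (cls (W \<tau>))))\<^sup>2)"
      using H that by (auto simp: eventually_at_filter H1_0_diff)
    ultimately show ?thesis by (rule Lim_transform_eventually)
  qed
  show "continuous_on {0..} (\<lambda>\<tau>. cls (W \<tau>))" unfolding continuous_on_def
  proof
    fix \<tau> :: real assume "\<tau> \<in> {0..}"
    then have l: "((\<lambda>s. sqrt ((norm (cls (W s) - cls (W \<tau>)))\<^sup>2 + (norm (Dw (cls (W s)) - Dw (cls (W \<tau>))))\<^sup>2)) \<longlongrightarrow> 0) (at \<tau> within {0..})"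
      by (intro lim) simp
    have "((\<lambda>s. cls (W s) - cls (W \<tau>)) \<longlongrightarrow> 0) (at \<tau> within {0..})"
      by (rule Lim_null_comparison[OF _ l]) (auto intro!: always_eventually real_le_rsqrt)
    then show "((\<lambda>\<tau>. cls (W \<tau>)) \<longlongrightarrow> cls (W \<tau>)) (at \<tau> within {0..})" by (rule LIM_zero_cancel)
  qed
  show "continuous_on {0..} (\<lambda>\<tau>. Dw (cls (W \<tau>)))" unfolding continuous_on_def
  proof
    fix \<tau> :: real assume "\<tau> \<in> {0..}"
    then have l: "((\<lambda>s. sqrt ((norm (cls (W s) - cls (W \<tau>)))\<^sup>2 + (norm (Dw (cls (W s)) - Dw (cls (W \<tau>))))\<^sup>2)) \<longlongrightarrow> 0) (at \<tau> within {0..})"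
      by (intro lim) simp
    have "((\<lambda>s. Dw (cls (W s)) - Dw (cls (W \<tau>))) \<longlongrightarrow> 0) (at \<tau> within {0..})"
      by (rule Lim_null_comparison[OF _ l]) (auto intro!: always_eventually real_le_rsqrt)
    then show "((\<lambda>\<tau>. Dw (cls (W \<tau>))) \<longlongrightarrow> Dw (cls (W \<tau>))) (at \<tau> within {0..})" by (rule LIM_zero_cancel)
  qed
  show "cls (W \<tau>) \<in> dA \<and>
      ((\<lambda>\<tau>. cls (W \<tau>)) has_vector_derivative 2 *\<^sub>R cls (W \<tau>) - A (cls (W \<tau>)) - cls (\<lambda>z. W \<tau> z * W \<tau> z)) (at \<tau>)"
    if t: "\<tau> > 0" for \<tau>
  proof
    have dom: "W \<tau> \<in> linop_domain" using W t unfolding evolution_solution_def by blast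
    note ld = linop_domain_dA[OF dom]
    show "cls (W \<tau>) \<in> dA" by (rule ld(1))
    have WL: "W s \<in> L2" if "s \<ge> 0" for s using H1_0_E[OF H[OF that]] by metis
    have sq: "(\<lambda>z. W \<tau> z * W \<tau> z) \<in> L2" using t by (intro bounded_square_L2 H WL) auto
    define d where "d = cls (linop c u (W \<tau>)) - cls (\<lambda>z. W \<tau> z * W \<tau> z)"
    have l: "((\<lambda>h. L2_norm (\<lambda>z. (W (\<tau> + h) z - W \<tau> z) / h - (linop c u (W \<tau>) z - (W \<tau> z)\<^sup>2))) \<longlongrightarrow> 0) (at 0)"
      using W t unfolding evolution_solution_def by blast
    have "\<forall>\<^sub>F h in at (0::real). h > - \<tau>" using t by (intro order_tendstoD(1)[OF tendsto_ident_at]) simp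
    then have ev: "\<forall>\<^sub>F h in at 0. L2_norm (\<lambda>z. (W (\<tau> + h) z - W \<tau> z) / h - (linop c u (W \<tau>) z - (W \<tau> z)\<^sup>2))
        = norm ((cls (W (\<tau> + h)) - cls (W \<tau>)) /\<^sub>R h - d)"
    proof eventually_elim
      fix h :: real assume h: "h > - \<tau>"
      have W1: "W (\<tau> + h) \<in> L2" "W \<tau> \<in> L2" using h t by (auto intro: WL)
      have "(\<lambda>z. (W (\<tau> + h) z - W \<tau> z) / h - (linop c u (W \<tau>) z - (W \<tau> z)\<^sup>2))
        = (\<lambda>z. inverse h * (W (\<tau> + h) z - W \<tau> z) - (linop c u (W \<tau>) z - W \<tau> z * W \<tau> z))"
        by (auto simp: divide_inverse power2_eq_square mult.commute)
      moreover have "norm (cls (\<lambda>z. inverse h * (W (\<tau> + h) z - W \<tau> z) - (linop c u (W \<tau>) z - W \<tau> z * W \<tau> z)))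
         = norm ((cls (W (\<tau> + h)) - cls (W \<tau>)) /\<^sub>R h - d)"
        by (simp add: d_def cls_diff cls_scale W1 sq ld(3) L2_diff L2_scale)
      moreover have "(\<lambda>z. inverse h * (W (\<tau> + h) z - W \<tau> z) - (linop c u (W \<tau>) z - W \<tau> z * W \<tau> z)) \<in> L2"
        by (intro L2_diff L2_scale W1 ld(3) sq)
      ultimately show "L2_norm (\<lambda>z. (W (\<tau> + h) z - W \<tau> z) / h - (linop c u (W \<tau>) z - (W \<tau> z)\<^sup>2))
        = norm ((cls (W (\<tau> + h)) - cls (W \<tau>)) /\<^sub>R h - d)" by (simp add: norm_cls[symmetric])
    qed
    have "((\<lambda>h. norm ((cls (W (\<tau> + h)) - cls (W \<tau>)) /\<^sub>R h - d)) \<longlongrightarrow> 0) (at 0)"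
      by (rule Lim_transform_eventually[OF l ev])
    then have "((\<lambda>h. (cls (W (\<tau> + h)) - cls (W \<tau>)) /\<^sub>R h - d) \<longlongrightarrow> 0) (at 0)"
      by (rule tendsto_norm_zero_cancel)
    then have "((\<lambda>h. (cls (W (\<tau> + h)) - cls (W \<tau>)) /\<^sub>R h) \<longlongrightarrow> d) (at 0)"
      by (rule LIM_zero_cancel)
    then have "((\<lambda>\<tau>. cls (W \<tau>)) has_vector_derivative d) (at \<tau>)"
      by (rule difference_quotient_vector_derivative[THEN iffD1])
    moreover have "d = 2 *\<^sub>R cls (W \<tau>) - A (cls (W \<tau>)) - cls (\<lambda>z. W \<tau> z * W \<tau> z)" by (simp add: d_def ld(2))
    ultimately show "((\<lambda>\<tau>. cls (W \<tau>)) has_vector_derivative 2 *\<^sub>R cls (W \<tau>) - A (cls (W \<tau>)) - cls (\<lambda>z. W \<tau> z * W \<tau> z)) (at \<tau>)"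
      by simp
  qed
qed

text \<open>Both solutions are bounded on compact time intervals by the supremum bound, so the squares differ by
  at most a constant times the difference, and accretivity of \<open>A\<close> yields a Gronwall inequality for
  \<open>\<parallel>d\<parallel>\<^sup>2\<close>.\<close>

lemma evolution_solution_unique:
  assumes W1: "evolution_solution c u W1" and W2: "evolution_solution c u W2"
    and init: "\<And>z. z \<le> 0 \<Longrightarrow> W1 0 z = W2 0 z"
    and \<tau>: "\<tau> \<ge> 0" and z: "z \<le> 0"
  shows "W1 \<tau> z = W2 \<tau> z"
proof -
  note s1 = evolution_solution_cls[OF W1]
  note s2 = evolution_solution_cls[OF W2]
  have bd: "\<exists>B\<ge>0. \<forall>s\<in>{0..\<tau>}. \<forall>z\<le>0. \<bar>W s z\<bar> \<le> B" if W: "evolution_solution c u W" for W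
  proof -
    note s = evolution_solution_cls[OF W]
    have "continuous_on {0..\<tau>} (\<lambda>s. 2 * ((norm (cls (W s)))\<^sup>2 + (norm (Dw (cls (W s))))\<^sup>2))"
      by (intro continuous_intros continuous_on_subset[OF s(2)] continuous_on_subset[OF s(3)]) auto
    then have "bounded ((\<lambda>s. 2 * ((norm (cls (W s)))\<^sup>2 + (norm (Dw (cls (W s))))\<^sup>2)) ` {0..\<tau>})"
      by (intro compact_imp_bounded compact_continuous_image) auto
    then obtain K where K: "K > 0" "\<And>s. s \<in> {0..\<tau>} \<Longrightarrow> 2 * ((norm (cls (W s)))\<^sup>2 + (norm (Dw (cls (W s))))\<^sup>2) \<le> K"
      unfolding bounded_pos by (auto simp: image_iff)
    have "\<bar>W s z\<bar> \<le> sqrt K" if "s \<in> {0..\<tau>}" "z \<le> 0" for s z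
      using H1_0_sup[OF s(1) that(2), of s] K(2)[OF that(1)] that by (intro real_le_rsqrt) auto
    then show ?thesis using K(1) by (intro exI[of _ "sqrt K"]) auto
  qed
  obtain B1 B2 where B: "\<And>s z. s \<in> {0..\<tau>} \<Longrightarrow> z \<le> 0 \<Longrightarrow> \<bar>W1 s z\<bar> \<le> B1" "\<And>s z. s \<in> {0..\<tau>} \<Longrightarrow> z \<le> 0 \<Longrightarrow> \<bar>W2 s z\<bar> \<le> B2"
    and Bp: "B1 \<ge> 0" "B2 \<ge> 0"
    using bd[OF W1] bd[OF W2] by blast
  define d where "d s = cls (W1 s) - cls (W2 s)" for s
  define k where "k = 2 * (2 + (B1 + B2))"
  have "inner (d \<tau>) (d \<tau>) \<le> exp (k * \<tau>) * inner (d 0) (d 0)"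
  proof (rule gronwall_derivative[OF _ _ \<tau>])
    show "continuous_on {0..\<tau>} (\<lambda>s. inner (d s) (d s))"
      unfolding d_def by (intro continuous_intros continuous_on_subset[OF s1(2)] continuous_on_subset[OF s2(2)]) auto
    fix s assume s: "0 < s" "s < \<tau>"
    define q where "q = cls (\<lambda>z. W1 s z * W1 s z) - cls (\<lambda>z. W2 s z * W2 s z)"
    have dom: "cls (W1 s) \<in> dA" "cls (W2 s) \<in> dA" using s1(4)[OF s(1)] s2(4)[OF s(1)] by auto
    have "(d has_vector_derivative (2 *\<^sub>R cls (W1 s) - A (cls (W1 s)) - cls (\<lambda>z. W1 s z * W1 s z))
        - (2 *\<^sub>R cls (W2 s) - A (cls (W2 s)) - cls (\<lambda>z. W2 s z * W2 s z))) (at s)"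
      unfolding d_def using s1(4)[OF s(1)] s2(4)[OF s(1)] by (intro has_vector_derivative_diff) auto
    moreover have "(2 *\<^sub>R cls (W1 s) - A (cls (W1 s)) - cls (\<lambda>z. W1 s z * W1 s z))
        - (2 *\<^sub>R cls (W2 s) - A (cls (W2 s)) - cls (\<lambda>z. W2 s z * W2 s z)) = 2 *\<^sub>R d s - A (d s) - q"
      using A_diff[OF dom] by (simp add: d_def q_def scaleR_diff_right)
    ultimately have dd: "(d has_vector_derivative 2 *\<^sub>R d s - A (d s) - q) (at s)" by simp
    have "((\<lambda>s. inner (d s) (d s)) has_real_derivative inner (2 *\<^sub>R d s - A (d s) - q) (d s) + inner (d s) (2 *\<^sub>R d s - A (d s) - q)) (at s)"
      by (rule inner_has_derivative[OF dd dd])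
    moreover have "inner (2 *\<^sub>R d s - A (d s) - q) (d s) + inner (d s) (2 *\<^sub>R d s - A (d s) - q) \<le> k * inner (d s) (d s)"
    proof -
      have "d s \<in> dA" unfolding d_def by (rule subspace_diff[OF dA_subspace dom])
      then have acc: "inner (A (d s)) (d s) \<ge> 0" by (rule accretive)
      have W: "W1 s \<in> H1_0" "W2 s \<in> H1_0" "W1 s \<in> L2" "W2 s \<in> L2"
        using s1(1)[of s] s2(1)[of s] s by (auto intro: H1_0_L2)
      have sq: "(\<lambda>z. W1 s z * W1 s z) \<in> L2" "(\<lambda>z. W2 s z * W2 s z) \<in> L2" by (intro bounded_square_L2 W)+
      have "norm q \<le> (B1 + B2) * norm (d s)"
        unfolding q_def d_def cls_diff[OF sq, symmetric] cls_diff[OF W(3,4), symmetric]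
      proof (rule norm_cls_le)
        show "(\<lambda>z. W1 s z * W1 s z - W2 s z * W2 s z) \<in> borel_measurable half_line" by (intro L2_measurable L2_diff sq)
        show "AE z in half_line. \<bar>W1 s z * W1 s z - W2 s z * W2 s z\<bar> \<le> (B1 + B2) * \<bar>W1 s z - W2 s z\<bar>"
        proof (rule AE_I2)
          fix z assume "z \<in> space half_line"
          then have "\<bar>W1 s z + W2 s z\<bar> \<le> B1 + B2"
            using B(1)[of s z] B(2)[of s z] s by (intro order_trans[OF abs_triangle_ineq] add_mono) auto
          moreover have "W1 s z * W1 s z - W2 s z * W2 s z = (W1 s z + W2 s z) * (W1 s z - W2 s z)" by (simp add: algebra_simps)
          ultimately show "\<bar>W1 s z * W1 s z - W2 s z * W2 s z\<bar> \<le> (B1 + B2) * \<bar>W1 s z - W2 s z\<bar>"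
            by (simp add: abs_mult mult_right_mono)
        qed
      qed (use Bp W in \<open>auto intro: L2_diff\<close>)
      then have "norm q * norm (d s) \<le> (B1 + B2) * norm (d s) * norm (d s)" by (rule mult_right_mono) simp
      moreover have "- inner q (d s) \<le> norm q * norm (d s)"
        using Cauchy_Schwarz_ineq2[of q "d s"] by linarith
      moreover have "(B1 + B2) * norm (d s) * norm (d s) = (B1 + B2) * inner (d s) (d s)"
        by (simp add: dot_square_norm power2_eq_square)
      ultimately have qd: "- inner q (d s) \<le> (B1 + B2) * inner (d s) (d s)" by linarith
      have "inner (2 *\<^sub>R d s - A (d s) - q) (d s) + inner (d s) (2 *\<^sub>R d s - A (d s) - q)
          = 2 * (2 * inner (d s) (d s) - inner (A (d s)) (d s) - inner q (d s))"
        by (simp add: inner_diff_left inner_diff_right inner_commute)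
      also have "\<dots> \<le> 2 * (2 * inner (d s) (d s) + (B1 + B2) * inner (d s) (d s))" 
        by (rule mult_left_mono) (use acc qd in linarith, simp)
      also have "\<dots> = k * inner (d s) (d s)" by (simp add: k_def algebra_simps)
      finally show ?thesis .
    qed
    ultimately show "\<exists>y. ((\<lambda>s. inner (d s) (d s)) has_real_derivative y) (at s) \<and> y \<le> k * inner (d s) (d s)" by blast
  qed
  moreover have "d 0 = 0"
  proof -
    have "W1 0 \<in> L2" "W2 0 \<in> L2" using s1(1)[of 0] s2(1)[of 0] by (auto intro: H1_0_L2)
    then have "cls (W1 0) = cls (W2 0)" by (rule cls_eqI) (use init in \<open>auto intro!: AE_I2\<close>)
    then show ?thesis by (simp add: d_def)
  qed
  ultimately have "inner (d \<tau>) (d \<tau>) \<le> 0" by simp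
  then have "inner (d \<tau>) (d \<tau>) = 0" using inner_ge_zero[of "d \<tau>"] by linarith
  then have "cls (W1 \<tau>) = cls (W2 \<tau>)" by (simp add: d_def)
  then show ?thesis using H1_0_eqI[OF s1(1)[OF \<tau>] s2(1)[OF \<tau>] _ z] by simp
qed

text \<open>The converse of \<open>evolution_solution_cls\<close>. At each positive time a representative in the domain of
  the operator is chosen; at time \<open>0\<close> it is the prescribed function.\<close>

lemma evolution_solution_from_strong:
  assumes w0: "w 0 = cls f0" and f0: "f0 \<in> H1_0"
    and cw: "continuous_on {0..} w" and wV: "\<And>t. t \<ge> 0 \<Longrightarrow> w t \<in> Vsp" and cD: "continuous_on {0..} (\<lambda>t. Dw (w t))"
    and dom: "\<And>t. t > 0 \<Longrightarrow> w t \<in> dA"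
    and der: "\<And>t f. t > 0 \<Longrightarrow> f \<in> H1_0 \<Longrightarrow> cls f = w t \<Longrightarrow>
       (w has_vector_derivative 2 *\<^sub>R w t - A (w t) - cls (\<lambda>z. f z * f z)) (at t)"
  obtains W where "evolution_solution c u W" "W 0 = f0" "\<And>t. t \<ge> 0 \<Longrightarrow> cls (W t) = w t"
    "\<And>t. t > 0 \<Longrightarrow> W t \<in> linop_domain"
proof -
  define W where "W t = (if t > 0 then SOME f. f \<in> linop_domain \<and> cls f = w t else f0)" for t
  have Wd: "W t \<in> linop_domain" "cls (W t) = w t" if "t > 0" for t
    using someI_ex[OF dA_rep[OF dom[OF that]]] that by (auto simp: W_def)
  have W0: "W 0 = f0" by (simp add: W_def)
  have WH: "W t \<in> H1_0" if "t \<ge> 0" for t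
    using that Wd(1)[of t] linop_domain_H1_0 f0 W0 by (cases "t = 0") auto
  have Wc: "cls (W t) = w t" if "t \<ge> 0" for t using that Wd(2)[of t] w0 W0 by (cases "t = 0") auto
  have "evolution_solution c u W"
    unfolding evolution_solution_def
  proof (intro conjI allI impI)
    show "W t \<in> H1_0" if "0 \<le> t" for t by (rule WH[OF that])
    show "((\<lambda>s. H1_norm (\<lambda>z. W s z - W t z)) \<longlongrightarrow> 0) (at t within {0..})" if t: "0 \<le> t" for t
    proof -
      have "((\<lambda>s. sqrt ((norm (w s - w t))\<^sup>2 + (norm (Dw (w s) - Dw (w t)))\<^sup>2))
         \<longlongrightarrow> sqrt ((norm (w t - w t))\<^sup>2 + (norm (Dw (w t) - Dw (w t)))\<^sup>2)) (at t within {0..})"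
        using cw cD t by (intro tendsto_intros) (auto simp: continuous_on_def)
      moreover have "\<forall>\<^sub>F s in at t within {0..}. sqrt ((norm (w s - w t))\<^sup>2 + (norm (Dw (w s) - Dw (w t)))\<^sup>2)
          = H1_norm (\<lambda>z. W s z - W t z)"
        using t WH Wc by (auto simp: eventually_at_filter H1_0_diff)
      ultimately have "((\<lambda>s. H1_norm (\<lambda>z. W s z - W t z))
         \<longlongrightarrow> sqrt ((norm (w t - w t))\<^sup>2 + (norm (Dw (w t) - Dw (w t)))\<^sup>2)) (at t within {0..})"
        by (rule Lim_transform_eventually)
      then show ?thesis by simp
    qed
    fix t :: real assume t: "0 < t"
    show "W t \<in> linop_domain" by (rule Wd(1)[OF t])
    note ld = linop_domain_dA[OF Wd(1)[OF t]]
    have WL: "W s \<in> L2" if "s \<ge> 0" for s by (rule H1_0_L2[OF WH[OF that]])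
    have sq: "(\<lambda>z. W t z * W t z) \<in> L2" using t by (intro bounded_square_L2 WH WL) auto
    define d where "d = cls (linop c u (W t)) - cls (\<lambda>z. W t z * W t z)"
    have "(w has_vector_derivative d) (at t)"
      using der[OF t WH[of t] Wd(2)[OF t]] t ld(2) Wd(2)[OF t] by (simp add: d_def)
    then have q: "((\<lambda>h. (w (t + h) - w t) /\<^sub>R h) \<longlongrightarrow> d) (at 0)"
      by (rule difference_quotient_vector_derivative[THEN iffD2])
    have l: "((\<lambda>h. norm ((w (t + h) - w t) /\<^sub>R h - d)) \<longlongrightarrow> 0) (at 0)"
      by (rule tendsto_norm_zero[OF LIM_zero[OF q]])
    have "\<forall>\<^sub>F h in at (0::real). h > - t" using t by (intro order_tendstoD(1)[OF tendsto_ident_at]) simp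
    then have ev: "\<forall>\<^sub>F h in at 0. norm ((w (t + h) - w t) /\<^sub>R h - d)
       = L2_norm (\<lambda>z. (W (t + h) z - W t z) / h - (linop c u (W t) z - (W t z)\<^sup>2))"
    proof eventually_elim
      fix h :: real assume h: "h > - t"
      have W1: "W (t + h) \<in> L2" "W t \<in> L2" using h t by (auto intro: WL)
      have c1: "cls (W (t + h)) = w (t + h)" "cls (W t) = w t" using h t by (auto intro: Wc)
      have "(\<lambda>z. (W (t + h) z - W t z) / h - (linop c u (W t) z - (W t z)\<^sup>2))
        = (\<lambda>z. inverse h * (W (t + h) z - W t z) - (linop c u (W t) z - W t z * W t z))"
        by (auto simp: divide_inverse power2_eq_square mult.commute)
      moreover have "norm (cls (\<lambda>z. inverse h * (W (t + h) z - W t z) - (linop c u (W t) z - W t z * W t z)))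
         = norm ((cls (W (t + h)) - cls (W t)) /\<^sub>R h - d)"
        by (simp add: d_def cls_diff cls_scale W1 sq ld(3) L2_diff L2_scale)
      moreover have "(\<lambda>z. inverse h * (W (t + h) z - W t z) - (linop c u (W t) z - W t z * W t z)) \<in> L2"
        by (intro L2_diff L2_scale W1 ld(3) sq)
      ultimately show "norm ((w (t + h) - w t) /\<^sub>R h - d)
       = L2_norm (\<lambda>z. (W (t + h) z - W t z) / h - (linop c u (W t) z - (W t z)\<^sup>2))" unfolding c1 by (simp add: norm_cls[symmetric])
    qed
    show "((\<lambda>h. L2_norm (\<lambda>z. (W (t + h) z - W t z) / h - (linop c u (W t) z - (W t z)\<^sup>2))) \<longlongrightarrow> 0) (at 0)"
      by (rule Lim_transform_eventually[OF l ev])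
  qed
  then show ?thesis using that[of W] W0 Wc Wd by blast
qed

end

context profile
begin

sublocale bounded_profile c u
  by unfold_locales (use u_cont u_ge u_lt in \<open>auto intro: less_imp_le\<close>)

text \<open>Both \<open>v\<close> and the derivative of \<open>f\<close>, which lies in \<open>H1\<close>, tend to \<open>0\<close>.\<close>

lemma boundary_derivative:
  assumes f: "f \<in> linop_domain"
  shows "((\<lambda>z. deriv (\<lambda>z. u z + f z) z) \<longlongrightarrow> 0) at_bot"
proof -
  obtain g k where a: "ac f g" "ac g k" "f \<in> L2" "g \<in> L2" "k \<in> L2" "f 0 = 0" using linop_domain_E[OF f] .
  have "((\<lambda>z. v z + g z) \<longlongrightarrow> 0 + 0) at_bot" by (intro tendsto_intros v_lim ac_tendsto_0[OF a(2,4,5)])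
  moreover have "\<forall>\<^sub>F z in at_bot. v z + g z = deriv (\<lambda>z. u z + f z) z"
    unfolding eventually_at_bot_dense
  proof -
    have "v z + g z = deriv (\<lambda>z. u z + f z) z" if z: "z < 0" for z
    proof -
      have "(u has_real_derivative v z) (at z)"
        using du[of z] z at_within_interior[of z "{..0}"] by (simp add: interior_Iic[where b = 1])
      then have "((\<lambda>z. u z + f z) has_real_derivative v z + g z) (at z)"
        by (intro DERIV_add ac_deriv[OF a(1) ac_continuous[OF a(2)] z])
      then show ?thesis by (simp add: DERIV_imp_deriv)
    qed
    then show "\<exists>N. \<forall>z<N. v z + g z = deriv (\<lambda>z. u z + f z) z" by blast
  qed
  ultimately have "((\<lambda>z. deriv (\<lambda>z. u z + f z) z) \<longlongrightarrow> 0 + 0) at_bot" by (rule Lim_transform_eventually)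
  then show ?thesis by simp
qed

text \<open>The functional \<open>G x = K2 \<langle>m x, x\<rangle> + energy x\<close> satisfies \<open>n \<le> G \<le> C2 n\<close> for the squared \<open>H1\<close> norm \<open>n\<close>.
  Along solutions of the truncated equation \<open>w' = N w - A w\<close> its two parts change at rates at most
  \<open>- K2 n / 2\<close> (\<open>diss\<close>) and \<open>C1 n\<close> (\<open>ediss\<close>). As \<open>K2 = 2 (C1 + 1)\<close>, \<open>G\<close> decays like
  \<open>exp (- t / C2)\<close>, whence the rate \<open>\<beta> = 1 / (2 C2)\<close> and the constant \<open>M = sqrt C2\<close> for the norm itself.\<close>

lemma nonlinear_stability:
  "\<exists>\<beta> \<nu> M :: real. \<beta> > 0 \<and> \<nu> > 0 \<and> M \<ge> 1 \<and>
    (\<forall>V0 :: real \<Rightarrow> real.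
       (\<lambda>z. V0 z - u z) \<in> H1_0 \<and> H1_norm (\<lambda>z. V0 z - u z) \<le> \<nu> / (2 * M) \<longrightarrow>
       (\<exists>V. fkpp_solution c u V0 V \<and>
          (\<forall>V'. fkpp_solution c u V0 V' \<longrightarrow> (\<forall>\<tau>\<ge>0. \<forall>z\<le>0. V' \<tau> z = V \<tau> z)) \<and>
          (\<forall>\<tau>>0. H1_norm (\<lambda>z. V \<tau> z - u z)
                    \<le> 2 * M * exp (- \<beta> * \<tau>) * H1_norm (\<lambda>z. V0 z - u z))))"
proof -
  obtain m K where m: "m \<in> borel_measurable half_line" and K: "K \<ge> 0"
    and m1: "\<And>z. z \<le> 0 \<Longrightarrow> 1 \<le> m z" and mK: "\<And>z. z \<le> 0 \<Longrightarrow> m z \<le> 1 + K"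
    and coer: "\<And>f g k. ac f g \<Longrightarrow> ac g k \<Longrightarrow> f \<in> L2 \<Longrightarrow> g \<in> L2 \<Longrightarrow> k \<in> L2 \<Longrightarrow> f 0 = 0 \<Longrightarrow>
      integral\<^sup>L half_line (\<lambda>z. (m z * f z) * (k z + c * g z + (1 - 2 * u z) * f z))
        \<le> - ((1/2) * (norm (cls f))\<^sup>2 + (norm (cls g))\<^sup>2)"
    using weighted_coercivity by blast
  have mb: "\<And>z. z < 0 \<Longrightarrow> \<bar>m z\<bar> \<le> 1 + K"
  proof -
    fix z :: real assume "z < 0"
    then show "\<bar>m z\<bar> \<le> 1 + K" using m1[of z] mK[of z] by simp
  qed
  have mm: "\<And>f. f \<in> L2 \<Longrightarrow> (\<lambda>z. m z * f z) \<in> L2" "linear (mul m)" "\<And>x. norm (mul m x) \<le> (1 + K) * norm x"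
    "\<And>x y. inner (mul m x) y = inner x (mul m y)" "\<And>f. f \<in> L2 \<Longrightarrow> mul m (cls f) = cls (\<lambda>z. m z * f z)"
    using mul[OF m mb] by blast+
  \<comment> \<open>Small enough for the truncated square to consume at most half of the coercivity constant 1/2.\<close>
  define \<sigma> where "\<sigma> = 1 / (4 * (1 + K))"
  have \<sigma>: "\<sigma> > 0" "(1 + K) * \<sigma> = 1/4" using K by (auto simp: \<sigma>_def)
  define F where "F s = 2 * s - s * clip \<sigma> s" for s
  define L where "L = 2 + 2 * \<sigma>"
  have L: "L > 0" using \<sigma> by (simp add: L_def)
  have F0: "F 0 = 0" by (simp add: F_def)
  have FL: "\<bar>F a - F b\<bar> \<le> L * \<bar>a - b\<bar>" for a b
  proof -
    have "F a - F b = 2 * (a - b) - (a * clip \<sigma> a - b * clip \<sigma> b)" by (simp add: F_def)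
    then have "\<bar>F a - F b\<bar> \<le> 2 * \<bar>a - b\<bar> + \<bar>a * clip \<sigma> a - b * clip \<sigma> b\<bar>"
      using abs_triangle_ineq4[of "2 * (a - b)" "a * clip \<sigma> a - b * clip \<sigma> b"]
      unfolding abs_mult by simp
    also have "\<dots> \<le> 2 * \<bar>a - b\<bar> + 2 * \<sigma> * \<bar>a - b\<bar>" using clipped_square_lipschitz[of \<sigma> a b] \<sigma> by simp
    finally show ?thesis by (simp add: L_def algebra_simps)
  qed
  note nem = nemytskii[of F L, OF F0 less_imp_le[OF L] FL]
  define N where "N = nemytskii F"
  have N0: "N 0 = 0" unfolding N_def by (rule nem(3))
  have NL: "norm (N x - N y) \<le> L * norm (x - y)" for x y unfolding N_def by (rule nem(4))
  have NLe: "norm (N x) \<le> L * norm x" for x using NL[of x 0] N0 by simp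
  define C1 where "C1 = 2 * c\<^sup>2 + 2 * L\<^sup>2"
  define K2 where "K2 = 2 * (C1 + 1)"
  define C2 where "C2 = K2 * (1 + K) + 3"
  have C1: "C1 \<ge> 0" by (simp add: C1_def)
  have K2: "K2 > 0" using C1 by (simp add: K2_def)
  have C2: "C2 \<ge> 1" using K2 K by (simp add: C2_def)
  define n where "n x = (norm x)\<^sup>2 + (norm (Dw x))\<^sup>2" for x
  define G where "G x = K2 * inner (mul m x) x + energy x" for x
  have mul_le: "inner (mul m x) x \<le> (1 + K) * (norm x)\<^sup>2" for x
  proof -
    have "inner (mul m x) x \<le> norm (mul m x) * norm x" by (rule norm_cauchy_schwarz)
    also have "\<dots> \<le> (1 + K) * norm x * norm x" by (intro mult_right_mono mm(3)) auto
    finally show ?thesis by (simp add: power2_eq_square mult.assoc)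
  qed
  have mul_ge: "inner (mul m x) x \<ge> 0" for x
  proof -
    have "inner (mul m x) x = integral\<^sup>L half_line (\<lambda>z. m z * rep x z * rep x z)"
      using inner_cls[OF mm(1)[OF rep_in] rep_in, of x x] by (simp add: mul_def)
    also have "\<dots> \<ge> 0"
    proof (rule Bochner_Integration.integral_nonneg)
      fix z assume "z \<in> space half_line"
      then have "m z \<ge> 0" using m1[of z] by simp
      then show "0 \<le> m z * rep x z * rep x z" by (simp add: mult.assoc)
    qed
    finally show ?thesis .
  qed
  have Gge: "n x \<le> G x" for x
  proof -
    have "0 \<le> K2 * inner (mul m x) x" using K2 mul_ge[of x] by simp
    then show ?thesis using Q_ge[of x] unfolding n_def G_def energy_def by linarith
  qed
  have Gle: "G x \<le> C2 * n x" for x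
  proof -
    have "inner (mul pot x) x \<le> norm (mul pot x) * norm x" by (rule norm_cauchy_schwarz)
    also have "\<dots> \<le> 3 * norm x * norm x" by (intro mult_right_mono Q_le) auto
    finally have 1: "inner (mul pot x) x \<le> 3 * (norm x)\<^sup>2" by (simp add: power2_eq_square)
    have 2: "K2 * inner (mul m x) x \<le> K2 * ((1 + K) * (norm x)\<^sup>2)" using K2 mul_le[of x] by (intro mult_left_mono) auto
    have 3: "1 * (norm (Dw x))\<^sup>2 \<le> C2 * (norm (Dw x))\<^sup>2" using C2 by (intro mult_right_mono) auto
    have "C2 * n x = K2 * ((1 + K) * (norm x)\<^sup>2) + 3 * (norm x)\<^sup>2 + C2 * (norm (Dw x))\<^sup>2"
      by (simp add: n_def C2_def algebra_simps)
    then show ?thesis using 1 2 3 unfolding G_def energy_def by linarith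
  qed
  \<comment> \<open>The equation reads N x - A x = L x - h with h the truncated square.\<close>
  have diss: "inner (mul m x) (N x - A x) \<le> - (1/4) * n x" if x: "x \<in> dA" for x
  proof -
    obtain f g k where a: "ac f g" "ac g k" "f \<in> L2" "g \<in> L2" "k \<in> L2" "f 0 = 0" and xf: "x = cls f" and Dx: "Dw x = cls g"
      and Ax: "A x = cls (\<lambda>z. pot z * f z - c * g z - k z)" by (rule dA_E[OF x]) blast
    define h where "h z = f z * clip \<sigma> (f z)" for z
    have hL: "h \<in> L2"
    proof -
      have "h = (\<lambda>z. 2 * f z - F (f z))" by (auto simp: h_def F_def)
      then show ?thesis using L2_diff[OF L2_scale[OF a(3), of 2] nem(1)[OF a(3)]] by simp
    qed
    define l where "l z = k z + c * g z + (1 - 2 * u z) * f z" for z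
    have lL: "l \<in> L2"
    proof -
      have "l = (\<lambda>z. 2 * f z - (pot z * f z - c * g z - k z))" by (auto simp: l_def pot_def algebra_simps)
      then show ?thesis using L2_diff[OF L2_scale[OF a(3), of 2] L2_diff[OF L2_diff[OF pot_L2[OF a(3)] L2_scale[OF a(4)]] a(5)]] by simp
    qed
    have "N x - A x = cls (\<lambda>z. F (f z) - (pot z * f z - c * g z - k z))"
      unfolding Ax unfolding xf N_def nem(2)[OF a(3)]
      by (rule cls_diff[symmetric, OF nem(1)[OF a(3)] L2_diff[OF L2_diff[OF pot_L2[OF a(3)] L2_scale[OF a(4)]] a(5)]])
    also have "(\<lambda>z. F (f z) - (pot z * f z - c * g z - k z)) = (\<lambda>z. l z - h z)"
      by (auto simp: F_def l_def h_def pot_def algebra_simps)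
    also have "cls (\<lambda>z. l z - h z) = cls l - cls h" by (rule cls_diff[OF lL hL])
    finally have e: "N x - A x = cls l - cls h" .
    have "inner (mul m x) (cls l) = integral\<^sup>L half_line (\<lambda>z. (m z * f z) * l z)"
      unfolding xf mm(5)[OF a(3)] by (rule inner_cls[OF mm(1)[OF a(3)] lL])
    also have "\<dots> \<le> - ((1/2) * (norm (cls f))\<^sup>2 + (norm (cls g))\<^sup>2)" unfolding l_def by (rule coer[OF a])
    finally have 1: "inner (mul m x) (cls l) \<le> - ((1/2) * (norm x)\<^sup>2 + (norm (Dw x))\<^sup>2)" unfolding Dx unfolding xf .
    have "norm (cls h) \<le> \<sigma> * norm (cls f)"
    proof (rule norm_cls_le[OF L2_measurable[OF hL] a(3) less_imp_le[OF \<sigma>(1)]])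
      have "\<bar>h z\<bar> \<le> \<sigma> * \<bar>f z\<bar>" for z
        using mult_right_mono[OF clip_bound[of \<sigma> "f z"], of "\<bar>f z\<bar>"] \<sigma> by (simp add: h_def abs_mult mult.commute)
      then show "AE z in half_line. \<bar>h z\<bar> \<le> \<sigma> * \<bar>f z\<bar>" by simp
    qed
    then have "norm (mul m x) * norm (cls h) \<le> ((1 + K) * norm x) * (\<sigma> * norm x)"
      unfolding xf[symmetric] using K by (intro mult_mono mm(3)) auto
    also have "\<dots> = ((1 + K) * \<sigma>) * (norm x)\<^sup>2" by (simp add: power2_eq_square)
    also have "\<dots> = (1/4) * (norm x)\<^sup>2" by (simp only: \<sigma>(2))
    finally have "- inner (mul m x) (cls h) \<le> (1/4) * (norm x)\<^sup>2"
      using Cauchy_Schwarz_ineq2[of "mul m x" "cls h"] by linarith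
    moreover have "(norm (Dw x))\<^sup>2 \<ge> 0" by simp
    ultimately show ?thesis using 1 unfolding e n_def inner_diff_right by argo
  qed
  have ediss: "2 * inner (A x + c *\<^sub>R Dw x) (N x - A x) \<le> C1 * n x" if x: "x \<in> dA" for x
  proof -
    have "2 * inner (A x + c *\<^sub>R Dw x) (N x - A x)
       = 2 * inner (A x) (N x) - 2 * inner (A x) (A x) + 2 * inner (c *\<^sub>R Dw x) (N x) - 2 * inner (c *\<^sub>R Dw x) (A x)"
      by (simp add: inner_add_left inner_diff_right algebra_simps)
    moreover have "2 * inner (A x) (N x) \<le> (norm (A x))\<^sup>2 + (norm (N x))\<^sup>2" using abs_inner_le[of "A x" "N x"] by linarith
    moreover have "2 * inner (c *\<^sub>R Dw x) (N x) \<le> (norm (c *\<^sub>R Dw x))\<^sup>2 + (norm (N x))\<^sup>2" using abs_inner_le[of "c *\<^sub>R Dw x" "N x"] by linarith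
    moreover have "- 2 * inner (c *\<^sub>R Dw x) (A x) \<le> (norm (c *\<^sub>R Dw x))\<^sup>2 + (norm (A x))\<^sup>2" using abs_inner_le[of "c *\<^sub>R Dw x" "A x"] by linarith
    ultimately have "2 * inner (A x + c *\<^sub>R Dw x) (N x - A x) \<le> 2 * (norm (c *\<^sub>R Dw x))\<^sup>2 + 2 * (norm (N x))\<^sup>2"
      by (simp add: dot_square_norm)
    also have "\<dots> \<le> 2 * (c\<^sup>2 * (norm (Dw x))\<^sup>2) + 2 * (L\<^sup>2 * (norm x)\<^sup>2)"
    proof -
      have "(norm (N x))\<^sup>2 \<le> (L * norm x)\<^sup>2" by (intro power_mono NLe) auto
      then show ?thesis by (simp add: power_mult_distrib)
    qed
    also have "\<dots> \<le> C1 * n x" by (simp add: C1_def n_def algebra_simps)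
    finally show ?thesis .
  qed
  define \<beta> where "\<beta> = 1 / (2 * C2)"
  define M where "M = sqrt C2"
  have \<beta>: "\<beta> > 0" using C2 by (simp add: \<beta>_def)
  have M: "M \<ge> 1" using C2 by (simp add: M_def)
  have M2: "M\<^sup>2 = C2" using C2 by (simp add: M_def)
  have "\<exists>V. fkpp_solution c u V0 V \<and>
          (\<forall>V'. fkpp_solution c u V0 V' \<longrightarrow> (\<forall>\<tau>\<ge>0. \<forall>z\<le>0. V' \<tau> z = V \<tau> z)) \<and>
          (\<forall>\<tau>>0. H1_norm (\<lambda>z. V \<tau> z - u z)
                    \<le> 2 * M * exp (- \<beta> * \<tau>) * H1_norm (\<lambda>z. V0 z - u z))"
    if f0: "(\<lambda>z. V0 z - u z) \<in> H1_0" and small: "H1_norm (\<lambda>z. V0 z - u z) \<le> \<sigma> / (2 * M)" for V0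
  proof -
    define f where "f z = V0 z - u z" for z
    have fH: "f \<in> H1_0" using f0 by (simp add: f_def[abs_def])
    have nf: "H1_norm f = sqrt (n (cls f))" and fV: "cls f \<in> Vsp"
      using H1_0_E[OF fH] unfolding n_def by metis+
    obtain w where w0: "w 0 = cls f" and cw: "continuous_on {0..} w" and wV: "\<And>t. t \<ge> 0 \<Longrightarrow> w t \<in> Vsp"
      and cD: "continuous_on {0..} (\<lambda>t. Dw (w t))" and dom: "\<And>t. t > 0 \<Longrightarrow> w t \<in> dA"
      and cA: "continuous_on {0<..} (\<lambda>t. A (w t))"
      and der: "\<And>t. t > 0 \<Longrightarrow> (w has_vector_derivative N (w t) - A (w t)) (at t)"
      using strong_solution_exists[OF N0 L NL fV] by blast
    have cm: "bounded_linear (mul m)"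
      using mm(2) mm(3) by (intro bounded_linear_intro[of _ "1 + K"]) (auto simp: linear_add linear_scale mult.commute)
    have cq: "bounded_linear (mul pot)"
      by (rule bounded_linear_intro[of _ 3]) (use Q_le Q_linear in \<open>auto simp: linear_add linear_scale mult.commute\<close>)
    have decay: "n (w t) \<le> C2 * exp (- (1 / C2) * t) * n (cls f)" if t: "t \<ge> 0" for t
    proof -
      have "G (w t) \<le> exp (- (1 / C2) * t) * G (w 0)"
      proof (rule gronwall_derivative[OF _ _ t])
        show "continuous_on {0..t} (\<lambda>t. G (w t))"
        proof (rule continuous_on_subset)
          show "continuous_on {0..} (\<lambda>t. G (w t))"
            unfolding G_def energy_def
            by (intro continuous_intros cw cD bounded_linear.continuous_on[OF cm cw] bounded_linear.continuous_on[OF cq cw])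
        qed auto
        fix s :: real assume s: "s > 0"
        define w' where "w' = N (w s) - A (w s)"
        have d: "(w has_vector_derivative w') (at s)" unfolding w'_def by (rule der[OF s])
        have "((\<lambda>t. inner (mul m (w t)) (w t)) has_real_derivative inner (mul m w') (w s) + inner (mul m (w s)) w') (at s)"
          by (rule inner_has_derivative[OF bounded_linear.has_vector_derivative[OF cm d] d])
        then have "((\<lambda>t. G (w t)) has_real_derivative K2 * (inner (mul m w') (w s) + inner (mul m (w s)) w')
            + 2 * inner (A (w s) + c *\<^sub>R Dw (w s)) w') (at s)"
          unfolding G_def by (intro DERIV_add DERIV_cmult energy_derivative[OF dom cA cD d s]) auto
        moreover have "K2 * (inner (mul m w') (w s) + inner (mul m (w s)) w') + 2 * inner (A (w s) + c *\<^sub>R Dw (w s)) w'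
            \<le> - (1 / C2) * G (w s)"
        proof -
          have "inner (mul m w') (w s) = inner (mul m (w s)) w'" by (metis mm(4) inner_commute)
          then have "K2 * (inner (mul m w') (w s) + inner (mul m (w s)) w') = 2 * K2 * inner (mul m (w s)) w'" by simp
          also have "\<dots> \<le> 2 * K2 * (- (1/4) * n (w s))"
            unfolding w'_def using diss[OF dom[OF s]] K2 by (intro mult_left_mono) auto
          also have "\<dots> = - (C1 + 1) * n (w s)" by (simp add: K2_def algebra_simps)
          finally have "K2 * (inner (mul m w') (w s) + inner (mul m (w s)) w') + 2 * inner (A (w s) + c *\<^sub>R Dw (w s)) w'
             \<le> - (C1 + 1) * n (w s) + C1 * n (w s)" using ediss[OF dom[OF s]] unfolding w'_def by linarith
          also have "\<dots> = - n (w s)" by (simp add: algebra_simps)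
          also have "\<dots> \<le> - (1 / C2) * G (w s)" using Gle[of "w s"] C2 by (simp add: field_simps)
          finally show ?thesis .
        qed
        ultimately show "\<exists>y. ((\<lambda>t. G (w t)) has_real_derivative y) (at s) \<and> y \<le> - (1 / C2) * G (w s)" by blast
      qed
      then have "n (w t) \<le> exp (- (1 / C2) * t) * G (cls f)" using Gge[of "w t"] w0 by simp
      also have "\<dots> \<le> exp (- (1 / C2) * t) * (C2 * n (cls f))" by (intro mult_left_mono Gle) auto
      finally show ?thesis by (simp add: mult_ac)
    qed
    have nn: "n x \<ge> 0" for x by (simp add: n_def)
    \<comment> \<open>The decay estimate and the smallness of the initial datum keep the solution below the threshold.\<close>
    have smallz: "\<bar>h z\<bar> \<le> \<sigma>" if h: "h \<in> H1_0" "cls h = w t" and t: "t \<ge> 0" and z: "z \<le> 0" for h t z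
    proof -
      have "(h z)\<^sup>2 \<le> 2 * n (w t)" using H1_0_sup[OF h(1) z] h(2) by (simp add: n_def)
      also have "\<dots> \<le> 2 * (C2 * 1 * n (cls f))"
      proof -
        have "C2 * exp (- (1 / C2) * t) * n (cls f) \<le> C2 * 1 * n (cls f)"
          using C2 t by (intro mult_mono nn) auto
        then show ?thesis using decay[OF t] by linarith
      qed
      also have "\<dots> = 2 * (M * H1_norm f)\<^sup>2" using nf M2 nn by (simp add: power_mult_distrib)
      also have "\<dots> \<le> 2 * (\<sigma> / 2)\<^sup>2"
      proof -
        have "H1_norm f * (2 * M) \<le> \<sigma>" using small M unfolding f_def[symmetric] by (simp add: pos_le_divide_eq)
        then have "M * H1_norm f \<le> \<sigma> / 2" by (simp add: mult_ac)
        moreover have "0 \<le> M * H1_norm f" using M nf nn by simp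
        ultimately have "(M * H1_norm f)\<^sup>2 \<le> (\<sigma> / 2)\<^sup>2" by (intro power_mono)
        then show ?thesis by simp
      qed
      also have "\<dots> \<le> \<sigma>\<^sup>2" by (simp add: power2_eq_square)
      finally show ?thesis using \<sigma> by (simp add: abs_le_square_iff[symmetric])
    qed
    have der2: "(w has_vector_derivative 2 *\<^sub>R w t - A (w t) - cls (\<lambda>z. h z * h z)) (at t)"
      if t: "t > 0" and h: "h \<in> H1_0" "cls h = w t" for t h
    proof -
      have hL: "h \<in> L2" by (rule H1_0_L2[OF h(1)])
      have sq: "(\<lambda>z. h z * h z) \<in> L2" by (rule bounded_square_L2[OF h(1) hL])
      have "N (w t) = cls (\<lambda>z. F (h z))" unfolding N_def h(2)[symmetric] by (rule nem(2)[OF hL])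
      also have "\<dots> = cls (\<lambda>z. 2 * h z - h z * h z)"
      proof (rule cls_eqI[OF nem(1)[OF hL] L2_diff[OF L2_scale[OF hL] sq]], rule AE_I2)
        fix z assume "z \<in> space half_line"
        then have "clip \<sigma> (h z) = h z" using smallz[OF h, of z] t \<sigma> by (intro clip_id) auto
        then show "F (h z) = 2 * h z - h z * h z" by (simp add: F_def)
      qed
      also have "\<dots> = 2 *\<^sub>R w t - cls (\<lambda>z. h z * h z)" by (simp add: cls_diff cls_scale hL sq L2_scale h(2))
      finally have "N (w t) - A (w t) = 2 *\<^sub>R w t - A (w t) - cls (\<lambda>z. h z * h z)" by simp
      then show ?thesis using der[OF t] by metis
    qed
    obtain W where W: "evolution_solution c u W" "W 0 = f" "\<And>t. t \<ge> 0 \<Longrightarrow> cls (W t) = w t"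
      and Wd: "\<And>t. t > 0 \<Longrightarrow> W t \<in> linop_domain"
      by (rule evolution_solution_from_strong[OF w0 fH cw wV cD dom der2]) blast+
    define V where "V \<tau> z = u z + W \<tau> z" for \<tau> z
    have VW: "(\<lambda>\<tau> z. V \<tau> z - u z) = W" by (simp add: V_def)
    have "fkpp_solution c u V0 V"
      unfolding fkpp_solution_def VW
    proof (intro conjI allI impI)
      show "evolution_solution c u W" by (rule W(1))
      show "((\<lambda>z. deriv (V \<tau>) z) \<longlongrightarrow> 0) at_bot" if "0 < \<tau>" for \<tau>
        using boundary_derivative[OF Wd[OF that]] by (simp add: V_def[abs_def])
      show "V \<tau> 0 = 0" if "0 < \<tau>" for \<tau> using Wd[OF that] u0 by (simp add: V_def linop_domain_def)
      show "V 0 z = V0 z" for z using W(2) by (simp add: V_def f_def)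
    qed
    moreover have "V' \<tau> z = V \<tau> z" if V': "fkpp_solution c u V0 V'" and "\<tau> \<ge> 0" "z \<le> 0" for V' \<tau> z
    proof -
      have "evolution_solution c u (\<lambda>\<tau> z. V' \<tau> z - u z)" "\<And>z. z \<le> 0 \<Longrightarrow> V' 0 z = V0 z"
        using V' unfolding fkpp_solution_def by auto
      then have "V' \<tau> z - u z = W \<tau> z"
        using evolution_solution_unique[of "\<lambda>\<tau> z. V' \<tau> z - u z" W] W(1,2) that by (simp add: f_def)
      then show ?thesis by (simp add: V_def)
    qed
    moreover have "H1_norm (\<lambda>z. V \<tau> z - u z) \<le> 2 * M * exp (- \<beta> * \<tau>) * H1_norm (\<lambda>z. V0 z - u z)" if \<tau>: "\<tau> > 0" for \<tau>
    proof -
      have WH: "W \<tau> \<in> H1_0" using linop_domain_H1_0 Wd[OF \<tau>] by blast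
      have "H1_norm (W \<tau>) = sqrt (n (w \<tau>))"
        using H1_0_E[OF WH] W(3)[of \<tau>] \<tau> unfolding n_def by (metis less_imp_le)
      also have "\<dots> \<le> sqrt (C2 * exp (- (1 / C2) * \<tau>) * n (cls f))" using decay[of \<tau>] \<tau> by (intro real_sqrt_le_mono) auto
      also have "\<dots> = M * sqrt (exp (- (1 / C2) * \<tau>)) * H1_norm f" by (simp add: real_sqrt_mult M_def nf)
      also have "sqrt (exp (- (1 / C2) * \<tau>)) = exp (- \<beta> * \<tau>)"
      proof (rule real_sqrt_unique)
        have "- (1 / C2) * \<tau> = - \<beta> * \<tau> + - \<beta> * \<tau>" using C2 by (simp add: \<beta>_def field_simps)
        then show "(exp (- \<beta> * \<tau>))\<^sup>2 = exp (- (1 / C2) * \<tau>)" by (simp only: exp_add power2_eq_square)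
      qed simp
      also have "M * exp (- \<beta> * \<tau>) * H1_norm f \<le> 2 * (M * exp (- \<beta> * \<tau>) * H1_norm f)"
        using M nf nn by simp
      finally show ?thesis by (simp add: V_def f_def[abs_def] mult.assoc)
    qed
    ultimately show ?thesis by blast
  qed
  then show ?thesis using \<beta> \<sigma>(1) M by blast
qed

end

theorem mainTheorem2:
  fixes c :: real and u :: "real \<Rightarrow> real"
  assumes "0 \<le> c" and "c < 2" and "spreading_profile c u"
  shows "\<exists>\<beta> \<nu> M :: real. \<beta> > 0 \<and> \<nu> > 0 \<and> M \<ge> 1 \<and>
    (\<forall>V0 :: real \<Rightarrow> real.
       (\<lambda>z. V0 z - u z) \<in> H1_0 \<and> H1_norm (\<lambda>z. V0 z - u z) \<le> \<nu> / (2 * M) \<longrightarrow>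
       (\<exists>V. fkpp_solution c u V0 V \<and>
          (\<forall>V'. fkpp_solution c u V0 V' \<longrightarrow> (\<forall>\<tau>\<ge>0. \<forall>z\<le>0. V' \<tau> z = V \<tau> z)) \<and>
          (\<forall>\<tau>>0. H1_norm (\<lambda>z. V \<tau> z - u z)
                    \<le> 2 * M * exp (- \<beta> * \<tau>) * H1_norm (\<lambda>z. V0 z - u z))))"
proof -
  obtain v where "profile c u v"
    using assms unfolding spreading_profile_def profile_def by (auto simp: Pi_iff)
  then interpret profile c u v .
  show ?thesis by (rule nonlinear_stability)
qed

end
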